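(* Let $N\ge 1$, let $a_1<b_1<a_2<b_2<\cdots<a_N<b_N$ be real numbers, let $\mathcal R$ be the associated hyperelliptic Riemann surface of $w^2=\prod_{k=1}^N(z-a_k)(z-b_k)$, let $\Gamma_1,\dots,\Gamma_{N-1}$ be its bounded real ovals, and let $\nu\in\{1,2\}$. Then the map $$\Psi^{(\nu)}:\Gamma_1\times\cdots\times\Gamma_{N-1}\to(\mathbb R/\mathbb Z)^{N-1},\qquad (P_1,\dots,P_{N-1})\mapsto \frac1{2\pi i}\left(\int_{B_1}\omega_P^{(\nu)},\dots,\int_{B_{N-1}}\omega_P^{(\nu)}\right)$$ is a bijection.
   Context: Riemann surface: $\mathcal R$ is the compact Riemann surface of genus $N-1$ for $w^2=\prod_{k=1}^N(z-a_k)(z-b_k)$, obtained by gluing two copies (the first and second sheet) of $\overline{\mathbb C}\setminus\bigcup_{k=1}^N[a_k,b_k]$ crosswise along the cuts $[a_k,b_k]$ (the upper side of a cut on one sheet is glued to the lower side on the other sheet). $\infty_1,\infty_2$ are the points at infinity on sheets 1 and 2. The branch points are denoted $a_k,b_k$ as well. Real ovals: $\Gamma_j=\{(z,w)\in\mathcal R: b_j\le z\le a_{j+1}\}$ for $j=1,\dots,N-1$; each is a closed curve consisting of the interval $[b_j,a_{j+1}]$ on both sheets. Cycles: $B_j$ is a closed curve on the first sheet, symmetric with respect to the real axis, encircling $[a_1,b_j]$ once counterclockwise and crossing the real line only in $(-\infty,a_1)$ and $(b_j,a_{j+1})$. $A_j$ is the closed curve that goes from a point over $(a_j,b_j)$ through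 the open upper half-plane of the first sheet to a point over $(a_{j+1},b_{j+1})$, passes there to the second sheet, and returns through the open lower half-plane of the second sheet; it is homotopic to, but disjoint from, $\Gamma_j$. $(A_1,\dots,A_{N-1};B_1,\dots,B_{N-1})$ is a canonical homology basis. Differential: for $(P_1,\dots,P_{N-1})\in\Gamma_1\times\cdots\times\Gamma_{N-1}$ and $\nu\in\{1,2\}$, $\omega_P^{(\nu)}$ is the unique meromorphic differential on $\mathcal R$ with at most simple poles such that: the residues at $a_k$ and $b_k$ are $-\tfrac12$ ($k=1,\dots,N$); the residue at each $P_j$ is $1$; the residue at $\infty_2$ (if $\nu=1$), respectively at $\infty_1$ (if $\nu=2$), is $1$; it is holomorphic elsewhere; and $\int_{A_j}\omega_P^{(\nu)}=0$ for $j=1,\dots,N-1$. If $P_j$ coincides with a branch point, the two prescribed residues are added, so the residue there is $\tfrac12$. Convention: if $P_k$ lies on $B_k$, then $\frac{1}{2\pi i}\int_{B_k}\omega_P^{(\nu)}$ modulo $\mathbb Z$ is computed by slightly deforming $B_k$ to avoid $P_k$; since the residue at $P_k$ is $1$, the class modulo $\mathbb Z$ does not depend on the deformation. The components of $\Psi^{(\nu)}$ are real modulo $\mathbb Z$, so $\Psi^{(\nu)}$ does take values in $(\mathbb R/\mathbb Z)^{N-1}$. *)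

theory Defs
  imports "HOL-Complex_Analysis.Complex_Analysis"
begin

datatype surface_point = Pt (zc: complex) (wc: complex) | Infty nat

text \<open>
  The locale carries no assumptions; the ordering of the end points is a hypothesis of the
  theorem. The surface is the affine curve \<open>w^2 = curve_poly z\<close> together with the two points
  at infinity \<open>Infty 1\<close> and \<open>Infty 2\<close>.
\<close>
locale hyperelliptic =
  fixes N :: nat and a b :: "nat \<Rightarrow> real"
begin

definition curve_poly :: "complex \<Rightarrow> complex" where
  "curve_poly z = (\<Prod>k\<in>{1..N}. (z - of_real (a k)) * (z - of_real (b k)))"

definition affine_part :: "surface_point set" where
  "affine_part = {Pt z w | z w. w\<^sup>2 = curve_poly z}"

definition surface :: "surface_point set" where
  "surface = affine_part \<union> {Infty 1, Infty 2}"

definition branch_values :: "complex set" where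
  "branch_values = of_real ` (a ` {1..N} \<union> b ` {1..N})"

definition branch_points :: "surface_point set" where
  "branch_points = (\<lambda>e. Pt e 0) ` branch_values"

definition cuts :: "complex set" where
  "cuts = (\<Union>k\<in>{1..N}. of_real ` {a k..b k})"

text \<open>
  The branch of the square root of \<open>curve_poly\<close> that is holomorphic outside the cuts and
  asymptotic to \<open>z ^ N\<close> at infinity: \<open>(z - a k) / (z - b k)\<close> is a nonpositive real number only
  for \<open>z\<close> in the \<open>k\<close>-th cut. Its graph over the slit plane is the first sheet, the graph of its
  negative the second one. The closures of the sheets meet along the cuts, where the upper
  boundary values of either function are the lower boundary values of the other one.
\<close>
definition root_branch :: "complex \<Rightarrow> complex" where
  "root_branch z =
    (\<Prod>k\<in>{1..N}. (z - of_real (b k)) * csqrt ((z - of_real (a k)) / (z - of_real (b k))))"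

definition sheet_sign :: "nat \<Rightarrow> complex" where
  "sheet_sign \<nu> = (if \<nu> = 1 then 1 else - 1)"

definition sheet :: "nat \<Rightarrow> surface_point set" where
  "sheet \<nu> = {Pt z (sheet_sign \<nu> * root_branch z) | z. z \<notin> cuts} \<union> {Infty \<nu>}"

text \<open>
  The complex structure. \<open>local_par Q\<close> is, near \<open>0\<close>, the inverse of the standard local
  coordinate \<open>t\<close> centred at \<open>Q\<close>: \<open>z = e + t^2\<close> at a branch point \<open>e\<close>, \<open>z = z0 + t\<close> at any other
  finite point, and \<open>z = 1 / t\<close> at infinity. The quotients under \<open>csqrt\<close> are close to \<open>1\<close>
  for small \<open>t\<close>, so \<open>w\<close> is holomorphic in \<open>t\<close> (meromorphic at the points at infinity).
\<close>
definition branch_cofactor :: "complex \<Rightarrow> complex \<Rightarrow> complex" where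
  "branch_cofactor e z = (\<Prod>e'\<in>branch_values - {e}. z - e')"

fun local_z :: "surface_point \<Rightarrow> complex \<Rightarrow> complex" where
  "local_z (Pt z w) t = (if w = 0 then z + t\<^sup>2 else z + t)"
| "local_z (Infty \<nu>) t = 1 / t"

fun local_w :: "surface_point \<Rightarrow> complex \<Rightarrow> complex" where
  "local_w (Pt z w) t =
    (if w = 0
     then t * csqrt (branch_cofactor z z)
            * csqrt (branch_cofactor z (z + t\<^sup>2) / branch_cofactor z z)
     else w * csqrt (curve_poly (z + t) / curve_poly z))"
| "local_w (Infty \<nu>) t = sheet_sign \<nu> * root_branch (1 / t)"

definition local_par :: "surface_point \<Rightarrow> complex \<Rightarrow> surface_point" where
  "local_par Q t = (if t = 0 then Q else Pt (local_z Q t) (local_w Q t))"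

text \<open>
  A meromorphic differential is represented by the function \<open>\<omega>\<close> that assigns to every point \<open>Q\<close>
  the coefficient at \<open>Q\<close> with respect to \<open>dt\<close>, where \<open>t\<close> is the standard local coordinate centred
  at \<open>Q\<close>; at a pole this value is \<open>0\<close> by convention. At a finite point that is not a branch point
  \<open>dt = dz\<close>, so there \<open>\<omega>\<close> is the coefficient of \<open>dz\<close>. Since all points close to but different
  from \<open>Q\<close> are of that kind, the differential is \<open>local_coeff \<omega> Q t dt\<close> in the coordinate
  centred at \<open>Q\<close>. The predicate \<open>nicely_meromorphic_on\<close> fixes the value at poles, and \<open>\<omega>\<close> is \<open>0\<close>
  off the surface, so equal differentials are equal functions.
\<close>
definition local_coeff ::
    "(surface_point \<Rightarrow> complex) \<Rightarrow> surface_point \<Rightarrow> complex \<Rightarrow> complex" where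
  "local_coeff \<omega> Q t = (if t = 0 then \<omega> Q else \<omega> (local_par Q t) * deriv (local_z Q) t)"

definition meromorphic_differential :: "(surface_point \<Rightarrow> complex) \<Rightarrow> bool" where
  "meromorphic_differential \<omega> \<longleftrightarrow>
     (\<forall>Q\<in>surface. local_coeff \<omega> Q nicely_meromorphic_on {0}) \<and> (\<forall>Q. Q \<notin> surface \<longrightarrow> \<omega> Q = 0)"

definition residue_at :: "(surface_point \<Rightarrow> complex) \<Rightarrow> surface_point \<Rightarrow> complex" where
  "residue_at \<omega> Q = residue (local_coeff \<omega> Q) 0"

definition at_most_simple_pole_at :: "(surface_point \<Rightarrow> complex) \<Rightarrow> surface_point \<Rightarrow> bool" where
  "at_most_simple_pole_at \<omega> Q \<longleftrightarrow>
     (is_pole (local_coeff \<omega> Q) 0 \<longrightarrow> zorder (local_coeff \<omega> Q) 0 = - 1)"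

definition holomorphic_at :: "(surface_point \<Rightarrow> complex) \<Rightarrow> surface_point \<Rightarrow> bool" where
  "holomorphic_at \<omega> Q \<longleftrightarrow> local_coeff \<omega> Q analytic_on {0}"

text \<open>
  Closed curves on the surface that avoid the branch points and the points at infinity. On such
  curves \<open>\<omega>\<close> is the coefficient of \<open>dz\<close>, which gives the formula for the integral.
\<close>
definition closed_curve :: "(real \<Rightarrow> surface_point) \<Rightarrow> bool" where
  "closed_curve \<gamma> \<longleftrightarrow>
     \<gamma> ` {0..1} \<subseteq> affine_part - branch_points \<and>
     valid_path (zc \<circ> \<gamma>) \<and> path (wc \<circ> \<gamma>) \<and> \<gamma> 1 = \<gamma> 0"

definition curve_integral :: "(surface_point \<Rightarrow> complex) \<Rightarrow> (real \<Rightarrow> surface_point) \<Rightarrow> complex" where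
  "curve_integral \<omega> \<gamma> =
     integral {0..1} (\<lambda>t. \<omega> (\<gamma> t) * vector_derivative (zc \<circ> \<gamma>) (at t within {0..1}))"

definition oval :: "nat \<Rightarrow> surface_point set" where
  "oval j = {Pt (of_real x) w | x w. Pt (of_real x) w \<in> surface \<and> b j \<le> x \<and> x \<le> a (j + 1)}"

definition A_cycle :: "nat \<Rightarrow> (real \<Rightarrow> surface_point) \<Rightarrow> bool" where
  "A_cycle j \<gamma> \<longleftrightarrow> closed_curve \<gamma> \<and>
     (\<exists>s\<in>{0<..<1}.
        zc (\<gamma> 0) \<in> of_real ` {a j<..<b j} \<and>
        (\<forall>t\<in>{0<..<s}. \<gamma> t \<in> sheet 1 \<and> Im (zc (\<gamma> t)) > 0) \<and>
        zc (\<gamma> s) \<in> of_real ` {a (j + 1)<..<b (j + 1)} \<and>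
        (\<forall>t\<in>{s<..<1}. \<gamma> t \<in> sheet 2 \<and> Im (zc (\<gamma> t)) < 0))"

definition B_cycle :: "nat \<Rightarrow> (real \<Rightarrow> surface_point) \<Rightarrow> bool" where
  "B_cycle j \<gamma> \<longleftrightarrow> closed_curve \<gamma> \<and>
     \<gamma> ` {0..1} \<subseteq> sheet 1 \<and>
     cnj ` path_image (zc \<circ> \<gamma>) = path_image (zc \<circ> \<gamma>) \<and>
     path_image (zc \<circ> \<gamma>) \<inter> \<real> \<subseteq> of_real ` ({..<a 1} \<union> {b j<..<a (j + 1)}) \<and>
     (\<forall>x\<in>{a 1..b j}. winding_number (zc \<circ> \<gamma>) (of_real x) = 1)"

text \<open>
  The prescribed residues are added if some \<open>P j\<close> is a branch point. The point \<open>Infty (3 - \<nu>)\<close> is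
  the one at infinity on the sheet other than \<open>\<nu>\<close>.
\<close>
definition prescribed_residue :: "nat \<Rightarrow> (nat \<Rightarrow> surface_point) \<Rightarrow> surface_point \<Rightarrow> complex" where
  "prescribed_residue \<nu> P Q =
     (if Q \<in> branch_points then - 1 / 2 else 0)
     + (\<Sum>j\<in>{1..N - 1}. if Q = P j then 1 else 0)
     + (if Q = Infty (3 - \<nu>) then 1 else 0)"

definition is_omega ::
    "nat \<Rightarrow> (nat \<Rightarrow> surface_point) \<Rightarrow> (surface_point \<Rightarrow> complex) \<Rightarrow> bool" where
  "is_omega \<nu> P \<omega> \<longleftrightarrow>
     meromorphic_differential \<omega> \<and>
     (\<forall>Q\<in>surface. at_most_simple_pole_at \<omega> Q) \<and>
     (\<forall>Q\<in>surface. residue_at \<omega> Q = prescribed_residue \<nu> P Q) \<and>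
     (\<forall>Q\<in>surface - (branch_points \<union> P ` {1..N - 1} \<union> {Infty (3 - \<nu>)}). holomorphic_at \<omega> Q) \<and>
     (\<forall>j\<in>{1..N - 1}. \<forall>\<gamma>. A_cycle j \<gamma> \<longrightarrow> curve_integral \<omega> \<gamma> = 0)"

definition omega :: "nat \<Rightarrow> (nat \<Rightarrow> surface_point) \<Rightarrow> surface_point \<Rightarrow> complex" where
  "omega \<nu> P = (THE \<omega>. is_omega \<nu> P \<omega>)"

end

definition real_mod_int :: "real set set" where
  "real_mod_int = UNIV // {(x, y). x - y \<in> \<int>}"

context hyperelliptic
begin

text \<open>
  The \<open>k\<close>-th component is the class in \<open>\<real>/\<int>\<close> represented by the normalized integrals of the
  differential over all \<open>B_k\<close>-cycles that avoid \<open>P k\<close>. Deforming a cycle that meets \<open>P k\<close>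
  is choosing another one that does not. Tuples are functions on \<open>{1..N - 1}\<close>, extensional as
  in \<open>PiE\<close>.
\<close>
definition Psi :: "nat \<Rightarrow> (nat \<Rightarrow> surface_point) \<Rightarrow> nat \<Rightarrow> real set" where
  "Psi \<nu> P = (\<lambda>k\<in>{1..N - 1}. THE c. c \<in> real_mod_int \<and>
     (\<forall>\<gamma>. B_cycle k \<gamma> \<and> P k \<notin> \<gamma> ` {0..1} \<longrightarrow>
        (\<exists>x\<in>c. 1 / (2 * of_real pi * \<i>) * curve_integral (omega \<nu> P) \<gamma> = of_real x)))"

end

end

theory Submission
  imports Defs
begin

text \<open>
  Write \<open>P j = (p j, y j)\<close>. The normalized differential is
  \<open>(even_part + (odd_part + q) / w) dz\<close> with explicit rational functions of \<open>z\<close> and a real polynomial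
  \<open>q\<close> of degree at most \<open>N - 2\<close> that makes the \<open>A\<close>-periods vanish; uniqueness follows by Liouville's
  theorem, because a real polynomial of degree at most \<open>N - 2\<close> whose integrals against \<open>1 / w\<close> over all
  \<open>N - 1\<close> gaps vanish has a zero in every gap. Interchange of argument and parameter for
  \<open>y dz / ((z - p) w)\<close> turns the \<open>B\<close>-periods, modulo integers, into a constant plus a sum over \<open>j\<close> of
  integrals of normalized holomorphic differentials along the \<open>j\<close>-th oval, up to the point \<open>P j\<close>.
  So in the angles \<open>\<theta> j\<close> of the ovals the map lifts to a sum of functions of one variable, which shifts
  by a unit vector with sign when some \<open>\<theta> j\<close> grows by \<open>2 * pi\<close>. The lift is injective: given two
  angle vectors, some real polynomial \<open>h\<close> of degree at most \<open>N - 2\<close> has on every gap the sign of the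
  change of angle there, so that the integrals of \<open>h / w\<close> between the angles cannot add up to zero.
  It is surjective by the Poincare--Miranda theorem on a large cube.
\<close>

section \<open>Slit domains and integrals over upper semicircles\<close>

text \<open>The reality of the curve carries the argument. \<open>w\<close> is real over the gaps
  and imaginary over the cuts, so the A-period of a real odd form is twice the real part, and its
  period over a symmetric loop on the first sheet is \<open>- 2 i\<close> times the imaginary part,
  of one integral over an upper arc. The real part is unchanged when the ends of the arc move inside
  cuts, the imaginary part when an end moves inside a gap without meeting a pole. The obstacle is
  \<open>P k\<close>, which may lie over the point where a B-cycle crosses its gap. The crossing
  point is therefore a free parameter \<open>x\<close> different from \<open>p k\<close>; passing
  the pole costs half a residue in the even part and half a residue in the odd part, which together
  make an integer. The same half residue yields the unit growth of the lift over one turn. A second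
  obstacle is that the ovals run through branch points, where \<open>z\<close> is no coordinate; in
  the angle, \<open>sin \<theta>\<close> cancels the zeros of \<open>w\<close>, and all integrands
  become smooth. The interchange itself comes from differentiating a normalized period with respect
  to the pole and adding an exact form.\<close>

text \<open>The slits point downwards, so that all arcs in the upper half plane lie in one domain.\<close>

definition slit_plane :: "real set \<Rightarrow> complex set" where
  "slit_plane E = {z. \<forall>e\<in>E. Re z = e \<longrightarrow> Im z > 0}"

lemma slit_plane_alt: "slit_plane E = - (\<Union>e\<in>E. {z. Re z = e} \<inter> {z. Im z \<le> 0})"
  by (auto simp: slit_plane_def)

lemma open_slit_plane: "finite E \<Longrightarrow> open (slit_plane E)"
  unfolding slit_plane_alt
  by (intro open_Compl closed_UN ballI closed_Int closed_halfspace_Im_le)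
     (auto intro!: closed_Collect_eq continuous_intros)

lemma slit_plane_mono: "E \<subseteq> F \<Longrightarrow> slit_plane F \<subseteq> slit_plane E"
  by (auto simp: slit_plane_def)

lemma upper_in_slit_plane: "Im z > 0 \<Longrightarrow> z \<in> slit_plane E"
  by (auto simp: slit_plane_def)

lemma real_in_slit_plane: "complex_of_real x \<in> slit_plane E \<longleftrightarrow> x \<notin> E"
  by (auto simp: slit_plane_def)

lemma connected_slit_plane: "connected (slit_plane E)"
proof -
  let ?S = "slit_plane E"
  have vert: "connected_component ?S z (z + \<i> * of_real (\<bar>Im z\<bar> + 1))" if "z \<in> ?S" for z
  proof (rule connected_componentI)
    show "connected (closed_segment z (z + \<i> * of_real (\<bar>Im z\<bar> + 1)))" by simp
    show "closed_segment z (z + \<i> * of_real (\<bar>Im z\<bar> + 1)) \<subseteq> ?S"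
    proof
      fix u assume "u \<in> closed_segment z (z + \<i> * of_real (\<bar>Im z\<bar> + 1))"
      then obtain t where t: "0 \<le> t" "t \<le> 1" and u: "u = (1 - t) *\<^sub>R z + t *\<^sub>R (z + \<i> * of_real (\<bar>Im z\<bar> + 1))"
        by (auto simp: in_segment)
      have "Re u = Re z" "Im u = Im z + t * (\<bar>Im z\<bar> + 1)"
        by (simp_all add: u algebra_simps)
      with that t show "u \<in> ?S"
        by (auto simp: slit_plane_def add_pos_nonneg)
    qed
  qed (auto)
  have H: "connected_component ?S u v" if "Im u > 0" "Im v > 0" for u v
  proof (rule connected_componentI)
    show "connected {z. Im z > 0}" by (intro convex_connected convex_halfspace_Im_gt)
  qed (use that in \<open>auto simp: slit_plane_def\<close>)
  show ?thesis
    unfolding connected_iff_connected_component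
  proof (intro ballI)
    fix u v assume uv: "u \<in> ?S" "v \<in> ?S"
    have "connected_component ?S (u + \<i> * of_real (\<bar>Im u\<bar> + 1)) (v + \<i> * of_real (\<bar>Im v\<bar> + 1))"
      by (rule H) auto
    with vert[OF uv(1)] vert[OF uv(2)] show "connected_component ?S u v"
      by (meson connected_component_sym connected_component_trans)
  qed
qed

text \<open>A component of the complement contains with one point of a slit the whole downward ray,
  so it is unbounded. Hence the domain is simply connected and primitives are global.\<close>

lemma slit_plane_primitive:
  assumes E: "finite E" and F: "F holomorphic_on slit_plane E"
  obtains G where "\<And>z. z \<in> slit_plane E \<Longrightarrow> (G has_field_derivative F z) (at z)"
proof -
  let ?S = "slit_plane E"
  have "\<not> bounded C" if C: "C \<in> components (- ?S)" for C
  proof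
    assume bC: "bounded C"
    obtain z where z: "z \<in> C" using C in_components_nonempty by blast
    then have "z \<notin> ?S" using C in_components_subset by auto
    then obtain e where e: "e \<in> E" "Re z = e" "Im z \<le> 0" by (auto simp: slit_plane_def)
    define R where "R = {u. Re u = e} \<inter> {u. Im u \<le> 0}"
    have "connected R" unfolding R_def
      by (intro convex_connected convex_Int convex_halfspace_Im_le) (simp add: convex_def algebra_simps flip: distrib_right)
    moreover have "R \<subseteq> - ?S" using e by (auto simp: R_def slit_plane_def)
    moreover have "z \<in> R" using e by (auto simp: R_def)
    ultimately have "R \<subseteq> C"
      using C z by (meson components_maximal disjoint_iff)
    then have "bounded R" using bC bounded_subset by blast
    then obtain B where B: "\<And>u. u \<in> R \<Longrightarrow> norm u \<le> B" by (auto simp: bounded_iff)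
    have "Complex e (- (\<bar>B\<bar> + 1)) \<in> R" by (auto simp: R_def)
    then have "norm (Complex e (- (\<bar>B\<bar> + 1))) \<le> B" by (rule B)
    then show False using abs_Im_le_cmod[of "Complex e (- (\<bar>B\<bar> + 1))"] by simp
  qed
  then have "simply_connected ?S"
    using simply_connected_eq_unbounded_complement_components[OF open_slit_plane[OF E]] connected_slit_plane
    by auto
  then show ?thesis
    using simply_connected_eq_global_primitive[OF open_slit_plane[OF E]] F that by blast
qed

text \<open>The angle runs from pi down to 0, so for \<open>x < y\<close> the arc goes clockwise
  from \<open>x\<close> to \<open>y\<close> through the upper half plane.\<close>

definition upper_arc :: "real \<Rightarrow> real \<Rightarrow> real \<Rightarrow> complex" where
  "upper_arc x y = part_circlepath (of_real ((x + y) / 2)) ((y - x) / 2) pi 0"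

lemma valid_path_upper_arc [simp]: "valid_path (upper_arc x y)"
  by (simp add: upper_arc_def)

lemma pathstart_upper_arc [simp]: "pathstart (upper_arc x y) = of_real x"
  by (simp add: upper_arc_def flip: of_real_minus of_real_mult of_real_add) (simp add: field_simps)

lemma pathfinish_upper_arc [simp]: "pathfinish (upper_arc x y) = of_real y"
  by (simp add: upper_arc_def flip: of_real_minus of_real_mult of_real_add) (simp add: field_simps)

lemma upper_arc_eq: "upper_arc x y t = Complex ((x + y) / 2 - (y - x) / 2 * cos (pi * t)) ((y - x) / 2 * sin (pi * t))"
proof -
  have "linepath pi 0 t = pi - pi * t" by (simp add: linepath_def algebra_simps)
  then show ?thesis
    unfolding upper_arc_def part_circlepath_def
    by (simp add: complex_eq_iff Re_exp Im_exp cos_diff sin_diff)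
qed

lemma upper_arc_image:
  assumes "x < y"
  shows "path_image (upper_arc x y) \<subseteq> insert (of_real x) (insert (of_real y) {z. Im z > 0})"
proof
  fix z assume "z \<in> path_image (upper_arc x y)"
  then obtain t where t: "0 \<le> t" "t \<le> 1" and z: "z = upper_arc x y t" by (auto simp: path_image_def)
  consider "t = 0" | "t = 1" | "0 < t" "t < 1" using t by force
  then show "z \<in> insert (of_real x) (insert (of_real y) {z. Im z > 0})"
  proof cases
    case 3
    then have "sin (pi * t) > 0" by (intro sin_gt_zero) auto
    with assms show ?thesis by (simp add: z upper_arc_eq)
  qed (simp_all add: z upper_arc_eq complex_eq_iff field_simps)
qed

lemma upper_arc_in_slit_plane:
  "x < y \<Longrightarrow> x \<notin> E \<Longrightarrow> y \<notin> E \<Longrightarrow> path_image (upper_arc x y) \<subseteq> slit_plane E"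
  using upper_arc_image[of x y] by (auto simp: slit_plane_def)

definition arc_integral :: "(complex \<Rightarrow> complex) \<Rightarrow> real \<Rightarrow> real \<Rightarrow> complex" where
  "arc_integral F x y = contour_integral (upper_arc x y) F"

lemma arc_integrable:
  assumes "F holomorphic_on slit_plane E" "x < y" "x \<notin> E" "y \<notin> E"
  shows "F contour_integrable_on upper_arc x y"
  unfolding upper_arc_def
  using assms upper_arc_in_slit_plane[OF assms(2-4)]
  by (intro contour_integrable_continuous_part_circlepath holomorphic_on_imp_continuous_on)
     (auto intro: holomorphic_on_subset simp: upper_arc_def)

lemma arc_integral_primitive:
  assumes "\<And>z. z \<in> slit_plane E \<Longrightarrow> (G has_field_derivative F z) (at z)"
    and "x < y" "x \<notin> E" "y \<notin> E"
  shows "arc_integral F x y = G (of_real y) - G (of_real x)"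
proof -
  have "(F has_contour_integral (G (pathfinish (upper_arc x y)) - G (pathstart (upper_arc x y)))) (upper_arc x y)"
    by (rule contour_integral_primitive[of "slit_plane E"])
       (use assms upper_arc_in_slit_plane[OF assms(2-4)] in \<open>auto intro: has_field_derivative_at_within\<close>)
  then show ?thesis unfolding arc_integral_def by (simp add: contour_integral_unique)
qed

lemma arc_integral_add:
  assumes "F holomorphic_on slit_plane E" "F' holomorphic_on slit_plane E" "x < y" "x \<notin> E" "y \<notin> E"
  shows "arc_integral (\<lambda>z. F z + F' z) x y = arc_integral F x y + arc_integral F' x y"
  unfolding arc_integral_def using assms by (intro contour_integral_add arc_integrable) auto

lemma arc_integral_cmult:
  assumes "F holomorphic_on slit_plane E" "x < y" "x \<notin> E" "y \<notin> E"
  shows "arc_integral (\<lambda>z. c * F z) x y = c * arc_integral F x y"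
  unfolding arc_integral_def using assms by (intro contour_integral_lmul arc_integrable) auto

lemma arc_integral_sum:
  assumes "finite I" "\<And>i. i \<in> I \<Longrightarrow> F i holomorphic_on slit_plane E" "x < y" "x \<notin> E" "y \<notin> E"
  shows "arc_integral (\<lambda>z. \<Sum>i\<in>I. F i z) x y = (\<Sum>i\<in>I. arc_integral (F i) x y)"
  unfolding arc_integral_def using assms by (intro contour_integral_sum arc_integrable) auto

lemma arc_integral_cong:
  assumes "x < y" "x \<notin> E" "y \<notin> E" "\<And>z. z \<in> slit_plane E \<Longrightarrow> F z = F' z"
  shows "arc_integral F x y = arc_integral F' x y"
  unfolding arc_integral_def
  using upper_arc_in_slit_plane[OF assms(1-3)] assms(4) by (intro contour_integral_cong) auto

text \<open>The branch \<open>Ln (- \<i> * (z - e))\<close> has its cut along the downward slit. Its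
  imaginary part is pi/2 on the real line left of \<open>e\<close> and - pi/2 right of it.\<close>

lemma Im_arc_integral_inverse:
  assumes "x < y" "e \<noteq> x" "e \<noteq> y"
  shows "Im (arc_integral (\<lambda>z. 1 / (z - of_real e)) x y) = (if x < e \<and> e < y then - pi else 0)"
proof -
  let ?G = "\<lambda>z. Ln (- \<i> * (z - of_real e))"
  have G: "(?G has_field_derivative 1 / (z - of_real e)) (at z)" if "z \<in> slit_plane {e}" for z
  proof -
    have "- \<i> * (z - of_real e) \<notin> \<real>\<^sub>\<le>\<^sub>0"
    proof
      assume "- \<i> * (z - of_real e) \<in> \<real>\<^sub>\<le>\<^sub>0"
      then have "Re z = e" "Im z \<le> 0"
        by (auto simp: complex_nonpos_Reals_iff)
      with that show False by (auto simp: slit_plane_def)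
    qed
    moreover have "z \<noteq> of_real e" using that by (auto simp: slit_plane_def)
    ultimately show ?thesis
      by (auto intro!: derivative_eq_intros simp: divide_simps)
  qed
  have *: "Im (?G (of_real x)) = (if x < e then pi / 2 else - pi / 2)" if "x \<noteq> e" for x
  proof (cases "x < e")
    case True
    have "- \<i> * (of_real x - of_real e) = of_real (e - x) * \<i>" by (simp add: algebra_simps)
    also have "Im (Ln \<dots>) = pi / 2" using True
      by (subst Ln_times_of_real) (auto simp: Ln_of_real simp del: of_real_diff)
    finally show ?thesis using True by simp
  next
    case False
    have "- \<i> * (of_real x - of_real e) = of_real (x - e) * (- \<i>)" by (simp add: algebra_simps)
    also have "Im (Ln \<dots>) = - pi / 2" using False that
      by (subst Ln_times_of_real) (auto simp: Ln_of_real simp del: of_real_diff)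
    finally show ?thesis using False by simp
  qed
  show ?thesis
    using arc_integral_primitive[of "{e}" ?G, OF G] assms * by auto
qed

subsection \<open>A square root with cut pointing downwards\<close>

text \<open>The factor - i turns the downward slit into the negative real axis;
  \<open>cis (pi / 4)\<close>, a square root of i, undoes the rotation.\<close>

definition down_sqrt :: "real \<Rightarrow> complex \<Rightarrow> complex" where
  "down_sqrt e z = cis (pi / 4) * csqrt (- \<i> * (z - of_real e))"

lemma down_sqrt_sq [simp]: "(down_sqrt e z)\<^sup>2 = z - of_real e"
proof -
  have "(cis (pi / 4))\<^sup>2 = \<i>" by (simp add: Complex.DeMoivre)
  then show ?thesis by (simp add: down_sqrt_def power_mult_distrib algebra_simps flip: mult.assoc)
qed

lemma down_sqrt_holomorphic: "down_sqrt e holomorphic_on slit_plane {e}"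
proof -
  have "- \<i> * (z - of_real e) \<notin> \<real>\<^sub>\<le>\<^sub>0" if "z \<in> slit_plane {e}" for z
    using that by (auto simp: complex_nonpos_Reals_iff slit_plane_def)
  then show ?thesis unfolding down_sqrt_def by (intro holomorphic_intros) auto
qed

lemma down_sqrt_eq_0: "down_sqrt e z = 0 \<longleftrightarrow> z = of_real e"
  by (auto simp: down_sqrt_def)

text \<open>The inner root \<open>v\<close> has argument between - pi/4 and pi/4, so the rotated
  value lies in the closed first quadrant, which identifies the principal root.\<close>

lemma down_sqrt_upper:
  assumes "Im z \<ge> 0"
  shows "down_sqrt e z = csqrt (z - of_real e)"
proof (rule csqrt_unique[symmetric])
  define v where "v = csqrt (- \<i> * (z - of_real e))"
  have v2: "v\<^sup>2 = - \<i> * (z - of_real e)" by (simp add: v_def)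
  have "Re (v\<^sup>2) \<ge> 0" using assms by (simp add: v2)
  then have le: "(Im v)\<^sup>2 \<le> (Re v)\<^sup>2" by (simp add: Re_power2)
  have "Re v \<ge> 0" using csqrt_principal[of "- \<i> * (z - of_real e)"] by (auto simp: v_def simp del: csqrt.simps)
  with le have i: "\<bar>Im v\<bar> \<le> Re v" by (metis abs_le_square_iff abs_of_nonneg)
  have ds: "down_sqrt e z = cis (pi / 4) * v" by (simp add: down_sqrt_def v_def)
  have "Re (down_sqrt e z) = (Re v - Im v) * (sqrt 2 / 2)" "Im (down_sqrt e z) = (Re v + Im v) * (sqrt 2 / 2)"
    by (simp_all add: ds cos_45 sin_45 algebra_simps)
  moreover have "0 \<le> (Re v - Im v) * (sqrt 2 / 2)" "0 \<le> (Re v + Im v) * (sqrt 2 / 2)"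
    using i by (auto intro!: mult_nonneg_nonneg)
  ultimately have "0 \<le> Re (down_sqrt e z)" "0 \<le> Im (down_sqrt e z)" by presburger+
  then show "0 < Re (down_sqrt e z) \<or> Re (down_sqrt e z) = 0 \<and> 0 \<le> Im (down_sqrt e z)"
    by linarith
qed simp

lemma down_sqrt_right: "e \<le> x \<Longrightarrow> down_sqrt e (of_real x) = of_real (sqrt (x - e))"
  by (simp add: down_sqrt_upper csqrt_of_real_nonneg flip: of_real_diff)

lemma down_sqrt_left: "x \<le> e \<Longrightarrow> down_sqrt e (of_real x) = \<i> * of_real (sqrt (e - x))"
  by (simp add: down_sqrt_upper csqrt_of_real_nonpos flip: of_real_diff)

section \<open>Cycles in a domain with two complementary components\<close>

text \<open>A path \<open>d\<close> joins the loops to the single closed path "g, d, h backwards, d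
  backwards". Its winding number vanishes at every point outside \<open>S\<close>, so the global
  Cauchy theorem applies, and the two passages along \<open>d\<close> cancel.\<close>

lemma contour_integral_eq_of_winding:
  assumes S: "open S" "connected S" and F: "F holomorphic_on S"
    and g: "valid_path g" "pathfinish g = pathstart g" "path_image g \<subseteq> S"
    and h: "valid_path h" "pathfinish h = pathstart h" "path_image h \<subseteq> S"
    and w: "\<And>z. z \<notin> S \<Longrightarrow> winding_number g z = winding_number h z"
  shows "contour_integral g F = contour_integral h F"
proof -
  have "pathstart g \<in> S" "pathstart h \<in> S"
    using g h by (metis pathstart_in_path_image subsetD)+
  then obtain d where d: "valid_path d" "path_image d \<subseteq> S" "pathstart d = pathstart g" "pathfinish d = pathstart h"
    using connected_open_polynomial_connected[OF S, of "pathstart g" "pathstart h"]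
    by (metis valid_path_polynomial_function)
  let ?p = "g +++ (d +++ (reversepath h +++ reversepath d))"
  have int: "F contour_integrable_on p" if "valid_path p" "path_image p \<subseteq> S" for p
    using contour_integrable_holomorphic_simple[OF F S(1)] that by blast
  have vp: "valid_path ?p" using g h d by (simp add: valid_path_join)
  have "(F has_contour_integral 0) ?p"
  proof (rule Cauchy_theorem_global[OF S(1) F vp])
    show "path_image ?p \<subseteq> S" using g h d by (simp add: path_image_join)
    fix z assume z: "z \<notin> S"
    have pg: "path g" "path h" "path d" using g h d by (auto intro: valid_path_imp_path)
    have nin: "z \<notin> path_image g" "z \<notin> path_image h" "z \<notin> path_image d" using z g h d by auto
    have "winding_number ?p z = winding_number g z + (winding_number d z + (winding_number (reversepath h) z + winding_number (reversepath d) z))"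
      using pg nin g h d by (simp add: winding_number_join path_image_join)
    also have "\<dots> = 0" using w[OF z] pg nin by (simp add: winding_number_reversepath)
    finally show "winding_number ?p z = 0" .
  qed (use g h d in auto)
  then have "contour_integral ?p F = 0" by (rule contour_integral_unique)
  moreover have "contour_integral ?p F = contour_integral g F + (contour_integral d F + (contour_integral (reversepath h) F + contour_integral (reversepath d) F))"
    using g h d by (simp add: int valid_path_join path_image_join)
  ultimately show ?thesis using g h d by (simp add: contour_integral_reversepath)
qed

section \<open>Linear systems and the Poincare--Miranda theorem\<close>

text \<open>Induction on the equations: a nonzero pivot \<open>A i0 m0\<close> eliminates the
  unknown \<open>m0\<close>, at the price of one equation and one unknown.\<close>

lemma underdetermined_system:
  fixes A :: "'i \<Rightarrow> 'm \<Rightarrow> real"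
  assumes "finite I" "finite M" "card I < card M"
  shows "\<exists>c. (\<exists>m\<in>M. c m \<noteq> 0) \<and> (\<forall>i\<in>I. (\<Sum>m\<in>M. A i m * c m) = 0)"
  using assms
proof (induction I arbitrary: M A rule: finite_induct)
  case empty
  then obtain m where "m \<in> M" by fastforce
  then show ?case by (intro exI[of _ "\<lambda>_. 1"]) auto
next
  case (insert i0 I)
  show ?case
  proof (cases "\<forall>m\<in>M. A i0 m = 0")
    case True
    with insert.IH[of M A] insert.prems insert.hyps show ?thesis by auto
  next
    case False
    then obtain m0 where m0: "m0 \<in> M" "A i0 m0 \<noteq> 0" by blast
    let ?M = "M - {m0}"
    have "card I < card ?M" using insert m0 by simp
    with insert.IH[of ?M "\<lambda>i m. A i m - A i m0 * A i0 m / A i0 m0"] insert.prems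
    obtain c where c: "\<exists>m\<in>?M. c m \<noteq> 0"
      and c0: "\<And>i. i \<in> I \<Longrightarrow> (\<Sum>m\<in>?M. (A i m - A i m0 * A i0 m / A i0 m0) * c m) = 0"
      by auto
    define s where "s = (\<Sum>m\<in>?M. A i0 m * c m)"
    define d where "d = c(m0 := - s / A i0 m0)"
    have sum: "(\<Sum>m\<in>M. A i m * d m) = (\<Sum>m\<in>?M. A i m * c m) - A i m0 * s / A i0 m0" for i
    proof -
      have "(\<Sum>m\<in>M. A i m * d m) = A i m0 * d m0 + (\<Sum>m\<in>?M. A i m * d m)"
        using insert.prems m0 by (intro sum.remove) auto
      also have "(\<Sum>m\<in>?M. A i m * d m) = (\<Sum>m\<in>?M. A i m * c m)"
        by (intro sum.cong) (auto simp: d_def)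
      finally show ?thesis by (simp add: d_def)
    qed
    have "(\<Sum>m\<in>M. A i m * d m) = 0" if "i \<in> insert i0 I" for i
    proof (cases "i = i0")
      case True
      then show ?thesis using m0 sum[of i0] by (simp add: s_def)
    next
      case False
      with that have "i \<in> I" by auto
      have "(\<Sum>m\<in>?M. (A i m - A i m0 * A i0 m / A i0 m0) * c m)
          = (\<Sum>m\<in>?M. A i m * c m) - A i m0 * s / A i0 m0"
        by (simp add: s_def sum_distrib_left sum_divide_distrib algebra_simps flip: sum_subtractf)
      with sum[of i] c0[OF \<open>i \<in> I\<close>] show ?thesis by simp
    qed
    moreover have "\<exists>m\<in>M. d m \<noteq> 0" using c by (auto simp: d_def)
    ultimately show ?thesis by blast
  qed
qed

text \<open>The right-hand side becomes one more column of a homogeneous system with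
  \<open>n + 1\<close> unknowns. Injectivity keeps the last unknown of a nontrivial solution from
  vanishing, so it can be scaled to 1.\<close>

lemma square_system_solvable:
  fixes A :: "nat \<Rightarrow> nat \<Rightarrow> real"
  assumes "\<And>c. (\<And>i. i < n \<Longrightarrow> (\<Sum>m<n. A i m * c m) = 0) \<Longrightarrow> \<forall>m<n. c m = 0"
  shows "\<exists>c. \<forall>i<n. (\<Sum>m<n. A i m * c m) = b i"
proof -
  obtain c where c: "\<exists>m\<in>{..n}. c m \<noteq> 0"
    and c0: "\<And>i. i < n \<Longrightarrow> (\<Sum>m\<le>n. (if m < n then A i m else - b i) * c m) = 0"
    using underdetermined_system[of "{..<n}" "{..n}" "\<lambda>i m. if m < n then A i m else - b i"] by auto
  have eq: "(\<Sum>m<n. A i m * c m) = b i * c n" if "i < n" for i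
  proof -
    have "(\<Sum>m\<le>n. (if m < n then A i m else - b i) * c m)
       = (\<Sum>m<n. (if m < n then A i m else - b i) * c m) - b i * c n"
      by (simp add: lessThan_Suc_atMost[symmetric])
    also have "(\<Sum>m<n. (if m < n then A i m else - b i) * c m) = (\<Sum>m<n. A i m * c m)"
      by (intro sum.cong) auto
    finally show ?thesis using c0[OF that] by simp
  qed
  have "c n \<noteq> 0"
  proof
    assume "c n = 0"
    with eq assms[of c] have "\<forall>m<n. c m = 0" by simp
    with \<open>c n = 0\<close> c show False by (auto simp: le_less)
  qed
  then have "\<forall>i<n. (\<Sum>m<n. A i m * (c m / c n)) = b i"
    using eq by (simp flip: sum_divide_distrib)
  then show ?thesis by (rule exI[of _ "\<lambda>m. c m / c n"])
qed

text \<open>The total absolute value has a minimum \<open>d\<close> on the compact cube. If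
  \<open>d\<close> were positive, Kuhn's combinatorial lemma on a fine grid would produce a point
  with total at most \<open>d / 2\<close>. Summands of one variable keep uniform continuity
  one-dimensional.\<close>

lemma poincare_miranda_sum:
  fixes v :: "nat \<Rightarrow> nat \<Rightarrow> real \<Rightarrow> real"
  assumes cont: "\<And>k j. k < n \<Longrightarrow> j < n \<Longrightarrow> continuous_on {0..1} (v k j)"
    and lo: "\<And>x k. (\<And>j. j < n \<Longrightarrow> x j \<in> {0..1}) \<Longrightarrow> k < n \<Longrightarrow> x k = 0 \<Longrightarrow> (\<Sum>j<n. v k j (x j)) \<le> 0"
    and hi: "\<And>x k. (\<And>j. j < n \<Longrightarrow> x j \<in> {0..1}) \<Longrightarrow> k < n \<Longrightarrow> x k = 1 \<Longrightarrow> (\<Sum>j<n. v k j (x j)) \<ge> 0"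
  shows "\<exists>x. (\<forall>j<n. x j \<in> {0..1}) \<and> (\<forall>k<n. (\<Sum>j<n. v k j (x j)) = 0)"
proof -
  define f where "f k x = (\<Sum>j<n. v k j (x j))" for k and x :: "nat \<Rightarrow> real"
  \<comment> \<open>Coordinates from \<open>n\<close> on are frozen at 0, so the cube is compact in
    the product topology on all sequences.\<close>
  define K where "K = PiE UNIV (\<lambda>j. if j < n then {0..1} else {0::real})"
  have "compactin (product_topology (\<lambda>_. euclidean) UNIV) K"
    unfolding K_def by (subst compactin_PiE) auto
  then have K: "compact K" by (simp add: euclidean_product_topology)
  have KD: "x j \<in> {0..1}" if "x \<in> K" "j < n" for x j
    using PiE_mem[OF that(1)[unfolded K_def], of j] that(2) by simp
  have "continuous_on K (\<lambda>x. v k j (x j))" if "k < n" "j < n" for k j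
  proof (rule continuous_on_compose2[OF cont[OF that]])
    show "continuous_on K (\<lambda>x. x j)"
      by (rule continuous_on_subset[OF continuous_on_product_coordinates]) simp
    show "(\<lambda>x. x j) ` K \<subseteq> {0..1}" using KD that(2) by blast
  qed
  then have cont': "continuous_on K (\<lambda>x. \<Sum>k<n. \<bar>f k x\<bar>)"
    unfolding f_def by (intro continuous_intros) auto
  have "(\<lambda>_. 0) \<in> K" by (auto simp: K_def)
  with continuous_attains_inf[OF K _ cont'] obtain x where x: "x \<in> K"
    and min: "\<And>y. y \<in> K \<Longrightarrow> (\<Sum>k<n. \<bar>f k x\<bar>) \<le> (\<Sum>k<n. \<bar>f k y\<bar>)" by blast
  define d where "d = (\<Sum>k<n. \<bar>f k x\<bar>)"
  have "d = 0"
  proof (rule ccontr)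
    assume "d \<noteq> 0"
    then have d: "d > 0" by (simp add: d_def sum_nonneg order.not_eq_order_implies_strict)
    then have n: "n > 0" by (auto simp: d_def intro!: gr0I)
    \<comment> \<open>One grid step changes each of the \<open>n\<close> summands of each of the
      \<open>n\<close> functions by at most this much, in total by at most
      \<open>d / 2\<close>.\<close>
    define \<epsilon> where "\<epsilon> = d / (2 * real n * real n)"
    have \<epsilon>: "\<epsilon> > 0" using d n by (simp add: \<epsilon>_def)
    have "\<forall>\<^sub>F p in sequentially. \<forall>s\<in>{0..1}. \<forall>t\<in>{0..1}. \<bar>s - t\<bar> \<le> 1 / real p \<longrightarrow> \<bar>v k j s - v k j t\<bar> \<le> \<epsilon>"
      if "k < n" "j < n" for k j
    proof -
      have "uniformly_continuous_on {0..1} (v k j)"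
        using cont[OF that] by (intro compact_uniformly_continuous) auto
      then obtain \<delta> where \<delta>: "\<delta> > 0"
        "\<And>s t. s \<in> {0..1} \<Longrightarrow> t \<in> {0..1} \<Longrightarrow> dist t s < \<delta> \<Longrightarrow> dist (v k j t) (v k j s) < \<epsilon>"
        using \<epsilon> unfolding uniformly_continuous_on_def by metis
      have "\<forall>\<^sub>F p in sequentially. 1 / real p < \<delta>"
        using \<delta>(1) by (rule order_tendstoD(2)[OF lim_1_over_n])
      then show ?thesis
        by eventually_elim (use \<delta>(2) in \<open>fastforce simp: dist_real_def\<close>)
    qed
    note ev = this
    have "\<forall>\<^sub>F p in sequentially. \<forall>k\<in>{..<n}. \<forall>j\<in>{..<n}. \<forall>s\<in>{0..1}. \<forall>t\<in>{0..1}. \<bar>s - t\<bar> \<le> 1 / real p \<longrightarrow> \<bar>v k j s - v k j t\<bar> \<le> \<epsilon>"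
      by (rule eventually_ball_finite, simp, rule ballI, rule eventually_ball_finite, simp, rule ballI, rule ev) auto
    from eventually_conj[OF this eventually_gt_at_top[of 0]]
    obtain p where p: "0 < p" and mod: "\<And>k j s t. k < n \<Longrightarrow> j < n \<Longrightarrow> s \<in> {0..1} \<Longrightarrow> t \<in> {0..1} \<Longrightarrow>
        \<bar>s - t\<bar> \<le> 1 / real p \<Longrightarrow> \<bar>v k j s - v k j t\<bar> \<le> \<epsilon>"
      by (auto dest!: eventually_happens)
    define sc where "sc q = (\<lambda>j. if j < n then real (q j) / real p else 0)" for q :: "nat \<Rightarrow> nat"
    \<comment> \<open>The label encodes the sign, with the values on opposite faces forced as Kuhn's
      lemma requires; \<open>lo\<close> and \<open>hi\<close> make the forced labels agree with the
      sign.\<close>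
    define label where "label q i = (if q i = 0 then 0 else if q i = p then 1 else if f i (sc q) \<le> 0 then 0 else 1 :: nat)" for q i
    have scI: "sc q j \<in> {0..1}" if "\<forall>i<n. q i \<le> p" "j < n" for q j
      using that p by (auto simp: sc_def divide_simps)
    have l0: "f i (sc q) \<le> 0" if "\<forall>i<n. q i \<le> p" "i < n" "label q i = 0" for q i
    proof (cases "q i = 0")
      case True
      then show ?thesis unfolding f_def using that by (intro lo) (auto simp: sc_def[of q] scI[unfolded sc_def] p divide_simps)
    next
      case False then show ?thesis using that by (auto simp: label_def split: if_splits)
    qed
    have l1: "f i (sc q) \<ge> 0" if "\<forall>i<n. q i \<le> p" "i < n" "label q i \<noteq> 0" for q i
    proof (cases "q i = p")
      case True
      then show ?thesis unfolding f_def using that p by (intro hi) (auto simp: sc_def[of q] divide_simps)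
    next
      case False then show ?thesis using that by (auto simp: label_def split: if_splits)
    qed
    \<comment> \<open>In the cell at \<open>q\<close> every component \<open>i\<close> has two
      corners with different labels, hence values of opposite weak sign, so its value at
      \<open>q\<close> is small.\<close>
    obtain q where q: "\<forall>i<n. q i < p"
      "\<forall>i<n. \<exists>r s. (\<forall>j<n. q j \<le> r j \<and> r j \<le> q j + 1) \<and> (\<forall>j<n. q j \<le> s j \<and> s j \<le> q j + 1) \<and> label r i \<noteq> label s i"
      by (rule kuhn_lemma[OF p, of n label]) (use p in \<open>auto simp: label_def\<close>)
    have near: "\<bar>f i (sc q) - f i (sc r)\<bar> \<le> real n * \<epsilon>"
      if "i < n" and r: "\<forall>j<n. q j \<le> r j \<and> r j \<le> q j + 1" for i r
    proof -
      have qp: "\<forall>j<n. q j \<le> p" "\<forall>j<n. r j \<le> p" using q(1) r by fastforce+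
      have "\<bar>v i j (sc q j) - v i j (sc r j)\<bar> \<le> \<epsilon>" if j: "j < n" for j
      proof (rule mod[OF \<open>i < n\<close> j scI[OF qp(1) j] scI[OF qp(2) j]])
        have "\<bar>real (q j) - real (r j)\<bar> \<le> 1" using r j by force
        then show "\<bar>sc q j - sc r j\<bar> \<le> 1 / real p"
          using j p by (simp add: sc_def divide_simps abs_mult flip: diff_divide_distrib)
      qed
      then have "(\<Sum>j<n. \<bar>v i j (sc q j) - v i j (sc r j)\<bar>) \<le> (\<Sum>j<n. \<epsilon>)" by (intro sum_mono) auto
      moreover have "\<bar>f i (sc q) - f i (sc r)\<bar> \<le> (\<Sum>j<n. \<bar>v i j (sc q j) - v i j (sc r j)\<bar>)"
        unfolding f_def by (simp flip: sum_subtractf)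
      ultimately show ?thesis by simp
    qed
    have "\<bar>f i (sc q)\<bar> \<le> real n * \<epsilon>" if i: "i < n" for i
    proof -
      obtain r s where rs: "\<forall>j<n. q j \<le> r j \<and> r j \<le> q j + 1" "\<forall>j<n. q j \<le> s j \<and> s j \<le> q j + 1" "label r i \<noteq> label s i"
        using q(2) i by blast
      have P: "\<forall>j<n. r j \<le> p" "\<forall>j<n. s j \<le> p" using q(1) rs by fastforce+
      have "label r i = 0 \<or> label r i = 1" "label s i = 0 \<or> label s i = 1" by (auto simp: label_def)
      with rs(3) l0[OF P(1) i] l0[OF P(2) i] l1[OF P(1) i] l1[OF P(2) i]
      have "f i (sc r) \<le> 0 \<and> f i (sc s) \<ge> 0 \<or> f i (sc s) \<le> 0 \<and> f i (sc r) \<ge> 0" by auto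
      with near[OF i rs(1)] near[OF i rs(2)] show ?thesis by linarith
    qed
    then have "(\<Sum>i<n. \<bar>f i (sc q)\<bar>) \<le> (\<Sum>i<n. real n * \<epsilon>)" by (intro sum_mono) auto
    also have "\<dots> < d" using n d by (simp add: \<epsilon>_def)
    also have "d \<le> (\<Sum>i<n. \<bar>f i (sc q)\<bar>)"
    proof -
      have "\<forall>j<n. q j \<le> p" using q(1) by auto
      from scI[OF this] have "sc q \<in> K" by (auto simp: K_def sc_def)
      then show ?thesis unfolding d_def by (rule min)
    qed
    finally show False by simp
  qed
  then have "\<forall>k<n. f k x = 0"
    by (auto simp: d_def sum_nonneg_eq_0_iff)
  with KD[OF x] show ?thesis unfolding f_def by blast
qed

section \<open>The square root of the curve polynomial\<close>

text \<open>At least one gap is assumed; for \<open>N = 1\<close> the product of the ovals is a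
  single point, which is settled in the final proof.\<close>

locale gap_surface = hyperelliptic N a b for N :: nat and a b :: "nat \<Rightarrow> real" +
  assumes N2: "2 \<le> N"
    and ab: "\<And>k. k \<in> {1..N} \<Longrightarrow> a k < b k"
    and ba: "\<And>k. k \<in> {1..<N} \<Longrightarrow> b k < a (k + 1)"
begin

declare One_nat_def [simp del]

lemma gap_index: "j \<in> {1..N-1} \<Longrightarrow> j \<in> {1..N}" "j \<in> {1..N-1} \<Longrightarrow> j + 1 \<in> {1..N}"
  by auto

section \<open>Order of the end points\<close>

lemma b_less_a: "1 \<le> i \<Longrightarrow> i < j \<Longrightarrow> j \<le> N \<Longrightarrow> b i < a j"
proof (induction j)
  case (Suc j)
  show ?case
  proof (cases "i = j")
    case True then show ?thesis using ba[of j] Suc.prems by (auto simp: Suc_eq_plus1)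
  next
    case False
    then have "b i < a j" using Suc by auto
    also have "a j < b j" using ab[of j] Suc.prems by auto
    also have "b j < a (Suc j)" using ba[of j] Suc.prems False by (auto simp: Suc_eq_plus1)
    finally show ?thesis .
  qed
qed simp

lemma a_less_b: "1 \<le> i \<Longrightarrow> i \<le> j \<Longrightarrow> j \<le> N \<Longrightarrow> a i < b j"
proof -
  assume ij: "1 \<le> i" "i \<le> j" "j \<le> N"
  then have "a i < b i" "a j < b j" using ab[of i] ab[of j] by auto
  with b_less_a[of i j] ij show "a i < b j" by (cases "i = j") auto
qed

lemma a_less_iff: "i \<in> {1..N} \<Longrightarrow> j \<in> {1..N} \<Longrightarrow> a i < a j \<longleftrightarrow> i < j"
  using b_less_a[of i j] b_less_a[of j i] ab[of i] ab[of j]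
  by (cases i j rule: linorder_cases) (auto simp: not_less intro: order.strict_trans less_imp_le)

lemma b_less_iff: "i \<in> {1..N} \<Longrightarrow> j \<in> {1..N} \<Longrightarrow> b i < b j \<longleftrightarrow> i < j"
  using b_less_a[of i j] b_less_a[of j i] ab[of i] ab[of j]
  by (cases i j rule: linorder_cases) (auto simp: not_less intro: order.strict_trans less_imp_le)

definition ends :: "real set" where "ends = a ` {1..N} \<union> b ` {1..N}"

lemma finite_ends [simp]: "finite ends" by (simp add: ends_def)

lemma branch_values_ends: "branch_values = of_real ` ends"
  by (simp add: branch_values_def ends_def)

lemma a_in_ends [simp]: "k \<in> {1..N} \<Longrightarrow> a k \<in> ends" and b_in_ends [simp]: "k \<in> {1..N} \<Longrightarrow> b k \<in> ends"
  by (auto simp: ends_def)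

lemma inj_a: "inj_on a {1..N}"
  by (rule inj_onI) (metis a_less_iff linorder_neqE_nat order_less_irrefl)

lemma inj_b: "inj_on b {1..N}"
  by (rule inj_onI) (metis b_less_iff linorder_neqE_nat order_less_irrefl)

lemma a_neq_b: "i \<in> {1..N} \<Longrightarrow> j \<in> {1..N} \<Longrightarrow> a i \<noteq> b j"
  using a_less_b[of i j] b_less_a[of j i] by (cases "i \<le> j") auto

lemma prod_ends: "(\<Prod>e\<in>ends. f e) = (\<Prod>k\<in>{1..N}. f (a k) * f (b k))"
proof -
  have "(\<Prod>e\<in>ends. f e) = (\<Prod>e\<in>a ` {1..N}. f e) * (\<Prod>e\<in>b ` {1..N}. f e)"
    unfolding ends_def using a_neq_b by (intro prod.union_disjoint) auto
  also have "\<dots> = (\<Prod>k\<in>{1..N}. f (a k) * f (b k))"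
    by (simp add: prod.reindex[OF inj_a] prod.reindex[OF inj_b] prod.distrib)
  finally show ?thesis .
qed

lemma sum_ends: "(\<Sum>e\<in>ends. f e) = (\<Sum>k\<in>{1..N}. f (a k) + f (b k))"
proof -
  have "(\<Sum>e\<in>ends. f e) = (\<Sum>e\<in>a ` {1..N}. f e) + (\<Sum>e\<in>b ` {1..N}. f e)"
    unfolding ends_def using a_neq_b by (intro sum.union_disjoint) auto
  also have "\<dots> = (\<Sum>k\<in>{1..N}. f (a k) + f (b k))"
    by (simp add: sum.reindex[OF inj_a] sum.reindex[OF inj_b] sum.distrib)
  finally show ?thesis .
qed

lemma curve_poly_ends: "curve_poly z = (\<Prod>e\<in>ends. z - of_real e)"
  by (simp add: curve_poly_def prod_ends)

lemma curve_poly_eq_0: "curve_poly z = 0 \<longleftrightarrow> z \<in> branch_values"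
  by (auto simp: curve_poly_ends branch_values_ends prod_zero_iff)

lemma curve_poly_cnj: "curve_poly (cnj z) = cnj (curve_poly z)"
  by (simp add: curve_poly_ends)

lemma gap_pos: "j \<in> {1..N-1} \<Longrightarrow> b j < a (j + 1)"
  using ba[of j] by auto

lemma gap_sides:
  assumes "j \<in> {1..N-1}" "b j \<le> x" "x \<le> a (j + 1)" "k \<in> {1..N}"
  shows "b k \<le> x \<or> x \<le> a k" "k \<le> j \<Longrightarrow> b k \<le> x" "j < k \<Longrightarrow> x \<le> a k"
proof -
  show 1: "b k \<le> x" if "k \<le> j"
    using that assms(2) b_less_iff[OF gap_index(1)[OF assms(1)] assms(4)] by linarith
  show 2: "x \<le> a k" if "j < k"
    using that assms(3) a_less_iff[OF assms(4) gap_index(2)[OF assms(1)]] by linarith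
  show "b k \<le> x \<or> x \<le> a k" using 1 2 by (cases "k \<le> j") auto
qed

lemma ends_cases_gap:
  assumes "j \<in> {1..N-1}" "e \<in> ends"
  shows "e \<le> a j \<or> e = b j \<or> e = a (j + 1) \<or> b (j + 1) \<le> e"
proof -
  obtain k where k: "k \<in> {1..N}" "e = a k \<or> e = b k" using assms by (auto simp: ends_def)
  have j: "j \<in> {1..N}" "j + 1 \<in> {1..N}" using assms by auto
  consider "k < j" | "k = j" | "k = j + 1" | "k > j + 1" by linarith
  then show ?thesis
  proof cases
    case 1 then show ?thesis using k j a_less_iff[of k j] b_less_a[of k j] by auto
  next
    case 4 then show ?thesis using k j b_less_iff[of "j+1" k] b_less_a[of "j+1" k] by auto
  qed (use k in auto)
qed

lemma gap_not_ends: "j \<in> {1..N-1} \<Longrightarrow> b j < x \<Longrightarrow> x < a (j + 1) \<Longrightarrow> x \<notin> ends"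
  using ends_cases_gap[of j x] ab[OF gap_index(1)[of j]] ab[OF gap_index(2)[of j]] by linarith

lemma cut_not_ends:
  assumes "j \<in> {1..N}" "a j < x" "x < b j"
  shows "x \<notin> ends"
proof
  assume "x \<in> ends"
  then obtain k where k: "k \<in> {1..N}" "x = a k \<or> x = b k" by (auto simp: ends_def)
  then show False
    using assms a_less_iff[of j k] b_less_iff[of k j] a_less_b[of j k] b_less_a[of k j] b_less_a[of j k]
    by (cases j k rule: linorder_cases) (auto simp: a_less_iff b_less_iff)
qed

lemma left_not_ends: "x < a 1 \<Longrightarrow> x \<notin> ends"
  using a_less_iff[of _ 1] a_less_b[of 1] N2 by (fastforce simp: ends_def)

section \<open>The cuts and the two square roots \<open>upper_root\<close> and
  \<open>root_branch\<close>\<close>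

lemma not_cuts_iff: "z \<notin> cuts \<longleftrightarrow> (\<forall>k\<in>{1..N}. \<not> (Im z = 0 \<and> a k \<le> Re z \<and> Re z \<le> b k))"
  by (auto simp: cuts_def image_iff complex_eq_iff)

lemma closed_cuts: "closed cuts"
  unfolding cuts_def
  by (intro closed_UN ballI compact_imp_closed compact_continuous_image continuous_intros) auto

lemma branch_values_cuts: "branch_values \<subseteq> cuts"
proof
  fix z assume "z \<in> branch_values"
  then obtain k where k: "k \<in> {1..N}" "z = of_real (a k) \<or> z = of_real (b k)"
    by (auto simp: branch_values_def)
  with ab[OF k(1)] show "z \<in> cuts" unfolding cuts_def by (intro UN_I[OF k(1)]) auto
qed

text \<open>On the closed upper half plane off the cuts this is the first-sheet root. Unlike
  \<open>root_branch\<close> it continues across the open cuts, being holomorphic off the downward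
  slits at the end points.\<close>

definition upper_root :: "complex \<Rightarrow> complex" where
  "upper_root z = (\<Prod>e\<in>ends. down_sqrt e z)"

lemma upper_root_sq: "(upper_root z)\<^sup>2 = curve_poly z"
  by (simp add: upper_root_def curve_poly_ends prod_power_distrib)

lemma upper_root_eq_0: "upper_root z = 0 \<longleftrightarrow> z \<in> branch_values"
  using upper_root_sq[of z] curve_poly_eq_0[of z] by auto

lemma upper_root_nz: "z \<in> slit_plane E \<Longrightarrow> ends \<subseteq> E \<Longrightarrow> upper_root z \<noteq> 0"
  by (auto simp: upper_root_eq_0 branch_values_ends slit_plane_def)

lemma upper_root_holomorphic: "ends \<subseteq> E \<Longrightarrow> upper_root holomorphic_on slit_plane E"
  unfolding upper_root_def
  by (intro holomorphic_intros holomorphic_on_subset[OF down_sqrt_holomorphic] slit_plane_mono) auto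

text \<open>Outside the interval both roots are real or both are imaginary.\<close>

lemma down_sqrt_pair_real:
  assumes "e \<le> e'" "e' \<le> x \<or> x \<le> e"
  shows "down_sqrt e (of_real x) * down_sqrt e' (of_real x) \<in> \<real>"
proof (cases "e' \<le> x")
  case True
  then show ?thesis using assms by (simp add: down_sqrt_right)
next
  case False
  have "(\<i> * of_real u) * (\<i> * of_real v) = complex_of_real (- (u * v))" for u v
    by (simp add: complex_eq_iff)
  with False show ?thesis using assms by (simp add: down_sqrt_left)
qed

lemma upper_root_real:
  assumes "\<And>k. k \<in> {1..N} \<Longrightarrow> b k \<le> x \<or> x \<le> a k"
  shows "upper_root (of_real x) \<in> \<real>"
  unfolding upper_root_def prod_ends
  using assms ab by (intro prod_in_Reals down_sqrt_pair_real) (auto intro: less_imp_le)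

lemma upper_root_gap_real: "j \<in> {1..N-1} \<Longrightarrow> b j \<le> x \<Longrightarrow> x \<le> a (j + 1) \<Longrightarrow> upper_root (of_real x) \<in> \<real>"
  using gap_sides(1) by (intro upper_root_real) blast

lemma upper_root_left_real: "x \<le> a 1 \<Longrightarrow> upper_root (of_real x) \<in> \<real>"
  using a_less_iff[of _ 1] N2 by (intro upper_root_real) force

text \<open>Only the pair belonging to this cut has exactly one imaginary factor; every other pair
  is real.\<close>

lemma upper_root_cut_imag:
  assumes j: "j \<in> {1..N}" and x: "a j \<le> x" "x \<le> b j"
  shows "Re (upper_root (of_real x)) = 0"
proof -
  let ?p = "\<lambda>k. down_sqrt (a k) (of_real x) * down_sqrt (b k) (of_real x)"
  have "upper_root (of_real x) = ?p j * (\<Prod>k\<in>{1..N}-{j}. ?p k)"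
    unfolding upper_root_def prod_ends using j by (intro prod.remove) auto
  moreover have "(\<Prod>k\<in>{1..N}-{j}. ?p k) \<in> \<real>"
  proof (intro prod_in_Reals down_sqrt_pair_real)
    fix k assume k: "k \<in> {1..N} - {j}"
    then show "a k \<le> b k" using ab[of k] by auto
    show "b k \<le> x \<or> x \<le> a k"
      using k j x b_less_a[of k j] b_less_a[of j k] by (cases "k < j") auto
  qed
  then obtain r where "(\<Prod>k\<in>{1..N}-{j}. ?p k) = of_real r" by (auto elim: Reals_cases)
  ultimately show ?thesis using x by (simp add: down_sqrt_left down_sqrt_right)
qed

text \<open>If the quotient is \<open>r <= 0\<close>, then \<open>Im z = r * Im z\<close> makes
  \<open>z\<close> real, and \<open>z - a k = r * (z - b k)\<close> puts it between
  \<open>a k\<close> and \<open>b k\<close>.\<close>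

lemma cut_quotient:
  assumes "a k < b k" "\<not> (Im z = 0 \<and> a k \<le> Re z \<and> Re z \<le> b k)"
  shows "(z - of_real (a k)) / (z - of_real (b k)) \<notin> \<real>\<^sub>\<le>\<^sub>0"
proof
  assume "(z - of_real (a k)) / (z - of_real (b k)) \<in> \<real>\<^sub>\<le>\<^sub>0"
  then obtain r where r: "r \<le> 0" "(z - of_real (a k)) / (z - of_real (b k)) = of_real r"
    by (auto elim!: nonpos_Reals_cases)
  have "z \<noteq> of_real (b k)" using assms by auto
  then have eq: "z - of_real (a k) = of_real r * (z - of_real (b k))" using r by (simp add: field_simps)
  then have "Im z = r * Im z" by (simp add: complex_eq_iff)
  then have "Im z = 0" using r by auto
  from eq have re: "Re z - a k = r * (Re z - b k)" by (simp add: complex_eq_iff)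
  consider "Re z < a k" | "Re z > b k" using assms \<open>Im z = 0\<close> by linarith
  then show False
  proof cases
    case 1
    then have "r * (Re z - b k) \<ge> 0" using r assms by (intro mult_nonpos_nonpos) auto
    with 1 re show False by simp
  next
    case 2
    then have "r * (Re z - b k) \<le> 0" using r assms by (intro mult_nonpos_nonneg) auto
    with 2 re assms show False by simp
  qed
qed

lemma cut_quotient': "z \<notin> cuts \<Longrightarrow> k \<in> {1..N} \<Longrightarrow> (z - of_real (a k)) / (z - of_real (b k)) \<notin> \<real>\<^sub>\<le>\<^sub>0"
  using cut_quotient[OF ab] by (auto simp: not_cuts_iff)

lemma root_branch_cnj: "z \<notin> cuts \<Longrightarrow> root_branch (cnj z) = cnj (root_branch z)"
  unfolding root_branch_def cnj_prod
  by (intro prod.cong) (simp_all add: cnj_csqrt[OF cut_quotient'])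

lemma root_branch_sq: "(root_branch z)\<^sup>2 = curve_poly z"
  unfolding root_branch_def curve_poly_def prod_power_distrib
  by (intro prod.cong refl) (simp add: power_mult_distrib, simp add: power2_eq_square)

lemma root_branch_eq_0: "root_branch z = 0 \<longleftrightarrow> z \<in> branch_values"
  using root_branch_sq[of z] curve_poly_eq_0[of z] by auto

lemma root_branch_nz: "z \<notin> cuts \<Longrightarrow> root_branch z \<noteq> 0"
  using branch_values_cuts by (auto simp: root_branch_eq_0)

lemma root_branch_holomorphic: "root_branch holomorphic_on - cuts"
proof -
  have "z \<noteq> of_real (b k)" if "z \<notin> cuts" "k \<in> {1..N}" for z k
    using that branch_values_cuts b_in_ends[OF that(2)] unfolding branch_values_ends by blast
  then show ?thesis
    unfolding root_branch_def using cut_quotient'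
    by (intro holomorphic_intros) auto
qed

text \<open>For each \<open>k\<close> the roots \<open>?u\<close> and \<open>?v\<close> lie in the
  closed first quadrant, so their arguments differ by at most pi/2, with equality only over the cut.
  Off the cut \<open>?u / ?v\<close> has positive real part and is therefore the principal root of
  its square.\<close>

lemma root_branch_upper:
  assumes "Im z \<ge> 0" "z \<notin> cuts"
  shows "root_branch z = upper_root z"
  unfolding root_branch_def upper_root_def prod_ends
proof (intro prod.cong refl)
  fix k assume k: "k \<in> {1..N}"
  let ?u = "down_sqrt (a k) z" and ?v = "down_sqrt (b k) z"
  have nz: "?v \<noteq> 0" "?u \<noteq> 0" using assms(2) k ab[OF k] unfolding down_sqrt_eq_0 not_cuts_iff by fastforce+
  have q: "Re w \<ge> 0 \<and> Im w \<ge> 0" if "w = down_sqrt e z" for w e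
  proof -
    have w: "w = csqrt (z - of_real e)" using that down_sqrt_upper[OF assms(1)] by simp
    have "0 < Re w \<or> Re w = 0 \<and> 0 \<le> Im w" unfolding w by (rule csqrt_principal)
    moreover have "Im (w\<^sup>2) \<ge> 0" using assms(1) by (simp add: that)
    ultimately show ?thesis by (auto simp: Im_power2 zero_le_mult_iff)
  qed
  have "Re (?u * cnj ?v) \<noteq> 0"
  proof
    assume "Re (?u * cnj ?v) = 0"
    then have "Re ?u * Re ?v + Im ?u * Im ?v = 0" by simp
    with q[of ?u "a k"] q[of ?v "b k"] have z: "Re ?u * Re ?v = 0" "Im ?u * Im ?v = 0"
      by (simp_all add: add_nonneg_eq_0_iff)
    have sq: "z - of_real (a k) = ?u\<^sup>2" "z - of_real (b k) = ?v\<^sup>2" by simp_all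
    from z nz have "Re ?u = 0 \<and> Im ?v = 0 \<or> Im ?u = 0 \<and> Re ?v = 0"
      by (auto simp: complex_eq_iff)
    moreover have "Re p = 0 \<and> Im q = 0 \<or> Im p = 0 \<and> Re q = 0 \<Longrightarrow>
      Im (p\<^sup>2) = 0 \<and> (Re (p\<^sup>2) \<le> 0 \<and> Re (q\<^sup>2) \<ge> 0 \<or> Re (p\<^sup>2) \<ge> 0 \<and> Re (q\<^sup>2) \<le> 0)" for p q :: complex
      by (auto simp: Im_power2 Re_power2)
    ultimately have "Im (?u\<^sup>2) = 0 \<and> (Re (?u\<^sup>2) \<le> 0 \<and> Re (?v\<^sup>2) \<ge> 0 \<or> Re (?u\<^sup>2) \<ge> 0 \<and> Re (?v\<^sup>2) \<le> 0)"
      by blast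
    then show False using assms(2) k ab[OF k] unfolding sq[symmetric] by (auto simp: not_cuts_iff)
  qed
  moreover have "Re (?u * cnj ?v) \<ge> 0" using q[of ?u "a k"] q[of ?v "b k"] by simp
  ultimately have "Re (?u * cnj ?v) > 0" by simp
  then have "Re (?u / ?v) > 0" using nz
    by (simp add: complex_div_cnj[of ?u ?v] zero_less_divide_iff)
  then have "csqrt ((?u / ?v)\<^sup>2) = ?u / ?v" by (simp add: csqrt_unique)
  then have "csqrt ((z - of_real (a k)) / (z - of_real (b k))) = ?u / ?v" by (simp add: power_divide)
  moreover have "z - of_real (b k) = ?v * ?v" by (metis down_sqrt_sq power2_eq_square)
  ultimately show "(z - of_real (b k)) * csqrt ((z - of_real (a k)) / (z - of_real (b k))) = ?u * ?v"
    using nz by simp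
qed

lemma affine_part_iff: "Pt z w \<in> affine_part \<longleftrightarrow> w\<^sup>2 = curve_poly z"
  by (auto simp: affine_part_def)

lemma surface_Pt_iff: "Pt z w \<in> surface \<longleftrightarrow> w\<^sup>2 = curve_poly z"
  by (auto simp: surface_def affine_part_iff)

lemma surface_Infty_iff: "Infty n \<in> surface \<longleftrightarrow> n = 1 \<or> n = 2"
  by (auto simp: surface_def affine_part_def)

lemma surface_w_eq_0: "Pt z w \<in> surface \<Longrightarrow> w = 0 \<longleftrightarrow> z \<in> branch_values"
  using curve_poly_eq_0[of z] by (auto simp: surface_Pt_iff)

lemma surface_w_cases: "w\<^sup>2 = curve_poly z \<Longrightarrow> w = root_branch z \<or> w = - root_branch z"
  using root_branch_sq[of z] by (simp flip: power2_eq_iff)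

section \<open>Parametrization of the ovals\<close>

definition gap_mid :: "nat \<Rightarrow> real" where "gap_mid j = (b j + a (j + 1)) / 2"
definition gap_rad :: "nat \<Rightarrow> real" where "gap_rad j = (a (j + 1) - b j) / 2"

lemma gap_rad_pos: "j \<in> {1..N-1} \<Longrightarrow> gap_rad j > 0"
  using gap_pos by (simp add: gap_rad_def)

definition other_ends :: "nat \<Rightarrow> real set" where "other_ends j = ends - {b j, a (j + 1)}"

lemma finite_other_ends [simp]: "finite (other_ends j)" by (simp add: other_ends_def)

lemma prod_other_ends:
  assumes "j \<in> {1..N-1}"
  shows "(\<Prod>e\<in>ends. f e) = f (b j) * f (a (j + 1)) * (\<Prod>e\<in>other_ends j. f e)"
proof -
  have "b j \<in> ends" "a (j+1) \<in> ends" "b j \<noteq> a (j+1)" using assms gap_pos[OF assms] by auto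
  then have "(\<Prod>e\<in>ends. f e) = (\<Prod>e\<in>{b j, a (j+1)}. f e) * (\<Prod>e\<in>other_ends j. f e)"
    unfolding other_ends_def by (subst prod.subset_diff[of "{b j, a (j+1)}"]) (auto simp: mult.commute)
  then show ?thesis using \<open>b j \<noteq> a (j+1)\<close> by simp
qed

text \<open>The modulus of \<open>w\<close> without the two factors that vanish at the ends of the
  gap; it stays positive into both adjacent cuts.\<close>

definition gap_root :: "nat \<Rightarrow> real \<Rightarrow> real" where
  "gap_root j x = (\<Prod>e\<in>other_ends j. sqrt \<bar>x - e\<bar>)"

text \<open>Every end point to the right of the gap contributes a factor i on the gap. Dividing by
  this constant gives \<open>gap_croot\<close>, the holomorphic continuation of the positive
  function \<open>gap_root\<close>.\<close>

definition gap_phase :: "nat \<Rightarrow> complex" where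
  "gap_phase j = (\<Prod>e\<in>other_ends j. if e < b j then 1 else \<i>)"

definition gap_croot :: "nat \<Rightarrow> complex \<Rightarrow> complex" where
  "gap_croot j z = (\<Prod>e\<in>other_ends j. down_sqrt e z) / gap_phase j"

lemma other_ends_sides:
  assumes "j \<in> {1..N-1}" "e \<in> other_ends j"
  shows "e \<le> a j \<and> e < b j \<or> b (j + 1) \<le> e \<and> \<not> e < b j"
  using ends_cases_gap[OF assms(1)] assms ab[of j] ab[of "j+1"] gap_pos[OF assms(1)]
  by (fastforce simp: other_ends_def)

lemma gap_phase_nz: "gap_phase j \<noteq> 0"
  by (auto simp: gap_phase_def prod_zero_iff)

lemma norm_gap_phase: "norm (gap_phase j) = 1"
  unfolding gap_phase_def prod_norm[symmetric] by (intro prod.neutral) auto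

lemma gap_croot_real:
  assumes j: "j \<in> {1..N-1}" and x: "a j < x" "x < b (j + 1)"
  shows "gap_croot j (of_real x) = of_real (gap_root j x)" "gap_root j x > 0"
proof -
  have "(\<Prod>e\<in>other_ends j. down_sqrt e (of_real x))
      = (\<Prod>e\<in>other_ends j. (if e < b j then 1 else \<i>) * of_real (sqrt \<bar>x - e\<bar>))"
    using other_ends_sides[OF j] x by (intro prod.cong) (force simp: down_sqrt_left down_sqrt_right)+
  then show "gap_croot j (of_real x) = of_real (gap_root j x)"
    by (simp add: gap_croot_def gap_root_def gap_phase_nz prod.distrib flip: gap_phase_def)
  show "gap_root j x > 0" unfolding gap_root_def
    using other_ends_sides[OF j] x by (intro prod_pos) force
qed

lemma upper_root_gap_croot:
  assumes "j \<in> {1..N-1}"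
  shows "upper_root z = gap_phase j * gap_croot j z * down_sqrt (b j) z * down_sqrt (a (j + 1)) z"
  unfolding upper_root_def prod_other_ends[OF assms] by (simp add: gap_croot_def gap_phase_nz)

definition gap_sign :: "nat \<Rightarrow> real" where "gap_sign j = Re (gap_phase j * \<i>)"

text \<open>At the midpoint of the gap the root is real and equals \<open>gap_phase j * \<i>\<close>
  times a positive number, the extra i coming from the right end of the gap. A real number of
  modulus 1 remains.\<close>

lemma gap_sign:
  assumes "j \<in> {1..N-1}"
  shows "gap_phase j * \<i> = of_real (gap_sign j)" "gap_sign j = 1 \<or> gap_sign j = -1"
proof -
  let ?x = "gap_mid j"
  have x: "b j < ?x" "?x < a (j+1)" using gap_pos[OF assms] by (auto simp: gap_mid_def field_simps)
  have x': "a j < ?x" "?x < b (j+1)" using x ab[OF gap_index(1)[OF assms]] ab[OF gap_index(2)[OF assms]] by linarith+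
  have "upper_root (of_real ?x) = (gap_phase j * \<i>) * of_real (gap_root j ?x * sqrt (?x - b j) * sqrt (a (j+1) - ?x))"
    using x by (simp add: upper_root_gap_croot[OF assms] gap_croot_real[OF assms x'] down_sqrt_left down_sqrt_right)
  moreover have "gap_root j ?x * sqrt (?x - b j) * sqrt (a (j+1) - ?x) > 0"
    using gap_croot_real(2)[OF assms x'] x by simp
  ultimately have "gap_phase j * \<i> = upper_root (of_real ?x) / of_real (gap_root j ?x * sqrt (?x - b j) * sqrt (a (j+1) - ?x))"
    by (metis less_irrefl nonzero_mult_div_cancel_right of_real_eq_0_iff)
  moreover have "upper_root (of_real ?x) \<in> \<real>" using upper_root_gap_real[OF assms] x by simp
  ultimately have R: "gap_phase j * \<i> \<in> \<real>" by simp
  then show 1: "gap_phase j * \<i> = of_real (gap_sign j)" unfolding gap_sign_def by (rule of_real_Re[symmetric])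
  have "norm (gap_phase j * \<i>) = 1" by (simp add: norm_mult norm_gap_phase)
  then have "\<bar>gap_sign j\<bar> = 1" unfolding 1 by simp
  then show "gap_sign j = 1 \<or> gap_sign j = -1" by linarith
qed

lemma gap_root_sq':
  assumes j: "j \<in> {1..N-1}" and x: "a j < x" "x < b (j + 1)"
  shows "(gap_root j x)\<^sup>2 = - (\<Prod>e\<in>other_ends j. x - e)"
proof -
  have "(gap_phase j)\<^sup>2 = - ((gap_phase j * \<i>)\<^sup>2)" by (simp add: power_mult_distrib)
  also have "\<dots> = -1" using gap_sign[OF j] by auto
  finally have p: "(gap_phase j)\<^sup>2 = -1" .
  have "complex_of_real ((gap_root j x)\<^sup>2) = (gap_croot j (of_real x))\<^sup>2"
    by (simp add: gap_croot_real[OF j x])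
  also have "\<dots> = of_real (- (\<Prod>e\<in>other_ends j. x - e))"
    by (simp add: gap_croot_def power_divide p prod_power_distrib)
  finally show ?thesis by (simp only: of_real_eq_iff)
qed

definition gap_point :: "nat \<Rightarrow> real \<Rightarrow> real" where
  "gap_point j \<theta> = gap_mid j + gap_rad j * cos \<theta>"

text \<open>The factor \<open>sin \<theta>\<close> carries the zeros of \<open>w\<close> at both
  ends of the gap and its change of sign between the sheets, so one smooth formula covers the whole
  oval.\<close>

definition gap_height :: "nat \<Rightarrow> real \<Rightarrow> real" where
  "gap_height j \<theta> = gap_rad j * sin \<theta> * gap_root j (gap_point j \<theta>)"

definition oval_point :: "nat \<Rightarrow> real \<Rightarrow> surface_point" where
  "oval_point j \<theta> = Pt (of_real (gap_point j \<theta>)) (of_real (gap_height j \<theta>))"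

lemma gap_point_bounds:
  assumes "j \<in> {1..N-1}"
  shows "b j \<le> gap_point j \<theta>" "gap_point j \<theta> \<le> a (j + 1)" "a j < gap_point j \<theta>" "gap_point j \<theta> < b (j + 1)"
proof -
  have "\<bar>gap_rad j * cos \<theta>\<bar> \<le> gap_rad j * 1"
    using gap_rad_pos[OF assms] by (simp add: abs_mult)
  then show 1: "b j \<le> gap_point j \<theta>" "gap_point j \<theta> \<le> a (j + 1)"
    by (auto simp: gap_point_def gap_mid_def gap_rad_def field_simps abs_le_iff)
  show "a j < gap_point j \<theta>" "gap_point j \<theta> < b (j + 1)"
    using 1 ab[OF gap_index(1)[OF assms]] ab[OF gap_index(2)[OF assms]] by linarith+
qed

lemma gap_point_ends: "gap_point j \<theta> - b j = gap_rad j * (1 + cos \<theta>)" "a (j + 1) - gap_point j \<theta> = gap_rad j * (1 - cos \<theta>)"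
  by (simp_all add: gap_point_def gap_mid_def gap_rad_def field_simps)

lemma gap_root_pos: "j \<in> {1..N-1} \<Longrightarrow> gap_root j (gap_point j \<theta>) > 0"
  using gap_croot_real(2) gap_point_bounds by blast

definition rcurve :: "real \<Rightarrow> real" where "rcurve x = (\<Prod>e\<in>ends. x - e)"

lemma curve_poly_of_real: "curve_poly (of_real x) = of_real (rcurve x)"
  by (simp add: curve_poly_ends rcurve_def)

lemma gap_height_sq:
  assumes j: "j \<in> {1..N-1}"
  shows "(gap_height j \<theta>)\<^sup>2 = rcurve (gap_point j \<theta>)"
proof -
  let ?x = "gap_point j \<theta>"
  have "rcurve ?x = (?x - b j) * (?x - a (j+1)) * (\<Prod>e\<in>other_ends j. ?x - e)"
    unfolding rcurve_def by (rule prod_other_ends[OF j])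
  also have "\<dots> = (?x - b j) * (a (j+1) - ?x) * (gap_root j ?x)\<^sup>2"
    using gap_root_sq'[OF j gap_point_bounds(3,4)[OF j, of \<theta>]] by (simp add: algebra_simps)
  also have "\<dots> = (gap_rad j)\<^sup>2 * (1 - (cos \<theta>)\<^sup>2) * (gap_root j ?x)\<^sup>2"
    unfolding gap_point_ends by (simp add: algebra_simps power2_eq_square)
  also have "1 - (cos \<theta>)\<^sup>2 = (sin \<theta>)\<^sup>2" by (simp add: cos_squared_eq)
  finally show ?thesis by (simp add: gap_height_def power_mult_distrib)
qed

lemma gap_height_eq_0: "j \<in> {1..N-1} \<Longrightarrow> gap_height j \<theta> = 0 \<longleftrightarrow> sin \<theta> = 0"
  using gap_root_pos[of j \<theta>] gap_rad_pos[of j] by (auto simp: gap_height_def)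

lemma oval_point_in_oval: "j \<in> {1..N-1} \<Longrightarrow> oval_point j \<theta> \<in> oval j"
  using gap_point_bounds[of j \<theta>] gap_height_sq[of j \<theta>]
  by (auto simp: oval_def oval_point_def surface_Pt_iff curve_poly_of_real simp flip: of_real_power)

lemma oval_eq:
  assumes j: "j \<in> {1..N-1}"
  shows "oval j = range (oval_point j)"
proof
  show "range (oval_point j) \<subseteq> oval j" using oval_point_in_oval[OF j] by auto
  show "oval j \<subseteq> range (oval_point j)"
  proof
    fix P assume "P \<in> oval j"
    then obtain x w where P: "P = Pt (of_real x) w" "w\<^sup>2 = of_real (rcurve x)" and x: "b j \<le> x" "x \<le> a (j+1)"
      by (auto simp: oval_def surface_Pt_iff curve_poly_of_real)
    define t where "t = arccos ((x - gap_mid j) / gap_rad j)"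
    have "-1 \<le> (x - gap_mid j) / gap_rad j" "(x - gap_mid j) / gap_rad j \<le> 1"
      using gap_rad_pos[OF j] x by (auto simp: field_simps gap_mid_def gap_rad_def)
    then have xt: "gap_point j t = x" using gap_rad_pos[OF j] by (simp add: gap_point_def t_def)
    have "w\<^sup>2 = (of_real (gap_height j t))\<^sup>2" using gap_height_sq[OF j, of t] P xt by (simp flip: of_real_power)
    then consider "w = of_real (gap_height j t)" | "w = - of_real (gap_height j t)" by (auto simp: power2_eq_iff)
    then show "P \<in> range (oval_point j)"
    proof cases
      case 1 then show ?thesis using P xt by (auto simp: oval_point_def)
    next
      \<comment> \<open>Reflecting the angle keeps \<open>z\<close> and changes the sign of
        \<open>w\<close>.\<close>
      case 2
      have "oval_point j (- t) = P" using 2 P xt by (simp add: oval_point_def gap_point_def gap_height_def)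
      then show ?thesis by (metis rangeI)
    qed
  qed
qed

lemma oval_point_periodic: "oval_point j (\<theta> + 2 * pi * of_int n) = oval_point j \<theta>"
proof -
  have "cos (\<theta> + 2 * pi * of_int n) = cos \<theta>" "sin (\<theta> + 2 * pi * of_int n) = sin \<theta>"
    using sin_cos_eq_iff[of "\<theta> + 2 * pi * of_int n" \<theta>] by (auto simp: mult.commute mult.left_commute)
  then show ?thesis by (simp add: oval_point_def gap_point_def gap_height_def)
qed

lemma upper_root_gap_point:
  assumes j: "j \<in> {1..N-1}" and t: "0 \<le> \<theta>" "\<theta> \<le> pi"
  shows "upper_root (of_real (gap_point j \<theta>)) = of_real (gap_sign j * gap_height j \<theta>)"
proof -
  let ?x = "gap_point j \<theta>"
  have "upper_root (of_real ?x) = (gap_phase j * \<i>) * of_real (gap_root j ?x * (sqrt (?x - b j) * sqrt (a (j+1) - ?x)))"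
    using gap_point_bounds[OF j, of \<theta>]
    by (simp add: upper_root_gap_croot[OF j] gap_croot_real[OF j] down_sqrt_left down_sqrt_right)
  also have "sqrt (?x - b j) * sqrt (a (j+1) - ?x) = sqrt ((gap_rad j * sin \<theta>)\<^sup>2)"
    unfolding gap_point_ends real_sqrt_mult[symmetric]
    unfolding power_mult_distrib sin_squared_eq by (simp add: power2_eq_square algebra_simps)
  also have "\<dots> = gap_rad j * sin \<theta>"
    using gap_rad_pos[OF j] sin_ge_zero[OF t] by simp
  finally show ?thesis by (simp add: gap_sign[OF j] gap_height_def)
qed

end

section \<open>Simple poles\<close>

text \<open>At most a simple pole with residue \<open>r\<close>, where \<open>r = 0\<close> includes
  removable singularities. In this form the notion is linear in \<open>f\<close>, which pole orders
  are not.\<close>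

definition simple_sing :: "complex \<Rightarrow> (complex \<Rightarrow> complex) \<Rightarrow> bool" where
  "simple_sing r f \<longleftrightarrow> (\<exists>h. h analytic_on {0} \<and> h 0 = r \<and> (\<forall>\<^sub>F t in at 0. f t = h t / t))"

lemma simple_singI:
  assumes "h analytic_on {0}" "h 0 = r" "\<And>t. t \<noteq> 0 \<Longrightarrow> f t = h t / t"
  shows "simple_sing r f"
  unfolding simple_sing_def
proof (intro exI conjI)
  show "\<forall>\<^sub>F t in at 0. f t = h t / t" using assms(3) by (auto simp: eventually_at_filter)
qed (use assms in auto)

lemma simple_sing_cong: "(\<forall>\<^sub>F t in at 0. f t = g t) \<Longrightarrow> simple_sing r f \<Longrightarrow> simple_sing r g"
  unfolding simple_sing_def
proof (elim exE conjE)
  fix h assume h: "\<forall>\<^sub>F t in at 0. f t = g t" "h analytic_on {0}" "h 0 = r" "\<forall>\<^sub>F t in at 0. f t = h t / t"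
  from h(1,4) have "\<forall>\<^sub>F t in at 0. g t = h t / t" by eventually_elim simp
  with h show "\<exists>h. h analytic_on {0} \<and> h 0 = r \<and> (\<forall>\<^sub>F t in at 0. g t = h t / t)" by blast
qed

lemma simple_sing_add:
  assumes "simple_sing r f" "simple_sing s g"
  shows "simple_sing (r + s) (\<lambda>t. f t + g t)"
proof -
  obtain h k where h: "h analytic_on {0}" "h 0 = r" "\<forall>\<^sub>F t in at 0. f t = h t / t"
    and k: "k analytic_on {0}" "k 0 = s" "\<forall>\<^sub>F t in at 0. g t = k t / t"
    using assms unfolding simple_sing_def by blast
  have "\<forall>\<^sub>F t in at 0. f t + g t = (h t + k t) / t"
    using h(3) k(3) by eventually_elim (simp add: add_divide_distrib)
  then show ?thesis unfolding simple_sing_def using h k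
    by (intro exI[of _ "\<lambda>t. h t + k t"]) (auto intro: analytic_intros)
qed

lemma simple_sing_cmult:
  assumes "simple_sing r f"
  shows "simple_sing (c * r) (\<lambda>t. c * f t)"
proof -
  obtain h where h: "h analytic_on {0}" "h 0 = r" "\<forall>\<^sub>F t in at 0. f t = h t / t"
    using assms unfolding simple_sing_def by blast
  have "\<forall>\<^sub>F t in at 0. c * f t = (c * h t) / t"
    using h(3) by eventually_elim simp
  then show ?thesis unfolding simple_sing_def using h
    by (intro exI[of _ "\<lambda>t. c * h t"]) (auto intro: analytic_intros)
qed

lemma simple_sing_zero: "simple_sing 0 (\<lambda>_. 0)"
  by (rule simple_singI[of "\<lambda>_. 0"]) (auto intro: analytic_intros)

lemma simple_sing_sum:
  "finite I \<Longrightarrow> (\<And>i. i \<in> I \<Longrightarrow> simple_sing (r i) (f i)) \<Longrightarrow> simple_sing (\<Sum>i\<in>I. r i) (\<lambda>t. \<Sum>i\<in>I. f i t)"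
  by (induction I rule: finite_induct) (auto intro: simple_sing_add simple_sing_zero)

lemma simple_sing_diff:
  "simple_sing r f \<Longrightarrow> simple_sing s g \<Longrightarrow> simple_sing (r - s) (\<lambda>t. f t - g t)"
  using simple_sing_add[OF _ simple_sing_cmult[of s g "-1"], of r f] by simp

lemma simple_sing_residue:
  assumes "simple_sing r f"
  shows "residue f 0 = r"
proof -
  obtain h where h: "h analytic_on {0}" "h 0 = r" "\<forall>\<^sub>F t in at 0. f t = h t / t"
    using assms unfolding simple_sing_def by blast
  obtain S where S: "open S" "0 \<in> S" "h holomorphic_on S" using h(1) by (auto simp: analytic_at)
  have "residue f 0 = residue (\<lambda>t. h t / (t - 0)) 0" by (rule residue_cong) (use h(3) in simp_all)
  then show ?thesis using residue_simple[OF S] h(2) by simp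
qed

lemma simple_sing_meromorphic: "simple_sing r f \<Longrightarrow> f meromorphic_on {0}"
proof -
  assume "simple_sing r f"
  then obtain h where h: "h analytic_on {0}" "h 0 = r" "\<forall>\<^sub>F t in at 0. f t = h t / t"
    unfolding simple_sing_def by blast
  have "(\<lambda>t. h t / t) meromorphic_on {0}"
    by (intro meromorphic_intros analytic_on_imp_meromorphic_on h)
  moreover have "f meromorphic_on {0} \<longleftrightarrow> (\<lambda>t. h t / t) meromorphic_on {0}"
    by (rule meromorphic_on_cong) (use h in auto)
  ultimately show ?thesis by simp
qed

lemma simple_sing_0_tendsto:
  assumes "simple_sing 0 f"
  shows "\<exists>l. (f \<longlongrightarrow> l) (at 0)"
proof -
  obtain h where h: "h analytic_on {0}" "h 0 = 0" "\<forall>\<^sub>F t in at 0. f t = h t / t"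
    using assms unfolding simple_sing_def by blast
  have "(h has_field_derivative deriv h 0) (at 0)"
    using h(1) by (simp add: analytic_on_imp_differentiable_at DERIV_deriv_iff_field_differentiable)
  then have "((\<lambda>t. h t / t) \<longlongrightarrow> deriv h 0) (at 0)"
    using h(2) by (simp add: has_field_derivative_iff)
  then have "(f \<longlongrightarrow> deriv h 0) (at 0)"
    by (rule Lim_transform_eventually) (use h(3) in \<open>auto elim: eventually_mono\<close>)
  then show ?thesis by blast
qed

lemma simple_sing_pole:
  assumes "simple_sing r f" "r \<noteq> 0"
  shows "is_pole f 0" "zorder f 0 = -1"
proof -
  obtain h where h: "h analytic_on {0}" "h 0 = r" "\<forall>\<^sub>F t in at 0. f t = h t / t"
    using assms unfolding simple_sing_def by blast
  obtain S where S: "open S" "0 \<in> S" "h holomorphic_on S" using h(1) by (auto simp: analytic_at)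
  have "is_pole (\<lambda>t. h t / t ^ 1) 0" by (rule is_pole_basic') (use S h assms in auto)
  then show "is_pole f 0" using is_pole_cong[OF h(3), of 0] by simp
  obtain d where d: "d > 0" "\<And>t. t \<noteq> 0 \<Longrightarrow> dist t 0 < d \<Longrightarrow> f t = h t / t"
    using h(3) unfolding eventually_at by auto
  show "zorder f 0 = -1"
  proof (rule zorder_eqI[of "S \<inter> ball 0 d" 0 h])
    show "h holomorphic_on S \<inter> ball 0 d" using S by (auto intro: holomorphic_on_subset)
    show "f w = h w * (w - 0) powi -1" if "w \<in> S \<inter> ball 0 d" "w \<noteq> 0" for w
      using that d(2)[of w] by (simp add: power_int_minus divide_inverse dist_commute)
  qed (use S d h assms in auto)
qed

text \<open>The predicate \<open>simple_sing\<close> leaves the value at 0 open. The value 0 at a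
  pole and the limit otherwise are what \<open>nicely_meromorphic_on\<close> asks for.\<close>

lemma simple_sing_nice:
  assumes f: "simple_sing r f" and 0: "r \<noteq> 0 \<Longrightarrow> f 0 = 0" "r = 0 \<Longrightarrow> (f \<longlongrightarrow> f 0) (at 0)"
  shows "f nicely_meromorphic_on {0}" "is_pole f 0 \<longrightarrow> zorder f 0 = -1" "r = 0 \<Longrightarrow> f analytic_on {0}"
proof -
  show an: "f analytic_on {0}" if "r = 0"
    by (rule meromorphic_at_isCont_imp_analytic[OF simple_sing_meromorphic[OF f]])
       (use 0(2) that in \<open>simp add: isCont_def\<close>)
  show "f nicely_meromorphic_on {0}"
    using simple_sing_meromorphic[OF f] simple_sing_pole(1)[OF f] 0
    by (cases "r = 0") (auto simp: nicely_meromorphic_on_def)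
  show "is_pole f 0 \<longrightarrow> zorder f 0 = -1"
  proof (cases "r = 0")
    case True
    then show ?thesis using 0(2) not_tendsto_and_filterlim_at_infinity[of "at 0" f "f 0"]
      by (auto simp: is_pole_def)
  qed (use simple_sing_pole[OF f] in auto)
qed

text \<open>The converse, needed to compare two arbitrary solutions: at a pole
  \<open>zor_poly\<close> is the numerator, otherwise \<open>t * f t\<close> is.\<close>

lemma nice_imp_simple_sing:
  assumes f: "f nicely_meromorphic_on {0}" and z: "is_pole f 0 \<longrightarrow> zorder f 0 = -1" and r: "residue f 0 = r"
  shows "simple_sing r f"
proof (cases "is_pole f 0")
  case False
  then have an: "f analytic_on {0}" using nicely_meromorphic_on_imp_analytic_at[OF f] by auto
  have "simple_sing 0 f"
    by (rule simple_singI[of "\<lambda>t. t * f t"]) (use an in \<open>auto intro!: analytic_intros\<close>)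
  then show ?thesis using simple_sing_residue r by metis
next
  case True
  have "f meromorphic_on {0}" using f by (simp add: nicely_meromorphic_on_def)
  then have "isolated_singularity_at f 0" by (simp add: meromorphic_on_isolated_singularity)
  then obtain R where R: "R > 0" "f analytic_on ball 0 R - {0}" by (auto simp: isolated_singularity_at_def)
  from zorder_exist_pole[of f "ball 0 R" 0] R True z
  obtain s where s: "s > 0" "zor_poly f 0 holomorphic_on cball 0 s"
    "\<And>w. w \<in> cball 0 s - {0} \<Longrightarrow> f w = zor_poly f 0 w / w"
    by (auto simp: analytic_imp_holomorphic)
  have "simple_sing (zor_poly f 0 0) f"
    unfolding simple_sing_def
  proof (intro exI conjI)
    show "zor_poly f 0 analytic_on {0}"
      using s by (auto simp: analytic_at intro!: exI[of _ "ball 0 s"] holomorphic_on_subset[OF s(2)])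
    show "\<forall>\<^sub>F t in at 0. f t = zor_poly f 0 t / t"
      unfolding eventually_at using s by (intro exI[of _ s]) auto
  qed simp
  then show ?thesis using simple_sing_residue r by metis
qed

lemma eventually_at_notin_finite: "finite F \<Longrightarrow> \<forall>\<^sub>F t in at (x::complex). t \<notin> F"
  using eventually_ball_finite[of F "\<lambda>t y. t \<noteq> y" "at x"]
  by (auto simp: eventually_neq_at_within elim!: eventually_mono)

context gap_surface
begin

section \<open>Elementary differentials in local coordinates\<close>

text \<open>For a differential given by \<open>\<Phi> z w\<close> times dz this is its coefficient
  with respect to dt away from \<open>t = 0\<close>, before values at the centres of charts are
  fixed.\<close>

definition pullback :: "(complex \<Rightarrow> complex \<Rightarrow> complex) \<Rightarrow> surface_point \<Rightarrow> complex \<Rightarrow> complex" where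
  "pullback \<Phi> Q t = \<Phi> (local_z Q t) (local_w Q t) * deriv (local_z Q) t"

lemma deriv_local_z_Pt: "deriv (local_z (Pt z w)) t = (if w = 0 then 2 * t else 1)"
proof -
  have "local_z (Pt z w) = (\<lambda>t. if w = 0 then z + t\<^sup>2 else z + t)" by (rule ext) simp
  then show ?thesis by (cases "w = 0") (auto intro!: DERIV_imp_deriv derivative_eq_intros)
qed

lemma deriv_local_z_Infty: "t \<noteq> 0 \<Longrightarrow> deriv (local_z (Infty n)) t = - 1 / t\<^sup>2"
proof -
  assume "t \<noteq> 0"
  have "local_z (Infty n) = (\<lambda>t. 1 / t)" by (rule ext) simp
  with \<open>t \<noteq> 0\<close> show "deriv (local_z (Infty n)) t = - 1 / t\<^sup>2"
    by (auto intro!: DERIV_imp_deriv derivative_eq_intros simp: power2_eq_square)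
qed

lemma curve_poly_branch_cofactor: "e \<in> branch_values \<Longrightarrow> curve_poly z = (z - e) * branch_cofactor e z"
  unfolding branch_cofactor_def branch_values_ends curve_poly_ends
  by (subst prod.remove[symmetric, of "of_real ` ends" e "\<lambda>e. z - e"]) (auto simp: prod.reindex inj_on_def)

lemma branch_cofactor_nz: "e \<in> branch_values \<Longrightarrow> branch_cofactor e e \<noteq> 0"
  unfolding branch_cofactor_def branch_values_ends by (auto simp: prod_zero_iff)

text \<open>The three forms of \<open>local_w\<close>: it is \<open>ord_w\<close> at an ordinary point, \<open>t * branch_v\<close> at a branch
  point and \<open>infty_u / t ^ N\<close>, up to the sign of the sheet, at infinity.\<close>

definition ord_w :: "complex \<Rightarrow> complex \<Rightarrow> complex \<Rightarrow> complex" where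
  "ord_w z w t = w * csqrt (curve_poly (z + t) / curve_poly z)"

definition branch_v :: "complex \<Rightarrow> complex \<Rightarrow> complex" where
  "branch_v e t = csqrt (branch_cofactor e e) * csqrt (branch_cofactor e (e + t\<^sup>2) / branch_cofactor e e)"

definition infty_u :: "complex \<Rightarrow> complex" where
  "infty_u t = (\<Prod>k\<in>{1..N}. (1 - of_real (b k) * t) * csqrt ((1 - of_real (a k) * t) / (1 - of_real (b k) * t)))"

lemma ord_w:
  assumes "w\<^sup>2 = curve_poly z" "w \<noteq> 0"
  shows "ord_w z w analytic_on {0}" "ord_w z w 0 = w" "(ord_w z w t)\<^sup>2 = curve_poly (z + t)"
proof -
  have nz: "curve_poly z \<noteq> 0" using assms by auto
  have "curve_poly analytic_on UNIV" unfolding curve_poly_def by (intro analytic_intros)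
  then have "(\<lambda>t. curve_poly (z + t)) analytic_on {0}"
    by (intro analytic_on_compose_gen[of "\<lambda>t. z + t" _ curve_poly UNIV, unfolded o_def] analytic_intros) auto
  then show "ord_w z w analytic_on {0}"
    unfolding ord_w_def using nz by (intro analytic_intros) auto
  show "ord_w z w 0 = w" using nz by (simp add: ord_w_def)
  show "(ord_w z w t)\<^sup>2 = curve_poly (z + t)" using nz assms(1) by (simp add: ord_w_def power_mult_distrib)
qed

lemma branch_v:
  assumes "e \<in> branch_values"
  shows "branch_v e analytic_on {0}" "branch_v e 0 \<noteq> 0" "(t * branch_v e t)\<^sup>2 = curve_poly (e + t\<^sup>2)"
proof -
  have "(\<lambda>t. branch_cofactor e (e + t\<^sup>2)) analytic_on {0}"
    unfolding branch_cofactor_def by (intro analytic_intros)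
  then show "branch_v e analytic_on {0}"
    unfolding branch_v_def using branch_cofactor_nz[OF assms] by (intro analytic_intros) auto
  show "branch_v e 0 \<noteq> 0" using branch_cofactor_nz[OF assms] by (simp add: branch_v_def)
  show "(t * branch_v e t)\<^sup>2 = curve_poly (e + t\<^sup>2)"
    using branch_cofactor_nz[OF assms] curve_poly_branch_cofactor[OF assms]
    by (simp add: branch_v_def power_mult_distrib)
qed

lemma infty_u:
  shows "infty_u analytic_on {0}" "infty_u 0 = 1" "t \<noteq> 0 \<Longrightarrow> root_branch (1 / t) = infty_u t / t ^ N"
proof -
  show "infty_u analytic_on {0}"
    unfolding infty_u_def by (intro analytic_intros) auto
  show "infty_u 0 = 1" by (simp add: infty_u_def)
  show "root_branch (1 / t) = infty_u t / t ^ N" if t: "t \<noteq> 0"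
  proof -
    have "root_branch (1 / t) = (\<Prod>k\<in>{1..N}. ((1 - of_real (b k) * t) * csqrt ((1 - of_real (a k) * t) / (1 - of_real (b k) * t))) / t)"
      unfolding root_branch_def
    proof (intro prod.cong refl)
      fix k
      have "1 / t - of_real c = (1 - of_real c * t) / t" for c using t by (simp add: field_simps)
      then show "(1 / t - of_real (b k)) * csqrt ((1 / t - of_real (a k)) / (1 / t - of_real (b k))) =
        ((1 - of_real (b k) * t) * csqrt ((1 - of_real (a k) * t) / (1 - of_real (b k) * t))) / t"
        using t by simp
    qed
    then show ?thesis by (simp add: infty_u_def prod_dividef)
  qed
qed

lemma local_w_ord: "w \<noteq> 0 \<Longrightarrow> local_w (Pt z w) = ord_w z w"
  by (auto simp: ord_w_def)

lemma local_w_branch: "local_w (Pt e 0) t = t * branch_v e t"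
  by (simp add: branch_v_def)

lemma local_w_infty: "t \<noteq> 0 \<Longrightarrow> local_w (Infty n) t = sheet_sign n * infty_u t / t ^ N"
  by (simp add: infty_u(3))

lemma surface_cases:
  assumes "Q \<in> surface"
  obtains (ord) z w where "Q = Pt z w" "w \<noteq> 0" "w\<^sup>2 = curve_poly z"
  | (branch) e where "Q = Pt e 0" "e \<in> branch_values"
  | (infty) n where "Q = Infty n" "n = 1 \<or> n = 2"
proof (cases Q)
  case (Pt z w)
  then show ?thesis using assms surface_Pt_iff[of z w] surface_w_eq_0[of z w] that by metis
next
  case (Infty n)
  then show ?thesis using assms surface_Infty_iff that by metis
qed

text \<open>In each chart only finitely many \<open>t\<close> lie over a finite set of values of
  \<open>z\<close>, so a punctured neighbourhood avoids both \<open>X\<close> and the branch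
  values.\<close>

lemma eventually_local_ordinary:
  assumes Q: "Q \<in> surface" and X: "finite X"
  shows "\<forall>\<^sub>F t in at 0. t \<noteq> 0 \<and> local_par Q t = Pt (local_z Q t) (local_w Q t) \<and> local_z Q t \<notin> X \<and>
     (local_w Q t)\<^sup>2 = curve_poly (local_z Q t) \<and> local_w Q t \<noteq> 0"
proof -
  let ?X = "X \<union> branch_values"
  have X': "finite ?X" using X by (simp add: branch_values_ends)
  define F where "F = {t. t \<noteq> 0 \<and> local_z Q t \<in> ?X}"
  have "finite F \<and> (\<forall>t. t \<noteq> 0 \<longrightarrow> (local_w Q t)\<^sup>2 = curve_poly (local_z Q t))"
    using Q
  proof (cases rule: surface_cases)
    case (ord z w)
    have "F \<subseteq> (\<lambda>x. x - z) ` ?X" using ord by (auto simp: F_def image_iff algebra_simps)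
    then have "finite F" using X' finite_surj by blast
    then show ?thesis using ord_w(3)[OF ord(3,2)] local_w_ord[OF ord(2), of z] ord(2)
      by (simp add: ord(1) del: local_w.simps)
  next
    case (branch e)
    have "F \<subseteq> (\<Union>x\<in>?X. {csqrt (x - e), - csqrt (x - e)})"
    proof
      fix t assume "t \<in> F"
      then have "e + t\<^sup>2 \<in> ?X" by (simp add: F_def branch)
      moreover have "t\<^sup>2 = (csqrt (e + t\<^sup>2 - e))\<^sup>2" by simp
      then have "t = csqrt (e + t\<^sup>2 - e) \<or> t = - csqrt (e + t\<^sup>2 - e)" by (simp only: power2_eq_iff)
      ultimately show "t \<in> (\<Union>x\<in>?X. {csqrt (x - e), - csqrt (x - e)})" by blast
    qed
    moreover have "finite (\<Union>x\<in>?X. {csqrt (x - e), - csqrt (x - e)})" using X' by blast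
    ultimately have "finite F" by (rule finite_subset)
    then show ?thesis using branch_v(3)[OF branch(2)] local_w_branch by (simp add: branch(1) del: local_w.simps)
  next
    case (infty n)
    have "F \<subseteq> inverse ` ?X"
    proof
      fix t assume "t \<in> F"
      then have "inverse t \<in> ?X" by (simp add: F_def infty inverse_eq_divide)
      then show "t \<in> inverse ` ?X" by (intro image_eqI[of _ _ "inverse t"]) auto
    qed
    then have "finite F" using X' finite_surj by blast
    moreover have "(sheet_sign n)\<^sup>2 = 1" by (simp add: sheet_sign_def)
    ultimately show ?thesis by (simp add: infty power_mult_distrib root_branch_sq)
  qed
  then have fin: "finite F" and sq: "\<And>t. t \<noteq> 0 \<Longrightarrow> (local_w Q t)\<^sup>2 = curve_poly (local_z Q t)" by auto
  have "\<forall>\<^sub>F t in at 0. t \<notin> insert 0 F" using fin by (intro eventually_at_notin_finite) auto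
  then show ?thesis
  proof eventually_elim
    case (elim t)
    then have "curve_poly (local_z Q t) \<noteq> 0" by (auto simp: F_def curve_poly_eq_0)
    then show ?case using elim sq[of t] by (auto simp: F_def local_par_def)
  qed
qed

text \<open>At a branch point \<open>z = e + t^2\<close> doubles the residue; at infinity
  \<open>z = 1 / t\<close> turns dz/(z - c) into - dt/(t (1 - c t)).\<close>

lemma pullback_inverse:
  assumes "Q \<in> surface"
  shows "simple_sing (case Q of Pt z w \<Rightarrow> if z = c then if w = 0 then 2 else 1 else 0 | Infty n \<Rightarrow> - 1)
           (pullback (\<lambda>z w. 1 / (z - c)) Q)"
  using assms
proof (cases rule: surface_cases)
  case (ord z w)
  show ?thesis
  proof (rule simple_singI)
    show "(\<lambda>t. if z = c then 1 else t / (z + t - c)) analytic_on {0}"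
      by (cases "z = c") (auto intro!: analytic_intros)
    show "pullback (\<lambda>z w. 1 / (z - c)) Q t = (if z = c then 1 else t / (z + t - c)) / t" if "t \<noteq> 0" for t
      using that ord by (simp add: pullback_def deriv_local_z_Pt)
  qed (use ord in auto)
next
  case (branch e)
  show ?thesis
  proof (rule simple_singI)
    show "(\<lambda>t. if e = c then 2 else 2 * t\<^sup>2 / (e + t\<^sup>2 - c)) analytic_on {0}"
      by (cases "e = c") (auto intro!: analytic_intros)
    show "pullback (\<lambda>z w. 1 / (z - c)) Q t = (if e = c then 2 else 2 * t\<^sup>2 / (e + t\<^sup>2 - c)) / t" if "t \<noteq> 0" for t
      using that branch by (simp add: pullback_def deriv_local_z_Pt power2_eq_square)
  qed (use branch in auto)
next
  case (infty n)
  show ?thesis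
  proof (rule simple_singI)
    show "(\<lambda>t. - 1 / (1 - c * t)) analytic_on {0}" by (auto intro!: analytic_intros)
    show "pullback (\<lambda>z w. 1 / (z - c)) Q t = (- 1 / (1 - c * t)) / t" if "t \<noteq> 0" for t
    proof -
      have "1 / t - c = (1 - c * t) / t" using that by (simp add: field_simps)
      then show ?thesis
        using that infty by (simp add: pullback_def deriv_local_z_Infty power2_eq_square)
    qed
  qed (use infty in auto)
qed

text \<open>At infinity \<open>w\<close> grows like \<open>t^(-N)\<close> and dz is
  \<open>- dt / t^2\<close>, so the order is \<open>N - 2 - m\<close> and only
  \<open>m = N - 1\<close> leaves a pole. At a branch point the zero of dz cancels that of
  \<open>w\<close>.\<close>

lemma pullback_power:
  assumes "Q \<in> surface" "m < N"
  shows "simple_sing (case Q of Pt z w \<Rightarrow> 0 | Infty n \<Rightarrow> if m = N - 1 then - sheet_sign n else 0)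
           (pullback (\<lambda>z w. z ^ m / w) Q)"
  using assms(1)
proof (cases rule: surface_cases)
  case (ord z w)
  show ?thesis
  proof (rule simple_singI)
    show "(\<lambda>t. t * (z + t) ^ m / ord_w z w t) analytic_on {0}"
      using ord_w[OF ord(3,2)] ord by (auto intro!: analytic_intros)
    show "pullback (\<lambda>z w. z ^ m / w) Q t = (t * (z + t) ^ m / ord_w z w t) / t" if "t \<noteq> 0" for t
      using that ord by (simp add: pullback_def deriv_local_z_Pt local_w_ord del: local_w.simps)
  qed (use ord in auto)
next
  case (branch e)
  show ?thesis
  proof (rule simple_singI)
    show "(\<lambda>t. 2 * t * (e + t\<^sup>2) ^ m / branch_v e t) analytic_on {0}"
      using branch_v[OF branch(2)] by (auto intro!: analytic_intros)
    show "pullback (\<lambda>z w. z ^ m / w) Q t = (2 * t * (e + t\<^sup>2) ^ m / branch_v e t) / t" if "t \<noteq> 0" for t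
      using that branch by (simp add: pullback_def deriv_local_z_Pt local_w_branch del: local_w.simps)
  qed (use branch in auto)
next
  case (infty n)
  have s: "1 / sheet_sign n = sheet_sign n" by (simp add: sheet_sign_def)
  show ?thesis
  proof (rule simple_singI)
    show "(\<lambda>t. - sheet_sign n * t ^ (N - 1 - m) / infty_u t) analytic_on {0}"
      using infty_u by (auto intro!: analytic_intros)
    show "- sheet_sign n * 0 ^ (N - 1 - m) / infty_u 0 = (case Q of Pt z w \<Rightarrow> 0 | Infty n \<Rightarrow> if m = N - 1 then - sheet_sign n else 0)"
      using infty assms(2) by (auto simp: infty_u power_0_left)
    show "pullback (\<lambda>z w. z ^ m / w) Q t = (- sheet_sign n * t ^ (N - 1 - m) / infty_u t) / t" if t: "t \<noteq> 0" for t
    proof -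
      have "t ^ N = t ^ (N - 1 - m) * t ^ m * t" using assms(2) by (simp flip: power_add power_Suc2)
      then have "(1 / t) ^ m * t ^ N / t\<^sup>2 = t ^ (N - 1 - m) / t"
        using t by (simp add: power_divide power2_eq_square)
      moreover have "pullback (\<lambda>z w. z ^ m / w) Q t = - (1 / sheet_sign n) * ((1 / t) ^ m * t ^ N / t\<^sup>2) / infty_u t"
        using t infty by (simp add: pullback_def deriv_local_z_Infty local_w_infty del: local_w.simps)
      ultimately show ?thesis by (simp add: s)
    qed
  qed
qed

text \<open>The numerator \<open>1 + y / w\<close> is 2 at \<open>(p, y)\<close> and 0 at
  \<open>(p, - y)\<close>, so only one of the two points over \<open>p\<close> is a pole. At a
  branch point \<open>y = 0\<close>, and the doubled residue is again 1.\<close>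

lemma pullback_third_kind:
  assumes "Q \<in> surface" "y\<^sup>2 = curve_poly p"
  shows "simple_sing (case Q of Pt z w \<Rightarrow> if z = p \<and> w = y then 1 else 0 | Infty n \<Rightarrow> - 1 / 2)
           (pullback (\<lambda>z w. (1 + y / w) / (2 * (z - p))) Q)"
  using assms(1)
proof (cases rule: surface_cases)
  case (ord z w)
  show ?thesis
  proof (rule simple_singI)
    show "(\<lambda>t. if z = p then (1 + y / ord_w z w t) / 2 else t * (1 + y / ord_w z w t) / (2 * (z + t - p))) analytic_on {0}"
      using ord_w[OF ord(3,2)] ord by (cases "z = p") (auto intro!: analytic_intros)
    have "w = y \<or> w = - y" if "z = p" using that ord assms(2) by (metis power2_eq_iff)
    then show "(if z = p then (1 + y / ord_w z w 0) / 2 else 0 * (1 + y / ord_w z w 0) / (2 * (z + 0 - p)))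
       = (case Q of Pt z w \<Rightarrow> if z = p \<and> w = y then 1 else 0 | Infty n \<Rightarrow> - 1 / 2)"
      using ord_w(2)[OF ord(3,2)] ord by auto
    show "pullback (\<lambda>z w. (1 + y / w) / (2 * (z - p))) Q t =
      (if z = p then (1 + y / ord_w z w t) / 2 else t * (1 + y / ord_w z w t) / (2 * (z + t - p))) / t" if "t \<noteq> 0" for t
      using that ord by (simp add: pullback_def deriv_local_z_Pt local_w_ord mult.commute del: local_w.simps)
  qed
next
  case (branch e)
  show ?thesis
  proof (rule simple_singI)
    show "(\<lambda>t. if e = p then 1 else t * (t + y / branch_v e t) / (e + t\<^sup>2 - p)) analytic_on {0}"
      using branch_v[OF branch(2)] by (cases "e = p") (auto intro!: analytic_intros)
    have y0: "e = p \<Longrightarrow> y = 0" using assms(2) branch(2) curve_poly_eq_0[of e] by auto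
    then show "(if e = p then 1 else 0 * (0 + y / branch_v e 0) / (e + 0\<^sup>2 - p)) =
       (case Q of Pt z w \<Rightarrow> if z = p \<and> w = y then 1 else 0 | Infty n \<Rightarrow> - 1 / 2)"
      using branch by auto
    show "pullback (\<lambda>z w. (1 + y / w) / (2 * (z - p))) Q t =
      (if e = p then 1 else t * (t + y / branch_v e t) / (e + t\<^sup>2 - p)) / t" if t: "t \<noteq> 0" for t
    proof (cases "e = p")
      case True
      then show ?thesis using y0 t branch by (simp add: pullback_def deriv_local_z_Pt power2_eq_square del: local_w.simps)
    next
      case False
      have *: "A / (2 * D) * (2 * t) = (A * t) / D" for A D :: complex by simp
      have "(1 + y / (t * branch_v e t)) * t = t + y / branch_v e t" using t by (simp add: distrib_right)
      then have "(1 + y / (t * branch_v e t)) / (2 * (e + t\<^sup>2 - p)) * (2 * t) = (t + y / branch_v e t) / (e + t\<^sup>2 - p)"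
        unfolding * by simp
      then show ?thesis using t False branch by (simp add: pullback_def deriv_local_z_Pt local_w_branch del: local_w.simps)
    qed
  qed
next
  case (infty n)
  have s: "1 / sheet_sign n = sheet_sign n" by (simp add: sheet_sign_def)
  show ?thesis
  proof (rule simple_singI)
    show "(\<lambda>t. - (1 + y / sheet_sign n * t ^ N / infty_u t) / (2 * (1 - p * t))) analytic_on {0}"
      using infty_u by (auto intro!: analytic_intros simp: sheet_sign_def)
    show "- (1 + y / sheet_sign n * 0 ^ N / infty_u 0) / (2 * (1 - p * 0)) = (case Q of Pt z w \<Rightarrow> if z = p \<and> w = y then 1 else 0 | Infty n \<Rightarrow> - 1 / 2)"
      using infty N2 by auto
    show "pullback (\<lambda>z w. (1 + y / w) / (2 * (z - p))) Q t = (- (1 + y / sheet_sign n * t ^ N / infty_u t) / (2 * (1 - p * t))) / t" if t: "t \<noteq> 0" for t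
    proof -
      have *: "1 / t - p = (1 - p * t) / t" using t by (simp add: field_simps)
      have w: "y / (sheet_sign n * infty_u t / t ^ N) = y / sheet_sign n * t ^ N / infty_u t"
        by simp
      have "pullback (\<lambda>z w. (1 + y / w) / (2 * (z - p))) Q t = (1 + y / sheet_sign n * t ^ N / infty_u t) / (2 * ((1 - p * t) / t)) * (- 1 / t\<^sup>2)"
        unfolding pullback_def infty(1) deriv_local_z_Infty[OF t] local_w_infty[OF t] w by (simp add: *)
      also have "\<dots> = (- (1 + y / sheet_sign n * t ^ N / infty_u t) / (2 * (1 - p * t))) / t"
      proof -
        have "B / (2 * (D / t)) * (- 1 / t\<^sup>2) = (- B / (2 * D)) / t" for B D
          using t by (simp add: power2_eq_square)
        then show ?thesis by blast
      qed
      finally show ?thesis .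
    qed
  qed
qed

end

section \<open>Periods\<close>

lemma Re_primitive_eq:
  assumes G: "\<And>x. l < x \<Longrightarrow> x < u \<Longrightarrow> (G has_field_derivative g x) (at (of_real x))"
    and g: "\<And>x. l < x \<Longrightarrow> x < u \<Longrightarrow> Re (g x) = 0"
    and xy: "l < x" "x < u" "l < y" "y < u"
  shows "Re (G (of_real x)) = Re (G (of_real y))"
proof (rule DERIV_isconst3[where a = l and b = u and f = "\<lambda>x. Re (G (of_real x))"])
  show "((\<lambda>x. Re (G (of_real x))) has_real_derivative 0) (at t)" if "t \<in> {l<..<u}" for t
    using has_field_derivative_Re[OF has_vector_derivative_real_field[OF G[of t], where s = UNIV]] g[of t] that by simp
qed (use xy in auto)

lemma Im_primitive_eq:
  assumes G: "\<And>x. l < x \<Longrightarrow> x < u \<Longrightarrow> (G has_field_derivative g x) (at (of_real x))"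
    and g: "\<And>x. l < x \<Longrightarrow> x < u \<Longrightarrow> Im (g x) = 0"
    and xy: "l < x" "x < u" "l < y" "y < u"
  shows "Im (G (of_real x)) = Im (G (of_real y))"
  using Re_primitive_eq[of l u "\<lambda>z. \<i> * G z" "\<lambda>x. \<i> * g x" x y] assms
  by (auto intro: DERIV_cmult)

lemma cos_complex_strip: "cos (of_real s - \<i> * of_real t) = Complex (cos s * cosh t) (sin s * sinh t)"
  by (simp add: complex_eq_iff Re_cos Im_cos cosh_field_def sinh_field_def field_simps)

lemma sin_complex_strip: "sin (of_real s - \<i> * of_real t) = Complex (sin s * cosh t) (- cos s * sinh t)"
  by (simp add: complex_eq_iff Re_sin Im_sin cosh_field_def sinh_field_def field_simps)

context gap_surface
begin

definition real_fun :: "real set \<Rightarrow> (complex \<Rightarrow> complex) \<Rightarrow> bool" where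
  "real_fun E f \<longleftrightarrow> f holomorphic_on - (of_real ` E) \<and> (\<forall>z. f (cnj z) = cnj (f z))"

text \<open>Singularities are confined to the end points and the closed gaps. The open cuts and the
  half line left of \<open>a 1\<close> stay free for the ends of arcs.\<close>

definition admissible :: "real set \<Rightarrow> bool" where
  "admissible E \<longleftrightarrow> finite E \<and> ends \<subseteq> E \<and> E \<subseteq> ends \<union> (\<Union>j\<in>{1..N-1}. {b j..a (j + 1)})"

lemma real_fun_real: "real_fun E f \<Longrightarrow> Im (f (of_real x)) = 0"
proof -
  assume "real_fun E f"
  then have "f (cnj (of_real x)) = cnj (f (of_real x))" unfolding real_fun_def by blast
  then show ?thesis by (simp add: complex_eq_iff)
qed

lemma real_fun_holomorphic_slit: "real_fun E f \<Longrightarrow> f holomorphic_on slit_plane E"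
  unfolding real_fun_def by (auto simp: slit_plane_def intro!: holomorphic_on_subset[of f "- complex_of_real ` E"])

lemma real_fun_add: "real_fun E f \<Longrightarrow> real_fun E g \<Longrightarrow> real_fun E (\<lambda>z. f z + g z)"
  and real_fun_mult: "real_fun E f \<Longrightarrow> real_fun E g \<Longrightarrow> real_fun E (\<lambda>z. f z * g z)"
  and real_fun_const: "real_fun E (\<lambda>z. of_real r)"
  and real_fun_ident: "real_fun E (\<lambda>z. z)"
  and real_fun_power: "real_fun E f \<Longrightarrow> real_fun E (\<lambda>z. f z ^ n)"
  unfolding real_fun_def by (auto intro!: holomorphic_intros)

lemma real_fun_cmult: "real_fun E f \<Longrightarrow> real_fun E (\<lambda>z. of_real c * f z)"
  by (intro real_fun_mult real_fun_const)

lemma real_fun_sum: "(\<And>i. i \<in> I \<Longrightarrow> real_fun E (f i)) \<Longrightarrow> real_fun E (\<lambda>z. \<Sum>i\<in>I. f i z)"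
  unfolding real_fun_def by (auto intro!: holomorphic_intros)

lemma real_fun_pole: "p \<in> E \<Longrightarrow> real_fun E (\<lambda>z. 1 / (z - of_real p))"
  unfolding real_fun_def by (auto intro!: holomorphic_intros)

lemma quotient_holomorphic:
  "admissible E \<Longrightarrow> real_fun E f \<Longrightarrow> (\<lambda>z. f z / upper_root z) holomorphic_on slit_plane E"
  unfolding admissible_def
  by (intro holomorphic_on_divide real_fun_holomorphic_slit upper_root_holomorphic) (auto simp: upper_root_nz)

lemma admissible_ends: "admissible ends" by (simp add: admissible_def)

lemma admissible_insert: "admissible E \<Longrightarrow> j \<in> {1..N-1} \<Longrightarrow> b j \<le> p \<Longrightarrow> p \<le> a (j + 1) \<Longrightarrow> admissible (insert p E)"
  unfolding admissible_def by auto

lemma admissible_cut: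
  assumes "admissible E" "k \<in> {1..N}" "a k < x" "x < b k"
  shows "x \<notin> E"
proof
  assume "x \<in> E"
  then consider "x \<in> ends" | j where "j \<in> {1..N-1}" "b j \<le> x" "x \<le> a (j+1)"
    using assms(1) by (auto simp: admissible_def)
  then show False
  proof cases
    case 1 then show False using cut_not_ends[OF assms(2-4)] by simp
  next
    case 2
    then show False using gap_sides(1)[OF 2 assms(2)] assms by auto
  qed
qed

lemma admissible_left:
  assumes "admissible E" "x < a 1"
  shows "x \<notin> E"
proof
  assume "x \<in> E"
  then consider "x \<in> ends" | j where "j \<in> {1..N-1}" "b j \<le> x" "x \<le> a (j+1)"
    using assms(1) by (auto simp: admissible_def)
  then show False
  proof cases
    case 1 then show False using left_not_ends[OF assms(2)] by simp
  next
    case 2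
    have "a 1 < b j" using 2 by (intro a_less_b) auto
    then show False using 2 assms by auto
  qed
qed

lemma primitive_quotient:
  assumes "admissible E" "real_fun E f"
  obtains G where "\<And>z. z \<in> slit_plane E \<Longrightarrow> (G has_field_derivative f z / upper_root z) (at z)"
  using slit_plane_primitive[OF _ quotient_holomorphic[OF assms]] assms(1) by (auto simp: admissible_def)

text \<open>Over a cut \<open>f\<close> is real and the root imaginary, so the integrand is
  imaginary. Hence the real part of an arc integral does not depend on where in the cut the arc
  ends.\<close>

lemma cut_primitive_Re:
  assumes E: "admissible E" "real_fun E f" and G: "\<And>z. z \<in> slit_plane E \<Longrightarrow> (G has_field_derivative f z / upper_root z) (at z)"
    and k: "k \<in> {1..N}" and x: "a k < x" "x < b k" and y: "a k < y" "y < b k"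
  shows "Re (G (of_real x)) = Re (G (of_real y))"
proof (rule Re_primitive_eq[of "a k" "b k" G "\<lambda>x. f (of_real x) / upper_root (of_real x)"])
  fix t assume t: "a k < t" "t < b k"
  show "(G has_field_derivative f (of_real t) / upper_root (of_real t)) (at (of_real t))"
    by (rule G) (use admissible_cut[OF E(1) k t] in \<open>simp add: real_in_slit_plane\<close>)
  show "Re (f (of_real t) / upper_root (of_real t)) = 0"
    using real_fun_real[OF E(2), of t] upper_root_cut_imag[OF k, of t] t by (simp add: Re_divide)
qed (use x y in auto)

lemma cut_primitive_Im:
  assumes E: "admissible E" "real_fun E f" and G: "\<And>z. z \<in> slit_plane E \<Longrightarrow> (G has_field_derivative f z) (at z)"
    and k: "k \<in> {1..N}" and x: "a k < x" "x < b k" and y: "a k < y" "y < b k"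
  shows "Im (G (of_real x)) = Im (G (of_real y))"
proof (rule Im_primitive_eq[of "a k" "b k" G "\<lambda>x. f (of_real x)"])
  fix t assume t: "a k < t" "t < b k"
  show "(G has_field_derivative f (of_real t)) (at (of_real t))"
    by (rule G) (use admissible_cut[OF E(1) k t] in \<open>simp add: real_in_slit_plane\<close>)
qed (use x y real_fun_real[OF E(2)] in auto)

definition gap_ext :: "nat \<Rightarrow> real" where
  "gap_ext j = min (b j - a j) (b (j + 1) - a (j + 1))"

text \<open>The points \<open>cut_left j\<close> and \<open>cut_right j\<close> are symmetric about
  the gap: they are the vertices of an ellipse with foci at the ends of the gap, the image of a
  horizontal line under \<open>cos\<close>.\<close>

definition cut_left :: "nat \<Rightarrow> real" where "cut_left j = gap_mid j - (gap_rad j + gap_ext j / 2)"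
definition cut_right :: "nat \<Rightarrow> real" where "cut_right j = gap_mid j + (gap_rad j + gap_ext j / 2)"

lemma gap_ext_pos: "j \<in> {1..N-1} \<Longrightarrow> gap_ext j > 0"
  using ab[OF gap_index(1)] ab[OF gap_index(2)] by (simp add: gap_ext_def)

lemma cut_left_right:
  assumes "j \<in> {1..N-1}"
  shows "a j < cut_left j" "cut_left j < b j" "a (j + 1) < cut_right j" "cut_right j < b (j + 1)" "cut_left j < cut_right j"
proof -
  have "gap_ext j \<le> b j - a j" "gap_ext j \<le> b (j+1) - a (j+1)" by (simp_all add: gap_ext_def)
  then show 1: "a j < cut_left j" "cut_left j < b j" "a (j + 1) < cut_right j" "cut_right j < b (j + 1)"
    using gap_ext_pos[OF assms] by (auto simp: cut_left_def cut_right_def gap_mid_def gap_rad_def field_simps)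
  show "cut_left j < cut_right j" using 1 gap_pos[OF assms] by linarith
qed

lemma cut_left_right_notin:
  assumes "admissible E" "j \<in> {1..N-1}"
  shows "cut_left j \<notin> E" "cut_right j \<notin> E"
  using admissible_cut[OF assms(1) gap_index(1)[OF assms(2)]] admissible_cut[OF assms(1) gap_index(2)[OF assms(2)]]
    cut_left_right[OF assms(2)] by auto

text \<open>Half the A-period of f dz/w, by \<open>A_cycle_integral\<close>.\<close>

definition gap_period :: "nat \<Rightarrow> (complex \<Rightarrow> complex) \<Rightarrow> real" where
  "gap_period j f = Re (arc_integral (\<lambda>z. f z / upper_root z) (cut_left j) (cut_right j))"

lemma gap_period_add:
  assumes "admissible E" "real_fun E f" "real_fun E g" "j \<in> {1..N-1}"
  shows "gap_period j (\<lambda>z. f z + g z) = gap_period j f + gap_period j g"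
  unfolding gap_period_def add_divide_distrib
  using arc_integral_add[OF quotient_holomorphic[OF assms(1,2)] quotient_holomorphic[OF assms(1,3)] cut_left_right(5)[OF assms(4)] cut_left_right_notin[OF assms(1,4)]]
  by simp

lemma gap_period_cmult:
  assumes "admissible E" "real_fun E f" "j \<in> {1..N-1}"
  shows "gap_period j (\<lambda>z. of_real c * f z) = c * gap_period j f"
  unfolding gap_period_def times_divide_eq_right[symmetric]
  using arc_integral_cmult[OF quotient_holomorphic[OF assms(1,2)] cut_left_right(5)[OF assms(3)] cut_left_right_notin[OF assms(1,3)]]
  by simp

lemma gap_period_zero: "gap_period j (\<lambda>z. 0) = 0"
  by (simp add: gap_period_def arc_integral_def)

lemma gap_period_sum:
  assumes "admissible E" "\<And>i. i \<in> I \<Longrightarrow> real_fun E (f i)" "j \<in> {1..N-1}" "finite I"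
  shows "gap_period j (\<lambda>z. \<Sum>i\<in>I. f i z) = (\<Sum>i\<in>I. gap_period j (f i))"
  using assms(4,2)
  by (induction I rule: finite_induct)
     (simp_all add: gap_period_zero gap_period_add[OF assms(1) _ real_fun_sum assms(3)])

text \<open>On the lower half plane of the second sheet the integrand is the conjugate of the reflected
  integrand on the first sheet with the opposite sign of the odd part.\<close>

lemma A_cycle_integral:
  assumes E: "admissible E" "real_fun E f1" "real_fun E f2"
    and \<omega>: "\<And>z w. Im z \<noteq> 0 \<Longrightarrow> w\<^sup>2 = curve_poly z \<Longrightarrow> \<omega> (Pt z w) = f1 z + f2 z / w"
    and j: "j \<in> {1..N-1}" and \<gamma>: "A_cycle j \<gamma>"
  shows "((\<lambda>t. \<omega> (\<gamma> t) * vector_derivative (zc \<circ> \<gamma>) (at t within {0..1})) has_integral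
    (2 * \<i> * of_real (Im (arc_integral f1 (cut_left j) (cut_right j))) + 2 * of_real (gap_period j f2))) {0..1}"
proof -
  have finE: "finite E" using E(1) by (simp add: admissible_def)
  obtain G1 where G1: "\<And>z. z \<in> slit_plane E \<Longrightarrow> (G1 has_field_derivative f1 z) (at z)"
    using slit_plane_primitive[OF finE real_fun_holomorphic_slit[OF E(2)]] by blast
  obtain G2 where G2: "\<And>z. z \<in> slit_plane E \<Longrightarrow> (G2 has_field_derivative f2 z / upper_root z) (at z)"
    using primitive_quotient[OF E(1,3)] by blast
  define F where "F = (\<lambda>z. f1 z + f2 z / upper_root z)"
  define F' where "F' = (\<lambda>z. cnj (f1 (cnj z) - f2 (cnj z) / upper_root (cnj z)))"
  define G where "G = (\<lambda>z. G1 z + G2 z)"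
  define G' where "G' = cnj \<circ> (\<lambda>z. G1 z - G2 z) \<circ> cnj"
  have DG: "(G has_field_derivative F z) (at z)" if "z \<in> slit_plane E" for z
    unfolding G_def F_def by (intro DERIV_add G1 G2 that)
  have DG': "(G' has_field_derivative F' z) (at z)" if "cnj z \<in> slit_plane E" for z
    unfolding G'_def F'_def by (intro has_field_derivative_cnj_cnj DERIV_diff G1 G2 that)
  obtain s where s: "0 < s" "s < 1" and cl: "closed_curve \<gamma>"
    and 0: "zc (\<gamma> 0) \<in> of_real ` {a j<..<b j}"
    and up: "\<And>t. 0 < t \<Longrightarrow> t < s \<Longrightarrow> \<gamma> t \<in> sheet 1 \<and> Im (zc (\<gamma> t)) > 0"
    and mid: "zc (\<gamma> s) \<in> of_real ` {a (j+1)<..<b (j+1)}"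
    and lo: "\<And>t. s < t \<Longrightarrow> t < 1 \<Longrightarrow> \<gamma> t \<in> sheet 2 \<and> Im (zc (\<gamma> t)) < 0"
    using \<gamma> unfolding A_cycle_def by auto
  define g where "g = zc \<circ> \<gamma>"
  obtain x0 where x0: "g 0 = of_real x0" "a j < x0" "x0 < b j" using 0 by (auto simp: g_def)
  obtain x1 where x1: "g s = of_real x1" "a (j+1) < x1" "x1 < b (j+1)" using mid by (auto simp: g_def)
  have g1: "g 1 = of_real x0" using cl x0 by (simp add: closed_curve_def g_def)
  have vp: "g piecewise_differentiable_on {0..1}"
    using cl unfolding closed_curve_def g_def valid_path_def by (blast intro: piecewise_C1_imp_differentiable)
  have xs: "of_real x0 \<in> slit_plane E" "of_real x1 \<in> slit_plane E"
    using admissible_cut[OF E(1) gap_index(1)[OF j] x0(2,3)] admissible_cut[OF E(1) gap_index(2)[OF j] x1(2,3)]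
    by (auto simp: real_in_slit_plane)
  have aff: "\<gamma> t \<in> affine_part" if "0 \<le> t" "t \<le> 1" for t
    using cl that by (force simp: closed_curve_def)
  have \<omega>up: "\<omega> (\<gamma> t) = F (g t)" if "0 < t" "t < s" for t
  proof -
    have "\<gamma> t \<in> sheet 1" "Im (g t) > 0" using up[OF that] by (auto simp: g_def)
    moreover have "\<gamma> t \<in> affine_part" using aff[of t] that s by auto
    ultimately obtain z where z: "\<gamma> t = Pt z (root_branch z)" "z \<notin> cuts"
      by (auto simp: sheet_def sheet_sign_def affine_part_def)
    then have "Im z > 0" using \<open>Im (g t) > 0\<close> by (simp add: g_def)
    with z \<omega>[of z "root_branch z"] show ?thesis by (simp add: g_def F_def upper_root_sq root_branch_upper)
  qed
  have \<omega>lo: "\<omega> (\<gamma> t) = F' (g t)" if "s < t" "t < 1" for t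
  proof -
    have "\<gamma> t \<in> sheet 2" "Im (g t) < 0" using lo[OF that] by (auto simp: g_def)
    moreover have "\<gamma> t \<in> affine_part" using aff[of t] that s by auto
    ultimately obtain z where z: "\<gamma> t = Pt z (- root_branch z)" "z \<notin> cuts"
      by (auto simp: sheet_def sheet_sign_def affine_part_def)
    then have Im: "Im z < 0" using \<open>Im (g t) < 0\<close> by (simp add: g_def)
    then have c: "cnj z \<notin> cuts" by (auto simp: not_cuts_iff)
    have "upper_root (cnj z) = cnj (root_branch z)"
      using root_branch_cnj[OF z(2)] root_branch_upper[of "cnj z"] c Im by simp
    moreover have "f1 (cnj z) = cnj (f1 z)" "f2 (cnj z) = cnj (f2 z)"
      using E(2,3) unfolding real_fun_def by blast+
    moreover have "\<omega> (Pt z (- root_branch z)) = f1 z + f2 z / (- root_branch z)"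
      using Im by (intro \<omega>) (simp_all add: root_branch_sq)
    ultimately show ?thesis
      using z by (simp add: g_def F'_def)
  qed
  have I1: "((\<lambda>t. \<omega> (\<gamma> t) * vector_derivative g (at t within {0..1})) has_integral (G (g s) - G (g 0))) {0..s}"
  \<comment> \<open>At the excluded times the curve passes over a cut, where it belongs to neither
    sheet.\<close>
  proof (rule has_integral_spike_finite[of "{0,s}"])
    show "((\<lambda>t. F (g t) * vector_derivative g (at t within {0..s})) has_integral (G (g s) - G (g 0))) {0..s}"
    proof (rule contour_integral_primitive_lemma[of 0 s "slit_plane E"])
      show "g t \<in> slit_plane E" if "t \<in> {0..s}" for t
        using that xs x0 x1 up[of t] upper_in_slit_plane[of "g t"]
        by (cases "t = 0 \<or> t = s") (auto simp: g_def)
    qed (use s vp DG in \<open>auto intro: has_field_derivative_at_within piecewise_differentiable_on_subset\<close>)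
    fix t assume t: "t \<in> {0..s} - {0, s}"
    then have "t \<in> interior {0..s}" "t \<in> interior {0..1}" using s by auto
    note this[THEN at_within_interior]
    then show "\<omega> (\<gamma> t) * vector_derivative g (at t within {0..1}) = F (g t) * vector_derivative g (at t within {0..s})"
      using \<omega>up[of t] t by simp
  qed simp
  have I2: "((\<lambda>t. \<omega> (\<gamma> t) * vector_derivative g (at t within {0..1})) has_integral (G' (g 1) - G' (g s))) {s..1}"
  proof (rule has_integral_spike_finite[of "{s,1}"])
    show "((\<lambda>t. F' (g t) * vector_derivative g (at t within {s..1})) has_integral (G' (g 1) - G' (g s))) {s..1}"
    proof (rule contour_integral_primitive_lemma[of s 1 "{z. cnj z \<in> slit_plane E}"])
      show "g t \<in> {z. cnj z \<in> slit_plane E}" if "t \<in> {s..1}" for t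
        using that xs g1 x1 lo[of t] upper_in_slit_plane[of "cnj (g t)"]
        by (cases "t = s \<or> t = 1") (auto simp: g_def)
    qed (use s vp DG' in \<open>auto intro: has_field_derivative_at_within piecewise_differentiable_on_subset\<close>)
    fix t assume t: "t \<in> {s..1} - {s, 1}"
    then have "t \<in> interior {s..1}" "t \<in> interior {0..1}" using s by auto
    note this[THEN at_within_interior]
    then show "\<omega> (\<gamma> t) * vector_derivative g (at t within {0..1}) = F' (g t) * vector_derivative g (at t within {s..1})"
      using \<omega>lo[of t] t by simp
  qed simp
  have I: "((\<lambda>t. \<omega> (\<gamma> t) * vector_derivative g (at t within {0..1})) has_integral ((G (g s) - G (g 0)) + (G' (g 1) - G' (g s)))) {0..1}"
    using has_integral_combine[OF _ _ I1 I2] s by auto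
  \<comment> \<open>On the way back the even part enters as minus a conjugate and the odd part as
    plus a conjugate, because the second sheet reverses its sign and the direction reverses it
    again.\<close>
  have "(G (g s) - G (g 0)) + (G' (g 1) - G' (g s)) = 2 * \<i> * of_real (Im (G1 (of_real x1) - G1 (of_real x0))) + 2 * of_real (Re (G2 (of_real x1) - G2 (of_real x0)))"
    unfolding x0 x1 g1 G_def G'_def by (simp add: complex_eq_iff)
  also have "Im (G1 (of_real x1) - G1 (of_real x0)) = Im (arc_integral f1 (cut_left j) (cut_right j))"
    using arc_integral_primitive[OF G1 cut_left_right(5)[OF j] cut_left_right_notin[OF E(1) j]]
      cut_primitive_Im[OF E(1,2) G1 gap_index(1)[OF j] x0(2,3) cut_left_right(1,2)[OF j]]
      cut_primitive_Im[OF E(1,2) G1 gap_index(2)[OF j] x1(2,3) cut_left_right(3,4)[OF j]]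
    by simp
  also have "Re (G2 (of_real x1) - G2 (of_real x0)) = gap_period j f2"
    unfolding gap_period_def
    using arc_integral_primitive[OF G2 cut_left_right(5)[OF j] cut_left_right_notin[OF E(1) j]]
      cut_primitive_Re[OF E(1,3) G2 gap_index(1)[OF j] x0(2,3) cut_left_right(1,2)[OF j]]
      cut_primitive_Re[OF E(1,3) G2 gap_index(2)[OF j] x1(2,3) cut_left_right(3,4)[OF j]]
    by simp
  finally show ?thesis using I by (simp only: g_def)
qed

text \<open>In the coordinate \<open>z = gap_mid j + gap_rad j * cos \<theta>\<close> the differential \<open>dz / w\<close> is regular
  across the whole gap, so the contour can be moved onto the gap.\<close>

lemma gap_period_integral:
  assumes j: "j \<in> {1..N-1}" and f: "f holomorphic_on UNIV" and fr: "\<And>x. f (of_real x) = of_real (fr x)"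
  shows "((\<lambda>s. fr (gap_point j s) / gap_root j (gap_point j s)) has_integral gap_sign j * gap_period j f) {0..pi}"
    and "\<exists>\<Gamma>. \<forall>s. (\<Gamma> has_real_derivative fr (gap_point j s) / gap_root j (gap_point j s)) (at s)"
proof -
  define m where "m = gap_mid j" define r where "r = gap_rad j"
  define R where "R = r + gap_ext j"
  define \<tau>1 where "\<tau>1 = arcosh (R / r)"
  \<comment> \<open>With this \<open>cosh \<tau>\<close> the line
    \<open>Im \<theta> = - \<tau>\<close>, taken over one half period, ends over
    \<open>cut_left j\<close> and \<open>cut_right j\<close>.\<close>
  define \<tau> where "\<tau> = arcosh ((r + gap_ext j / 2) / r)"
  have r: "r > 0" using gap_rad_pos[OF j] by (simp add: r_def)
  have ext: "gap_ext j > 0" by (rule gap_ext_pos[OF j])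
  have ge1: "1 < (r + gap_ext j / 2) / r" "(r + gap_ext j / 2) / r < R / r"
    using r ext by (auto simp: R_def field_simps)
  have cosh1: "cosh \<tau>1 = R / r" and cosh0: "cosh \<tau> = (r + gap_ext j / 2) / r"
    using ge1 by (simp_all add: \<tau>1_def \<tau>_def)
  have tau: "0 < \<tau>" "\<tau> < \<tau>1"
  proof -
    have "arcosh 1 < \<tau>" unfolding \<tau>_def using ge1 by (intro arcosh_real_strict_mono) auto
    then show "0 < \<tau>" by simp
    show "\<tau> < \<tau>1" unfolding \<tau>_def \<tau>1_def using ge1 by (intro arcosh_real_strict_mono) auto
  qed
  \<comment> \<open>On this strip the real part of \<open>Z\<close> stays between \<open>a j\<close>
    and \<open>b (j + 1)\<close>, where \<open>gap_croot\<close> is holomorphic without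
    zeros.\<close>
  define D where "D = {\<theta>::complex. Im \<theta> < \<tau>1} \<inter> {\<theta>. Im \<theta> > - \<tau>1}"
  define Z where "Z = (\<lambda>\<theta>. of_real m + of_real r * cos \<theta> :: complex)"
  have Zc: "Z (of_real s - \<i> * of_real t) = Complex (m + r * (cos s * cosh t)) (r * (sin s * sinh t))" for s t
    unfolding Z_def cos_complex_strip by (simp add: complex_eq_iff)
  have Zreal: "Z (of_real s) = of_real (gap_point j s)" for s
    using Zc[of s 0] by (simp add: gap_point_def m_def r_def complex_eq_iff)
  have Re_Z: "a j < Re (Z \<theta>) \<and> Re (Z \<theta>) < b (j + 1)" if "\<theta> \<in> D" for \<theta>
  proof -
    have \<theta>: "\<theta> = of_real (Re \<theta>) - \<i> * of_real (- Im \<theta>)" by (simp add: complex_eq_iff)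
    have "cosh \<bar>Im \<theta>\<bar> < cosh \<tau>1"
      using that by (intro cosh_real_strict_mono) (auto simp: D_def)
    then have c: "r * cosh (Im \<theta>) < R" using r by (simp add: cosh1 field_simps)
    have "\<bar>r * (cos (Re \<theta>) * cosh (- Im \<theta>))\<bar> = r * (\<bar>cos (Re \<theta>)\<bar> * cosh (Im \<theta>))"
      using r cosh_real_pos[of "Im \<theta>"] by (simp add: abs_mult)
    also have "\<dots> \<le> r * (1 * cosh (Im \<theta>))"
      using r cosh_real_pos[of "Im \<theta>"] by (intro mult_left_mono mult_right_mono) auto
    finally have "\<bar>Re (Z \<theta>) - m\<bar> < R" using c by (subst \<theta>) (simp only: Zc complex.sel)
    moreover have "R \<le> r + (b j - a j)" "R \<le> r + (b (j+1) - a (j+1))" by (auto simp: R_def gap_ext_def)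
    moreover have "m - r = b j" "m + r = a (j+1)" by (auto simp: m_def r_def gap_mid_def gap_rad_def field_simps)
    ultimately show ?thesis by (auto simp: abs_less_iff)
  qed
  have croot: "gap_croot j holomorphic_on {z. a j < Re z \<and> Re z < b (j + 1)}"
    unfolding gap_croot_def
    using other_ends_sides[OF j] gap_phase_nz
    by (intro holomorphic_intros holomorphic_on_subset[OF down_sqrt_holomorphic]) (fastforce simp: slit_plane_def)+
  have croot_nz: "gap_croot j z \<noteq> 0" if "a j < Re z" "Re z < b (j + 1)" for z
    using other_ends_sides[OF j] gap_phase_nz that by (force simp: gap_croot_def prod_zero_iff down_sqrt_eq_0)
  define q where "q = (\<lambda>\<theta>. f (Z \<theta>) / gap_croot j (Z \<theta>))"
  have Zhol: "Z holomorphic_on D" unfolding Z_def by (intro holomorphic_intros)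
  have qhol: "q holomorphic_on D"
    unfolding q_def
  proof (intro holomorphic_on_divide)
    show "(\<lambda>\<theta>. f (Z \<theta>)) holomorphic_on D"
      using holomorphic_on_compose_gen[OF Zhol f] by (simp add: o_def)
    show "(\<lambda>\<theta>. gap_croot j (Z \<theta>)) holomorphic_on D"
      using holomorphic_on_compose_gen[OF Zhol croot] Re_Z by (auto simp: o_def)
    show "gap_croot j (Z \<theta>) \<noteq> 0" if "\<theta> \<in> D" for \<theta> using croot_nz Re_Z[OF that] by blast
  qed
  have "convex D" "open D" unfolding D_def
    by (auto intro!: convex_Int convex_halfspace_Im_lt convex_halfspace_Im_gt open_Int open_halfspace_Im_lt open_halfspace_Im_gt)
  then obtain \<Gamma> where \<Gamma>: "\<And>\<theta>. \<theta> \<in> D \<Longrightarrow> (\<Gamma> has_field_derivative q \<theta>) (at \<theta>)"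
    using holomorphic_convex_primitive'[OF _ _ qhol] by (metis at_within_open)
  have qreal: "q (of_real s) = of_real (fr (gap_point j s) / gap_root j (gap_point j s))" for s
    unfolding q_def Zreal fr gap_croot_real(1)[OF j gap_point_bounds(3,4)[OF j]] by simp
  have RD: "of_real s \<in> D" for s using tau by (simp add: D_def)
  have realD: "((\<lambda>s. Re (\<Gamma> (of_real s))) has_real_derivative fr (gap_point j s) / gap_root j (gap_point j s)) (at s)" for s
    using has_field_derivative_Re[OF has_vector_derivative_real_field[OF \<Gamma>[OF RD], where a = s and s = UNIV]] by (simp add: qreal)
  then show "\<exists>\<Gamma>. \<forall>s. (\<Gamma> has_real_derivative fr (gap_point j s) / gap_root j (gap_point j s)) (at s)" by blast
  have I: "((\<lambda>s. fr (gap_point j s) / gap_root j (gap_point j s)) has_integral (Re (\<Gamma> (of_real pi)) - Re (\<Gamma> (of_real 0)))) {0..pi}"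
    by (rule fundamental_theorem_of_calculus)
       (auto simp flip: has_real_derivative_iff_has_vector_derivative intro: has_field_derivative_at_within realD)
  obtain G where G: "\<And>z. z \<in> slit_plane ends \<Longrightarrow> (G has_field_derivative f z / upper_root z) (at z)"
    using slit_plane_primitive[OF finite_ends, of "\<lambda>z. f z / upper_root z"]
    by (metis holomorphic_on_divide holomorphic_on_subset[OF f subset_UNIV] upper_root_holomorphic[OF order_refl] upper_root_nz[OF _ order_refl])
  define \<theta> where "\<theta> = (\<lambda>s. of_real s - \<i> * of_real \<tau> :: complex)"
  have \<theta>D: "\<theta> s \<in> D" for s using tau by (simp add: \<theta>_def D_def)
  have D\<theta>: "(\<theta> has_vector_derivative 1) (at s)" for s
    unfolding \<theta>_def by (auto intro!: derivative_eq_intros)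
  have Zup: "Im (Z (\<theta> s)) > 0" if "0 < s" "s < pi" for s
    unfolding \<theta>_def Zc using r sin_gt_zero[OF that] tau by simp
  have Z0: "Z (\<theta> 0) = of_real (cut_right j)"
    using r by (simp add: \<theta>_def Zc[of 0 \<tau>, simplified] cosh0 cut_right_def m_def r_def complex_eq_iff)
  have Zpi: "Z (\<theta> pi) = of_real (cut_left j)"
    using r by (simp add: \<theta>_def Zc cosh0 cut_left_def m_def r_def complex_eq_iff)
  have Zslit: "Z (\<theta> s) \<in> slit_plane ends" if "0 \<le> s" "s \<le> pi" for s
    using that Zup[of s] Z0 Zpi cut_left_right_notin[OF admissible_ends j] upper_in_slit_plane[of "Z (\<theta> s)"]
    by (cases "s = 0 \<or> s = pi") (auto simp: real_in_slit_plane)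
  \<comment> \<open>Half-angle formulas make \<open>z - b j\<close> and \<open>z - a (j + 1)\<close>
    squares; positive real parts show that the displayed roots are the ones in
    \<open>down_sqrt\<close>.\<close>
  have W: "upper_root (Z (\<theta> s)) = of_real (gap_sign j) * gap_croot j (Z (\<theta> s)) * (of_real r * sin (\<theta> s))"
    if s: "0 < s" "s < pi" for s
  proof -
    let ?z = "Z (\<theta> s)" and ?h = "of_real (s/2) - \<i> * of_real (\<tau>/2) :: complex"
    have h: "\<theta> s = 2 * ?h" by (simp add: \<theta>_def field_simps)
    have zb: "?z - of_real (b j) = (of_real (sqrt (2 * r)) * cos ?h)\<^sup>2"
    proof -
      have "?z - of_real (b j) = of_real r * (1 + cos (2 * ?h))"
        unfolding Z_def h m_def r_def by (simp add: gap_mid_def gap_rad_def field_simps)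
      also have "\<dots> = of_real (2 * r) * (cos ?h)\<^sup>2" unfolding cos_double_cos by simp
      finally show ?thesis using r by (simp add: power_mult_distrib flip: of_real_power)
    qed
    have za: "?z - of_real (a (j+1)) = (\<i> * of_real (sqrt (2 * r)) * sin ?h)\<^sup>2"
    proof -
      have "?z - of_real (a (j+1)) = of_real r * (cos (2 * ?h) - 1)"
        unfolding Z_def h m_def r_def by (simp add: gap_mid_def gap_rad_def field_simps)
      also have "\<dots> = - of_real (2 * r) * (sin ?h)\<^sup>2" unfolding cos_double_sin by simp
      finally show ?thesis using r by (simp add: power_mult_distrib flip: of_real_power)
    qed
    have c0: "cos (s/2) > 0" using s by (intro cos_gt_zero) auto
    have "sinh (\<tau>/2) > 0" using tau by simp
    have b: "down_sqrt (b j) ?z = of_real (sqrt (2 * r)) * cos ?h"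
      using Zup[OF s] zb c0 r cosh_real_pos[of "\<tau>/2"] unfolding cos_complex_strip
      by (subst down_sqrt_upper) (auto intro!: csqrt_unique)
    have a: "down_sqrt (a (j+1)) ?z = \<i> * of_real (sqrt (2 * r)) * sin ?h"
      using Zup[OF s] za c0 r \<open>sinh (\<tau>/2) > 0\<close> unfolding sin_complex_strip
      by (subst down_sqrt_upper) (auto intro!: csqrt_unique simp del: sinh_real_pos_iff)
    have "upper_root ?z = (gap_phase j * \<i>) * gap_croot j ?z * ((of_real (sqrt (2 * r)))\<^sup>2 * (sin ?h * cos ?h))"
      unfolding upper_root_gap_croot[OF j] a b by (simp add: power2_eq_square)
    also have "(of_real (sqrt (2 * r)))\<^sup>2 * (sin ?h * cos ?h) = of_real r * sin (2 * ?h)"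
      using r unfolding sin_double by (simp flip: of_real_power)
    finally show ?thesis by (simp only: gap_sign(1)[OF j] h)
  qed
  \<comment> \<open>Its derivative vanishes: dz supplies \<open>- r * sin \<theta>\<close>, which
    cancels the same factor of \<open>w\<close> up to the sign \<open>gap_sign j\<close>.\<close>
  define P where "P = (\<lambda>s. G (Z (\<theta> s)) + of_real (gap_sign j) * \<Gamma> (\<theta> s))"
  have DZ: "((\<lambda>s. Z (\<theta> s)) has_vector_derivative - of_real r * sin (\<theta> s)) (at s)" for s
  proof -
    have "(Z has_field_derivative - of_real r * sin (\<theta> s)) (at (\<theta> s))"
      unfolding Z_def by (auto intro!: derivative_eq_intros)
    from field_vector_diff_chain_at[OF D\<theta> this] show ?thesis by (simp add: o_def)
  qed
  have DGZ: "((\<lambda>s. G (Z (\<theta> s))) has_vector_derivative (- of_real r * sin (\<theta> s)) * (f (Z (\<theta> s)) / upper_root (Z (\<theta> s)))) (at s)"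
    if "0 \<le> s" "s \<le> pi" for s
    using field_vector_diff_chain_at[OF DZ G[OF Zslit[OF that]]] by (simp add: o_def)
  have D\<Gamma>: "((\<lambda>s. \<Gamma> (\<theta> s)) has_vector_derivative q (\<theta> s)) (at s)" for s
    using field_vector_diff_chain_at[OF D\<theta> \<Gamma>[OF \<theta>D]] by (simp add: o_def)
  have contP: "continuous_on {0..pi} P"
    unfolding P_def
    by (intro continuous_intros continuous_at_imp_continuous_on ballI has_vector_derivative_continuous)
       (use DGZ D\<Gamma> in auto)
  have DP: "(P has_vector_derivative 0) (at s)" if s: "s \<in> {0<..<pi}" for s
  proof -
    have "sin (\<theta> s) \<noteq> 0"
    proof -
      have "sin s * cosh \<tau> \<noteq> 0" using sin_gt_zero[of s] s cosh_real_pos[of \<tau>] by simp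
      then show ?thesis unfolding \<theta>_def sin_complex_strip by (simp add: complex_eq_iff)
    qed
    moreover have gs: "of_real (gap_sign j) * of_real (gap_sign j) = (1::complex)" using gap_sign(2)[OF j] by auto
    moreover have "gap_croot j (Z (\<theta> s)) \<noteq> 0" using croot_nz Re_Z[OF \<theta>D] by blast
    ultimately have "(- of_real r * sin (\<theta> s)) * (f (Z (\<theta> s)) / upper_root (Z (\<theta> s))) = - (of_real (gap_sign j) * q (\<theta> s))"
      using s r gap_sign(2)[OF j] by (auto simp: W q_def field_simps)
    then show ?thesis
      using has_vector_derivative_add[OF DGZ[of s] has_vector_derivative_mult_right[OF D\<Gamma>, of "of_real (gap_sign j)" s]] s
      unfolding P_def by simp
  qed
  have "((\<lambda>_. 0) has_integral (P pi - P 0)) {0..pi}"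
    by (rule fundamental_theorem_of_calculus_interior) (use contP DP in auto)
  then have PP: "P pi = P 0" by (simp add: has_integral_iff)
  \<comment> \<open>On the two vertical sides \<open>Z\<close> and therefore \<open>q\<close> are
    real, so moving in the direction - i does not change the real part of the primitive.\<close>
  have Re\<Gamma>: "Re (\<Gamma> (of_real s - \<i> * of_real \<tau>)) = Re (\<Gamma> (of_real s))" if s: "s = 0 \<or> s = pi" for s
  proof -
    define \<phi> where "\<phi> = (\<lambda>t. of_real s - \<i> * of_real t :: complex)"
    have D\<phi>: "(\<phi> has_vector_derivative - \<i>) (at t)" for t unfolding \<phi>_def by (auto intro!: derivative_eq_intros)
    have \<phi>D: "\<phi> t \<in> D" if "t \<in> {0..\<tau>}" for t using that tau by (simp add: \<phi>_def D_def)
    have "((\<lambda>t. Re (\<Gamma> (\<phi> t))) has_real_derivative 0) (at t)" if t: "t \<in> {0..\<tau>}" for t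
    proof -
      have "Z (\<phi> t) = of_real (m + r * (cos s * cosh t))" unfolding \<phi>_def Zc using s by (auto simp: complex_eq_iff)
      moreover have "Im (f (of_real x) / gap_croot j (of_real x)) = 0" if "a j < x" "x < b (j+1)" for x
        using that by (simp add: fr gap_croot_real[OF j])
      ultimately have "Im (q (\<phi> t)) = 0" using Re_Z[OF \<phi>D[OF t]] by (simp only: q_def Re_complex_of_real)
      then show ?thesis
        using has_field_derivative_Re[OF field_vector_diff_chain_at[OF D\<phi> \<Gamma>[OF \<phi>D[OF t]]]] by (simp add: o_def)
    qed
    then have "Re (\<Gamma> (\<phi> \<tau>)) = Re (\<Gamma> (\<phi> 0))"
      using tau by (intro DERIV_isconst_end[where f = "\<lambda>t. Re (\<Gamma> (\<phi> t))"] continuous_at_imp_continuous_on ballI) (auto intro: DERIV_isCont)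
    then show ?thesis by (simp add: \<phi>_def)
  qed
  have "gap_period j f = Re (G (Z (\<theta> 0)) - G (Z (\<theta> pi)))"
    unfolding gap_period_def Z0 Zpi
    using arc_integral_primitive[OF G cut_left_right(5)[OF j] cut_left_right_notin[OF admissible_ends j]] by simp
  also have "\<dots> = gap_sign j * (Re (\<Gamma> (\<theta> pi)) - Re (\<Gamma> (\<theta> 0)))"
    using arg_cong[OF PP, of Re] by (simp add: P_def algebra_simps)
  also have "\<dots> = gap_sign j * (Re (\<Gamma> (of_real pi)) - Re (\<Gamma> (of_real 0)))"
    using Re\<Gamma>[of 0] Re\<Gamma>[of pi] by (simp add: \<theta>_def)
  finally have "gap_sign j * gap_period j f = Re (\<Gamma> (of_real pi)) - Re (\<Gamma> (of_real 0))"
    using gap_sign(2)[OF j] by auto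
  with I show "((\<lambda>s. fr (gap_point j s) / gap_root j (gap_point j s)) has_integral gap_sign j * gap_period j f) {0..pi}"
    by simp
qed

end

section \<open>Existence and uniqueness of the differentials\<close>

text \<open>Removable singularities are filled in one at a time, on balls that meet \<open>X\<close>
  only in their centres.\<close>

lemma removable_finite_entire:
  assumes X: "finite X" and an: "\<And>z. z \<notin> X \<Longrightarrow> T analytic_on {z}"
    and lim: "\<And>x. x \<in> X \<Longrightarrow> ((\<lambda>z. (z - x) * T z) \<longlongrightarrow> 0) (at x)"
  shows "\<exists>F. F holomorphic_on UNIV \<and> (\<forall>z. z \<notin> X \<longrightarrow> F z = T z)"
proof -
  have "\<exists>r g. 0 < r \<and> ball x r \<inter> X = {x} \<and> g holomorphic_on ball x r \<and> (\<forall>z\<in>ball x r - {x}. g z = T z)" if x: "x \<in> X" for x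
  proof -
    have "\<forall>\<^sub>F t in at x. t \<notin> X" by (rule eventually_at_notin_finite[OF X])
    then obtain r where r: "r > 0" "\<And>t. t \<noteq> x \<Longrightarrow> dist t x < r \<Longrightarrow> t \<notin> X"
      unfolding eventually_at by auto
    have "T holomorphic_on ball x r - {x}"
    proof (rule analytic_imp_holomorphic, subst analytic_on_analytic_at, rule ballI)
      fix z assume "z \<in> ball x r - {x}"
      then show "T analytic_on {z}" using r(2)[of z] by (intro an) (auto simp: dist_commute)
    qed
    then obtain g where "g holomorphic_on ball x r" "\<forall>z\<in>ball x r - {x}. g z = T z"
      using holomorphic_on_extend_lim[of T "ball x r" x] lim[OF x] r(1) by (auto simp: interior_open)
    moreover have "ball x r \<inter> X = {x}" using r x by (auto simp: dist_commute) (metis dist_commute)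
    ultimately show ?thesis using r(1) by blast
  qed
  then obtain r g where rg: "\<And>x. x \<in> X \<Longrightarrow> 0 < r x \<and> ball x (r x) \<inter> X = {x} \<and> g x holomorphic_on ball x (r x) \<and> (\<forall>z\<in>ball x (r x) - {x}. g x z = T z)"
    by metis
  define F where "F z = (if z \<in> X then g z z else T z)" for z
  have "F analytic_on {z}" for z
  proof (cases "z \<in> X")
    case True
    have "F u = g z u" if "u \<in> ball z (r z)" for u
      using rg[OF True] that by (cases "u = z") (auto simp: F_def True)
    then have "F holomorphic_on ball z (r z)" using rg[OF True] holomorphic_transform by metis
    then show ?thesis using rg[OF True] by (auto simp: analytic_at)
  next
    case False
    have "open (- X)" using X by (simp add: finite_imp_closed open_Compl)
    then have "\<forall>\<^sub>F u in nhds z. u \<in> - X" using False by (intro eventually_nhds_in_open) auto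
    then have "\<forall>\<^sub>F u in nhds z. F u = T u" by eventually_elim (simp add: F_def)
    then show ?thesis using an[OF False] analytic_at_cong by metis
  qed
  then have "F holomorphic_on UNIV" by (metis UNIV_I analytic_imp_holomorphic analytic_on_analytic_at)
  then show ?thesis by (intro exI[of _ F]) (auto simp: F_def)
qed

context gap_surface
begin

section \<open>Real polynomials of degree at most \<open>N - 2\<close> and their gap periods\<close>

definition rpoly :: "(nat \<Rightarrow> real) \<Rightarrow> 'x :: real_field \<Rightarrow> 'x" where
  "rpoly c x = (\<Sum>m<N-1. of_real (c m) * x ^ m)"

lemma rpoly_of_real: "rpoly c (of_real x) = of_real (rpoly c x)"
  by (simp add: rpoly_def)

lemma rpoly_holomorphic: "rpoly c holomorphic_on S"
  unfolding rpoly_def by (intro holomorphic_intros)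

lemma rpoly_real_fun: "real_fun E (rpoly c)"
  unfolding rpoly_def by (intro real_fun_sum real_fun_cmult real_fun_power real_fun_ident)

text \<open>The gaps are disjoint, so these are \<open>N - 1\<close> distinct zeros, one more than
  the degree allows.\<close>

lemma rpoly_zero_of_gap_roots:
  assumes "\<And>j. j \<in> {1..N-1} \<Longrightarrow> \<exists>x. b j < x \<and> x < a (j + 1) \<and> rpoly c x = 0"
  shows "\<forall>m<N-1. c m = 0"
proof (rule ccontr)
  assume "\<not> (\<forall>m<N-1. c m = 0)"
  then obtain m where m: "m < N - 1" "c m \<noteq> 0" by blast
  obtain x where x: "\<And>j. j \<in> {1..N-1} \<Longrightarrow> b j < x j \<and> x j < a (j + 1) \<and> rpoly c (x j) = 0"
    using assms by metis
  have less: "x i < x j" if "i \<in> {1..N-1}" "j \<in> {1..N-1}" "i < j" for i j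
  proof -
    have "a (i + 1) < b j" using that by (intro a_less_b) auto
    moreover have "x i < a (i + 1)" "b j < x j" using x[OF that(1)] x[OF that(2)] by auto
    ultimately show ?thesis by linarith
  qed
  have inj: "inj_on x {1..N-1}"
    by (rule inj_onI) (metis less linorder_neqE_nat order_less_irrefl)
  let ?R = "{z. (\<Sum>i\<le>N-2. c i * z ^ i) = (0::real)}"
  have eq: "rpoly c z = (\<Sum>i\<le>N-2. c i * z ^ i)" for z :: real
  proof -
    have "{..<N-1} = {..N-2}" using N2 by auto
    then show ?thesis by (simp add: rpoly_def)
  qed
  have "c m \<noteq> 0" "m \<le> N - 2" using m by auto
  then have "\<exists>k. k \<le> N - 2 \<and> c k \<noteq> 0" by blast
  from Poly_Roots.polyfun_rootbound[OF this]
  have R: "finite ?R" "card ?R \<le> N - 2" by auto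
  have "x ` {1..N-1} \<subseteq> ?R" using x eq by auto
  then have "card (x ` {1..N-1}) \<le> N - 2" using R card_mono by (meson le_trans)
  then show False using card_image[OF inj] N2 by simp
qed

lemma gap_point_interior:
  assumes "j \<in> {1..N-1}" "sin \<theta> \<noteq> 0"
  shows "b j < gap_point j \<theta>" "gap_point j \<theta> < a (j + 1)"
proof -
  have "(cos \<theta>)\<^sup>2 < 1" using assms(2) sin_cos_squared_add[of \<theta>] by (metis add_less_same_cancel2 not_less power2_less_eq_zero_iff zero_less_power2 less_add_same_cancel2)
  then have "\<bar>cos \<theta>\<bar> < 1" by (simp add: abs_square_less_1)
  then have "gap_rad j * (1 + cos \<theta>) > 0" "gap_rad j * (1 - cos \<theta>) > 0"
    using gap_rad_pos[OF assms(1)] by (auto simp: abs_less_iff)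
  then show "b j < gap_point j \<theta>" "gap_point j \<theta> < a (j + 1)"
    unfolding gap_point_ends[symmetric] by auto
qed

text \<open>Rolle's theorem for a primitive in the angle; the denominator \<open>gap_root\<close> is
  positive, so the numerator vanishes.\<close>

lemma gap_integral_zero_root:
  assumes j: "j \<in> {1..N-1}"
    and 0: "((\<lambda>s. rpoly c (gap_point j s) / gap_root j (gap_point j s)) has_integral 0) {0..pi}"
  shows "\<exists>x. b j < x \<and> x < a (j + 1) \<and> rpoly c x = 0"
proof -
  obtain G where G: "\<And>s. (G has_real_derivative rpoly c (gap_point j s) / gap_root j (gap_point j s)) (at s)"
    using gap_period_integral(2)[OF j rpoly_holomorphic rpoly_of_real] by blast
  have "((\<lambda>s. rpoly c (gap_point j s) / gap_root j (gap_point j s)) has_integral (G pi - G 0)) {0..pi}"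
    by (rule fundamental_theorem_of_calculus)
       (auto simp flip: has_real_derivative_iff_has_vector_derivative intro: has_field_derivative_at_within G)
  then have "G 0 = G pi" using has_integral_unique[OF 0] by fastforce
  then obtain s where s: "0 < s" "s < pi" "(G has_real_derivative 0) (at s)"
    using Rolle[of 0 pi G] G by (auto simp: differentiable_def has_field_derivative_def intro!: continuous_at_imp_continuous_on DERIV_isCont[OF G])
  have "sin s \<noteq> 0" using sin_gt_zero[OF s(1,2)] by simp
  moreover have "rpoly c (gap_point j s) = 0"
    using DERIV_unique[OF s(3) G[of s]] gap_root_pos[OF j, of s] by auto
  ultimately show ?thesis using gap_point_interior[OF j, of s] by blast
qed

lemma gap_period_rpoly_eq_0:
  assumes "\<And>j. j \<in> {1..N-1} \<Longrightarrow> gap_period j (rpoly c) = 0"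
  shows "\<forall>m<N-1. c m = 0"
  using gap_integral_zero_root gap_period_integral(1)[OF _ rpoly_holomorphic rpoly_of_real, of _ c] assms
  by (intro rpoly_zero_of_gap_roots) fastforce

lemma gap_period_rpoly:
  "j \<in> {1..N-1} \<Longrightarrow> gap_period j (rpoly c) = (\<Sum>m<N-1. c m * gap_period j (\<lambda>z. z ^ m))"
  unfolding rpoly_def
  by (subst gap_period_sum[OF admissible_ends])
     (auto intro!: sum.cong real_fun_cmult real_fun_power real_fun_ident gap_period_cmult[OF admissible_ends])

text \<open>The square system for the coefficients is injective by
  \<open>gap_period_rpoly_eq_0\<close>. Rows are numbered from 0 and gaps from 1.\<close>

lemma exists_rpoly_periods: "\<exists>c. \<forall>j\<in>{1..N-1}. gap_period j (rpoly c) = \<beta> j"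
proof -
  have "\<exists>c. \<forall>i<N-1. (\<Sum>m<N-1. gap_period (i+1) (\<lambda>z. z ^ m) * c m) = \<beta> (i+1)"
  proof (rule square_system_solvable)
    fix c assume 0: "\<And>i. i < N - 1 \<Longrightarrow> (\<Sum>m<N-1. gap_period (i+1) (\<lambda>z. z ^ m) * c m) = 0"
    show "\<forall>m<N-1. c m = 0"
    proof (rule gap_period_rpoly_eq_0)
      fix j assume j: "j \<in> {1..N-1}"
      then have "j - 1 < N - 1" by auto
      with j show "gap_period j (rpoly c) = 0"
        using 0[of "j - 1"] gap_period_rpoly[OF j, of c] by (simp add: mult.commute)
    qed
  qed
  then obtain c where c: "\<And>i. i < N - 1 \<Longrightarrow> (\<Sum>m<N-1. gap_period (i+1) (\<lambda>z. z ^ m) * c m) = \<beta> (i+1)" by blast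
  have "gap_period j (rpoly c) = \<beta> j" if j: "j \<in> {1..N-1}" for j
  proof -
    have "j - 1 < N - 1" using j by auto
    then show ?thesis using c[of "j - 1"] gap_period_rpoly[OF j, of c] j by (simp add: mult.commute)
  qed
  then show ?thesis by blast
qed

text \<open>Vanishing over all A-cycles gives information only if there is one; the circle through
  \<open>cut_left j\<close> and \<open>cut_right j\<close> serves.\<close>

lemma A_cycle_exists:
  assumes j: "j \<in> {1..N-1}"
  shows "\<exists>\<gamma>. A_cycle j \<gamma>"
proof -
  define R where "R = gap_rad j + gap_ext j / 2"
  define z where "z = part_circlepath (of_real (gap_mid j)) R pi (- pi)"
  have R: "R > 0" using gap_rad_pos[OF j] gap_ext_pos[OF j] by (simp add: R_def)
  have zt: "z t = Complex (gap_mid j - R * cos (2 * pi * t)) (R * sin (2 * pi * t))" for t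
  proof -
    have "linepath pi (- pi) t = pi - 2 * pi * t" by (simp add: linepath_def algebra_simps)
    then show ?thesis unfolding z_def part_circlepath_def by (simp add: complex_eq_iff Re_exp Im_exp cos_diff sin_diff)
  qed
  have z0: "z 0 = of_real (cut_left j)" "z 1 = of_real (cut_left j)" and z2: "z (1/2) = of_real (cut_right j)"
    by (simp_all add: zt cut_left_def cut_right_def R_def complex_eq_iff)
  have up: "Im (z t) > 0" if "0 < t" "t < 1/2" for t
    using R that sin_gt_zero[of "2 * pi * t"] by (simp add: zt)
  have lo: "Im (z t) < 0" if "1/2 < t" "t < 1" for t
  proof -
    have "sin (2 * pi * t - pi) > 0" using that by (intro sin_gt_zero) (auto simp: field_simps)
    then show ?thesis using R by (simp add: zt sin_diff mult_pos_neg)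
  qed
  have ne: "cut_left j \<notin> ends" "cut_right j \<notin> ends" using cut_left_right_notin[OF admissible_ends j] by auto
  have imag: "Re (upper_root (of_real (cut_left j))) = 0" "Re (upper_root (of_real (cut_right j))) = 0"
    using upper_root_cut_imag[OF gap_index(1)[OF j]] upper_root_cut_imag[OF gap_index(2)[OF j]] cut_left_right[OF j] by auto
  \<comment> \<open>On the lower half this is minus the first-sheet root. Over the cuts the root is
    imaginary, so both formulas agree at the crossing and the curve closes up.\<close>
  define w where "w t = (if t \<le> 1/2 then upper_root (z t) else - cnj (upper_root (cnj (z t))))" for t
  define \<gamma> where "\<gamma> t = Pt (z t) (w t)" for t
  have zc: "zc \<circ> \<gamma> = z" and wc: "wc \<circ> \<gamma> = w" by (auto simp: \<gamma>_def)
  have sl1: "z t \<in> slit_plane ends" if "0 \<le> t" "t \<le> 1/2" for t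
  proof -
    consider "t = 0" | "t = 1/2" | "0 < t" "t < 1/2" using \<open>0 \<le> t\<close> \<open>t \<le> 1/2\<close> by linarith
    then show ?thesis
      by cases (simp_all only: z0 z2 real_in_slit_plane ne upper_in_slit_plane[OF up] not_False_eq_True)
  qed
  have sl2: "cnj (z t) \<in> slit_plane ends" if "1/2 \<le> t" "t \<le> 1" for t
  proof -
    consider "t = 1" | "t = 1/2" | "1/2 < t" "t < 1" using \<open>1/2 \<le> t\<close> \<open>t \<le> 1\<close> by linarith
    then show ?thesis
      using upper_in_slit_plane[of "cnj (z t)"] lo[of t]
      by cases (simp_all only: z0 z2 real_in_slit_plane ne complex_cnj_complex_of_real cnj.sel neg_0_less_iff_less not_False_eq_True)
  qed
  have zcont: "continuous_on S z" for S unfolding z_def part_circlepath_def linepath_def by (intro continuous_intros)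
  have Wcont: "continuous_on (slit_plane ends) upper_root"
    by (intro holomorphic_on_imp_continuous_on upper_root_holomorphic) simp
  have "continuous_on ({0..1/2} \<union> {1/2..1}) w"
    unfolding w_def
  proof (rule continuous_on_cases_le)
    show "continuous_on {t \<in> {0..1/2} \<union> {1/2..1}. t \<le> 1/2} (\<lambda>t. upper_root (z t))"
      by (rule continuous_on_compose2[OF Wcont zcont]) (use sl1 in auto)
    show "continuous_on {t \<in> {0..1/2} \<union> {1/2..1}. 1/2 \<le> t} (\<lambda>t. - cnj (upper_root (cnj (z t))))"
      by (intro continuous_intros continuous_on_compose2[OF Wcont] zcont) (use sl2 in auto)
    show "upper_root (z t) = - cnj (upper_root (cnj (z t)))" if "t = 1/2" for t
      using imag(2) unfolding that z2 by (simp add: complex_eq_iff)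
  qed (auto intro: continuous_intros)
  moreover have "{0..1/2} \<union> {1/2..1} = {0..1::real}" by auto
  ultimately have wpath: "path w" by (simp add: path_def)
  have nb: "z t \<notin> branch_values" if "0 \<le> t" "t \<le> 1" for t
    using sl1[of t] sl2[of t] that by (cases "t \<le> 1/2") (auto simp: branch_values_ends slit_plane_def)
  have wsq: "(w t)\<^sup>2 = curve_poly (z t)" for t
    using upper_root_sq[of "cnj (z t)"] by (auto simp: w_def upper_root_sq curve_poly_cnj simp flip: complex_cnj_power)
  have cl: "closed_curve \<gamma>"
    unfolding closed_curve_def zc wc
  proof (intro conjI)
    show "\<gamma> ` {0..1} \<subseteq> affine_part - branch_points"
      using nb by (auto simp: \<gamma>_def affine_part_iff wsq branch_points_def)
    show "valid_path z" by (simp add: z_def)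
    show "\<gamma> 1 = \<gamma> 0" using imag(1) by (simp add: \<gamma>_def w_def z0 complex_eq_iff)
  qed (fact wpath)
  have "A_cycle j \<gamma>"
    unfolding A_cycle_def
  proof (intro conjI bexI[of _ "1/2"] ballI)
    show "zc (\<gamma> 0) \<in> of_real ` {a j<..<b j}" using cut_left_right[OF j] by (auto simp: \<gamma>_def z0)
    show "zc (\<gamma> (1/2)) \<in> of_real ` {a (j + 1)<..<b (j + 1)}" using cut_left_right[OF j] by (auto simp: \<gamma>_def z2)
    fix t :: real assume t: "t \<in> {0<..<1/2}"
    then have i: "Im (z t) > 0" using up by auto
    then have c: "z t \<notin> cuts" by (auto simp: not_cuts_iff)
    show "Im (zc (\<gamma> t)) > 0" using i by (simp add: \<gamma>_def)
    show "\<gamma> t \<in> sheet 1" using i c t root_branch_upper[of "z t"] by (auto simp: \<gamma>_def w_def sheet_def sheet_sign_def)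
  next
    fix t :: real assume t: "t \<in> {1/2<..<1}"
    then have i: "Im (z t) < 0" using lo by auto
    then have c: "z t \<notin> cuts" "cnj (z t) \<notin> cuts" by (auto simp: not_cuts_iff)
    show "Im (zc (\<gamma> t)) < 0" using i by (simp add: \<gamma>_def)
    have "upper_root (cnj (z t)) = cnj (root_branch (z t))"
      using root_branch_cnj[OF c(1)] root_branch_upper[of "cnj (z t)"] c i by simp
    then show "\<gamma> t \<in> sheet 2" using c t by (auto simp: \<gamma>_def w_def sheet_def sheet_sign_def)
  qed (use cl in auto)
  then show ?thesis by blast
qed

section \<open>From rational coefficients to meromorphic differentials\<close>

text \<open>The value is 0 where the residue is nonzero and the limit in the local coordinate
  elsewhere. At branch points and at infinity this limit is a coefficient of dt, which
  \<open>\<Phi>\<close> itself does not give.\<close>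

lemma differential_from_coefficient:
  assumes X: "finite X" "branch_values \<subseteq> X"
    and cont: "\<forall>z w. w\<^sup>2 = curve_poly z \<longrightarrow> z \<notin> X \<longrightarrow> isCont (\<lambda>t. \<Phi> (z + t) (ord_w z w t)) 0"
    and sing: "\<forall>Q\<in>surface. simple_sing (R Q) (pullback \<Phi> Q)"
    and R0: "\<forall>z w. w\<^sup>2 = curve_poly z \<longrightarrow> z \<notin> X \<longrightarrow> R (Pt z w) = 0"
  defines "\<omega> \<equiv> \<lambda>Q. if Q \<notin> surface \<or> R Q \<noteq> 0 then 0 else Lim (at 0) (pullback \<Phi> Q)"
  shows "w\<^sup>2 = curve_poly z \<Longrightarrow> z \<notin> X \<Longrightarrow> \<omega> (Pt z w) = \<Phi> z w"
    and "meromorphic_differential \<omega>"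
    and "Q \<in> surface \<Longrightarrow> at_most_simple_pole_at \<omega> Q"
    and "Q \<in> surface \<Longrightarrow> residue_at \<omega> Q = R Q"
    and "Q \<in> surface \<Longrightarrow> R Q = 0 \<Longrightarrow> holomorphic_at \<omega> Q"
proof -
  show val: "\<omega> (Pt z w) = \<Phi> z w" if zw: "w\<^sup>2 = curve_poly z" "z \<notin> X" for z w
  proof -
    have w: "w \<noteq> 0" using zw X(2) curve_poly_eq_0[of z] by auto
    have "pullback \<Phi> (Pt z w) = (\<lambda>t. \<Phi> (z + t) (ord_w z w t))"
      using w by (auto simp: pullback_def deriv_local_z_Pt local_w_ord simp del: local_w.simps)
    then have "(pullback \<Phi> (Pt z w) \<longlongrightarrow> \<Phi> z w) (at 0)"
      using cont[rule_format, OF zw] ord_w(2)[OF zw(1) w] by (simp add: isCont_def)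
    then have "Lim (at 0) (pullback \<Phi> (Pt z w)) = \<Phi> z w" by (intro tendsto_Lim) auto
    then show ?thesis using zw R0[rule_format, OF zw] by (simp add: \<omega>_def surface_Pt_iff)
  qed
  have main: "simple_sing (R Q) (local_coeff \<omega> Q) \<and> (R Q \<noteq> 0 \<longrightarrow> local_coeff \<omega> Q 0 = 0) \<and> (R Q = 0 \<longrightarrow> (local_coeff \<omega> Q \<longlongrightarrow> local_coeff \<omega> Q 0) (at 0))"
    if Q: "Q \<in> surface" for Q
  proof -
    have ev: "\<forall>\<^sub>F t in at 0. pullback \<Phi> Q t = local_coeff \<omega> Q t"
      using eventually_local_ordinary[OF Q X(1)]
      by eventually_elim (auto simp: local_coeff_def pullback_def val simp del: local_w.simps local_z.simps)
    have "\<exists>l. (pullback \<Phi> Q \<longlongrightarrow> l) (at 0)" if "R Q = 0"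
      using simple_sing_0_tendsto sing[rule_format, OF Q] that by simp
    then have "(pullback \<Phi> Q \<longlongrightarrow> \<omega> Q) (at 0)" if "R Q = 0"
      using that Q tendsto_Lim[of "at 0" "pullback \<Phi> Q"] by (auto simp: \<omega>_def)
    then have "R Q = 0 \<longrightarrow> (local_coeff \<omega> Q \<longlongrightarrow> local_coeff \<omega> Q 0) (at 0)"
      using Lim_transform_eventually[OF _ ev, of "\<omega> Q"] local_coeff_def[of \<omega> Q 0] by simp
    moreover have "R Q \<noteq> 0 \<longrightarrow> local_coeff \<omega> Q 0 = 0" by (simp add: local_coeff_def \<omega>_def)
    ultimately show ?thesis using simple_sing_cong[OF ev sing[rule_format, OF Q]] by blast
  qed
  note nice = simple_sing_nice[of "R Q" "local_coeff \<omega> Q" for Q]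
  show "meromorphic_differential \<omega>"
    unfolding meromorphic_differential_def using main nice(1) by (auto simp: \<omega>_def)
  show "Q \<in> surface \<Longrightarrow> at_most_simple_pole_at \<omega> Q"
    unfolding at_most_simple_pole_at_def using main nice(2) by blast
  show "Q \<in> surface \<Longrightarrow> residue_at \<omega> Q = R Q"
    unfolding residue_at_def using main simple_sing_residue by blast
  show "Q \<in> surface \<Longrightarrow> R Q = 0 \<Longrightarrow> holomorphic_at \<omega> Q"
    unfolding holomorphic_at_def using main nice(3) by blast
qed


section \<open>The explicit differential, its residues and A-periods\<close>

definition gap_data :: "(nat \<Rightarrow> surface_point) \<Rightarrow> (nat \<Rightarrow> real) \<Rightarrow> (nat \<Rightarrow> real) \<Rightarrow> bool" where
  "gap_data P p y \<longleftrightarrow> (\<forall>j\<in>{1..N-1}. P j = Pt (of_real (p j)) (of_real (y j)) \<and> (y j)\<^sup>2 = rcurve (p j) \<and>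
     b j \<le> p j \<and> p j \<le> a (j + 1))"

definition sing_set :: "(nat \<Rightarrow> real) \<Rightarrow> real set" where "sing_set p = ends \<union> p ` {1..N-1}"

lemma finite_sing_set [simp]: "finite (sing_set p)" by (simp add: sing_set_def)

lemma sing_set_admissible: "gap_data P p y \<Longrightarrow> admissible (sing_set p)"
  unfolding admissible_def gap_data_def sing_set_def by auto

definition nu_sign :: "nat \<Rightarrow> real" where "nu_sign \<nu> = (if \<nu> = 1 then 1 else -1)"

text \<open>The term \<open>(1 + y j / w) / (2 * (z - p j))\<close> has residue 1 at \<open>(p j, y j)\<close> and none at
  \<open>(p j, - y j)\<close>; the term \<open>z ^ (N - 1) / (2 * w)\<close> moves all the residue at infinity to one point.\<close>

definition even_part :: "(nat \<Rightarrow> real) \<Rightarrow> complex \<Rightarrow> complex" where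
  "even_part p z = (\<Sum>j\<in>{1..N-1}. of_real (1/2) * (1 / (z - of_real (p j)))) + (\<Sum>e\<in>ends. of_real (-1/4) * (1 / (z - of_real e)))"

definition odd_part :: "nat \<Rightarrow> (nat \<Rightarrow> real) \<Rightarrow> (nat \<Rightarrow> real) \<Rightarrow> complex \<Rightarrow> complex" where
  "odd_part \<nu> p y z = of_real (nu_sign \<nu> / 2) * z ^ (N-1) + (\<Sum>j\<in>{1..N-1}. of_real (y j / 2) * (1 / (z - of_real (p j))))"

lemma real_fun_even_part: "real_fun (sing_set p) (even_part p)"
  unfolding even_part_def
  by (intro real_fun_add real_fun_sum real_fun_cmult real_fun_pole) (auto simp: sing_set_def)

lemma real_fun_odd_part: "real_fun (sing_set p) (odd_part \<nu> p y)"
  unfolding odd_part_def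
  by (intro real_fun_add real_fun_sum real_fun_cmult real_fun_pole real_fun_power real_fun_ident) (auto simp: sing_set_def)

text \<open>Each pole under the arc contributes - pi times its coefficient, which is 1/2 at the
  \<open>p j\<close> and -1/4 at the end points.\<close>

lemma Im_arc_even_part:
  assumes "finite E" "x < x'" "x \<notin> sing_set p" "x' \<notin> sing_set p"
  shows "Im (arc_integral (even_part p) x x') =
    - pi / 2 * card {j \<in> {1..N-1}. x < p j \<and> p j < x'} + pi / 4 * card {e \<in> ends. x < e \<and> e < x'}"
proof -
  have pole: "(\<lambda>z. of_real c * (1 / (z - of_real e))) holomorphic_on slit_plane (sing_set p)" if "e \<in> sing_set p" for c e
    using that by (intro real_fun_holomorphic_slit real_fun_cmult real_fun_pole)
  have one: "Im (arc_integral (\<lambda>z. of_real c * (1 / (z - of_real e))) x x') = (if x < e \<and> e < x' then - c * pi else 0)"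
    if "e \<in> sing_set p" for c e
  proof -
    have "e \<noteq> x" "e \<noteq> x'" using that assms(3,4) by auto
    then show ?thesis
      using arc_integral_cmult[OF real_fun_holomorphic_slit[OF real_fun_pole[OF that]] assms(2-4), of "of_real c"]
        Im_arc_integral_inverse[OF assms(2), of e] by auto
  qed
  have sub: "p j \<in> sing_set p" if "j \<in> {1..N-1}" for j using that by (simp add: sing_set_def)
  have subE: "e \<in> sing_set p" if "e \<in> ends" for e using that by (simp add: sing_set_def)
  have "arc_integral (even_part p) x x' =
     (\<Sum>j\<in>{1..N-1}. arc_integral (\<lambda>z. of_real (1/2) * (1 / (z - of_real (p j)))) x x')
     + (\<Sum>e\<in>ends. arc_integral (\<lambda>z. of_real (-1/4) * (1 / (z - of_real e))) x x')"
    unfolding even_part_def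
    by (subst arc_integral_add[OF holomorphic_on_sum[OF pole[OF sub]] holomorphic_on_sum[OF pole[OF subE]] assms(2-4)], assumption, assumption,
        subst arc_integral_sum[OF _ pole[OF sub] assms(2-4)], simp, assumption,
        subst arc_integral_sum[OF _ pole[OF subE] assms(2-4)], simp, assumption, rule refl)
  then have "Im (arc_integral (even_part p) x x') =
     (\<Sum>j\<in>{1..N-1}. if x < p j \<and> p j < x' then - (1/2) * pi else 0) + (\<Sum>e\<in>ends. if x < e \<and> e < x' then - (-1/4) * pi else 0)" (is ?I)
  proof -
    assume eq: "arc_integral (even_part p) x x' =
     (\<Sum>j\<in>{1..N-1}. arc_integral (\<lambda>z. of_real (1/2) * (1 / (z - of_real (p j)))) x x')
     + (\<Sum>e\<in>ends. arc_integral (\<lambda>z. of_real (-1/4) * (1 / (z - of_real e))) x x')"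
    show ?I unfolding eq plus_complex.sel Im_sum
      by (intro arg_cong2[of _ _ _ _ "(+)"] sum.cong refl one sub subE)
  qed
  then show ?thesis by (simp add: sum.If_cases Int_def mult.commute)
qed

lemma gap_data_between:
  assumes "gap_data P p y" and j: "j \<in> {1..N-1}"
  shows "{i \<in> {1..N-1}. cut_left j < p i \<and> p i < cut_right j} = {j}"
    "{e \<in> ends. cut_left j < e \<and> e < cut_right j} = {b j, a (j + 1)}"
proof -
  have p: "b i \<le> p i" "p i \<le> a (i + 1)" if "i \<in> {1..N-1}" for i using assms(1) that by (auto simp: gap_data_def)
  have "i = j" if i: "i \<in> {1..N-1}" and b: "cut_left j < p i" "p i < cut_right j" for i
  proof (rule ccontr)
    assume "i \<noteq> j"
    then consider "i < j" | "j < i" by linarith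
    then show False
    proof cases
      case 1
      then have "a (i+1) \<le> a j" using a_less_iff[OF gap_index(1)[OF j] gap_index(2)[OF i]] by simp
      then show False using p[OF i] b cut_left_right[OF j] by linarith
    next
      case 2
      then have "b (j+1) \<le> b i" using b_less_iff[OF gap_index(1)[OF i] gap_index(2)[OF j]] by simp
      then show False using p[OF i] b cut_left_right[OF j] by linarith
    qed
  qed
  then show "{i \<in> {1..N-1}. cut_left j < p i \<and> p i < cut_right j} = {j}"
    using p[OF j] cut_left_right[OF j] j by auto
  show "{e \<in> ends. cut_left j < e \<and> e < cut_right j} = {b j, a (j + 1)}"
  proof (intro equalityI subsetI)
    fix e assume "e \<in> {e \<in> ends. cut_left j < e \<and> e < cut_right j}"
    then show "e \<in> {b j, a (j + 1)}" using ends_cases_gap[OF j, of e] cut_left_right[OF j] by auto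
  next
    fix e assume "e \<in> {b j, a (j + 1)}"
    then show "e \<in> {e \<in> ends. cut_left j < e \<and> e < cut_right j}"
      using cut_left_right[OF j] gap_pos[OF j] b_in_ends[OF gap_index(1)[OF j]] a_in_ends[OF gap_index(2)[OF j]] by auto
  qed
qed

text \<open>Under the arc lie one \<open>p j\<close> and two end points, contributing - pi/2 and
  twice pi/4. They cancel, so only the odd part has to be normalized.\<close>

lemma even_part_A_period:
  assumes "gap_data P p y" "j \<in> {1..N-1}"
  shows "Im (arc_integral (even_part p) (cut_left j) (cut_right j)) = 0"
  using Im_arc_even_part[OF finite_ends cut_left_right(5)[OF assms(2)] cut_left_right_notin[OF sing_set_admissible[OF assms(1)] assms(2)]]
    gap_data_between[OF assms] gap_pos[OF assms(2)] by simp

definition omega_coeff :: "nat \<Rightarrow> (nat \<Rightarrow> real) \<Rightarrow> (nat \<Rightarrow> real) \<Rightarrow> (nat \<Rightarrow> real) \<Rightarrow> complex \<Rightarrow> complex \<Rightarrow> complex" where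
  "omega_coeff \<nu> p y c z w = even_part p z + (odd_part \<nu> p y z + rpoly c z) / w"

text \<open>Regroups the coefficient into the elementary differentials whose residues are known in
  every chart.\<close>

lemma omega_coeff_expand:
  "omega_coeff \<nu> p y c z w =
    ((\<Sum>j\<in>{1..N-1}. (1 + of_real (y j) / w) / (2 * (z - of_real (p j)))) + (-1/4) * (\<Sum>e\<in>ends. 1 / (z - of_real e)))
    + (of_real (nu_sign \<nu> / 2) * (z ^ (N-1) / w) + (\<Sum>m<N-1. of_real (c m) * (z ^ m / w)))"
proof -
  have "(1 + of_real (y j) / w) / (2 * (z - of_real (p j))) =
      of_real (1/2) * (1 / (z - of_real (p j))) + of_real (y j / 2) * (1 / (z - of_real (p j))) / w" for j
    by (simp add: add_divide_distrib mult.commute mult.left_commute)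
  then have "(\<Sum>j\<in>{1..N-1}. (1 + of_real (y j) / w) / (2 * (z - of_real (p j)))) =
     (\<Sum>j\<in>{1..N-1}. of_real (1/2) * (1 / (z - of_real (p j)))) + (\<Sum>j\<in>{1..N-1}. of_real (y j / 2) * (1 / (z - of_real (p j)))) / w"
    by (simp add: sum.distrib sum_divide_distrib)
  then show ?thesis
    unfolding omega_coeff_def even_part_def odd_part_def rpoly_def
    by (simp add: sum_distrib_left sum_divide_distrib add_divide_distrib algebra_simps)
qed

lemma card_ends: "card ends = 2 * N"
  using sum_ends[of "\<lambda>_. 1::nat"] by simp

lemma sum_ends_indicator: "(\<Sum>e\<in>ends. if z = complex_of_real e then c else 0) = (if z \<in> branch_values then c else 0)"
proof (cases "z \<in> branch_values")
  case True
  then obtain e where e: "e \<in> ends" "z = of_real e" by (auto simp: branch_values_ends)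
  then have "(\<Sum>e'\<in>ends. if z = complex_of_real e' then c else 0) = (\<Sum>e'\<in>ends. if e' = e then c else 0)"
    by (intro sum.cong) auto
  then show ?thesis using e True by simp
next
  case False
  then show ?thesis by (auto simp: branch_values_ends intro!: sum.neutral)
qed

text \<open>At a branch point the weight -1/4 meets the doubled residue. At infinity the
  \<open>N - 1\<close> poles give - (N - 1)/2 and the \<open>2 * N\<close> end points give N/2, so
  1/2 is left on each sheet, which the term with \<open>z ^ (N - 1)\<close> changes to 0 and
  1.\<close>

lemma omega_coeff_sing:
  assumes P: "gap_data P p y" and \<nu>: "\<nu> \<in> {1,2}" and Q: "Q \<in> surface"
  shows "simple_sing (prescribed_residue \<nu> P Q) (pullback (omega_coeff \<nu> p y c) Q)"
proof -
  define r1 where "r1 j = (case Q of Pt z w \<Rightarrow> if z = complex_of_real (p j) \<and> w = of_real (y j) then 1 else (0::complex) | Infty n \<Rightarrow> - 1 / 2)" for j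
  define r2 where "r2 e = (case Q of Pt z w \<Rightarrow> if z = complex_of_real e then if w = 0 then 2 else 1 else (0::complex) | Infty n \<Rightarrow> - 1)" for e
  define r3 where "r3 m = (case Q of Pt z w \<Rightarrow> 0 | Infty n \<Rightarrow> if m = N - 1 then - sheet_sign n else 0)" for m
  define f1 where "f1 j = pullback (\<lambda>z w. (1 + of_real (y j) / w) / (2 * (z - of_real (p j)))) Q" for j
  define f2 where "f2 e = pullback (\<lambda>z w. 1 / (z - complex_of_real e)) Q" for e
  define f3 where "f3 m = pullback (\<lambda>z w. z ^ m / w) Q" for m
  have s1: "simple_sing (r1 j) (f1 j)" if "j \<in> {1..N-1}" for j
    unfolding r1_def f1_def
    by (rule pullback_third_kind[OF Q]) (use P that in \<open>auto simp: gap_data_def curve_poly_of_real simp flip: of_real_power\<close>)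
  have s2: "simple_sing (r2 e) (f2 e)" for e unfolding r2_def f2_def by (rule pullback_inverse[OF Q])
  have s3: "simple_sing (r3 m) (f3 m)" if "m < N" for m unfolding r3_def f3_def by (rule pullback_power[OF Q that])
  have eq: "pullback (omega_coeff \<nu> p y c) Q = (\<lambda>t. ((\<Sum>j\<in>{1..N-1}. f1 j t) + (-1/4) * (\<Sum>e\<in>ends. f2 e t))
    + (of_real (nu_sign \<nu> / 2) * f3 (N-1) t + (\<Sum>m<N-1. of_real (c m) * f3 m t)))"
    unfolding f1_def f2_def f3_def pullback_def omega_coeff_expand
    by (simp add: sum_distrib_left sum_distrib_right algebra_simps)
  have res: "((\<Sum>j\<in>{1..N-1}. r1 j) + (-1/4) * (\<Sum>e\<in>ends. r2 e)) + (of_real (nu_sign \<nu> / 2) * r3 (N-1) + (\<Sum>m<N-1. of_real (c m) * r3 m))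
      = prescribed_residue \<nu> P Q"
  proof (cases Q)
    case (Pt z w)
    have "r1 j = (if Q = P j then 1 else 0)" if "j \<in> {1..N-1}" for j
      using P that by (auto simp: r1_def Pt gap_data_def)
    then have 1: "(\<Sum>j\<in>{1..N-1}. r1 j) = (\<Sum>j\<in>{1..N-1}. if Q = P j then 1 else 0)" by (intro sum.cong) auto
    have "r2 e = (if z = complex_of_real e then 2 else 0)" if "e \<in> ends" for e
      using that surface_w_eq_0[OF Q[unfolded Pt]] by (auto simp: r2_def Pt branch_values_ends)
    then have "(\<Sum>e\<in>ends. r2 e) = (if z \<in> branch_values then 2 else 0)"
      using sum_ends_indicator[of z 2] by simp
    moreover have "Q \<in> branch_points \<longleftrightarrow> z \<in> branch_values"
      using surface_w_eq_0[OF Q[unfolded Pt]] by (auto simp: branch_points_def Pt)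
    ultimately show ?thesis
      unfolding prescribed_residue_def 1 by (simp add: r3_def Pt)
  next
    case (Infty n)
    have n: "n = 1 \<or> n = 2" using Q Infty surface_Infty_iff by simp
    have [simp]: "Q \<noteq> P j" if "j \<in> {1..N-1}" for j using P that by (auto simp: Infty gap_data_def)
    have nb: "Q \<notin> branch_points" by (auto simp: branch_points_def Infty)
    have "(\<Sum>j\<in>{1..N-1}. if Q = P j then 1 else 0) = (0::complex)" by (intro sum.neutral) auto
    then have "prescribed_residue \<nu> P Q = (if n = 3 - \<nu> then 1 else 0)"
      using nb by (simp add: prescribed_residue_def Infty)
    moreover have "(\<Sum>m<N-1. of_real (c m) * r3 m) = 0" by (intro sum.neutral) (auto simp: r3_def Infty)
    ultimately show ?thesis
      using n \<nu> N2 by (auto simp: r1_def r2_def r3_def Infty card_ends nu_sign_def sheet_sign_def of_nat_diff field_simps)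
  qed
  show ?thesis
    unfolding eq res[symmetric]
    by (intro simple_sing_add simple_sing_cmult simple_sing_sum s1 s2 s3) (use N2 in auto)
qed

lemma omega_exists:
  assumes P: "gap_data P p y" and \<nu>: "\<nu> \<in> {1,2}"
    and c: "\<And>j. j \<in> {1..N-1} \<Longrightarrow> gap_period j (rpoly c) = - gap_period j (odd_part \<nu> p y)"
  shows "\<exists>\<omega>. is_omega \<nu> P \<omega> \<and> (\<forall>z w. w\<^sup>2 = curve_poly z \<longrightarrow> z \<notin> of_real ` sing_set p \<longrightarrow> \<omega> (Pt z w) = omega_coeff \<nu> p y c z w)"
proof -
  let ?X = "complex_of_real ` sing_set p"
  let ?\<Phi> = "omega_coeff \<nu> p y c"
  let ?R = "prescribed_residue \<nu> P"
  have X: "finite ?X" "branch_values \<subseteq> ?X" by (auto simp: branch_values_ends sing_set_def)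
  have cont: "isCont (\<lambda>t. ?\<Phi> (z + t) (ord_w z w t)) 0" if zw: "w\<^sup>2 = curve_poly z" "z \<notin> ?X" for z w
  proof -
    have w: "w \<noteq> 0" using zw X(2) curve_poly_eq_0[of z] by auto
    note ow = ord_w[OF zw(1) w]
    have "isCont (ord_w z w) 0" using ow(1) analytic_at_imp_isCont by blast
    then show ?thesis
      unfolding omega_coeff_def even_part_def odd_part_def rpoly_def
      using zw(2) w ow(2) by (intro continuous_intros) (auto simp: sing_set_def)
  qed
  have R0: "?R (Pt z w) = 0" if "w\<^sup>2 = curve_poly z" "z \<notin> ?X" for z w
  proof -
    have "Pt z w \<noteq> P j" if "j \<in> {1..N-1}" for j using P that \<open>z \<notin> ?X\<close> by (auto simp: gap_data_def sing_set_def)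
    then have "(\<Sum>j\<in>{1..N-1}. if Pt z w = P j then 1 else 0) = (0::complex)" by (intro sum.neutral) auto
    moreover have "Pt z w \<notin> branch_points" using that X(2) by (auto simp: branch_points_def)
    ultimately show ?thesis by (simp add: prescribed_residue_def)
  qed
  define \<omega> where "\<omega> = (\<lambda>Q. if Q \<notin> surface \<or> ?R Q \<noteq> 0 then 0 else Lim (at 0) (pullback ?\<Phi> Q))"
  have "\<forall>z w. w\<^sup>2 = curve_poly z \<longrightarrow> z \<notin> ?X \<longrightarrow> isCont (\<lambda>t. ?\<Phi> (z + t) (ord_w z w t)) 0"
    "\<forall>Q\<in>surface. simple_sing (?R Q) (pullback ?\<Phi> Q)"
    "\<forall>z w. w\<^sup>2 = curve_poly z \<longrightarrow> z \<notin> ?X \<longrightarrow> ?R (Pt z w) = 0"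
    using cont omega_coeff_sing[OF P \<nu>, of _ c] R0 by blast+
  note D = differential_from_coefficient[OF X this, folded \<omega>_def]
  have val: "\<And>z w. w\<^sup>2 = curve_poly z \<Longrightarrow> z \<notin> ?X \<Longrightarrow> \<omega> (Pt z w) = ?\<Phi> z w"
    unfolding \<omega>_def using D(1) by blast
  have "?R Q = 0" if "Q \<in> surface - (branch_points \<union> P ` {1..N-1} \<union> {Infty (3 - \<nu>)})" for Q
  proof -
    have "(\<Sum>j\<in>{1..N-1}. if Q = P j then 1 else 0) = (0::complex)" using that by (intro sum.neutral) auto
    then show ?thesis using that by (simp add: prescribed_residue_def)
  qed
  moreover have "curve_integral \<omega> \<gamma> = 0" if j: "j \<in> {1..N-1}" and \<gamma>: "A_cycle j \<gamma>" for j \<gamma>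
  proof -
    note adm = sing_set_admissible[OF P]
    have "\<omega> (Pt z w) = even_part p z + (odd_part \<nu> p y z + rpoly c z) / w" if "Im z \<noteq> 0" "w\<^sup>2 = curve_poly z" for z w
    proof -
      have "z \<notin> ?X" using that(1) by auto
      then show ?thesis using val[OF that(2)] by (simp add: omega_coeff_def)
    qed
    from A_cycle_integral[OF adm real_fun_even_part real_fun_add[OF real_fun_odd_part rpoly_real_fun] this j \<gamma>]
    show ?thesis
      unfolding curve_integral_def even_part_A_period[OF P j] gap_period_add[OF adm real_fun_odd_part rpoly_real_fun j] c[OF j]
      by (auto intro: integral_unique)
  qed
  ultimately have "is_omega \<nu> P \<omega>"
    unfolding is_omega_def using D(2-5) by blast
  with val show ?thesis by blast
qed

section \<open>Uniqueness of the differential\<close>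

lemma branch_v_minus: "branch_v e (- t) = branch_v e t"
  by (simp add: branch_v_def)

lemma ord_w_minus: "ord_w z (- w) t = - ord_w z w t"
  by (simp add: ord_w_def)

text \<open>The difference \<open>\<eta>\<close> has no poles. The sum \<open>T\<close> of its
  values on the two sheets and \<open>w\<close> times their difference, \<open>D\<close>, are
  functions of \<open>z\<close> alone that extend to entire functions. At infinity \<open>T\<close>
  tends to 0 and \<open>D\<close> is bounded by a multiple of \<open>z^(N-2)\<close>.\<close>

lemma omega_difference:
  assumes P: "gap_data P p y" and \<omega>: "is_omega \<nu> P \<omega>" "is_omega \<nu> P \<omega>'"
  shows "\<exists>d. \<forall>z w. w\<^sup>2 = curve_poly z \<longrightarrow> z \<notin> of_real ` sing_set p \<longrightarrow>
      \<omega> (Pt z w) - \<omega>' (Pt z w) = (\<Sum>m<N-1. d m * z ^ m) / w"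
proof -
  let ?X = "complex_of_real ` sing_set p"
  have X: "finite ?X" "branch_values \<subseteq> ?X" by (auto simp: branch_values_ends sing_set_def)
  define \<eta> where "\<eta> Q = \<omega> Q - \<omega>' Q" for Q
  have lc: "local_coeff \<eta> Q = (\<lambda>t. local_coeff \<omega> Q t - local_coeff \<omega>' Q t)" for Q
    by (rule ext) (simp add: local_coeff_def \<eta>_def algebra_simps)
  have s: "simple_sing (prescribed_residue \<nu> P Q) (local_coeff \<omega> Q)" if "Q \<in> surface" "is_omega \<nu> P \<omega>" for Q \<omega>
    using that unfolding is_omega_def meromorphic_differential_def at_most_simple_pole_at_def residue_at_def
    by (intro nice_imp_simple_sing) auto
  have lim: "\<exists>l. (local_coeff \<eta> Q \<longlongrightarrow> l) (at 0)" if "Q \<in> surface" for Q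
    using simple_sing_0_tendsto[of "local_coeff \<eta> Q"] simple_sing_diff[OF s[OF that \<omega>(1)] s[OF that \<omega>(2)]] by (simp add: lc)
  have an: "local_coeff \<eta> (Pt z w) analytic_on {0}" if "w\<^sup>2 = curve_poly z" "z \<notin> ?X" for z w
  proof -
    have "Pt z w \<in> surface - (branch_points \<union> P ` {1..N - 1} \<union> {Infty (3 - \<nu>)})"
      using that X(2) P by (auto simp: surface_Pt_iff branch_points_def gap_data_def sing_set_def)
    then have "local_coeff \<omega> (Pt z w) analytic_on {0}" "local_coeff \<omega>' (Pt z w) analytic_on {0}"
      using \<omega> unfolding is_omega_def holomorphic_at_def by blast+
    then show ?thesis unfolding lc by (intro analytic_intros)
  qed
  have lc_ord: "local_coeff \<eta> (Pt z w) t = \<eta> (Pt (z + t) (ord_w z w t))" if "w\<^sup>2 = curve_poly z" "w \<noteq> 0" for z w t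
    using that ord_w(2)[OF that] local_w_ord[of w z]
    by (simp add: local_coeff_def local_par_def deriv_local_z_Pt del: local_w.simps)
  have lc_branch: "local_coeff \<eta> (Pt e 0) t = \<eta> (Pt (e + t\<^sup>2) (t * branch_v e t)) * (2 * t)" if "t \<noteq> 0" for e t
    using that local_w_branch[of e t] by (simp add: local_coeff_def local_par_def deriv_local_z_Pt del: local_w.simps)
  have lc_infty: "\<eta> (Pt z (sheet_sign n * root_branch z)) = - ((1/z)\<^sup>2 * local_coeff \<eta> (Infty n) (1 / z))" if "z \<noteq> 0" for z n
    using that by (simp add: local_coeff_def local_par_def deriv_local_z_Infty)
  \<comment> \<open>Some root, in general not continuous in \<open>z\<close>; \<open>T\<close> and
    \<open>D\<close> do not depend on its sign.\<close>
  define q where "q z = csqrt (curve_poly z)" for z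
  define T where "T z = \<eta> (Pt z (q z)) + \<eta> (Pt z (- q z))" for z
  define D where "D z = q z * (\<eta> (Pt z (q z)) - \<eta> (Pt z (- q z)))" for z
  have TD: "T z = \<eta> (Pt z w) + \<eta> (Pt z (- w)) \<and> D z = w * (\<eta> (Pt z w) - \<eta> (Pt z (- w)))" if "w\<^sup>2 = curve_poly z" for z w
  proof -
    have "w\<^sup>2 = (q z)\<^sup>2" using that by (simp add: q_def)
    then have "w = q z \<or> w = - q z" by (simp only: power2_eq_iff)
    then show ?thesis by (auto simp: T_def D_def algebra_simps)
  qed
  have ord: "T (z + t) = local_coeff \<eta> (Pt z w) t + local_coeff \<eta> (Pt z (- w)) t
     \<and> D (z + t) = ord_w z w t * (local_coeff \<eta> (Pt z w) t - local_coeff \<eta> (Pt z (- w)) t)"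
    if w: "w\<^sup>2 = curve_poly z" "w \<noteq> 0" for z w t
    using TD[OF ord_w(3)[OF w, of t]] lc_ord[OF w, of t] lc_ord[of "- w" z t] w by (simp add: ord_w_minus)
  have shift: "F analytic_on {z}" if "(\<lambda>t. F (z + t)) analytic_on {0}" for F z
  proof -
    have "((\<lambda>t. F (z + t)) \<circ> (\<lambda>u. u - z)) analytic_on {z}"
      by (rule analytic_on_compose) (use that in \<open>auto intro: analytic_intros\<close>)
    then show ?thesis by (simp add: o_def)
  qed
  have anTD: "T analytic_on {z} \<and> D analytic_on {z}" if z: "z \<notin> ?X" for z
  proof -
    have w: "(q z)\<^sup>2 = curve_poly z" "q z \<noteq> 0" using z X(2) by (auto simp: q_def curve_poly_eq_0)
    have "(- q z)\<^sup>2 = curve_poly z" using w by simp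
    note an' = an[OF w(1) z] an[OF this z] ord_w(1)[OF w]
    have "(\<lambda>t. T (z + t)) analytic_on {0}" "(\<lambda>t. D (z + t)) analytic_on {0}"
      unfolding ord[OF w, THEN conjunct1] ord[OF w, THEN conjunct2] using an' by (auto intro!: analytic_intros)
    then show ?thesis using shift by blast
  qed
  have limTD: "((\<lambda>z. (z - x) * T z) \<longlongrightarrow> 0) (at x) \<and> ((\<lambda>z. (z - x) * D z) \<longlongrightarrow> 0) (at x)" if x: "x \<in> ?X" for x
  proof (cases "x \<in> branch_values")
    case False
    then have w: "(q x)\<^sup>2 = curve_poly x" "q x \<noteq> 0" by (auto simp: q_def curve_poly_eq_0)
    then have "Pt x (q x) \<in> surface" "Pt x (- q x) \<in> surface" by (auto simp: surface_Pt_iff)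
    then obtain l l' where l: "(local_coeff \<eta> (Pt x (q x)) \<longlongrightarrow> l) (at 0)" "(local_coeff \<eta> (Pt x (- q x)) \<longlongrightarrow> l') (at 0)"
      using lim by blast
    have o: "(ord_w x (q x) \<longlongrightarrow> ord_w x (q x) 0) (at 0)"
      using ord_w(1)[OF w] analytic_at_imp_isCont isContD by blast
    have "((\<lambda>t. t * T (x + t)) \<longlongrightarrow> 0 * (l + l')) (at 0)" "((\<lambda>t. t * D (x + t)) \<longlongrightarrow> 0 * (ord_w x (q x) 0 * (l - l'))) (at 0)"
      unfolding ord[OF w, THEN conjunct1] ord[OF w, THEN conjunct2] by (intro tendsto_intros l o)+
    then show ?thesis by (subst (1 2) LIM_offset_zero_iff) auto
  next
    case True
    then have Q: "Pt x 0 \<in> surface" by (simp add: surface_Pt_iff curve_poly_eq_0)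
    then obtain l where l: "(local_coeff \<eta> (Pt x 0) \<longlongrightarrow> l) (at 0)" using lim by blast
    have mf: "filterlim uminus (at 0) (at (0::complex))"
      by (rule filterlim_atI) (auto intro!: tendsto_eq_intros simp: eventually_at_filter)
    have l': "((\<lambda>t. local_coeff \<eta> (Pt x 0) (- t)) \<longlongrightarrow> l) (at 0)"
      using filterlim_compose[OF l mf] by simp
    have v: "(branch_v x \<longlongrightarrow> branch_v x 0) (at 0)"
      using branch_v(1)[OF True] analytic_at_imp_isCont isContD by blast
    \<comment> \<open>Near a branch point \<open>t\<close> and \<open>- t\<close> are the two points
      over the same \<open>z\<close>; the coefficient of dt contains the factor \<open>2 * t\<close>
      from dz.\<close>
    have eqs: "t\<^sup>2 * T (x + t\<^sup>2) = t * (local_coeff \<eta> (Pt x 0) t - local_coeff \<eta> (Pt x 0) (- t)) / 2 \<and>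
        t\<^sup>2 * D (x + t\<^sup>2) = t\<^sup>2 * (branch_v x t * (local_coeff \<eta> (Pt x 0) t + local_coeff \<eta> (Pt x 0) (- t)) / 2)"
      if t: "t \<noteq> 0" for t
    proof -
      let ?A = "\<eta> (Pt (x + t\<^sup>2) (t * branch_v x t))" and ?B = "\<eta> (Pt (x + t\<^sup>2) (- (t * branch_v x t)))"
      note e = TD[OF branch_v(3)[OF True, of t]]
      have L: "local_coeff \<eta> (Pt x 0) t = ?A * (2 * t)" "local_coeff \<eta> (Pt x 0) (- t) = - (?B * (2 * t))"
        using lc_branch[OF t, of x] lc_branch[of "- t" x] t by (simp_all add: branch_v_minus)
      show ?thesis unfolding L e[THEN conjunct1] e[THEN conjunct2] by (simp add: power2_eq_square algebra_simps)
    qed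
    have "((\<lambda>t. t * (local_coeff \<eta> (Pt x 0) t - local_coeff \<eta> (Pt x 0) (- t)) / 2) \<longlongrightarrow> 0 * (l - l) / 2) (at 0)"
      "((\<lambda>t. t\<^sup>2 * (branch_v x t * (local_coeff \<eta> (Pt x 0) t + local_coeff \<eta> (Pt x 0) (- t)) / 2)) \<longlongrightarrow> 0\<^sup>2 * (branch_v x 0 * (l + l) / 2)) (at 0)"
      by (intro tendsto_intros l l' v; simp)+
    then have lims: "((\<lambda>t. t\<^sup>2 * T (x + t\<^sup>2)) \<longlongrightarrow> 0) (at 0)" "((\<lambda>t. t\<^sup>2 * D (x + t\<^sup>2)) \<longlongrightarrow> 0) (at 0)"
    proof -
      assume L: "((\<lambda>t. t * (local_coeff \<eta> (Pt x 0) t - local_coeff \<eta> (Pt x 0) (- t)) / 2) \<longlongrightarrow> 0 * (l - l) / 2) (at 0)"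
        "((\<lambda>t. t\<^sup>2 * (branch_v x t * (local_coeff \<eta> (Pt x 0) t + local_coeff \<eta> (Pt x 0) (- t)) / 2)) \<longlongrightarrow> 0\<^sup>2 * (branch_v x 0 * (l + l) / 2)) (at 0)"
      have ev: "\<forall>\<^sub>F t in at 0. t \<noteq> (0::complex)" by (auto simp: eventually_at_filter)
      have "((\<lambda>t. t\<^sup>2 * T (x + t\<^sup>2)) \<longlongrightarrow> 0 * (l - l) / 2) (at 0)"
      proof (rule Lim_transform_eventually[OF L(1)])
        show "\<forall>\<^sub>F t in at 0. t * (local_coeff \<eta> (Pt x 0) t - local_coeff \<eta> (Pt x 0) (- t)) / 2 = t\<^sup>2 * T (x + t\<^sup>2)"
          using ev by eventually_elim (rule eqs[THEN conjunct1, symmetric])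
      qed
      moreover have "((\<lambda>t. t\<^sup>2 * D (x + t\<^sup>2)) \<longlongrightarrow> 0\<^sup>2 * (branch_v x 0 * (l + l) / 2)) (at 0)"
      proof (rule Lim_transform_eventually[OF L(2)])
        show "\<forall>\<^sub>F t in at 0. t\<^sup>2 * (branch_v x t * (local_coeff \<eta> (Pt x 0) t + local_coeff \<eta> (Pt x 0) (- t)) / 2) = t\<^sup>2 * D (x + t\<^sup>2)"
          using ev by eventually_elim (rule eqs[THEN conjunct2, symmetric])
      qed
      ultimately show "((\<lambda>t. t\<^sup>2 * T (x + t\<^sup>2)) \<longlongrightarrow> 0) (at 0)" "((\<lambda>t. t\<^sup>2 * D (x + t\<^sup>2)) \<longlongrightarrow> 0) (at 0)" by simp_all
    qed
    \<comment> \<open>Substituting \<open>t = csqrt (z - x)\<close> turns limits in the branch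
      coordinate into limits in \<open>z\<close>.\<close>
    have "((\<lambda>z. csqrt (z - x)) \<longlongrightarrow> 0) (at x)"
    proof (subst tendsto_norm_zero_iff[symmetric], simp only: norm_csqrt)
      have "((\<lambda>z. sqrt (norm (z - x))) \<longlongrightarrow> sqrt (norm (x - x))) (at x)" by (intro tendsto_intros)
      then show "((\<lambda>z. sqrt (norm (z - x))) \<longlongrightarrow> 0) (at x)" by simp
    qed
    then have "filterlim (\<lambda>z. csqrt (z - x)) (at 0) (at x)"
      by (rule filterlim_atI) (auto simp: eventually_at_filter)
    from filterlim_compose[OF lims(1) this] filterlim_compose[OF lims(2) this]
    show ?thesis by simp
  qed
  obtain FT where FT: "FT holomorphic_on UNIV" "\<And>z. z \<notin> ?X \<Longrightarrow> FT z = T z"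
    using removable_finite_entire[OF X(1), of T] anTD limTD by blast
  obtain FD where FD: "FD holomorphic_on UNIV" "\<And>z. z \<notin> ?X \<Longrightarrow> FD z = D z"
    using removable_finite_entire[OF X(1), of D] anTD limTD by blast
  obtain B0 where B0: "\<And>x. x \<in> ?X \<Longrightarrow> norm x \<le> B0" using finite_imp_bounded[OF X(1)] unfolding bounded_iff by blast
  have large: "\<forall>\<^sub>F z in at_infinity. z \<notin> ?X \<and> z \<noteq> 0"
    unfolding eventually_at_infinity using B0 by (intro exI[of _ "\<bar>B0\<bar> + 1"]) fastforce
  obtain l1 l2 where l: "(local_coeff \<eta> (Infty 1) \<longlongrightarrow> l1) (at 0)" "(local_coeff \<eta> (Infty 2) \<longlongrightarrow> l2) (at 0)"
    using lim[of "Infty 1"] lim[of "Infty 2"] by (auto simp: surface_Infty_iff)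
  have inv: "filterlim (\<lambda>z::complex. 1 / z) (at 0) at_infinity"
    by (simp add: filterlim_def at_to_infinity flip: inverse_eq_divide)
  note L = filterlim_compose[OF l(1) inv] filterlim_compose[OF l(2) inv]
  have i0: "((\<lambda>z::complex. 1 / z) \<longlongrightarrow> 0) at_infinity" using inv by (simp add: filterlim_at)
  have u: "((\<lambda>z. infty_u (1 / z)) \<longlongrightarrow> 1) at_infinity"
    using filterlim_compose[OF isContD[OF analytic_at_imp_isCont[OF infty_u(1)]] inv] by (simp add: infty_u(2))
  have inf: "T z = - ((1/z)\<^sup>2 * (local_coeff \<eta> (Infty 1) (1/z) + local_coeff \<eta> (Infty 2) (1/z))) \<and>
     D z = z ^ (N-2) * - (infty_u (1/z) * (local_coeff \<eta> (Infty 1) (1/z) - local_coeff \<eta> (Infty 2) (1/z)))" if z: "z \<noteq> 0" for z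
  proof -
    have e: "\<eta> (Pt z (root_branch z)) = - ((1/z)\<^sup>2 * local_coeff \<eta> (Infty 1) (1/z))"
      "\<eta> (Pt z (- root_branch z)) = - ((1/z)\<^sup>2 * local_coeff \<eta> (Infty 2) (1/z))"
      using lc_infty[OF z, of 1] lc_infty[OF z, of 2] by (simp_all add: sheet_sign_def)
    have r: "root_branch z = infty_u (1/z) * z ^ N"
      using infty_u(3)[of "1/z"] z by (simp add: power_divide)
    have "z ^ N * (1/z)\<^sup>2 = z ^ (N-2)" using z N2 by (simp add: power_diff power_divide)
    then have rD: "root_branch z * (1/z)\<^sup>2 = z ^ (N-2) * infty_u (1/z)" by (simp add: r)
    have "D z = root_branch z * (1/z)\<^sup>2 * - (local_coeff \<eta> (Infty 1) (1/z) - local_coeff \<eta> (Infty 2) (1/z))"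
      unfolding TD[OF root_branch_sq, THEN conjunct2] e by (simp add: algebra_simps)
    then have "D z = z ^ (N-2) * - (infty_u (1/z) * (local_coeff \<eta> (Infty 1) (1/z) - local_coeff \<eta> (Infty 2) (1/z)))"
      unfolding rD by (simp add: algebra_simps)
    moreover have "T z = - ((1/z)\<^sup>2 * (local_coeff \<eta> (Infty 1) (1/z) + local_coeff \<eta> (Infty 2) (1/z)))"
      unfolding TD[OF root_branch_sq, THEN conjunct1] e by (simp add: algebra_simps)
    ultimately show ?thesis by blast
  qed
  have "((\<lambda>z. - ((1/z)\<^sup>2 * (local_coeff \<eta> (Infty 1) (1/z) + local_coeff \<eta> (Infty 2) (1/z)))) \<longlongrightarrow> - (0\<^sup>2 * (l1 + l2))) at_infinity"
    by (intro tendsto_intros L i0)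
  then have "(FT \<longlongrightarrow> - (0\<^sup>2 * (l1 + l2))) at_infinity"
    by (rule Lim_transform_eventually) (use large in \<open>eventually_elim, use inf FT(2) in auto\<close>)
  then have FT0: "FT z = 0" for z using Liouville_weak_0[OF FT(1)] by simp
  have "((\<lambda>z. - (infty_u (1/z) * (local_coeff \<eta> (Infty 1) (1/z) - local_coeff \<eta> (Infty 2) (1/z)))) \<longlongrightarrow> - (1 * (l1 - l2))) at_infinity"
    by (intro tendsto_intros L u)
  then have "\<forall>\<^sub>F z in at_infinity. norm (- (infty_u (1/z) * (local_coeff \<eta> (Infty 1) (1/z) - local_coeff \<eta> (Infty 2) (1/z)))) < norm (- (1 * (l1 - l2))) + 1"
    by (intro order_tendstoD(2)[OF tendsto_norm]) auto
  with large have "\<forall>\<^sub>F z in at_infinity. norm (FD z) \<le> (norm (- (1 * (l1 - l2))) + 1) * norm z ^ (N-2)"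
  proof eventually_elim
    case (elim z)
    then have "norm (FD z) = norm z ^ (N-2) * norm (- (infty_u (1/z) * (local_coeff \<eta> (Infty 1) (1/z) - local_coeff \<eta> (Infty 2) (1/z))))"
      using inf[of z] FD(2)[of z] by (simp add: norm_mult norm_power)
    also have "\<dots> \<le> norm z ^ (N-2) * (norm (- (1 * (l1 - l2))) + 1)"
      using elim by (intro mult_left_mono) auto
    finally show ?case by (simp add: mult.commute)
  qed
  then obtain A where A: "\<And>z. A \<le> norm z \<Longrightarrow> norm (FD z) \<le> (norm (- (1 * (l1 - l2))) + 1) * norm z ^ (N-2)"
    unfolding eventually_at_infinity by blast
  \<comment> \<open>The factor 1/2 is there because \<open>D\<close> equals
    \<open>2 * w * \<eta>\<close> once \<open>T\<close> vanishes.\<close>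
  define d where "d k = (deriv ^^ k) FD 0 / fact k / 2" for k
  have FDeq: "FD z = 2 * (\<Sum>m<N-1. d m * z ^ m)" for z
  proof -
    have "{..N-2} = {..<N-1}" using N2 by auto
    then show ?thesis using Liouville_polynomial[OF FD(1), of A _ _ z, OF A] by (simp add: d_def sum_distrib_left)
  qed
  have "\<omega> (Pt z w) - \<omega>' (Pt z w) = (\<Sum>m<N-1. d m * z ^ m) / w" if zw: "w\<^sup>2 = curve_poly z" "z \<notin> ?X" for z w
  proof -
    have w: "w \<noteq> 0" using zw X(2) curve_poly_eq_0[of z] by auto
    have "\<eta> (Pt z w) + \<eta> (Pt z (- w)) = 0" "w * (\<eta> (Pt z w) - \<eta> (Pt z (- w))) = 2 * (\<Sum>m<N-1. d m * z ^ m)"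
      using TD[OF zw(1)] FT(2)[OF zw(2)] FD(2)[OF zw(2)] FT0 FDeq by auto
    moreover from this(1) have B: "\<eta> (Pt z (- w)) = - \<eta> (Pt z w)" by (simp add: eq_neg_iff_add_eq_0 add.commute)
    ultimately have "w * \<eta> (Pt z w) = (\<Sum>m<N-1. d m * z ^ m)" by (simp add: algebra_simps)
    then show ?thesis using w unfolding \<eta>_def by (simp add: field_simps)
  qed
  then show ?thesis by blast
qed

text \<open>The complex coefficients of the difference split into two real polynomials. Gap periods
  are real, so the vanishing of the A-periods separates into two real conditions, and each
  polynomial is zero.\<close>

lemma omega_unique:
  assumes P: "gap_data P p y" and \<omega>: "is_omega \<nu> P \<omega>" "is_omega \<nu> P \<omega>'"
    and form: "\<And>z w. w\<^sup>2 = curve_poly z \<Longrightarrow> z \<notin> of_real ` sing_set p \<Longrightarrow> \<omega>' (Pt z w) = omega_coeff \<nu> p y c z w"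
  shows "\<omega> = \<omega>'"
proof -
  let ?X = "complex_of_real ` sing_set p"
  have X: "finite ?X" by simp
  note adm = sing_set_admissible[OF P]
  obtain d where d: "\<And>z w. w\<^sup>2 = curve_poly z \<Longrightarrow> z \<notin> ?X \<Longrightarrow> \<omega> (Pt z w) - \<omega>' (Pt z w) = (\<Sum>m<N-1. d m * z ^ m) / w"
    using omega_difference[OF P \<omega>] by blast
  define d1 where "d1 m = Re (d m)" for m
  define d2 where "d2 m = Im (d m)" for m
  have dd: "(\<Sum>m<N-1. d m * z ^ m) = rpoly d1 z + \<i> * rpoly d2 z" for z
  proof -
    have "d m = of_real (d1 m) + \<i> * of_real (d2 m)" for m by (simp add: d1_def d2_def complex_eq_iff)
    then show ?thesis by (simp add: rpoly_def sum_distrib_left algebra_simps flip: sum.distrib)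
  qed
  have "gap_period j (rpoly d1) = 0 \<and> gap_period j (rpoly d2) = 0" if j: "j \<in> {1..N-1}" for j
  proof -
    obtain \<gamma> where \<gamma>: "A_cycle j \<gamma>" using A_cycle_exists[OF j] by blast
    \<comment> \<open>\<open>\<alpha>\<close> and \<open>\<beta>\<close> are built from functions
      symmetric under conjugation, as \<open>A_cycle_integral\<close> requires; off the real axis
      the differential is \<open>\<alpha>\<close> plus i times \<open>\<beta>\<close>.\<close>
    define \<alpha> where "\<alpha> = (\<lambda>Q. case Q of Pt z w \<Rightarrow> omega_coeff \<nu> p y c z w + rpoly d1 z / w | Infty n \<Rightarrow> 0)"
    define \<beta> where "\<beta> = (\<lambda>Q. case Q of Pt z w \<Rightarrow> (0::complex) + rpoly d2 z / w | Infty n \<Rightarrow> 0)"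
    have c0: "gap_period j (\<lambda>z. odd_part \<nu> p y z + rpoly c z) = 0"
    proof -
      have "curve_integral \<omega>' \<gamma> = 0" using \<omega>(2) j \<gamma> unfolding is_omega_def by blast
      moreover have "\<omega>' (Pt z w) = even_part p z + (odd_part \<nu> p y z + rpoly c z) / w" if "Im z \<noteq> 0" "w\<^sup>2 = curve_poly z" for z w
      proof -
        have "z \<notin> ?X" using that(1) by auto
        then show ?thesis using form[OF that(2)] by (simp add: omega_coeff_def)
      qed
      from integral_unique[OF A_cycle_integral[OF adm real_fun_even_part real_fun_add[OF real_fun_odd_part rpoly_real_fun] this j \<gamma>]]
      have "curve_integral \<omega>' \<gamma> = 2 * of_real (gap_period j (\<lambda>z. odd_part \<nu> p y z + rpoly c z))"
        unfolding even_part_A_period[OF P j] curve_integral_def by simp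
      ultimately show ?thesis by simp
    qed
    have "\<alpha> (Pt z w) = even_part p z + ((odd_part \<nu> p y z + rpoly c z) + rpoly d1 z) / w" for z w
      by (simp add: \<alpha>_def omega_coeff_def add_divide_distrib)
    from A_cycle_integral[OF adm real_fun_even_part real_fun_add[OF real_fun_add[OF real_fun_odd_part rpoly_real_fun] rpoly_real_fun] this j \<gamma>]
    have I1: "((\<lambda>t. \<alpha> (\<gamma> t) * vector_derivative (zc \<circ> \<gamma>) (at t within {0..1})) has_integral 2 * of_real (gap_period j (rpoly d1))) {0..1}"
      using gap_period_add[OF adm real_fun_add[OF real_fun_odd_part rpoly_real_fun] rpoly_real_fun[of _ d1] j] c0
      unfolding even_part_A_period[OF P j] by simp
    have "\<beta> (Pt z w) = of_real 0 + rpoly d2 z / w" for z w by (simp add: \<beta>_def)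
    from A_cycle_integral[OF adm real_fun_const[of _ 0] rpoly_real_fun this j \<gamma>]
    have I2: "((\<lambda>t. \<beta> (\<gamma> t) * vector_derivative (zc \<circ> \<gamma>) (at t within {0..1})) has_integral 2 * of_real (gap_period j (rpoly d2))) {0..1}"
      by (simp add: arc_integral_def)
    obtain s where cl: "closed_curve \<gamma>" and s: "0 < s" "s < 1"
      and up: "\<And>t. 0 < t \<Longrightarrow> t < s \<Longrightarrow> Im (zc (\<gamma> t)) > 0"
      and lo: "\<And>t. s < t \<Longrightarrow> t < 1 \<Longrightarrow> Im (zc (\<gamma> t)) < 0"
      using \<gamma> unfolding A_cycle_def by auto
    have "((\<lambda>t. \<omega> (\<gamma> t) * vector_derivative (zc \<circ> \<gamma>) (at t within {0..1})) has_integral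
       (2 * of_real (gap_period j (rpoly d1)) + \<i> * (2 * of_real (gap_period j (rpoly d2))))) {0..1}"
    proof (rule has_integral_spike_finite[of "{0, s, 1}"])
      show "((\<lambda>t. \<alpha> (\<gamma> t) * vector_derivative (zc \<circ> \<gamma>) (at t within {0..1}) + \<i> * (\<beta> (\<gamma> t) * vector_derivative (zc \<circ> \<gamma>) (at t within {0..1})))
        has_integral (2 * of_real (gap_period j (rpoly d1)) + \<i> * (2 * of_real (gap_period j (rpoly d2))))) {0..1}"
        by (intro has_integral_add has_integral_mult_right I1 I2)
      fix t assume t: "t \<in> {0..1} - {0, s, 1}"
      then have "\<gamma> t \<in> affine_part" using cl by (force simp: closed_curve_def)
      then obtain z w where zw: "\<gamma> t = Pt z w" "w\<^sup>2 = curve_poly z" by (auto simp: affine_part_def)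
      have "Im z \<noteq> 0" using t up[of t] lo[of t] zw by (cases "t < s") auto
      then have "z \<notin> ?X" by auto
      with form[OF zw(2)] d[OF zw(2)] have "\<omega> (\<gamma> t) = \<alpha> (\<gamma> t) + \<i> * \<beta> (\<gamma> t)"
        by (simp add: zw(1) \<alpha>_def \<beta>_def dd add_divide_distrib algebra_simps)
      then show "\<omega> (\<gamma> t) * vector_derivative (zc \<circ> \<gamma>) (at t within {0..1}) =
         \<alpha> (\<gamma> t) * vector_derivative (zc \<circ> \<gamma>) (at t within {0..1}) + \<i> * (\<beta> (\<gamma> t) * vector_derivative (zc \<circ> \<gamma>) (at t within {0..1}))"
        by (simp add: algebra_simps)
    qed simp
    then have "curve_integral \<omega> \<gamma> = 2 * of_real (gap_period j (rpoly d1)) + \<i> * (2 * of_real (gap_period j (rpoly d2)))"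
      unfolding curve_integral_def by (rule integral_unique)
    moreover have "curve_integral \<omega> \<gamma> = 0" using \<omega>(1) j \<gamma> unfolding is_omega_def by blast
    ultimately show ?thesis by (simp add: complex_eq_iff)
  qed
  then have "\<forall>m<N-1. d1 m = 0" "\<forall>m<N-1. d2 m = 0" using gap_period_rpoly_eq_0 by blast+
  then have d0: "(\<Sum>m<N-1. d m * z ^ m) = 0" for z unfolding dd by (simp add: rpoly_def)
  have eq: "\<omega> (Pt z w) = \<omega>' (Pt z w)" if "w\<^sup>2 = curve_poly z" "z \<notin> ?X" for z w
    using d[OF that] d0 by simp
  have m: "local_coeff \<omega> Q nicely_meromorphic_on {0}" if "Q \<in> surface" "is_omega \<nu> P \<omega>" for Q \<omega>
    using that unfolding is_omega_def meromorphic_differential_def by blast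
  show ?thesis
  proof
    fix Q
    show "\<omega> Q = \<omega>' Q"
    proof (cases "Q \<in> surface")
      case False
      then show ?thesis using \<omega> unfolding is_omega_def meromorphic_differential_def by simp
    next
      case True
      have ev: "\<forall>\<^sub>F t in at 0. local_coeff \<omega> Q t = local_coeff \<omega>' Q t"
        using eventually_local_ordinary[OF True X]
        by eventually_elim (auto simp: local_coeff_def eq simp del: local_w.simps local_z.simps)
      have pole: "is_pole (local_coeff \<omega> Q) 0 \<longleftrightarrow> is_pole (local_coeff \<omega>' Q) 0" by (rule is_pole_cong[OF ev refl])
      have n: "(is_pole (local_coeff \<omega>'' Q) 0 \<and> local_coeff \<omega>'' Q 0 = 0) \<or> (local_coeff \<omega>'' Q \<longlongrightarrow> local_coeff \<omega>'' Q 0) (at 0)"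
        if "is_omega \<nu> P \<omega>''" for \<omega>''
        using m[OF True that] unfolding nicely_meromorphic_on_def by blast
      have np: "\<not> is_pole (local_coeff \<omega>'' Q) 0" if "(local_coeff \<omega>'' Q \<longlongrightarrow> l) (at 0)" for \<omega>'' l
        using that not_tendsto_and_filterlim_at_infinity[OF at_neq_bot] unfolding is_pole_def by blast
      \<comment> \<open>Both functions agree near \<open>Q\<close>, so they have a pole together.
        The value is then 0 for both, and otherwise it is the common limit.\<close>
      have "local_coeff \<omega> Q 0 = local_coeff \<omega>' Q 0"
      proof (cases "is_pole (local_coeff \<omega> Q) 0")
        case True
        then show ?thesis using n[OF \<omega>(1)] n[OF \<omega>(2)] np pole by metis
      next
        case False
        then have "(local_coeff \<omega> Q \<longlongrightarrow> local_coeff \<omega> Q 0) (at 0)" "(local_coeff \<omega>' Q \<longlongrightarrow> local_coeff \<omega>' Q 0) (at 0)"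
          using n[OF \<omega>(1)] n[OF \<omega>(2)] pole by blast+
        then show ?thesis using Lim_transform_eventually[OF _ ev] tendsto_unique[of "at (0::complex)"] by (metis at_neq_bot)
      qed
      then show ?thesis by (simp add: local_coeff_def)
    qed
  qed
qed

lemma omega_form:
  assumes P: "gap_data P p y" and \<nu>: "\<nu> \<in> {1,2}"
    and c: "\<And>j. j \<in> {1..N-1} \<Longrightarrow> gap_period j (rpoly c) = - gap_period j (odd_part \<nu> p y)"
  shows "is_omega \<nu> P (omega \<nu> P)"
    "w\<^sup>2 = curve_poly z \<Longrightarrow> z \<notin> of_real ` sing_set p \<Longrightarrow> omega \<nu> P (Pt z w) = omega_coeff \<nu> p y c z w"
proof -
  obtain \<omega> where \<omega>: "is_omega \<nu> P \<omega>"
    "\<And>z w. w\<^sup>2 = curve_poly z \<Longrightarrow> z \<notin> of_real ` sing_set p \<Longrightarrow> \<omega> (Pt z w) = omega_coeff \<nu> p y c z w"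
    using omega_exists[OF P \<nu> c] by blast
  have "omega \<nu> P = \<omega>"
    unfolding omega_def
  proof (rule the_equality)
    show "\<omega>' = \<omega>" if "is_omega \<nu> P \<omega>'" for \<omega>'
      by (rule omega_unique[OF P that \<omega>(1)]) (rule \<omega>(2))
  qed (rule \<omega>(1))
  with \<omega> show "is_omega \<nu> P (omega \<nu> P)"
    "w\<^sup>2 = curve_poly z \<Longrightarrow> z \<notin> of_real ` sing_set p \<Longrightarrow> omega \<nu> P (Pt z w) = omega_coeff \<nu> p y c z w" by auto
qed

end

section \<open>The periods over the cycles around the cuts\<close>

lemma winding_number_circlepath_outside:
  assumes "R > 0" "norm (z - c) > R"
  shows "winding_number (circlepath c R) z = 0"
  by (rule winding_number_zero_outside[of _ "cball c R"])
     (use assms in \<open>auto simp: path_image_circlepath dist_norm norm_minus_commute\<close>)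

context gap_surface
begin

section \<open>The domain of the B-cycles\<close>

definition base_point :: real where "base_point = a 1 - 1"

text \<open>The complement is the segment from \<open>a 1\<close> to \<open>b k\<close> and the ray
  from \<open>a (k + 1)\<close> to the right, so one winding number, around the segment, describes a
  loop up to homology.\<close>

definition ring_domain :: "nat \<Rightarrow> complex set" where
  "ring_domain k = {z. Im z = 0 \<longrightarrow> Re z < a 1 \<or> b k < Re z \<and> Re z < a (k + 1)}"

lemma a1_le: "k \<in> {1..N} \<Longrightarrow> a 1 \<le> a k"
  using a_less_iff[of k 1] by (auto simp: not_less[symmetric])

lemma a1_less_b: "k \<in> {1..N-1} \<Longrightarrow> a 1 < b k"
  using a1_le[OF gap_index(1)[of k]] ab[OF gap_index(1)[of k]] by linarith

lemma open_ring_domain: "open (ring_domain k)"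
proof -
  have "ring_domain k = - ({z. Im z = 0} \<inter> {z. Re z \<ge> a 1} \<inter> ({z. Re z \<le> b k} \<union> {z. Re z \<ge> a (k + 1)}))"
    by (auto simp: ring_domain_def)
  then show ?thesis
    by (simp only:) (intro open_Compl closed_Int closed_Un closed_halfspace_Re_ge closed_halfspace_Re_le, auto intro!: closed_Collect_eq continuous_intros)
qed

text \<open>Union of two starlike sets, with centres in the gap and left of \<open>a 1\<close>, that
  both contain \<i>.\<close>

lemma connected_ring_domain:
  assumes k: "k \<in> {1..N-1}"
  shows "connected (ring_domain k)"
proof -
  define g where "g = complex_of_real (gap_mid k)"
  define l where "l = complex_of_real (a 1 - 1)"
  have gm: "b k < gap_mid k" "gap_mid k < a (k + 1)" using gap_pos[OF k] by (auto simp: gap_mid_def)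
  let ?A = "{z. Im z = 0 \<longrightarrow> b k < Re z \<and> Re z < a (k + 1)}" and ?B = "{z. Im z = 0 \<longrightarrow> Re z < a 1}"
  have sA: "closed_segment g z \<subseteq> ?A" if "z \<in> ?A" for z
  proof
    fix u assume "u \<in> closed_segment g z"
    then obtain t where t: "0 \<le> t" "t \<le> 1" and u: "u = (1 - t) *\<^sub>R g + t *\<^sub>R z" by (auto simp: in_segment)
    have Im: "Im u = t * Im z" and Re: "Re u = (1 - t) * gap_mid k + t * Re z" by (simp_all add: u g_def)
    show "u \<in> ?A"
    proof (cases "t = 0 \<or> Im z \<noteq> 0")
      case True then show ?thesis using gm by (auto simp: Im Re)
    next
      case False
      then have "b k < Re z" "Re z < a (k+1)" using that by auto
      then have "(1 - t) *\<^sub>R gap_mid k + t *\<^sub>R Re z \<in> {b k<..<a (k+1)}"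
        using gm t by (intro convexD_alt) auto
      then show ?thesis using Re by auto
    qed
  qed
  have sB: "closed_segment l z \<subseteq> ?B" if "z \<in> ?B" for z
  proof
    fix u assume "u \<in> closed_segment l z"
    then obtain t where t: "0 \<le> t" "t \<le> 1" and u: "u = (1 - t) *\<^sub>R l + t *\<^sub>R z" by (auto simp: in_segment)
    have Im: "Im u = t * Im z" and Re: "Re u = (1 - t) * (a 1 - 1) + t * Re z" by (simp_all add: u l_def)
    show "u \<in> ?B"
    proof (cases "t = 0 \<or> Im z \<noteq> 0")
      case True then show ?thesis by (auto simp: Im Re)
    next
      case False
      then have "Re z < a 1" using that by auto
      then have "(1 - t) *\<^sub>R (a 1 - 1) + t *\<^sub>R Re z \<in> {..<a 1}"
        using t by (intro convexD_alt) auto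
      then show ?thesis using Re by auto
    qed
  qed
  have "g \<in> ?A" "l \<in> ?B" using gm by (auto simp: g_def l_def)
  then have "starlike ?A" "starlike ?B" unfolding starlike_def using sA sB by blast+
  then have "connected ?A" "connected ?B" by (auto intro: starlike_imp_connected)
  moreover have "\<i> \<in> ?A \<inter> ?B" by simp
  ultimately have "connected (?A \<union> ?B)" by (intro connected_Un) blast+
  moreover have "ring_domain k = ?A \<union> ?B" by (auto simp: ring_domain_def)
  ultimately show ?thesis by simp
qed

lemma ring_domain_not_cuts:
  assumes k: "k \<in> {1..N-1}" "z \<in> ring_domain k"
  shows "z \<notin> cuts"
  unfolding not_cuts_iff
proof (intro ballI notI)
  fix i assume i: "i \<in> {1..N}" and "Im z = 0 \<and> a i \<le> Re z \<and> Re z \<le> b i"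
  then consider "Re z < a 1" "a i \<le> Re z" | "b k < Re z" "Re z < a (k+1)" "a i \<le> Re z" "Re z \<le> b i"
    using k(2) by (auto simp: ring_domain_def)
  then show False
  proof cases
    case 1 then show False using a1_le[OF i] by linarith
  next
    case 2
    then show False using gap_sides(2)[OF k(1), of "b k" i] gap_sides(3)[OF k(1), of "a (k+1)" i] i gap_pos[OF k(1)]
      by (cases "i \<le> k") auto
  qed
qed

lemma gap_sing_set:
  assumes P: "gap_data P p y" and k: "k \<in> {1..N-1}" and x: "b k < x" "x < a (k + 1)" and "x \<in> sing_set p"
  shows "x = p k"
proof -
  have "x \<notin> ends" using gap_not_ends[OF k x] .
  then obtain j where j: "j \<in> {1..N-1}" "x = p j" using assms(5) by (auto simp: sing_set_def)
  then have pj: "b j \<le> x" "x \<le> a (j+1)" using P by (auto simp: gap_data_def)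
  consider "j < k" | "j = k" | "k < j" by linarith
  then show ?thesis
  proof cases
    case 1
    then have "a (j+1) \<le> a k" using a_less_iff[OF gap_index(1)[OF k] gap_index(2)[OF j(1)]] by simp
    then show ?thesis using pj x ab[OF gap_index(1)[OF k]] by linarith
  next
    case 3
    then have "b (k+1) \<le> b j" using b_less_iff[OF gap_index(1)[OF j(1)] gap_index(2)[OF k]] by simp
    then show ?thesis using pj x ab[OF gap_index(2)[OF k]] by linarith
  qed (use j in simp)
qed

lemma ring_domain_sing:
  assumes P: "gap_data P p y" and k: "k \<in> {1..N-1}" and z: "z \<in> ring_domain k" "z \<in> of_real ` sing_set p"
  shows "z = of_real (p k)"
proof -
  obtain x where x: "x \<in> sing_set p" "z = of_real x" using z by auto
  have "\<not> x < a 1" using admissible_left[OF sing_set_admissible[OF P]] x(1) by blast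
  then show ?thesis using gap_sing_set[OF P k _ _ x(1)] z(1) x(2) by (auto simp: ring_domain_def)
qed

text \<open>By continuity the quotient of neighbouring values of the root has positive real part, so
  the principal root in \<open>ord_w\<close> selects the same branch.\<close>

lemma root_branch_local:
  assumes "z \<notin> cuts"
  shows "\<forall>\<^sub>F t in at 0. ord_w z (root_branch z) t = root_branch (z + t)"
proof -
  have nz: "root_branch z \<noteq> 0" using root_branch_nz[OF assms] .
  have "isCont root_branch z"
    using root_branch_holomorphic closed_cuts assms
    by (metis Compl_iff continuous_on_eq_continuous_at holomorphic_on_imp_continuous_on open_Compl)
  then have "(root_branch \<longlongrightarrow> root_branch z) (at z)" by (simp add: isCont_def)
  then have "((\<lambda>t. root_branch (z + t)) \<longlongrightarrow> root_branch z) (at 0)"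
    by (subst (asm) LIM_offset_zero_iff) auto
  then have "((\<lambda>t. Re (root_branch (z + t) / root_branch z)) \<longlongrightarrow> Re (root_branch z / root_branch z)) (at 0)"
    using nz by (intro tendsto_intros)
  then have "\<forall>\<^sub>F t in at 0. Re (root_branch (z + t) / root_branch z) > 0"
    by (rule order_tendstoD(1)) (simp add: nz)
  then show ?thesis
  proof eventually_elim
    case (elim t)
    then have "csqrt ((root_branch (z + t) / root_branch z)\<^sup>2) = root_branch (z + t) / root_branch z"
      by (intro csqrt_unique) auto
    then show ?case using nz by (simp add: ord_w_def power_divide root_branch_sq)
  qed
qed

text \<open>On the first sheet the only possible pole over the domain is at \<open>p k\<close>. Its
  residue \<open>\<rho>\<close> is 1 or 0 according to the sheet of \<open>P k\<close>; integrality
  of this residue is why periods make sense modulo integers.\<close>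

lemma sheet_one_function:
  assumes P: "gap_data P p y" and \<nu>: "\<nu> \<in> {1,2}" and k: "k \<in> {1..N-1}"
    and c: "\<And>j. j \<in> {1..N-1} \<Longrightarrow> gap_period j (rpoly c) = - gap_period j (odd_part \<nu> p y)"
  obtains Fh and \<rho> :: nat where "Fh holomorphic_on ring_domain k"
    "\<And>z. z \<in> ring_domain k \<Longrightarrow> z \<noteq> of_real (p k) \<or> \<rho> = 0 \<Longrightarrow>
       omega \<nu> P (Pt z (root_branch z)) = Fh z + of_nat \<rho> / (z - of_real (p k))"
    "\<rho> = 0 \<or> P k = Pt (of_real (p k)) (root_branch (of_real (p k)))"
proof -
  let ?A = "ring_domain k" and ?X = "complex_of_real ` sing_set p" and ?p = "complex_of_real (p k)"
  let ?F = "\<lambda>z. omega \<nu> P (Pt z (root_branch z))"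
  note om = omega_form[OF P \<nu> c]
  have rh: "root_branch holomorphic_on ?A"
    using ring_domain_not_cuts[OF k] by (intro holomorphic_on_subset[OF root_branch_holomorphic]) auto
  have rnz: "root_branch z \<noteq> 0" if "z \<in> ?A" for z using root_branch_nz ring_domain_not_cuts[OF k that] by blast
  define \<rho> :: nat where "\<rho> = (if ?p \<in> ?A \<and> of_real (y k) = root_branch ?p then 1 else 0)"
  \<comment> \<open>With the residue subtracted in advance, the numerator vanishes at the pole and
    \<open>nq\<close> is holomorphic.\<close>
  define n where "n z = 1/2 + of_real (y k / 2) / root_branch z - of_nat \<rho>" for z
  have nh: "n holomorphic_on ?A" unfolding n_def using rnz by (intro holomorphic_intros rh) auto
  have yk: "(complex_of_real (y k))\<^sup>2 = curve_poly ?p"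
    using P k by (auto simp: gap_data_def curve_poly_of_real simp flip: of_real_power)
  have n0: "n ?p = 0" if "?p \<in> ?A"
  proof -
    have "of_real (y k) = root_branch ?p \<or> of_real (y k) = - root_branch ?p" using surface_w_cases[OF yk] .
    then show ?thesis using rnz[OF that] that by (auto simp: n_def \<rho>_def)
  qed
  define nq where "nq z = (if z = ?p then deriv n ?p else (n z - n ?p) / (z - ?p))" for z
  have nqh: "nq holomorphic_on ?A" unfolding nq_def by (rule pole_lemma_open[OF nh open_ring_domain])
  have nq: "n z / (z - ?p) = (if ?p \<in> ?A then nq z else n z / (z - ?p))" if "z \<noteq> ?p" for z
    using n0 that by (simp add: nq_def)
  define rest where "rest z = (\<Sum>j\<in>{1..N-1}-{k}. of_real (1/2) * (1 / (z - of_real (p j)))) + (\<Sum>e\<in>ends. of_real (-1/4) * (1 / (z - of_real e)))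
     + (of_real (nu_sign \<nu> / 2) * z ^ (N-1) + (\<Sum>j\<in>{1..N-1}-{k}. of_real (y j / 2) * (1 / (z - of_real (p j)))) + rpoly c z) / root_branch z" for z
  have nsing: "z \<noteq> of_real e" if "z \<in> ?A" "e \<in> ends" for z e
  proof
    assume "z = of_real e"
    then have "z \<in> branch_values" using that by (auto simp: branch_values_ends)
    then show False using branch_values_cuts ring_domain_not_cuts[OF k that(1)] by blast
  qed
  have nsing': "z \<noteq> of_real (p j)" if "z \<in> ?A" "j \<in> {1..N-1} - {k}" for z j
  proof
    assume zj: "z = of_real (p j)"
    then have "p j = p k" using ring_domain_sing[OF P k that(1)] that(2) by (auto simp: sing_set_def)
    moreover have "b k \<le> p k" "p k \<le> a (k+1)" using P k unfolding gap_data_def by blast+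
    moreover from this have "p j \<in> {i \<in> UNIV. cut_left k < i \<and> i < cut_right k}"
      using calculation(1) cut_left_right[OF k] by auto
    ultimately have "j \<in> {i \<in> {1..N-1}. cut_left k < p i \<and> p i < cut_right k}" using that(2) by auto
    then show False unfolding gap_data_between(1)[OF P k] using that(2) by auto
  qed
  have resth: "rest holomorphic_on ?A"
    unfolding rest_def using nsing nsing' rnz
    by (intro holomorphic_intros rh rpoly_holomorphic) auto
  define Fh where "Fh z = rest z + (if ?p \<in> ?A then nq z else n z / (z - ?p))" for z
  have Fhh: "Fh holomorphic_on ?A"
    unfolding Fh_def using nqh nh resth by (cases "?p \<in> ?A") (auto intro!: holomorphic_intros)
  have val: "?F z = Fh z + of_nat \<rho> / (z - ?p)" if z: "z \<in> ?A" "z \<noteq> ?p" for z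
  proof -
    have "z \<notin> ?X" using ring_domain_sing[OF P k z(1)] z(2) by blast
    then have "?F z = omega_coeff \<nu> p y c z (root_branch z)" by (intro om(2)) (auto simp: root_branch_sq)
    also have "\<dots> = rest z + n z / (z - ?p) + of_nat \<rho> / (z - ?p)"
    proof -
      have s: "(\<Sum>j\<in>{1..N-1}. f j) = f k + (\<Sum>j\<in>{1..N-1}-{k}. f j)" for f :: "nat \<Rightarrow> complex"
        using k by (intro sum.remove) auto
      have "n z / (z - ?p) + of_nat \<rho> / (z - ?p) = of_real (1/2) * (1 / (z - ?p)) + of_real (y k / 2) * (1 / (z - ?p)) / root_branch z"
        by (simp add: n_def add_divide_distrib diff_divide_distrib mult.commute)
      then show ?thesis
        unfolding omega_coeff_def even_part_def odd_part_def s rest_def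
        by (simp add: add_divide_distrib)
    qed
    finally show ?thesis using nq[OF z(2)] by (simp add: Fh_def)
  qed
  \<comment> \<open>The explicit formula omits \<open>z = p k\<close>. If \<open>P k\<close> is not
    the first-sheet point over it, holomorphy of the differential supplies the missing value as a
    limit.\<close>
  have val': "?F ?p = Fh ?p" if p: "?p \<in> ?A" "\<rho> = 0"
  proof -
    let ?Q = "Pt ?p (root_branch ?p)"
    have nc: "?p \<notin> cuts" using ring_domain_not_cuts[OF k p(1)] .
    have w: "(root_branch ?p)\<^sup>2 = curve_poly ?p" "root_branch ?p \<noteq> 0" using root_branch_sq root_branch_nz[OF nc] by auto
    have "?Q \<noteq> P j" if "j \<in> {1..N-1}" for j
    proof (cases "j = k")
      case True
      then show ?thesis using p P k by (auto simp: \<rho>_def gap_data_def)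
    next
      case False
      then show ?thesis using nsing'[OF p(1), of j] that P by (auto simp: gap_data_def)
    qed
    then have "?Q \<notin> P ` {1..N-1}" by blast
    then have "?Q \<in> surface - (branch_points \<union> P ` {1..N-1} \<union> {Infty (3 - \<nu>)})"
      using w by (auto simp: surface_Pt_iff branch_points_def)
    then have "holomorphic_at (omega \<nu> P) ?Q" using om(1) unfolding is_omega_def by blast
    then have "isCont (local_coeff (omega \<nu> P) ?Q) 0"
      unfolding holomorphic_at_def by (rule analytic_at_imp_isCont)
    then have l1: "(local_coeff (omega \<nu> P) ?Q \<longlongrightarrow> ?F ?p) (at 0)" by (simp add: isCont_def local_coeff_def)
    have "\<forall>\<^sub>F t in at 0. t \<in> (\<lambda>z. z - ?p) ` ?A"
      by (rule eventually_at_in_open') (use p open_ring_domain[of k] in \<open>auto intro!: open_translation_subtract image_eqI[of _ _ ?p]\<close>)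
    moreover have "\<forall>\<^sub>F t in at 0. t \<noteq> (0::complex)" by (auto simp: eventually_at_filter)
    ultimately have "\<forall>\<^sub>F t in at 0. local_coeff (omega \<nu> P) ?Q t = Fh (?p + t)"
      using root_branch_local[OF nc]
    proof eventually_elim
      case (elim t)
      then have "?p + t \<in> ?A" by auto
      then show ?case
        using elim val[of "?p + t"] p(2) local_w_ord[OF w(2), of ?p]
        using w(2) by (simp add: local_coeff_def local_par_def deriv_local_z_Pt del: local_w.simps)
    qed
    then have "((\<lambda>t. Fh (?p + t)) \<longlongrightarrow> ?F ?p) (at 0)" by (rule Lim_transform_eventually[OF l1])
    then have "(Fh \<longlongrightarrow> ?F ?p) (at ?p)" by (subst LIM_offset_zero_iff) auto
    moreover have "(Fh \<longlongrightarrow> Fh ?p) (at ?p)"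
      using Fhh open_ring_domain p(1)
      by (metis continuous_on_eq_continuous_at holomorphic_on_imp_continuous_on isContD)
    ultimately show ?thesis using tendsto_unique[OF at_neq_bot] by blast
  qed
  show ?thesis
  proof (rule that[OF Fhh, of \<rho>])
    show "?F z = Fh z + of_nat \<rho> / (z - ?p)" if "z \<in> ?A" "z \<noteq> ?p \<or> \<rho> = 0" for z
      using val[OF that(1)] val' that by (cases "z = ?p") auto
    show "\<rho> = 0 \<or> P k = Pt ?p (root_branch ?p)" using P k by (auto simp: \<rho>_def gap_data_def)
  qed
qed

text \<open>A pole with integer residue adds 2 pi i times an integer, whatever the winding number
  around it.\<close>

lemma ring_cycle_integral:
  assumes Fh: "Fh holomorphic_on ring_domain k" and F: "\<And>z. z \<in> ring_domain k \<Longrightarrow> z \<noteq> q \<or> \<rho> = 0 \<Longrightarrow> F z = Fh z + of_nat \<rho> / (z - q)"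
    and g: "valid_path g" "pathfinish g = pathstart g" "path_image g \<subseteq> ring_domain k" "\<rho> = 0 \<or> q \<notin> path_image g"
  shows "\<exists>n::int. (F has_contour_integral (contour_integral g Fh + 2 * of_real pi * \<i> * of_int n)) g"
proof -
  have int: "Fh contour_integrable_on g"
    using contour_integrable_holomorphic_simple[OF Fh open_ring_domain g(1,3)] .
  have "\<exists>n::int. ((\<lambda>z. of_nat \<rho> / (z - q)) has_contour_integral (2 * of_real pi * \<i> * of_int n)) g"
  proof (cases "\<rho> = 0")
    case True
    then show ?thesis by (intro exI[of _ 0]) (simp add: has_contour_integral_0)
  next
    case False
    then have q: "q \<notin> path_image g" using g by simp
    have "winding_number g q \<in> \<int>" using integer_winding_number g q valid_path_imp_path by blast
    then obtain n :: int where n: "winding_number g q = of_int n" by (auto elim: Ints_cases)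
    have "((\<lambda>z. of_nat \<rho> * (1 / (z - q))) has_contour_integral of_nat \<rho> * (2 * of_real pi * \<i> * winding_number g q)) g"
      using has_contour_integral_winding_number[OF g(1) q] by (intro has_contour_integral_lmul) simp
    then show ?thesis by (intro exI[of _ "int \<rho> * n"]) (simp add: n mult_ac)
  qed
  then obtain n :: int where n: "((\<lambda>z. of_nat \<rho> / (z - q)) has_contour_integral (2 * of_real pi * \<i> * of_int n)) g" by blast
  have "((\<lambda>z. Fh z + of_nat \<rho> / (z - q)) has_contour_integral (contour_integral g Fh + 2 * of_real pi * \<i> * of_int n)) g"
    by (intro has_contour_integral_add has_contour_integral_integral int n)
  then have "(F has_contour_integral (contour_integral g Fh + 2 * of_real pi * \<i> * of_int n)) g"
    by (rule has_contour_integral_eq) (use F g(3,4) in force)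
  then show ?thesis by blast
qed

text \<open>A model B-cycle with prescribed crossing point; it starts at \<open>x\<close> and
  traverses the upper half plane first.\<close>

definition ring_circle :: "real \<Rightarrow> real \<Rightarrow> complex" where
  "ring_circle x = circlepath (of_real ((base_point + x) / 2)) ((x - base_point) / 2)"

lemma ring_circle_eq: "ring_circle x t = Complex ((base_point + x) / 2 + (x - base_point) / 2 * cos (2 * pi * t)) ((x - base_point) / 2 * sin (2 * pi * t))"
  unfolding ring_circle_def circlepath by (simp add: complex_eq_iff Re_exp Im_exp mult.commute)

lemma ring_circle_real:
  assumes x: "base_point < x" and z: "z \<in> path_image (ring_circle x)" "Im z = 0"
  shows "Re z = base_point \<or> Re z = x"
proof -
  let ?R = "(x - base_point) / 2"
  have "norm (z - of_real ((base_point + x) / 2)) = ?R"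
    using z(1) x by (simp add: ring_circle_def path_image_circlepath dist_norm norm_minus_commute)
  moreover have "z - of_real ((base_point + x) / 2) = of_real (Re z - (base_point + x) / 2)" using z(2) by (simp add: complex_eq_iff)
  ultimately have "\<bar>Re z - (base_point + x) / 2\<bar> = ?R" by (metis norm_of_real)
  then show ?thesis by (auto simp: abs_if field_simps split: if_splits)
qed

lemma ring_circle:
  assumes k: "k \<in> {1..N-1}" and x: "b k < x" "x < a (k + 1)"
  shows "base_point < x" "valid_path (ring_circle x)" "pathfinish (ring_circle x) = pathstart (ring_circle x)"
    "path_image (ring_circle x) \<subseteq> ring_domain k"
    "\<And>u. a 1 \<le> u \<Longrightarrow> u \<le> b k \<Longrightarrow> winding_number (ring_circle x) (of_real u) = 1"
    "\<And>u. a (k + 1) \<le> u \<Longrightarrow> winding_number (ring_circle x) (of_real u) = 0"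
proof -
  show bx: "base_point < x" using x a1_less_b[OF k] by (simp add: base_point_def)
  show "valid_path (ring_circle x)" "pathfinish (ring_circle x) = pathstart (ring_circle x)" by (simp_all add: ring_circle_def)
  show "path_image (ring_circle x) \<subseteq> ring_domain k"
  proof
    fix z assume "z \<in> path_image (ring_circle x)"
    then show "z \<in> ring_domain k"
      using ring_circle_real[OF bx, of z] x unfolding ring_domain_def base_point_def by force
  qed
  have n: "norm (of_real u - complex_of_real ((base_point + x) / 2)) = \<bar>u - (base_point + x) / 2\<bar>" for u
    by (metis norm_of_real of_real_diff)
  show "winding_number (ring_circle x) (of_real u) = 1" if "a 1 \<le> u" "u \<le> b k" for u
    unfolding ring_circle_def
    by (rule winding_number_circlepath, subst n) (use that x in \<open>auto simp: base_point_def abs_if field_simps\<close>)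
  show "winding_number (ring_circle x) (of_real u) = 0" if "a (k + 1) \<le> u" for u
    unfolding ring_circle_def
    by (rule winding_number_circlepath_outside, simp add: bx, subst n) (use that x bx in \<open>auto simp: abs_if field_simps\<close>)
qed

text \<open>On the segment both winding numbers are 1. The ray is connected, unbounded and disjoint
  from the loop, so it lies outside and both are 0 there.\<close>

lemma ring_cycle_winding:
  assumes k: "k \<in> {1..N-1}" and g: "valid_path g" "pathfinish g = pathstart g" "path_image g \<subseteq> ring_domain k"
    and w: "\<And>u. a 1 \<le> u \<Longrightarrow> u \<le> b k \<Longrightarrow> winding_number g (of_real u) = 1"
    and x: "b k < x" "x < a (k + 1)" and z: "z \<notin> ring_domain k"
  shows "winding_number g z = winding_number (ring_circle x) z"
proof -
  have Imz: "z = of_real (Re z)" using z by (auto simp: ring_domain_def complex_eq_iff)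
  from z consider "a 1 \<le> Re z" "Re z \<le> b k" | "a (k+1) \<le> Re z"
    using a1_less_b[OF k] gap_pos[OF k] by (auto simp: ring_domain_def not_less)
  then show ?thesis
  proof cases
    case 1
    then show ?thesis using w[of "Re z"] ring_circle(5)[OF k x, of "Re z"] Imz by simp
  next
    case 2
    define Ray where "Ray = {u::complex. Im u = 0} \<inter> {u. Re u \<ge> a (k + 1)}"
    have "connected Ray" unfolding Ray_def
      by (intro convex_connected convex_Int convex_halfspace_Re_ge) (simp add: convex_def)
    have disj: "Ray \<subseteq> - path_image g"
      using g(3) gap_pos[OF k] a1_less_b[OF k] by (fastforce simp: Ray_def ring_domain_def)
    have zR: "z \<in> Ray" using 2 Imz by (auto simp: Ray_def complex_eq_iff)
    have "\<not> bounded Ray"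
    proof
      assume "bounded Ray"
      then obtain B where B: "\<And>u. u \<in> Ray \<Longrightarrow> norm u \<le> B" by (auto simp: bounded_iff)
      have "of_real (max (a (k+1)) (\<bar>B\<bar> + 1)) \<in> Ray" by (auto simp: Ray_def)
      from B[OF this] show False unfolding norm_of_real by linarith
    qed
    moreover have "Ray \<subseteq> connected_component_set (- path_image g) z"
      using zR disj \<open>connected Ray\<close> by (intro connected_component_maximal) auto
    ultimately have "\<not> bounded (connected_component_set (- path_image g) z)" using bounded_subset by blast
    then have "z \<in> outside (path_image g)" using disj zR by (auto simp: outside_def)
    then have "winding_number g z = 0"
      using g valid_path_imp_path by (intro winding_number_zero_in_outside) auto
    then show ?thesis using ring_circle(6)[OF k x 2] Imz by simp
  qed
qed

lemma B_cycle_props: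
  assumes k: "k \<in> {1..N-1}" and \<gamma>: "B_cycle k \<gamma>"
  shows "valid_path (zc \<circ> \<gamma>)" "pathfinish (zc \<circ> \<gamma>) = pathstart (zc \<circ> \<gamma>)" "path_image (zc \<circ> \<gamma>) \<subseteq> ring_domain k"
    "t \<in> {0..1} \<Longrightarrow> \<gamma> t = Pt (zc (\<gamma> t)) (root_branch (zc (\<gamma> t)))"
proof -
  have cl: "closed_curve \<gamma>" and sh: "\<gamma> ` {0..1} \<subseteq> sheet 1"
    and re: "path_image (zc \<circ> \<gamma>) \<inter> \<real> \<subseteq> of_real ` ({..<a 1} \<union> {b k<..<a (k + 1)})"
    using \<gamma> unfolding B_cycle_def by auto
  show "valid_path (zc \<circ> \<gamma>)" "pathfinish (zc \<circ> \<gamma>) = pathstart (zc \<circ> \<gamma>)"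
    using cl by (auto simp: closed_curve_def pathfinish_def pathstart_def)
  show "path_image (zc \<circ> \<gamma>) \<subseteq> ring_domain k"
  proof
    fix z assume z: "z \<in> path_image (zc \<circ> \<gamma>)"
    show "z \<in> ring_domain k"
    proof (cases "Im z = 0")
      case True
      then have "z \<in> \<real>" by (simp add: complex_is_Real_iff)
      then show ?thesis using re z by (auto simp: ring_domain_def)
    qed (simp add: ring_domain_def)
  qed
  assume t: "t \<in> {0..1}"
  then have "\<gamma> t \<in> sheet 1" "\<gamma> t \<in> affine_part" using sh cl by (force simp: closed_curve_def)+
  then show "\<gamma> t = Pt (zc (\<gamma> t)) (root_branch (zc (\<gamma> t)))"
    by (auto simp: sheet_def sheet_sign_def affine_part_def)
qed

text \<open>The holomorphic part \<open>Fh\<close> has equal integrals over homologous loops, and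
  the pole changes each integral by an integer multiple of 2 pi i only.\<close>

lemma B_period_mod_int:
  assumes P: "gap_data P p y" and \<nu>: "\<nu> \<in> {1,2}" and k: "k \<in> {1..N-1}"
    and c: "\<And>j. j \<in> {1..N-1} \<Longrightarrow> gap_period j (rpoly c) = - gap_period j (odd_part \<nu> p y)"
    and x: "b k < x" "x < a (k + 1)" "x \<noteq> p k"
    and \<gamma>: "B_cycle k \<gamma>" "P k \<notin> \<gamma> ` {0..1}"
  shows "\<exists>n::int. curve_integral (omega \<nu> P) \<gamma> =
     contour_integral (ring_circle x) (\<lambda>z. omega \<nu> P (Pt z (root_branch z))) + 2 * of_real pi * \<i> * of_int n"
proof -
  let ?F = "\<lambda>z. omega \<nu> P (Pt z (root_branch z))"
  let ?g = "zc \<circ> \<gamma>"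
  note B = B_cycle_props[OF k \<gamma>(1)]
  note C = ring_circle[OF k x(1,2)]
  obtain Fh and \<rho> :: nat where Fh: "Fh holomorphic_on ring_domain k"
    "\<And>z. z \<in> ring_domain k \<Longrightarrow> z \<noteq> of_real (p k) \<or> \<rho> = 0 \<Longrightarrow> ?F z = Fh z + of_nat \<rho> / (z - of_real (p k))"
    and \<rho>: "\<rho> = 0 \<or> P k = Pt (of_real (p k)) (root_branch (of_real (p k)))"
    using sheet_one_function[OF P \<nu> k c] by blast
  have g4: "\<rho> = 0 \<or> of_real (p k) \<notin> path_image ?g"
    using \<rho> \<gamma>(2) B(4) by (force simp: path_image_def)
  have pk: "b k \<le> p k" using P k unfolding gap_data_def by blast
  have C4: "\<rho> = 0 \<or> of_real (p k) \<notin> path_image (ring_circle x)"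
    using ring_circle_real[OF C(1), of "of_real (p k)"] x(3) a1_less_b[OF k] pk by (auto simp: base_point_def)
  have w: "winding_number ?g (of_real u) = 1" if "a 1 \<le> u" "u \<le> b k" for u
    using \<gamma>(1) that unfolding B_cycle_def by auto
  obtain n1 :: int where n1: "(?F has_contour_integral (contour_integral ?g Fh + 2 * of_real pi * \<i> * of_int n1)) ?g"
    using ring_cycle_integral[OF Fh B(1-3) g4] by blast
  obtain n2 :: int where n2: "(?F has_contour_integral (contour_integral (ring_circle x) Fh + 2 * of_real pi * \<i> * of_int n2)) (ring_circle x)"
    using ring_cycle_integral[OF Fh C(2-4) C4] by blast
  have eq: "contour_integral ?g Fh = contour_integral (ring_circle x) Fh"
    by (rule contour_integral_eq_of_winding[OF open_ring_domain connected_ring_domain[OF k] Fh(1) B(1-3) C(2-4)])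
       (rule ring_cycle_winding[OF k B(1-3) w x(1,2)])
  have "((\<lambda>t. omega \<nu> P (\<gamma> t) * vector_derivative ?g (at t within {0..1})) has_integral contour_integral ?g ?F) {0..1}"
  proof (rule has_integral_eq[rotated])
    show "((\<lambda>t. ?F (?g t) * vector_derivative ?g (at t within {0..1})) has_integral contour_integral ?g ?F) {0..1}"
      using n1 contour_integral_unique[OF n1] by (simp add: has_contour_integral_def)
    show "?F (?g t) * vector_derivative ?g (at t within {0..1}) = omega \<nu> P (\<gamma> t) * vector_derivative ?g (at t within {0..1})"
      if "t \<in> {0..1}" for t using B(4)[OF that] by simp
  qed
  then have "curve_integral (omega \<nu> P) \<gamma> = contour_integral ?g ?F"
    unfolding curve_integral_def by (rule integral_unique)
  also have "\<dots> = contour_integral (ring_circle x) ?F + 2 * of_real pi * \<i> * of_int (n1 - n2)"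
    using contour_integral_unique[OF n1] contour_integral_unique[OF n2] eq by (simp add: algebra_simps)
  finally show ?thesis by blast
qed

end

section \<open>Classes of real numbers modulo the integers\<close>

definition residue_class :: "real \<Rightarrow> real set" where "residue_class v = {y. v - y \<in> \<int>}"

lemma residue_class_eq: "residue_class v = residue_class u \<longleftrightarrow> v - u \<in> \<int>"
proof
  assume eq: "residue_class v = residue_class u"
  have "u \<in> residue_class v" unfolding eq by (simp add: residue_class_def)
  then show "v - u \<in> \<int>" by (simp add: residue_class_def)
next
  assume d: "v - u \<in> \<int>"
  have "v - y \<in> \<int> \<longleftrightarrow> u - y \<in> \<int>" for y
  proof
    assume "v - y \<in> \<int>" from Ints_diff[OF this d] show "u - y \<in> \<int>" by simp
  next
    assume "u - y \<in> \<int>" from Ints_add[OF this d] show "v - y \<in> \<int>" by simp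
  qed
  then show "residue_class v = residue_class u" by (simp add: residue_class_def)
qed

lemma real_mod_int_eq: "real_mod_int = range residue_class"
  by (auto simp: real_mod_int_def quotient_def residue_class_def)

lemma mem_residue_class_iff: "x \<in> residue_class v \<longleftrightarrow> residue_class v = residue_class x"
  by (simp add: residue_class_eq) (simp add: residue_class_def)

context gap_surface
begin

text \<open>On the first sheet reflection conjugates the integrand, both its even and its odd part.
  The circle thus gives minus the arc integral plus its conjugate.\<close>

lemma ring_circle_integral:
  assumes P: "gap_data P p y" and \<nu>: "\<nu> \<in> {1,2}" and k: "k \<in> {1..N-1}"
    and c: "\<And>j. j \<in> {1..N-1} \<Longrightarrow> gap_period j (rpoly c) = - gap_period j (odd_part \<nu> p y)"
    and x: "b k < x" "x < a (k + 1)" "x \<noteq> p k"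
  shows "contour_integral (ring_circle x) (\<lambda>z. omega \<nu> P (Pt z (root_branch z))) =
    - 2 * \<i> * of_real (Im (arc_integral (even_part p) base_point x)
      + Im (arc_integral (\<lambda>z. (odd_part \<nu> p y z + rpoly c z) / upper_root z) base_point x))"
proof -
  let ?E = "sing_set p" and ?F = "\<lambda>z. omega \<nu> P (Pt z (root_branch z))" and ?g = "ring_circle x"
  note adm = sing_set_admissible[OF P]
  note C = ring_circle[OF k x(1,2)]
  define f2 where "f2 z = odd_part \<nu> p y z + rpoly c z" for z
  have rf: "real_fun ?E (even_part p)" "real_fun ?E f2"
    unfolding f2_def by (intro real_fun_even_part real_fun_add real_fun_odd_part rpoly_real_fun)+
  have notin: "base_point \<notin> ?E" "x \<notin> ?E"
    using admissible_left[OF adm] gap_sing_set[OF P k x(1,2)] x(3) by (auto simp: base_point_def)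
  obtain G1 where G1: "\<And>z. z \<in> slit_plane ?E \<Longrightarrow> (G1 has_field_derivative even_part p z) (at z)"
    using slit_plane_primitive[OF finite_sing_set real_fun_holomorphic_slit[OF rf(1)]] by blast
  obtain G2 where G2: "\<And>z. z \<in> slit_plane ?E \<Longrightarrow> (G2 has_field_derivative f2 z / upper_root z) (at z)"
    using primitive_quotient[OF adm rf(2)] by blast
  define H where "H z = even_part p z + f2 z / upper_root z" for z
  define H' where "H' = (\<lambda>z. cnj (H (cnj z)))"
  define G where "G = (\<lambda>z. G1 z + G2 z)"
  define G' where "G' = cnj \<circ> G \<circ> cnj"
  have DG: "(G has_field_derivative H z) (at z)" if "z \<in> slit_plane ?E" for z
    unfolding G_def H_def by (intro DERIV_add G1 G2 that)
  have DG': "(G' has_field_derivative H' z) (at z)" if "cnj z \<in> slit_plane ?E" for z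
    unfolding G'_def H'_def by (intro has_field_derivative_cnj_cnj DG that)
  have vp: "?g piecewise_differentiable_on {0..1}"
    using C(2) unfolding valid_path_def by (rule piecewise_C1_imp_differentiable)
  have g0: "?g 0 = of_real x" "?g 1 = of_real x" "?g (1/2) = of_real base_point"
    by (simp_all add: ring_circle_eq complex_eq_iff field_simps)
  have up: "Im (?g t) > 0" if "0 < t" "t < 1/2" for t
    using C(1) that sin_gt_zero[of "2 * pi * t"] by (simp add: ring_circle_eq)
  have lo: "Im (?g t) < 0" if "1/2 < t" "t < 1" for t
  proof -
    have "sin (2 * pi * t - pi) > 0" using that by (intro sin_gt_zero) (auto simp: field_simps)
    then show ?thesis using C(1) by (simp add: ring_circle_eq sin_diff mult_pos_neg)
  qed
  have \<omega>: "?F z = even_part p z + f2 z / root_branch z" if "Im z \<noteq> 0" for z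
  proof -
    have "z \<notin> of_real ` sing_set p" using that by auto
    then show ?thesis using omega_form(2)[OF P \<nu> c root_branch_sq] by (simp add: omega_coeff_def f2_def)
  qed
  have Fup: "?F z = H z" if "Im z > 0" for z
  proof -
    have "z \<notin> cuts" using that by (auto simp: not_cuts_iff)
    then show ?thesis using \<omega>[of z] that root_branch_upper[of z] by (simp add: H_def)
  qed
  have Flo: "?F z = H' z" if "Im z < 0" for z
  proof -
    have c: "z \<notin> cuts" "cnj z \<notin> cuts" using that by (auto simp: not_cuts_iff)
    have "upper_root (cnj z) = cnj (root_branch z)"
      using root_branch_cnj[OF c(1)] root_branch_upper[of "cnj z"] c that by simp
    moreover have "even_part p (cnj z) = cnj (even_part p z)" "f2 (cnj z) = cnj (f2 z)"
      using rf unfolding real_fun_def by blast+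
    ultimately show ?thesis using \<omega>[of z] that by (simp add: H'_def H_def)
  qed
  have I1: "((\<lambda>t. ?F (?g t) * vector_derivative ?g (at t within {0..1})) has_integral (G (?g (1/2)) - G (?g 0))) {0..1/2}"
  proof (rule has_integral_spike_finite[of "{0,1/2}"])
    show "((\<lambda>t. H (?g t) * vector_derivative ?g (at t within {0..1/2})) has_integral (G (?g (1/2)) - G (?g 0))) {0..1/2}"
    proof (rule contour_integral_primitive_lemma[of 0 "1/2" "slit_plane ?E"])
      show "?g t \<in> slit_plane ?E" if t: "t \<in> {0..1/2}" for t
      proof -
        consider "t = 0" | "t = 1/2" | "0 < t" "t < 1/2" using t by force
        then show ?thesis
          by cases (simp_all only: g0 real_in_slit_plane notin upper_in_slit_plane[OF up] not_False_eq_True)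
      qed
    qed (use vp DG in \<open>auto intro: has_field_derivative_at_within piecewise_differentiable_on_subset\<close>)
    fix t :: real assume t: "t \<in> {0..1/2} - {0, 1/2}"
    then have "t \<in> interior {0..1/2}" "t \<in> interior {0..1}" by auto
    note this[THEN at_within_interior]
    then show "?F (?g t) * vector_derivative ?g (at t within {0..1}) = H (?g t) * vector_derivative ?g (at t within {0..1/2})"
      using Fup[OF up[of t]] t by simp
  qed simp
  have I2: "((\<lambda>t. ?F (?g t) * vector_derivative ?g (at t within {0..1})) has_integral (G' (?g 1) - G' (?g (1/2)))) {1/2..1}"
  proof (rule has_integral_spike_finite[of "{1/2,1}"])
    show "((\<lambda>t. H' (?g t) * vector_derivative ?g (at t within {1/2..1})) has_integral (G' (?g 1) - G' (?g (1/2)))) {1/2..1}"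
    proof (rule contour_integral_primitive_lemma[of "1/2" 1 "{z. cnj z \<in> slit_plane ?E}"])
      show "?g t \<in> {z. cnj z \<in> slit_plane ?E}" if t: "t \<in> {1/2..1}" for t
      proof -
        consider "t = 1" | "t = 1/2" | "1/2 < t" "t < 1" using t by force
        then show ?thesis
          using upper_in_slit_plane[of "cnj (?g t)"] lo[of t]
          by cases (simp_all only: mem_Collect_eq g0 real_in_slit_plane notin complex_cnj_complex_of_real cnj.sel neg_0_less_iff_less not_False_eq_True)
      qed
    qed (use vp DG' in \<open>auto intro: has_field_derivative_at_within piecewise_differentiable_on_subset\<close>)
    fix t :: real assume t: "t \<in> {1/2..1} - {1/2, 1}"
    then have "t \<in> interior {1/2..1}" "t \<in> interior {0..1}" by auto
    note this[THEN at_within_interior]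
    then show "?F (?g t) * vector_derivative ?g (at t within {0..1}) = H' (?g t) * vector_derivative ?g (at t within {1/2..1})"
      using Flo[OF lo[of t]] t by simp
  qed simp
  have "(?F has_contour_integral ((G (?g (1/2)) - G (?g 0)) + (G' (?g 1) - G' (?g (1/2))))) ?g"
    unfolding has_contour_integral_def using has_integral_combine[OF _ _ I1 I2] by simp
  then have "contour_integral ?g ?F = (G (?g (1/2)) - G (?g 0)) + (G' (?g 1) - G' (?g (1/2)))"
    by (rule contour_integral_unique)
  also have "\<dots> = - 2 * \<i> * of_real (Im (G1 (of_real x) - G1 (of_real base_point)) + Im (G2 (of_real x) - G2 (of_real base_point)))"
    unfolding g0 G_def G'_def by (simp add: complex_eq_iff)
  also have "G1 (of_real x) - G1 (of_real base_point) = arc_integral (even_part p) base_point x"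
    using arc_integral_primitive[OF G1 C(1) notin] by simp
  also have "G2 (of_real x) - G2 (of_real base_point) = arc_integral (\<lambda>z. f2 z / upper_root z) base_point x"
    using arc_integral_primitive[OF G2 C(1) notin] by simp
  finally show ?thesis by (simp add: f2_def)
qed

text \<open>Supplies a cycle on which the class in \<open>Psi\<close> can be read off, which makes
  the definite description unique.\<close>

lemma B_cycle_exists:
  assumes k: "k \<in> {1..N-1}" and x: "b k < x" "x < a (k + 1)"
  shows "B_cycle k (\<lambda>t. Pt (ring_circle x t) (root_branch (ring_circle x t)))" (is "B_cycle k ?\<gamma>")
proof -
  note C = ring_circle[OF k x]
  have zc: "zc \<circ> ?\<gamma> = ring_circle x" and wc: "wc \<circ> ?\<gamma> = root_branch \<circ> ring_circle x" by (auto simp: o_def)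
  have nc: "ring_circle x t \<notin> cuts" if "t \<in> {0..1}" for t
    using C(4) ring_domain_not_cuts[OF k] that unfolding path_image_def by blast
  have nb: "ring_circle x t \<notin> branch_values" if "t \<in> {0..1}" for t
    using nc[OF that] branch_values_cuts by blast
  have "path (root_branch \<circ> ring_circle x)"
    unfolding path_def
    by (intro continuous_on_compose holomorphic_on_imp_continuous_on[OF holomorphic_on_subset[OF root_branch_holomorphic]])
       (use C(2) nc in \<open>auto simp: valid_path_imp_path simp flip: path_def\<close>)
  then have cl: "closed_curve ?\<gamma>"
    unfolding closed_curve_def zc wc using C(2,3) nb
    by (auto simp: affine_part_iff root_branch_sq branch_points_def pathfinish_def pathstart_def)
  have "cnj z \<in> path_image (ring_circle x)" if "z \<in> path_image (ring_circle x)" for z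
  proof -
    have "cnj z - of_real c = cnj (z - of_real c)" for c by simp
    then have "norm (of_real c - cnj z) = norm (of_real c - z)" for c by (metis complex_mod_cnj norm_minus_commute)
    moreover have "path_image (ring_circle x) = sphere (of_real ((base_point + x) / 2)) ((x - base_point) / 2)"
      unfolding ring_circle_def using C(1) by (intro path_image_circlepath_nonneg) simp
    ultimately show ?thesis using that by (simp only: mem_sphere dist_norm)
  qed
  then have "cnj ` path_image (ring_circle x) = path_image (ring_circle x)"
    by (auto simp: image_iff) (metis complex_cnj_cnj)
  moreover have "path_image (ring_circle x) \<inter> \<real> \<subseteq> of_real ` ({..<a 1} \<union> {b k<..<a (k + 1)})"
    using C(4) by (auto simp: ring_domain_def elim!: Reals_cases)
  moreover have "?\<gamma> ` {0..1} \<subseteq> sheet 1" using nc by (auto simp: sheet_def sheet_sign_def)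
  ultimately show ?thesis
    unfolding B_cycle_def zc using cl C(5) by auto
qed

section \<open>Normalized periods\<close>

definition ring_period :: "real \<Rightarrow> (complex \<Rightarrow> complex) \<Rightarrow> real" where
  "ring_period x f = Im (arc_integral (\<lambda>z. f z / upper_root z) base_point x)"

definition crossing :: "nat \<Rightarrow> real \<Rightarrow> real set \<Rightarrow> bool" where
  "crossing k x E \<longleftrightarrow> k \<in> {1..N-1} \<and> b k < x \<and> x < a (k + 1) \<and> x \<notin> E \<and> admissible E"

lemma crossingD:
  assumes "crossing k x E"
  shows "k \<in> {1..N-1}" "base_point < x" "base_point \<notin> E" "x \<notin> E" "admissible E"
proof -
  show "k \<in> {1..N-1}" "x \<notin> E" "admissible E" using assms by (auto simp: crossing_def)
  then show "base_point < x" "base_point \<notin> E"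
    using assms a1_less_b[of k] admissible_left[of E base_point] by (auto simp: crossing_def base_point_def)
qed

lemma ring_period_add:
  assumes "crossing k x E" "real_fun E f" "real_fun E g"
  shows "ring_period x (\<lambda>z. f z + g z) = ring_period x f + ring_period x g"
  unfolding ring_period_def add_divide_distrib
  using arc_integral_add[OF quotient_holomorphic[OF crossingD(5)[OF assms(1)] assms(2)] quotient_holomorphic[OF crossingD(5)[OF assms(1)] assms(3)] crossingD(2-4)[OF assms(1)]]
  by simp

lemma ring_period_cmult:
  assumes "crossing k x E" "real_fun E f"
  shows "ring_period x (\<lambda>z. of_real c * f z) = c * ring_period x f"
  unfolding ring_period_def times_divide_eq_right[symmetric]
  using arc_integral_cmult[OF quotient_holomorphic[OF crossingD(5)[OF assms(1)] assms(2)] crossingD(2-4)[OF assms(1)]]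
  by simp

lemma ring_period_zero: "ring_period x (\<lambda>z. 0) = 0"
  by (simp add: ring_period_def arc_integral_def)

lemma ring_period_sum:
  assumes "crossing k x E" "\<And>i. i \<in> I \<Longrightarrow> real_fun E (f i)" "finite I"
  shows "ring_period x (\<lambda>z. \<Sum>i\<in>I. f i z) = (\<Sum>i\<in>I. ring_period x (f i))"
  using assms(3,2)
  by (induction I rule: finite_induct)
     (simp_all add: ring_period_zero ring_period_add[OF assms(1) _ real_fun_sum])

text \<open>Numerators of the holomorphic differentials dual to the gaps, normalized by gap periods
  instead of full A-periods.\<close>

definition normal_poly :: "nat \<Rightarrow> nat \<Rightarrow> real" where
  "normal_poly i = (SOME c. \<forall>j\<in>{1..N-1}. gap_period j (rpoly c) = (if j = i then 1 else 0))"

lemma normal_poly: "j \<in> {1..N-1} \<Longrightarrow> gap_period j (rpoly (normal_poly i)) = (if j = i then 1 else 0)"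
  using someI_ex[OF exists_rpoly_periods[of "\<lambda>j. if j = i then 1 else 0"]] unfolding normal_poly_def by blast

text \<open>The period over the cycle around the first cuts of \<open>f z / w\<close> plus the holomorphic differential
  that makes all gap periods vanish.\<close>

definition reduced_period :: "real \<Rightarrow> (complex \<Rightarrow> complex) \<Rightarrow> real" where
  "reduced_period x f = ring_period x f - (\<Sum>i\<in>{1..N-1}. gap_period i f * ring_period x (rpoly (normal_poly i)))"

lemma reduced_period_add:
  assumes "crossing k x E" "real_fun E f" "real_fun E g"
  shows "reduced_period x (\<lambda>z. f z + g z) = reduced_period x f + reduced_period x g"
  using ring_period_add[OF assms] gap_period_add[OF crossingD(5)[OF assms(1)] assms(2,3)]
  by (simp add: reduced_period_def sum.distrib distrib_right)

lemma reduced_period_cmult: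
  assumes "crossing k x E" "real_fun E f"
  shows "reduced_period x (\<lambda>z. of_real c * f z) = c * reduced_period x f"
  using ring_period_cmult[OF assms] gap_period_cmult[OF crossingD(5)[OF assms(1)] assms(2)]
  by (simp add: reduced_period_def sum_distrib_left right_diff_distrib mult.assoc)

lemma reduced_period_zero: "reduced_period x (\<lambda>z. 0) = 0"
  by (simp add: reduced_period_def ring_period_zero gap_period_zero)

lemma reduced_period_sum:
  assumes "crossing k x E" "\<And>i. i \<in> I \<Longrightarrow> real_fun E (f i)" "finite I"
  shows "reduced_period x (\<lambda>z. \<Sum>i\<in>I. f i z) = (\<Sum>i\<in>I. reduced_period x (f i))"
  using assms(3,2)
  by (induction I rule: finite_induct)
     (simp_all add: reduced_period_zero reduced_period_add[OF assms(1) _ real_fun_sum])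

lemma rpoly_sum: "rpoly (\<lambda>m. \<Sum>i\<in>I. d i * c i m) z = (\<Sum>i\<in>I. of_real (d i) * rpoly (c i) z)"
  unfolding rpoly_def
  by (simp add: sum_distrib_left sum_distrib_right mult.assoc, subst sum.swap, simp)

lemma rpoly_minus: "rpoly (\<lambda>m. - c m) z = - rpoly c z"
  by (simp add: rpoly_def sum_negf)

lemma gap_period_combination:
  assumes j: "j \<in> {1..N-1}"
  shows "gap_period j (rpoly (\<lambda>m. \<Sum>i\<in>{1..N-1}. d i * normal_poly i m)) = d j"
proof -
  have "gap_period j (rpoly (\<lambda>m. \<Sum>i\<in>{1..N-1}. d i * normal_poly i m)) = (\<Sum>i\<in>{1..N-1}. d i * (if j = i then 1 else 0))"
    unfolding rpoly_sum[abs_def]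
    by (subst gap_period_sum[OF admissible_ends _ j])
       (auto intro!: sum.cong real_fun_cmult rpoly_real_fun simp: gap_period_cmult[OF admissible_ends rpoly_real_fun j] normal_poly[OF j])
  also have "\<dots> = (\<Sum>i\<in>{1..N-1}. if j = i then d i else 0)" by (intro sum.cong) auto
  also have "\<dots> = d j" using j by simp
  finally show ?thesis .
qed

lemma ring_period_combination:
  assumes "crossing k x E"
  shows "ring_period x (rpoly (\<lambda>m. \<Sum>i\<in>{1..N-1}. d i * normal_poly i m)) = (\<Sum>i\<in>{1..N-1}. d i * ring_period x (rpoly (normal_poly i)))"
  unfolding rpoly_sum[abs_def]
  by (subst ring_period_sum[OF assms])
     (auto intro!: sum.cong real_fun_cmult rpoly_real_fun simp: ring_period_cmult[OF assms rpoly_real_fun])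

text \<open>A polynomial of this degree is determined by its gap periods, so it equals the
  combination of dual polynomials that is subtracted.\<close>

lemma reduced_period_rpoly:
  assumes "crossing k x E"
  shows "reduced_period x (rpoly c) = 0"
proof -
  let ?d = "\<lambda>m. \<Sum>i\<in>{1..N-1}. gap_period i (rpoly c) * normal_poly i m"
  have "\<forall>m<N-1. (\<lambda>m. c m - ?d m) m = 0"
  proof (rule gap_period_rpoly_eq_0)
    fix j assume j: "j \<in> {1..N-1}"
    have "gap_period j (rpoly (\<lambda>m. c m - ?d m)) = gap_period j (rpoly c) - gap_period j (rpoly ?d)"
      unfolding gap_period_rpoly[OF j] by (simp add: left_diff_distrib sum_subtractf)
    then show "gap_period j (rpoly (\<lambda>m. c m - ?d m)) = 0" using gap_period_combination[OF j] by simp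
  qed
  then have "rpoly c z = rpoly ?d z" for z :: complex by (simp add: rpoly_def)
  then have "rpoly c = (rpoly ?d :: complex \<Rightarrow> complex)" by blast
  then have "ring_period x (rpoly c) = (\<Sum>i\<in>{1..N-1}. gap_period i (rpoly c) * ring_period x (rpoly (normal_poly i)))"
    using ring_period_combination[OF assms, of "\<lambda>i. gap_period i (rpoly c)"] by simp
  then show ?thesis by (simp add: reduced_period_def)
qed

text \<open>Left of \<open>x\<close> lie \<open>2 * k\<close> end points with contribution pi/4
  each, and \<open>k\<close> or \<open>k - 1\<close> of the \<open>p j\<close> with - pi/2 each,
  depending on the side of \<open>p k\<close>.\<close>

lemma Im_arc_even_ring:
  assumes P: "gap_data P p y" and k: "k \<in> {1..N-1}" and x: "b k < x" "x < a (k + 1)" "x \<noteq> p k"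
  shows "Im (arc_integral (even_part p) base_point x) = (if p k < x then 0 else pi / 2)"
proof -
  have pb: "b i \<le> p i" "p i \<le> a (i + 1)" if "i \<in> {1..N-1}" for i using P that by (auto simp: gap_data_def)
  have cr: "crossing k x (sing_set p)"
    using k x gap_sing_set[OF P k x(1,2)] sing_set_admissible[OF P] by (auto simp: crossing_def)
  have bp: "base_point < a 1" by (simp add: base_point_def)
  have A: "{j \<in> {1..N-1}. base_point < p j \<and> p j < x} = {1..<k} \<union> (if p k < x then {k} else {})"
  proof (intro equalityI subsetI)
    fix j assume j: "j \<in> {j \<in> {1..N-1}. base_point < p j \<and> p j < x}"
    have "\<not> k < j"
    proof
      assume "k < j"
      then have "b (k+1) \<le> b j" using b_less_iff[OF gap_index(1)[of j] gap_index(2)[OF k]] j by auto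
      then show False using pb[of j] j x ab[OF gap_index(2)[OF k]] by auto
    qed
    then show "j \<in> {1..<k} \<union> (if p k < x then {k} else {})" using j by (cases "j = k") auto
  next
    fix j assume j: "j \<in> {1..<k} \<union> (if p k < x then {k} else {})"
    then have j1: "j \<in> {1..N-1}" using k by (auto split: if_splits)
    have "p j < x"
    proof (cases "j = k")
      case False
      then have "j < k" using j by (auto split: if_splits)
      then have "a (j+1) \<le> a k" using a_less_iff[OF gap_index(1)[OF k] gap_index(2)[OF j1]] by simp
      then show ?thesis using pb[OF j1] x ab[OF gap_index(1)[OF k]] by linarith
    qed (use j in \<open>auto split: if_splits\<close>)
    moreover have "base_point < p j" using pb(1)[OF j1] a1_less_b[OF j1] bp by linarith
    ultimately show "j \<in> {j \<in> {1..N-1}. base_point < p j \<and> p j < x}" using j1 by auto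
  qed
  have B: "{e \<in> ends. base_point < e \<and> e < x} = a ` {1..k} \<union> b ` {1..k}"
  proof (intro equalityI subsetI)
    fix e assume e: "e \<in> {e \<in> ends. base_point < e \<and> e < x}"
    then obtain i where i: "i \<in> {1..N}" "e = a i \<or> e = b i" by (auto simp: ends_def)
    have "i \<le> k"
    proof (rule ccontr)
      assume "\<not> i \<le> k"
      then have "a (k+1) \<le> a i" using gap_sides(3)[OF k, of "a (k+1)" i] gap_pos[OF k] i by auto
      then show False using e i ab[OF i(1)] x by auto
    qed
    then show "e \<in> a ` {1..k} \<union> b ` {1..k}" using i by auto
  next
    fix e assume "e \<in> a ` {1..k} \<union> b ` {1..k}"
    then obtain i where i: "1 \<le> i" "i \<le> k" "e = a i \<or> e = b i" by auto
    then have iN: "i \<in> {1..N}" using k by auto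
    have "b i \<le> b k" using gap_sides(2)[OF k, of "b k" i] gap_pos[OF k] i iN by auto
    moreover have "a 1 \<le> a i" using a1_le[OF iN] .
    ultimately have "base_point < e" "e < x" using i(3) ab[OF iN] bp x by auto
    then show "e \<in> {e \<in> ends. base_point < e \<and> e < x}" using i(3) iN by auto
  qed
  have sub: "{1..k} \<subseteq> {1..N}" using k by auto
  have "card (a ` {1..k} \<union> b ` {1..k}) = card (a ` {1..k}) + card (b ` {1..k})"
    using a_neq_b sub by (intro card_Un_disjoint) auto
  also have "\<dots> = 2 * k"
    using card_image[OF inj_on_subset[OF inj_a sub]] card_image[OF inj_on_subset[OF inj_b sub]] by simp
  finally have cB: "card {e \<in> ends. base_point < e \<and> e < x} = 2 * k" by (simp only: B)
  have cA: "card {j \<in> {1..N-1}. base_point < p j \<and> p j < x} = (if p k < x then k else k - 1)"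
    unfolding A using k by (auto simp: card_Un_disjoint)
  show ?thesis
    unfolding Im_arc_even_part[OF finite_ends crossingD(2)[OF cr] crossingD(3)[OF cr] crossingD(4)[OF cr]] cA cB
    using k by (auto simp: of_nat_diff field_simps)
qed

text \<open>The polynomial that normalizes the differential turns the period of its odd part into
  \<open>reduced_period\<close>. The class is read off on the model circle; any other cycle avoiding
  \<open>P k\<close> differs by an integer.\<close>

lemma Psi_reduced_period:
  assumes P: "gap_data P p y" and \<nu>: "\<nu> \<in> {1,2}" and k: "k \<in> {1..N-1}"
    and x: "b k < x" "x < a (k + 1)" "x \<noteq> p k"
  shows "Psi \<nu> P k = residue_class ((if p k < x then 0 else - 1 / 2) - reduced_period x (odd_part \<nu> p y) / pi)"
proof -
  let ?E = "sing_set p"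
  note adm = sing_set_admissible[OF P]
  have cr: "crossing k x ?E"
    using k x gap_sing_set[OF P k x(1,2)] adm by (auto simp: crossing_def)
  define c where "c m = - (\<Sum>i\<in>{1..N-1}. gap_period i (odd_part \<nu> p y) * normal_poly i m)" for m
  have c': "rpoly c = (\<lambda>z. of_real (-1) * rpoly (\<lambda>m. \<Sum>i\<in>{1..N-1}. gap_period i (odd_part \<nu> p y) * normal_poly i m) z :: complex)"
    unfolding c_def by (rule ext) (simp only: rpoly_minus of_real_minus of_real_1 mult_minus1)
  have c: "gap_period j (rpoly c) = - gap_period j (odd_part \<nu> p y)" if j: "j \<in> {1..N-1}" for j
    unfolding c' gap_period_cmult[OF admissible_ends rpoly_real_fun j] gap_period_combination[OF j] by simp
  have "ring_period x (rpoly c) = - (\<Sum>i\<in>{1..N-1}. gap_period i (odd_part \<nu> p y) * ring_period x (rpoly (normal_poly i)))"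
    unfolding c' ring_period_cmult[OF cr rpoly_real_fun] ring_period_combination[OF cr] by simp
  then have rp: "ring_period x (\<lambda>z. odd_part \<nu> p y z + rpoly c z) = reduced_period x (odd_part \<nu> p y)"
    unfolding ring_period_add[OF cr real_fun_odd_part rpoly_real_fun] reduced_period_def by simp
  define v where "v = (if p k < x then 0 else - 1 / 2) - reduced_period x (odd_part \<nu> p y) / pi"
  have circ: "contour_integral (ring_circle x) (\<lambda>z. omega \<nu> P (Pt z (root_branch z))) = 2 * of_real pi * \<i> * of_real v"
  proof -
    have "contour_integral (ring_circle x) (\<lambda>z. omega \<nu> P (Pt z (root_branch z))) =
       - 2 * \<i> * of_real ((if p k < x then 0 else pi / 2) + reduced_period x (odd_part \<nu> p y))"
      using ring_circle_integral[OF P \<nu> k c x] Im_arc_even_ring[OF P k x] rp[unfolded ring_period_def] by simp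
    moreover have "pi * v = - ((if p k < x then 0 else pi / 2) + reduced_period x (odd_part \<nu> p y))"
      by (simp add: v_def right_diff_distrib)
    moreover have "2 * of_real pi * \<i> * of_real v = 2 * \<i> * complex_of_real (pi * v)" by simp
    ultimately show ?thesis by (simp only: of_real_minus) (simp add: algebra_simps)
  qed
  have val: "\<exists>n::int. 1 / (2 * of_real pi * \<i>) * curve_integral (omega \<nu> P) \<gamma> = of_real (v + of_int n)"
    if \<gamma>: "B_cycle k \<gamma>" "P k \<notin> \<gamma> ` {0..1}" for \<gamma>
  proof -
    obtain n :: int where "curve_integral (omega \<nu> P) \<gamma> = 2 * of_real pi * \<i> * of_real v + 2 * of_real pi * \<i> * of_int n"
      using B_period_mod_int[OF P \<nu> k c x \<gamma>] circ by auto
    then have "curve_integral (omega \<nu> P) \<gamma> = (2 * of_real pi * \<i>) * of_real (v + of_int n)" by (simp add: algebra_simps)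
    then show ?thesis by (intro exI[of _ n]) simp
  qed
  let ?\<gamma> = "\<lambda>t. Pt (ring_circle x t) (root_branch (ring_circle x t))"
  have \<gamma>: "B_cycle k ?\<gamma>" by (rule B_cycle_exists[OF k x(1,2)])
  have nin: "P k \<notin> ?\<gamma> ` {0..1}"
  proof
    assume "P k \<in> ?\<gamma> ` {0..1}"
    then have "of_real (p k) \<in> path_image (ring_circle x)" using P k by (auto simp: gap_data_def path_image_def)
    from ring_circle_real[OF crossingD(2)[OF cr] this] have "p k = base_point \<or> p k = x" by simp
    moreover have "b k \<le> p k" using P k unfolding gap_data_def by blast
    ultimately show False using x(3) a1_less_b[OF k] by (auto simp: base_point_def)
  qed
  have "(THE c. c \<in> real_mod_int \<and> (\<forall>\<gamma>. B_cycle k \<gamma> \<and> P k \<notin> \<gamma> ` {0..1} \<longrightarrow>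
        (\<exists>x\<in>c. 1 / (2 * of_real pi * \<i>) * curve_integral (omega \<nu> P) \<gamma> = of_real x))) = residue_class v"
  proof (rule the_equality)
    show "residue_class v \<in> real_mod_int \<and> (\<forall>\<gamma>. B_cycle k \<gamma> \<and> P k \<notin> \<gamma> ` {0..1} \<longrightarrow>
        (\<exists>x\<in>residue_class v. 1 / (2 * of_real pi * \<i>) * curve_integral (omega \<nu> P) \<gamma> = of_real x))"
    proof (intro conjI allI impI)
      show "residue_class v \<in> real_mod_int" by (simp add: real_mod_int_eq)
      fix \<gamma> assume "B_cycle k \<gamma> \<and> P k \<notin> \<gamma> ` {0..1}"
      then obtain n :: int where n: "1 / (2 * of_real pi * \<i>) * curve_integral (omega \<nu> P) \<gamma> = of_real (v + of_int n)"
        using val by blast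
      have "v + of_int n \<in> residue_class v" by (simp add: residue_class_def)
      with n show "\<exists>x\<in>residue_class v. 1 / (2 * of_real pi * \<i>) * curve_integral (omega \<nu> P) \<gamma> = of_real x" by blast
    qed
  next
    fix c assume c: "c \<in> real_mod_int \<and> (\<forall>\<gamma>. B_cycle k \<gamma> \<and> P k \<notin> \<gamma> ` {0..1} \<longrightarrow>
        (\<exists>x\<in>c. 1 / (2 * of_real pi * \<i>) * curve_integral (omega \<nu> P) \<gamma> = of_real x))"
    then obtain u where u: "u \<in> c" "1 / (2 * of_real pi * \<i>) * curve_integral (omega \<nu> P) ?\<gamma> = of_real u"
      using \<gamma> nin by blast
    obtain n :: int where "1 / (2 * of_real pi * \<i>) * curve_integral (omega \<nu> P) ?\<gamma> = of_real (v + of_int n)"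
      using val[OF \<gamma> nin] by blast
    then have "u = v + of_int n" using u(2) by (metis of_real_eq_iff)
    then have "residue_class v = residue_class u" by (simp add: residue_class_eq)
    moreover obtain w where w: "c = residue_class w" using c by (auto simp: real_mod_int_eq)
    then have "c = residue_class u" using u(1) mem_residue_class_iff by blast
    ultimately show "c = residue_class v" by simp
  qed
  then show ?thesis using k by (simp add: Psi_def v_def)
qed

end

section \<open>Interchange of argument and parameter\<close>

text \<open>The left side is the error of the trapezoidal rule for the derivative of a power. It is
  divisible by \<open>(z - p)^2\<close>, and the induction tracks the cofactor by means of the
  geometric sum \<open>?g\<close>.\<close>

lemma mixed_kernel_Suc:
  fixes z p :: "'a :: field_char_0"
  shows "of_nat (Suc m) * (z ^ m + p ^ m) / 2 * (z - p) - (z ^ Suc m - p ^ Suc m) =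
    (z - p)\<^sup>2 * (\<Sum>i<m. (of_nat (2 * i + 1) - of_nat m) / 2 * (z ^ i * p ^ (m - Suc i)))"
proof (induction m)
  case 0
  show ?case by simp
next
  case (Suc m)
  let ?S = "\<Sum>i<m. (of_nat (2 * i + 1) - of_nat m) / 2 * (z ^ i * p ^ (m - Suc i))"
  let ?g = "\<Sum>i<m. z ^ i * p ^ (m - Suc i)"
  have g: "(z - p) * ?g = z ^ m - p ^ m"
    using power_diff_sumr2[of z m p] by (simp add: mult.commute)
  have "(\<Sum>i<m. (of_nat (2 * i + 1) - of_nat (Suc m)) / 2 * (z ^ i * p ^ (Suc m - Suc i)))
      = (\<Sum>i<m. p * ((of_nat (2 * i + 1) - of_nat m) / 2 * (z ^ i * p ^ (m - Suc i))) - p / 2 * (z ^ i * p ^ (m - Suc i)))"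
  proof (intro sum.cong refl)
    fix i assume "i \<in> {..<m}"
    then have "Suc m - Suc i = Suc (m - Suc i)" by auto
    then show "(of_nat (2 * i + 1) - of_nat (Suc m)) / 2 * (z ^ i * p ^ (Suc m - Suc i)) =
      p * ((of_nat (2 * i + 1) - of_nat m) / 2 * (z ^ i * p ^ (m - Suc i))) - p / 2 * (z ^ i * p ^ (m - Suc i))"
      by (simp add: field_simps)
  qed
  also have "\<dots> = p * ?S - p / 2 * ?g" by (simp add: sum_subtractf sum_distrib_left)
  finally have S0: "(\<Sum>i<m. (of_nat (2 * i + 1) - of_nat (Suc m)) / 2 * (z ^ i * p ^ (Suc m - Suc i))) = p * ?S - p / 2 * ?g" .
  have last: "(of_nat (2 * m + 1) - of_nat (Suc m)) / 2 * (z ^ m * p ^ (Suc m - Suc m)) = of_nat m / 2 * z ^ m"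
    by simp
  have S: "(\<Sum>i<Suc m. (of_nat (2 * i + 1) - of_nat (Suc m)) / 2 * (z ^ i * p ^ (Suc m - Suc i)))
      = p * ?S - p / 2 * ?g + of_nat m / 2 * z ^ m"
    unfolding sum.lessThan_Suc S0 last ..
  have "(z - p)\<^sup>2 * (p * ?S - p / 2 * ?g + of_nat m / 2 * z ^ m) =
     p * ((z - p)\<^sup>2 * ?S) - p / 2 * (z - p) * ((z - p) * ?g) + of_nat m / 2 * z ^ m * (z - p)\<^sup>2"
  proof -
    have "d\<^sup>2 * (p * S - p / 2 * G + M) = p * (d\<^sup>2 * S) - p / 2 * d * (d * G) + M * d\<^sup>2" for d S G M :: 'a
      by (simp add: power2_eq_square algebra_simps)
    then show ?thesis .
  qed
  also have "\<dots> = p * (of_nat (Suc m) * (z ^ m + p ^ m) / 2 * (z - p) - (z ^ Suc m - p ^ Suc m))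
      - p / 2 * (z - p) * (z ^ m - p ^ m) + of_nat m / 2 * z ^ m * (z - p)\<^sup>2"
    unfolding g Suc.IH ..
  also have "\<dots> = of_nat (Suc (Suc m)) * (z ^ Suc m + p ^ Suc m) / 2 * (z - p) - (z ^ Suc (Suc m) - p ^ Suc (Suc m))"
    by (simp add: field_simps power2_eq_square)
  finally show ?case unfolding S by simp
qed

text \<open>The cofactor is antisymmetric in \<open>z\<close> and \<open>p\<close>: exchanging
  \<open>i\<close> and \<open>n - 2 - i\<close> negates the coefficient.\<close>

lemma mixed_kernel_power:
  fixes z p :: "'a :: field_char_0"
  shows "(of_nat n * z ^ (n - 1) + of_nat n * p ^ (n - 1)) / 2 * (z - p) - (z ^ n - p ^ n) =
    (z - p)\<^sup>2 * (\<Sum>i<n-1. (of_nat (2 * i + 2) - of_nat n) / 2 * (z ^ i * p ^ (n - 2 - i)))"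
proof (cases n)
  case (Suc m)
  have e: "(\<Sum>i<n-1. (of_nat (2 * i + 2) - of_nat n) / 2 * (z ^ i * p ^ (n - 2 - i))) =
    (\<Sum>i<m. (of_nat (2 * i + 1) - of_nat m) / 2 * (z ^ i * p ^ (m - Suc i)))"
    using Suc by (intro sum.cong) (auto simp: numeral_2_eq_2 add_diff_eq)
  have l: "(of_nat n * z ^ (n - 1) + of_nat n * p ^ (n - 1)) / 2 * (z - p) - (z ^ n - p ^ n) =
    of_nat (Suc m) * (z ^ m + p ^ m) / 2 * (z - p) - (z ^ Suc m - p ^ Suc m)"
    using Suc by (simp add: distrib_left)
  show ?thesis unfolding e l by (rule mixed_kernel_Suc)
qed simp

lemma prod_linear_factors:
  fixes S :: "real set"
  assumes "finite S"
  shows "\<exists>c. \<forall>z::complex. (\<Prod>e\<in>S. z - of_real e) = (\<Sum>n\<le>card S. of_real (c n) * z ^ n)"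
  using assms
proof (induction S rule: finite_induct)
  case empty
  show ?case by (intro exI[of _ "\<lambda>_. 1"]) simp
next
  case (insert s S)
  then obtain c where c: "\<And>z::complex. (\<Prod>e\<in>S. z - of_real e) = (\<Sum>n\<le>card S. of_real (c n) * z ^ n)" by blast
  define d where "d n = (if n = 0 then 0 else c (n - 1)) - s * (if n \<le> card S then c n else 0)" for n
  have "(\<Prod>e\<in>insert s S. z - of_real e) = (\<Sum>n\<le>card (insert s S). of_real (d n) * z ^ n)" for z :: complex
  proof -
    have "(\<Sum>n\<le>Suc (card S). of_real (d n) * z ^ n) =
        (\<Sum>n\<le>Suc (card S). of_real (if n = 0 then 0 else c (n - 1)) * z ^ n) - of_real s * (\<Sum>n\<le>Suc (card S). of_real (if n \<le> card S then c n else 0) * z ^ n)"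
      by (simp add: d_def sum_subtractf left_diff_distrib sum_distrib_left mult.assoc del: sum.atMost_Suc)
    also have "(\<Sum>n\<le>Suc (card S). of_real (if n = 0 then 0 else c (n - 1)) * z ^ n) = z * (\<Sum>n\<le>card S. of_real (c n) * z ^ n)"
      by (subst sum.atMost_Suc_shift) (simp add: sum_distrib_left mult_ac)
    also have "(\<Sum>n\<le>Suc (card S). of_real (if n \<le> card S then c n else 0) * z ^ n) = (\<Sum>n\<le>card S. of_real (c n) * z ^ n)"
      by simp
    finally show ?thesis using insert by (simp add: c left_diff_distrib del: sum.atMost_Suc)
  qed
  then show ?case by blast
qed

text \<open>Differentiation under the integral sign. The parameter stays in a ball that omits
  \<open>x\<close> and \<open>y\<close>, the only real points of the arc.\<close>

lemma upper_arc_pole_deriv: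
  assumes xy: "x < y" and p: "p \<noteq> x" "p \<noteq> y" and g: "continuous_on (path_image (upper_arc x y)) g"
  shows "((\<lambda>p. arc_integral (\<lambda>z. g z * (1 / (z - of_real p))) x y) has_vector_derivative
    arc_integral (\<lambda>z. g z * (1 / (z - of_real p))\<^sup>2) x y) (at p)"
proof -
  define c where "c = upper_arc x y"
  define d where "d t = \<i> * ((y - x) / 2) * (of_real 0 - of_real pi) * exp (\<i> * of_real (linepath pi 0 t))" for t
  have d: "vector_derivative c (at t) = d t" for t
    unfolding c_def upper_arc_def d_def by (subst vector_derivative_part_circlepath) simp
  have cd: "continuous_on A d" for A unfolding d_def linepath_def by (intro continuous_intros)
  have cc: "continuous_on {0..1} c" unfolding c_def using valid_path_imp_path[OF valid_path_upper_arc] by (simp add: path_def)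
  define \<delta> where "\<delta> = min \<bar>p - x\<bar> \<bar>p - y\<bar>"
  define U where "U = ball p \<delta>"
  have \<delta>: "\<delta> > 0" using p by (simp add: \<delta>_def)
  have ne: "c t - of_real u \<noteq> 0" if "u \<in> U" "t \<in> {0..1}" for u t
  proof
    assume "c t - of_real u = 0"
    then have "of_real u \<in> path_image (upper_arc x y)" using that(2) by (auto simp: path_image_def c_def) (metis eq_iff_diff_eq_0 image_eqI atLeastAtMost_iff)
    then have "u = x \<or> u = y" using upper_arc_image[OF xy] by auto
    then show False using that(1) by (auto simp: U_def \<delta>_def dist_real_def abs_minus_commute)
  qed
  have gc: "continuous_on {0..1} (\<lambda>t. g (c t))"
    by (rule continuous_on_compose2[OF g cc]) (auto simp: c_def path_image_def)
  have "((\<lambda>u. integral (cbox 0 1) (\<lambda>t. g (c t) * (1 / (c t - of_real u)) * d t)) has_vector_derivative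
      integral (cbox 0 1) (\<lambda>t. g (c t) * (1 / (c t - of_real p))\<^sup>2 * d t)) (at p within U)"
  proof (rule leibniz_rule_vector_derivative)
    fix u t assume ut: "u \<in> U" "t \<in> cbox (0::real) 1"
    have "((\<lambda>v. g (c t) * (1 / (c t - v)) * d t) has_field_derivative g (c t) * (1 / (c t - of_real u))\<^sup>2 * d t) (at (of_real u))"
      using ne[of u t] ut by (auto intro!: derivative_eq_intros simp: power2_eq_square)
    then show "((\<lambda>u. g (c t) * (1 / (c t - of_real u)) * d t) has_vector_derivative g (c t) * (1 / (c t - of_real u))\<^sup>2 * d t) (at u within U)"
      by (rule has_vector_derivative_real_field)
  next
    fix u assume "u \<in> U"
    then show "(\<lambda>t. g (c t) * (1 / (c t - of_real u)) * d t) integrable_on cbox 0 1"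
      using ne by (intro integrable_continuous continuous_intros gc[simplified] cc[simplified] cd) (auto intro: gc cc)
  next
    have "continuous_on (U \<times> {0..1}) (\<lambda>w. g (c (snd w)) * (1 / (c (snd w) - of_real (fst w)))\<^sup>2 * d (snd w))"
      using ne
      by (intro continuous_intros continuous_on_compose2[OF gc] continuous_on_compose2[OF cc] continuous_on_compose2[OF cd[of "{0..1}"]]) auto
    then show "continuous_on (U \<times> cbox 0 1) (\<lambda>(u, t). g (c t) * (1 / (c t - of_real u))\<^sup>2 * d t)"
      by (simp add: case_prod_unfold)
  qed (use \<delta> in \<open>auto simp: U_def\<close>)
  moreover have "at p within U = at p" using \<delta> by (intro at_within_open) (auto simp: U_def)
  ultimately show ?thesis
    unfolding arc_integral_def contour_integral_integral c_def[symmetric] d by simp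
qed

context gap_surface
begin

section \<open>Derivatives of the curve polynomial and of its roots\<close>

definition curve_coeff :: "nat \<Rightarrow> real" where
  "curve_coeff = (SOME c. \<forall>z::complex. (\<Prod>e\<in>ends. z - of_real e) = (\<Sum>n\<le>card ends. of_real (c n) * z ^ n))"

lemma curve_poly_coeff: "curve_poly z = (\<Sum>n\<le>2*N. of_real (curve_coeff n) * z ^ n)"
  using someI_ex[OF prod_linear_factors[OF finite_ends]] unfolding curve_poly_ends curve_coeff_def card_ends by blast

lemma rcurve_coeff: "rcurve x = (\<Sum>n\<le>2*N. curve_coeff n * x ^ n)"
proof -
  have "complex_of_real (rcurve x) = of_real (\<Sum>n\<le>2*N. curve_coeff n * x ^ n)"
    by (simp add: curve_poly_of_real[symmetric] curve_poly_coeff)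
  then show ?thesis by (simp only: of_real_eq_iff)
qed

definition curve_deriv :: "'x :: real_field \<Rightarrow> 'x" where
  "curve_deriv z = (\<Sum>n\<le>2*N. of_real (curve_coeff n) * (of_nat n * z ^ (n - 1)))"

lemma curve_poly_deriv: "(curve_poly has_field_derivative curve_deriv z) (at z)"
proof -
  have "((\<lambda>z. \<Sum>n\<le>2*N. of_real (curve_coeff n) * z ^ n) has_field_derivative curve_deriv z) (at z)"
    unfolding curve_deriv_def by (auto intro!: derivative_eq_intros sum.cong simp: One_nat_def)
  moreover have "curve_poly = (\<lambda>z. \<Sum>n\<le>2*N. of_real (curve_coeff n) * z ^ n)" by (rule ext) (rule curve_poly_coeff)
  ultimately show ?thesis by simp
qed

lemma rcurve_deriv: "(rcurve has_real_derivative curve_deriv x) (at x)"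
proof -
  have "((\<lambda>x. \<Sum>n\<le>2*N. curve_coeff n * x ^ n) has_real_derivative curve_deriv x) (at x)"
    unfolding curve_deriv_def by (auto intro!: derivative_eq_intros sum.cong simp: One_nat_def)
  moreover have "rcurve = (\<lambda>x. \<Sum>n\<le>2*N. curve_coeff n * x ^ n)" by (rule ext) (rule rcurve_coeff)
  ultimately show ?thesis by simp
qed

text \<open>This is \<open>y y' = curve_deriv p * p' / 2\<close> with
  \<open>p' = - r sin \<theta>\<close>, divided by \<open>y\<close>. Factoring the two gap ends out
  of the polynomial makes the computation valid also at the branch points, where
  \<open>y = 0\<close>.\<close>

lemma gap_height_deriv:
  assumes j: "j \<in> {1..N-1}"
  shows "(gap_height j has_real_derivative - curve_deriv (gap_point j \<theta>) / (2 * gap_root j (gap_point j \<theta>))) (at \<theta>)"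
proof -
  define Q where "Q x = - (\<Prod>e\<in>other_ends j. x - e)" for x
  define r where "r = gap_rad j"
  let ?x = "gap_point j \<theta>"
  note bd = gap_point_bounds[OF j]
  obtain c where c: "\<And>z::complex. (\<Prod>e\<in>other_ends j. z - of_real e) = (\<Sum>n\<le>card (other_ends j). of_real (c n) * z ^ n)"
    using prod_linear_factors[OF finite_other_ends] by blast
  have Qc: "Q x = - (\<Sum>n\<le>card (other_ends j). c n * x ^ n)" for x
  proof -
    have "complex_of_real (- Q x) = of_real (\<Sum>n\<le>card (other_ends j). c n * x ^ n)"
      using c[of "of_real x"] by (simp add: Q_def)
    then show ?thesis unfolding of_real_eq_iff by linarith
  qed
  obtain Q' where Q': "(Q has_real_derivative Q') (at ?x)"
  proof -
    have "((\<lambda>x. - (\<Sum>n\<le>card (other_ends j). c n * x ^ n)) has_real_derivative - (\<Sum>n\<le>card (other_ends j). c n * (of_nat n * ?x ^ (n - 1)))) (at ?x)"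
      by (auto intro!: derivative_eq_intros sum.cong simp: One_nat_def)
    moreover have "Q = (\<lambda>x. - (\<Sum>n\<le>card (other_ends j). c n * x ^ n))" by (rule ext) (rule Qc)
    ultimately show ?thesis using that by metis
  qed
  have root: "gap_root j x = sqrt (Q x)" "Q x > 0" if "a j < x" "x < b (j + 1)" for x
  proof -
    have "(gap_root j x)\<^sup>2 = Q x" unfolding Q_def by (rule gap_root_sq'[OF j that])
    moreover have "gap_root j x > 0" by (rule gap_croot_real(2)[OF j that])
    ultimately show "gap_root j x = sqrt (Q x)" "Q x > 0"
      using real_sqrt_unique[of "gap_root j x" "Q x"] zero_less_power[of "gap_root j x" 2] by auto
  qed
  let ?s = "sqrt (Q ?x)"
  have s: "?s > 0" "?s * ?s = Q ?x" using root(2)[OF bd(3)[of \<theta>] bd(4)[of \<theta>]] by auto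
  have Dx: "(gap_point j has_real_derivative - r * sin \<theta>) (at \<theta>)"
    unfolding gap_point_def r_def by (auto intro!: derivative_eq_intros)
  have "(rcurve has_real_derivative ((a (j+1) - ?x) - (?x - b j)) * Q ?x + (?x - b j) * (a (j+1) - ?x) * Q') (at ?x)"
  proof -
    have "rcurve = (\<lambda>x. (x - b j) * (a (j+1) - x) * Q x)"
      by (rule ext) (simp add: rcurve_def prod_other_ends[OF j] Q_def algebra_simps)
    then show ?thesis by (auto intro!: derivative_eq_intros Q' simp: algebra_simps)
  qed
  then have cd: "curve_deriv ?x = ((a (j+1) - ?x) - (?x - b j)) * Q ?x + (?x - b j) * (a (j+1) - ?x) * Q'"
    using DERIV_unique rcurve_deriv by blast
  have "(?x - b j) * (a (j+1) - ?x) = r\<^sup>2 * (1 - (cos \<theta>)\<^sup>2)"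
    unfolding gap_point_ends r_def by (simp add: power2_eq_square algebra_simps)
  then have e: "(?x - b j) * (a (j+1) - ?x) = r\<^sup>2 * (sin \<theta>)\<^sup>2" by (simp add: sin_squared_eq)
  have e': "(a (j+1) - ?x) - (?x - b j) = - (2 * r * cos \<theta>)"
    unfolding gap_point_ends r_def by (simp add: algebra_simps)
  have "gap_height j = (\<lambda>\<theta>. r * sin \<theta> * sqrt (Q (gap_point j \<theta>)))"
    by (rule ext) (simp add: gap_height_def r_def root(1)[OF bd(3,4)])
  moreover have "((\<lambda>\<theta>. r * sin \<theta> * sqrt (Q (gap_point j \<theta>))) has_real_derivative
      r * cos \<theta> * ?s + r * sin \<theta> * (Q' * (- r * sin \<theta>) * (inverse ?s / 2))) (at \<theta>)"
    using abs_of_pos[of "Q ?x"] root(2)[OF bd(3)[of \<theta>] bd(4)[of \<theta>]]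
    by (auto intro!: derivative_eq_intros DERIV_chain2[OF Q' Dx] simp: algebra_simps)
  moreover have "r * cos \<theta> * ?s + r * sin \<theta> * (Q' * (- r * sin \<theta>) * (inverse ?s / 2)) = - curve_deriv ?x / (2 * gap_root j ?x)"
  proof -
    have "- curve_deriv ?x = 2 * r * cos \<theta> * (?s * ?s) - r\<^sup>2 * (sin \<theta>)\<^sup>2 * Q'"
      unfolding cd e e' s(2) by simp
    then show ?thesis unfolding root(1)[OF bd(3,4)] using s(1) by (simp add: field_simps power2_eq_square)
  qed
  ultimately show ?thesis by simp
qed

lemma upper_root_deriv:
  assumes "z \<in> slit_plane ends"
  shows "(upper_root has_field_derivative curve_deriv z / (2 * upper_root z)) (at z)"
proof -
  have "upper_root field_differentiable at z"
    using upper_root_holomorphic[OF order_refl] open_slit_plane[OF finite_ends] assms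
    by (meson holomorphic_on_imp_differentiable_at)
  then obtain D where D: "(upper_root has_field_derivative D) (at z)" by (auto simp: field_differentiable_def)
  have "((\<lambda>z. (upper_root z)\<^sup>2) has_field_derivative 2 * upper_root z * D) (at z)"
    by (auto intro!: derivative_eq_intros D simp: power2_eq_square)
  then have "(curve_poly has_field_derivative 2 * upper_root z * D) (at z)" by (simp add: upper_root_sq[abs_def])
  then have "2 * upper_root z * D = curve_deriv z" using DERIV_unique curve_poly_deriv by blast
  then show ?thesis using D upper_root_nz[OF assms order_refl] by (metis nonzero_mult_div_cancel_left mult_eq_0_iff zero_neq_numeral)
qed

lemma curve_deriv_real_fun: "real_fun E curve_deriv"
  unfolding curve_deriv_def
  by (intro real_fun_sum real_fun_cmult real_fun_mult real_fun_power real_fun_ident) (use real_fun_const[of _ "real n" for n] in simp)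

lemma curve_poly_real_fun: "real_fun E curve_poly"
  unfolding curve_poly_coeff[abs_def]
  by (intro real_fun_sum real_fun_cmult real_fun_power real_fun_ident)

text \<open>Divided by \<open>w\<close>, the function is the derivative of
  \<open>w / (z - p)\<close>. That primitive is real at both ends of the ring arc and imaginary at
  the ends of every gap arc, so all periods vanish.\<close>

lemma reduced_period_exact:
  assumes cr: "crossing k x (insert p ends)"
  shows "reduced_period x (\<lambda>z. of_real (1/2) * (curve_deriv z * (1 / (z - of_real p))) + of_real (-1) * (curve_poly z * (1 / (z - of_real p))\<^sup>2)) = 0"
    (is "reduced_period x ?f = 0")
proof -
  let ?E = "insert p ends"
  note C = crossingD[OF cr]
  have G: "((\<lambda>z. upper_root z * (1 / (z - of_real p))) has_field_derivative ?f z / upper_root z) (at z)" if "z \<in> slit_plane ?E" for z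
  proof -
    have z: "z \<in> slit_plane ends" using that slit_plane_mono[of ends ?E] by auto
    have zp: "z - of_real p \<noteq> 0" using that by (auto simp: slit_plane_def)
    have W: "upper_root z \<noteq> 0" using upper_root_nz[OF z order_refl] .
    have "((\<lambda>z. upper_root z * (1 / (z - of_real p))) has_field_derivative
       curve_deriv z / (2 * upper_root z) * (1 / (z - of_real p)) + upper_root z * (- (1 / (z - of_real p))\<^sup>2)) (at z)"
    proof -
      have inv: "((\<lambda>z. 1 / (z - of_real p)) has_field_derivative - (1 / (z - of_real p))\<^sup>2) (at z)"
        using zp by (auto intro!: derivative_eq_intros simp: power2_eq_square)
      show ?thesis using DERIV_mult[OF upper_root_deriv[OF z] inv] by (simp add: mult.commute)
    qed
    moreover have "curve_deriv z / (2 * upper_root z) * (1 / (z - of_real p)) + upper_root z * (- (1 / (z - of_real p))\<^sup>2) = ?f z / upper_root z"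
      using W upper_root_sq[of z] by (simp add: field_simps power2_eq_square)
    ultimately show ?thesis by simp
  qed
  have Im0: "Im (r / (of_real u - of_real v)) = 0" if "Im r = 0" for r and u v :: real
    using that by (simp add: Im_divide_of_real flip: of_real_diff)
  have Re0: "Re (r / (of_real u - of_real v)) = 0" if "Re r = 0" for r and u v :: real
    using that by (simp add: Re_divide_of_real flip: of_real_diff)
  have "Im (upper_root (of_real x)) = 0" "Im (upper_root (of_real base_point)) = 0"
    unfolding complex_is_Real_iff[symmetric]
    using upper_root_gap_real[OF C(1), of x] upper_root_left_real[of base_point] cr by (auto simp: crossing_def base_point_def)
  then have r0: "ring_period x ?f = 0"
    unfolding ring_period_def using arc_integral_primitive[OF G C(2-4)] by (simp add: Im0)
  moreover have "gap_period i ?f = 0" if i: "i \<in> {1..N-1}" for i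
    unfolding gap_period_def
    using arc_integral_primitive[OF G cut_left_right(5)[OF i] cut_left_right_notin[OF C(5) i]]
      upper_root_cut_imag[OF gap_index(1)[OF i], of "cut_left i"] upper_root_cut_imag[OF gap_index(2)[OF i], of "cut_right i"] cut_left_right[OF i]
    by (simp add: Re0)
  ultimately show ?thesis by (simp add: reduced_period_def)
qed

lemma arc_cong_slit:
  assumes "x < y" "x \<notin> E" "y \<notin> E" "\<And>z. z \<in> slit_plane E \<Longrightarrow> f z = g z"
  shows "arc_integral (\<lambda>z. f z / upper_root z) x y = arc_integral (\<lambda>z. g z / upper_root z) x y"
  using assms by (intro arc_integral_cong[of x y E]) auto

lemma reduced_period_cong:
  assumes cr: "crossing k x E" and eq: "\<And>z. z \<in> slit_plane E \<Longrightarrow> f z = g z"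
  shows "reduced_period x f = reduced_period x g"
proof -
  have "gap_period i f = gap_period i g" if "i \<in> {1..N-1}" for i
    unfolding gap_period_def
    using arc_cong_slit[OF cut_left_right(5)[OF that] cut_left_right_notin[OF crossingD(5)[OF cr] that] eq] by simp
  moreover have "ring_period x f = ring_period x g"
    unfolding ring_period_def using arc_cong_slit[OF crossingD(2-4)[OF cr] eq] by simp
  ultimately show ?thesis by (simp add: reduced_period_def)
qed

text \<open>Over the gap the integrand is real, so moving the crossing point does not affect the
  imaginary part.\<close>

lemma ring_period_gap_indep:
  assumes k: "k \<in> {1..N-1}" and f: "real_fun ends f" and x: "b k < x" "x < a (k+1)" "b k < x'" "x' < a (k+1)"
  shows "ring_period x f = ring_period x' f"
proof -
  obtain G where G: "\<And>z. z \<in> slit_plane ends \<Longrightarrow> (G has_field_derivative f z / upper_root z) (at z)"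
    using primitive_quotient[OF admissible_ends f] by blast
  have cr: "crossing k u ends" if "b k < u" "u < a (k+1)" for u
    using k that gap_not_ends[OF k that] admissible_ends by (simp add: crossing_def)
  have "Im (G (of_real x)) = Im (G (of_real x'))"
  proof (rule Im_primitive_eq[of "b k" "a (k+1)" G "\<lambda>t. f (of_real t) / upper_root (of_real t)"])
    fix t assume t: "b k < t" "t < a (k+1)"
    show "(G has_field_derivative f (of_real t) / upper_root (of_real t)) (at (of_real t))"
      using G gap_not_ends[OF k t] by (simp add: real_in_slit_plane)
    show "Im (f (of_real t) / upper_root (of_real t)) = 0"
      using real_fun_real[OF f, of t] upper_root_gap_real[OF k, of t] t by (auto elim!: Reals_cases)
  qed (use x in auto)
  then show ?thesis
    unfolding ring_period_def
    using arc_integral_primitive[OF G crossingD(2-4)[OF cr[OF x(1,2)]]] arc_integral_primitive[OF G crossingD(2-4)[OF cr[OF x(3,4)]]] by simp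
qed

lemma reduced_period_gap_indep:
  assumes k: "k \<in> {1..N-1}" and f: "real_fun ends f" and x: "b k < x" "x < a (k+1)" "b k < x'" "x' < a (k+1)"
  shows "reduced_period x f = reduced_period x' f"
  unfolding reduced_period_def using ring_period_gap_indep[OF k f x] ring_period_gap_indep[OF k rpoly_real_fun x] by simp

section \<open>Moments and the interchange kernel\<close>

definition moment :: "nat \<Rightarrow> nat \<Rightarrow> real" where "moment k m = reduced_period (gap_mid k) (\<lambda>z. z ^ m)"

lemma gap_mid_bounds: "k \<in> {1..N-1} \<Longrightarrow> b k < gap_mid k \<and> gap_mid k < a (k + 1)"
proof -
  assume "k \<in> {1..N-1}"
  then have "b k < a (k + 1)" by (rule gap_pos)
  then show "b k < gap_mid k \<and> gap_mid k < a (k + 1)" unfolding gap_mid_def by auto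
qed

lemma rpoly_single: "m < N - 1 \<Longrightarrow> rpoly (\<lambda>i. if i = m then 1 else 0) x = x ^ m"
proof -
  assume m: "m < N - 1"
  have "rpoly (\<lambda>i. if i = m then 1 else 0) x = (\<Sum>i<N-1. if i = m then x ^ i else 0)"
    unfolding rpoly_def by (intro sum.cong) auto
  then show ?thesis using m by simp
qed

lemma moment_eq: "crossing k x E \<Longrightarrow> reduced_period x (\<lambda>z. z ^ m) = moment k m"
  unfolding moment_def using gap_mid_bounds[of k]
  by (intro reduced_period_gap_indep real_fun_power real_fun_ident) (auto simp: crossing_def)

lemma moment_low: "k \<in> {1..N-1} \<Longrightarrow> m < N - 1 \<Longrightarrow> moment k m = 0"
proof -
  assume k: "k \<in> {1..N-1}" and m: "m < N - 1"
  have cr: "crossing k (gap_mid k) ends"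
    using k gap_mid_bounds[OF k] gap_not_ends[OF k] admissible_ends by (simp add: crossing_def)
  have "(\<lambda>z::complex. z ^ m) = rpoly (\<lambda>i. if i = m then 1 else 0)"
    by (intro ext) (simp add: rpoly_single[OF m])
  then show "moment k m = 0" unfolding moment_def using reduced_period_rpoly[OF cr] by simp
qed

definition low :: "(real \<Rightarrow> real) \<Rightarrow> bool" where "low f \<longleftrightarrow> (\<exists>c. \<forall>p. f p = rpoly c p)"

lemma low_sum: "finite I \<Longrightarrow> (\<And>i. i \<in> I \<Longrightarrow> low (f i)) \<Longrightarrow> low (\<lambda>p. \<Sum>i\<in>I. f i p)"
proof (induction I rule: finite_induct)
  case empty
  show ?case unfolding low_def by (intro exI[of _ "\<lambda>_. 0"]) (simp add: rpoly_def)
next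
  case (insert i I)
  then have "low (f i)" "low (\<lambda>p. \<Sum>i\<in>I. f i p)" by auto
  then obtain c d where "\<forall>p. f i p = rpoly c p" "\<forall>p. (\<Sum>i\<in>I. f i p) = rpoly d p" unfolding low_def by blast
  then show ?case using insert unfolding low_def
    by (intro exI[of _ "\<lambda>m. c m + d m"]) (simp add: rpoly_def distrib_right sum.distrib)
qed

lemma low_cmult: "low f \<Longrightarrow> low (\<lambda>p. r * f p)"
proof -
  assume "low f"
  then obtain c where "\<forall>p. f p = rpoly c p" unfolding low_def by blast
  then show ?thesis unfolding low_def
    by (intro exI[of _ "\<lambda>m. r * c m"]) (simp add: rpoly_def sum_distrib_left mult.assoc)
qed

lemma low_power: "m < N - 1 \<Longrightarrow> low (\<lambda>p. p ^ m)"
  unfolding low_def by (intro exI[of _ "\<lambda>i. if i = m then 1 else 0"]) (simp add: rpoly_single)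

lemma low_zero: "low (\<lambda>p. 0)"
  unfolding low_def by (intro exI[of _ "\<lambda>_. 0"]) (simp add: rpoly_def)

text \<open>Modulo the exact differential of \<open>w / (z - p)\<close> the integrand of \<open>kernel_period_eq\<close> below is a
  polynomial in \<open>z\<close> and \<open>p\<close> over \<open>w\<close>. The part due to the monomial of degree \<open>n\<close> in \<open>curve_poly\<close> is
  antisymmetric and homogeneous of degree \<open>n - 2\<close>. Since moments of order below \<open>N - 1\<close> vanish, only
  powers of \<open>p\<close> below \<open>N - 1\<close> survive.\<close>

definition kernel_period :: "nat \<Rightarrow> real \<Rightarrow> real" where
  "kernel_period k p = (\<Sum>n\<le>2*N. curve_coeff n * (\<Sum>i<n-1. (real (2 * i + 2) - real n) / 2 * moment k i * p ^ (n - 2 - i)))"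

lemma kernel_period_low:
  assumes k: "k \<in> {1..N-1}"
  shows "\<exists>c. \<forall>p. kernel_period k p = rpoly c p"
proof -
  have summand: "low (\<lambda>p. (real (2 * i + 2) - real n) / 2 * moment k i * p ^ (n - 2 - i))" if "n \<le> 2 * N" "i < n - 1" for n i
  proof -
    have "i < N - 1 \<or> (n = 2 * N \<and> i = N - 1) \<or> n - 2 - i < N - 1"
      using that N2 by arith
    then consider "i < N - 1" | "n = 2 * N" "i = N - 1" | "n - 2 - i < N - 1" by blast
    then show ?thesis
    proof cases
      case 1 then show ?thesis using moment_low[OF k] low_zero by simp
    next
      \<comment> \<open>Here the moment and the power of \<open>p\<close> both have order
        \<open>N - 1\<close>; antisymmetry makes this middle coefficient zero.\<close>
      case 2 then show ?thesis using N2 low_zero by (simp add: of_nat_diff)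
    next
      case 3 then show ?thesis by (intro low_cmult low_power)
    qed
  qed
  have "low (\<lambda>p. curve_coeff n * (\<Sum>i<n-1. (real (2 * i + 2) - real n) / 2 * moment k i * p ^ (n - 2 - i)))"
    if "n \<le> 2 * N" for n
    by (rule low_cmult, rule low_sum, simp, rule summand[OF that], simp)
  then have "low (kernel_period k)" unfolding kernel_period_def[abs_def]
    by (intro low_sum) auto
  then show ?thesis unfolding low_def .
qed

lemma kernel_period_eq:
  assumes cr: "crossing k x (insert p ends)"
  shows "curve_deriv p / 2 * reduced_period x (\<lambda>z. 1 / (z - of_real p)) + rcurve p * reduced_period x (\<lambda>z. (1 / (z - of_real p))\<^sup>2)
    = kernel_period k p"
proof -
  let ?E = "insert p ends"
  let ?u = "\<lambda>z. 1 / (z - complex_of_real p)"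
  have ru: "real_fun ?E ?u" "real_fun ?E (\<lambda>z. (?u z)\<^sup>2)" by (intro real_fun_power real_fun_pole; simp)+
  let ?f = "\<lambda>z. of_real (curve_deriv p / 2) * ?u z + of_real (rcurve p) * (?u z)\<^sup>2"
  let ?g = "\<lambda>z. of_real (1/2) * (curve_deriv z * ?u z) + of_real (-1) * (curve_poly z * (?u z)\<^sup>2)"
  let ?R = "\<lambda>z. \<Sum>n\<le>2*N. of_real (curve_coeff n) * (\<Sum>i<n-1. of_real ((real (2 * i + 2) - real n) / 2 * p ^ (n - 2 - i)) * z ^ i)"
  have rf: "real_fun ?E ?f" by (intro real_fun_add real_fun_cmult ru)
  have rg: "real_fun ?E ?g"
    by (intro real_fun_add real_fun_cmult real_fun_mult ru curve_deriv_real_fun curve_poly_real_fun)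
  have "curve_deriv p / 2 * reduced_period x ?u + rcurve p * reduced_period x (\<lambda>z. (?u z)\<^sup>2) = reduced_period x ?f"
    by (simp only: reduced_period_add[OF cr real_fun_cmult[OF ru(1)] real_fun_cmult[OF ru(2)]] reduced_period_cmult[OF cr ru(1)] reduced_period_cmult[OF cr ru(2)])
  \<comment> \<open>Adding the exact form changes no reduced period and cancels the pole at
    \<open>p\<close>.\<close>
  also have "\<dots> = reduced_period x (\<lambda>z. ?f z + ?g z)"
    unfolding reduced_period_add[OF cr rf rg] reduced_period_exact[OF cr] by simp
  also have "\<dots> = reduced_period x ?R"
  proof (rule reduced_period_cong[OF cr])
    fix z assume "z \<in> slit_plane ?E"
    then have zp: "z - of_real p \<noteq> 0" by (auto simp: slit_plane_def)
    have "?f z + ?g z = ((curve_deriv z + of_real (curve_deriv p)) / 2 * (z - of_real p) - (curve_poly z - of_real (rcurve p))) / (z - of_real p)\<^sup>2"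
    proof -
      have "B / 2 * (1 / d) + D * (1 / d)\<^sup>2 + (1 / 2 * (A * (1 / d)) + (-1) * (C * (1 / d)\<^sup>2)) = ((A + B) / 2 * d - (C - D)) / d\<^sup>2"
        if "d \<noteq> 0" for A B C D d :: complex
        using that by (simp add: field_simps power2_eq_square)
      from this[OF zp] show ?thesis by simp
    qed
    also have "(curve_deriv z + of_real (curve_deriv p)) / 2 * (z - of_real p) - (curve_poly z - of_real (rcurve p)) =
       (\<Sum>n\<le>2*N. of_real (curve_coeff n) * ((of_nat n * z ^ (n - 1) + of_nat n * of_real p ^ (n - 1)) / 2 * (z - of_real p) - (z ^ n - of_real p ^ n)))"
      unfolding curve_poly_coeff rcurve_coeff curve_deriv_def
      by (simp add: sum_distrib_left sum_distrib_right sum_divide_distrib algebra_simps flip: sum.distrib sum_subtractf)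
    also have "\<dots> = (z - of_real p)\<^sup>2 * ?R z"
      unfolding mixed_kernel_power sum_distrib_left by (intro sum.cong refl) (simp add: mult_ac)
    finally show "?f z + ?g z = ?R z" using zp by simp
  qed
  also have "\<dots> = kernel_period k p"
  proof -
    let ?c = "\<lambda>n i. (real (2 * i + 2) - real n) / 2 * p ^ (n - 2 - i)"
    have rfi: "real_fun ?E (\<lambda>z. of_real (?c n i) * z ^ i)" for n i
      by (intro real_fun_cmult real_fun_power real_fun_ident)
    have "reduced_period x (\<lambda>z. of_real (?c n i) * z ^ i) = ?c n i * moment k i" for n i
      using reduced_period_cmult[OF cr real_fun_power[OF real_fun_ident], of "?c n i" i] moment_eq[OF cr, of i] by simp
    moreover have "reduced_period x (\<lambda>z. \<Sum>i<n-1. of_real (?c n i) * z ^ i) = (\<Sum>i<n-1. reduced_period x (\<lambda>z. of_real (?c n i) * z ^ i))" for n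
      by (rule reduced_period_sum[OF cr]) (rule rfi, simp)
    ultimately have inner: "reduced_period x (\<lambda>z. \<Sum>i<n-1. of_real (?c n i) * z ^ i) = (\<Sum>i<n-1. ?c n i * moment k i)" for n
      by presburger
    have rfn: "real_fun ?E (\<lambda>z. \<Sum>i<n-1. of_real (?c n i) * z ^ i)" for n
      by (rule real_fun_sum) (rule rfi)
    have n: "reduced_period x (\<lambda>z. of_real (curve_coeff n) * (\<Sum>i<n-1. of_real (?c n i) * z ^ i)) = curve_coeff n * (\<Sum>i<n-1. ?c n i * moment k i)" for n
      unfolding reduced_period_cmult[OF cr rfn] inner ..
    have "reduced_period x ?R = (\<Sum>n\<le>2*N. reduced_period x (\<lambda>z. of_real (curve_coeff n) * (\<Sum>i<n-1. of_real (?c n i) * z ^ i)))"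
      by (rule reduced_period_sum[OF cr]) (rule real_fun_cmult, rule rfn, simp)
    then show ?thesis unfolding n kernel_period_def by (simp only: mult_ac)
  qed
  finally show ?thesis .
qed

end

section \<open>The periods as functions of the angles\<close>

lemma const_on_interval:
  fixes f :: "real \<Rightarrow> real"
  assumes "u \<le> v" "\<And>s. u \<le> s \<Longrightarrow> s \<le> v \<Longrightarrow> (f has_real_derivative 0) (at s)"
  shows "f u = f v"
proof (cases "u = v")
  case False
  then show ?thesis
    using assms by (intro DERIV_isconst_end[symmetric] continuous_at_imp_continuous_on ballI) (auto intro: DERIV_isCont)
qed simp

context gap_surface
begin

section \<open>Differentiating periods with respect to the pole\<close>

lemma arc_pole_deriv:
  assumes xy: "x < y" "x \<notin> ends" "y \<notin> ends" and p: "p \<noteq> x" "p \<noteq> y"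
  shows "((\<lambda>p. arc_integral (\<lambda>z. 1 / (z - of_real p) / upper_root z) x y) has_vector_derivative
    arc_integral (\<lambda>z. (1 / (z - of_real p))\<^sup>2 / upper_root z) x y) (at p)"
proof -
  have "(\<lambda>z. 1 / upper_root z) holomorphic_on slit_plane ends"
    by (intro holomorphic_intros upper_root_holomorphic upper_root_nz) auto
  then have "continuous_on (path_image (upper_arc x y)) (\<lambda>z. 1 / upper_root z)"
    using upper_arc_in_slit_plane[OF xy] holomorphic_on_imp_continuous_on continuous_on_subset by blast
  from upper_arc_pole_deriv[OF xy(1) p this] show ?thesis by (simp add: mult.commute)
qed

lemma reduced_period_pole_deriv:
  assumes cr: "crossing k x (insert p ends)"
  shows "((\<lambda>p. reduced_period x (\<lambda>z. 1 / (z - of_real p))) has_real_derivative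
    reduced_period x (\<lambda>z. (1 / (z - of_real p))\<^sup>2)) (at p)"
proof -
  note C = crossingD[OF cr]
  have "((\<lambda>p. ring_period x (\<lambda>z. 1 / (z - of_real p))) has_real_derivative ring_period x (\<lambda>z. (1 / (z - of_real p))\<^sup>2)) (at p)"
    unfolding ring_period_def using C(2-4) by (intro has_field_derivative_Im arc_pole_deriv) auto
  moreover have "((\<lambda>p. gap_period i (\<lambda>z. 1 / (z - of_real p))) has_real_derivative gap_period i (\<lambda>z. (1 / (z - of_real p))\<^sup>2)) (at p)"
    if i: "i \<in> {1..N-1}" for i
    unfolding gap_period_def using cut_left_right_notin[OF C(5) i] cut_left_right(5)[OF i]
    by (intro has_field_derivative_Re arc_pole_deriv) auto
  ultimately show ?thesis
    unfolding reduced_period_def by (intro DERIV_diff DERIV_sum DERIV_cmult_right) auto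
qed

text \<open>Numerator of the holomorphic differential in the variable \<open>p\<close> that the
  interchange produces from the \<open>k\<close>-th period.\<close>

definition period_poly :: "nat \<Rightarrow> nat \<Rightarrow> real" where
  "period_poly k = (SOME c. \<forall>p. kernel_period k p = rpoly c p)"

lemma period_poly: "k \<in> {1..N-1} \<Longrightarrow> kernel_period k p = rpoly (period_poly k) p"
  using someI_ex[OF kernel_period_low] unfolding period_poly_def by blast

definition pole_period :: "real \<Rightarrow> nat \<Rightarrow> real \<Rightarrow> real" where
  "pole_period x j \<theta> = gap_height j \<theta> * reduced_period x (\<lambda>z. 1 / (z - of_real (gap_point j \<theta>)))"

text \<open>By the product rule, with the derivative of the height and
  \<open>y p' = - rcurve p / gap_root\<close>, the result is minus the left side of
  \<open>kernel_period_eq\<close> over \<open>gap_root\<close>. Here a period in \<open>z\<close>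
  becomes an integrand in the angle of the pole.\<close>

lemma pole_period_deriv:
  assumes cr: "crossing k x (insert (gap_point j \<theta>) ends)" and j: "j \<in> {1..N-1}"
  shows "(pole_period x j has_real_derivative - (rpoly (period_poly k) (gap_point j \<theta>) / gap_root j (gap_point j \<theta>))) (at \<theta>)"
proof -
  let ?p = "gap_point j \<theta>" and ?L = "\<lambda>p. reduced_period x (\<lambda>z. 1 / (z - of_real p))"
  let ?L2 = "reduced_period x (\<lambda>z. (1 / (z - of_real ?p))\<^sup>2)" and ?\<kappa> = "gap_root j ?p"
  have \<kappa>: "?\<kappa> > 0" by (rule gap_root_pos[OF j])
  have Dx: "(gap_point j has_real_derivative - gap_rad j * sin \<theta>) (at \<theta>)"
    unfolding gap_point_def by (auto intro!: derivative_eq_intros)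
  have "((\<lambda>\<theta>. ?L (gap_point j \<theta>)) has_real_derivative ?L2 * (- gap_rad j * sin \<theta>)) (at \<theta>)"
    by (rule DERIV_chain2[OF reduced_period_pole_deriv[OF cr] Dx])
  from DERIV_mult[OF gap_height_deriv[OF j, of \<theta>] this]
  have "(pole_period x j has_real_derivative
    - curve_deriv ?p / (2 * ?\<kappa>) * ?L ?p + ?L2 * (- gap_rad j * sin \<theta>) * gap_height j \<theta>) (at \<theta>)"
    unfolding pole_period_def[abs_def] .
  moreover have "- curve_deriv ?p / (2 * ?\<kappa>) * ?L ?p + ?L2 * (- gap_rad j * sin \<theta>) * gap_height j \<theta>
     = - ((curve_deriv ?p / 2 * ?L ?p + rcurve ?p * ?L2) / ?\<kappa>)"
  proof -
    have "(- gap_rad j * sin \<theta>) * gap_height j \<theta> = - (rcurve ?p / ?\<kappa>)"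
      unfolding gap_height_sq[OF j, symmetric] using \<kappa> by (simp add: gap_height_def power2_eq_square)
    then have "?L2 * (- gap_rad j * sin \<theta>) * gap_height j \<theta> = ?L2 * - (rcurve ?p / ?\<kappa>)" by (simp only: mult.assoc)
    then show ?thesis by (simp add: add_divide_distrib mult.commute)
  qed
  moreover have "curve_deriv ?p / 2 * ?L ?p + rcurve ?p * ?L2 = rpoly (period_poly k) ?p"
    unfolding kernel_period_eq[OF cr] by (rule period_poly[OF crossingD(1)[OF cr]])
  ultimately show ?thesis by simp
qed

definition period_integral :: "nat \<Rightarrow> nat \<Rightarrow> real \<Rightarrow> real" where
  "period_integral k j = (SOME V. V 0 = 0 \<and> (\<forall>s. (V has_real_derivative rpoly (period_poly k) (gap_point j s) / gap_root j (gap_point j s)) (at s)))"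

lemma period_integral:
  assumes j: "j \<in> {1..N-1}"
  shows "period_integral k j 0 = 0"
    "(period_integral k j has_real_derivative rpoly (period_poly k) (gap_point j s) / gap_root j (gap_point j s)) (at s)"
proof -
  obtain G where G: "\<And>s. (G has_real_derivative rpoly (period_poly k) (gap_point j s) / gap_root j (gap_point j s)) (at s)"
    using gap_period_integral(2)[OF j rpoly_holomorphic rpoly_of_real] by blast
  have "\<exists>V. V 0 = 0 \<and> (\<forall>s. (V has_real_derivative rpoly (period_poly k) (gap_point j s) / gap_root j (gap_point j s)) (at s))"
    by (intro exI[of _ "\<lambda>s. G s - G 0"]) (auto intro!: derivative_eq_intros G)
  from someI_ex[OF this] show "period_integral k j 0 = 0"
    "(period_integral k j has_real_derivative rpoly (period_poly k) (gap_point j s) / gap_root j (gap_point j s)) (at s)"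
    unfolding period_integral_def by blast+
qed

lemma period_integral_minus:
  assumes j: "j \<in> {1..N-1}"
  shows "period_integral k j (- \<theta>) = - period_integral k j \<theta>"
proof -
  let ?V = "period_integral k j"
  have "((\<lambda>s. ?V (- s) + ?V s) has_real_derivative 0) (at s)" for s
  proof -
    have "gap_point j (- s) = gap_point j s" by (simp add: gap_point_def)
    then have "((\<lambda>s. ?V (- s)) has_real_derivative (rpoly (period_poly k) (gap_point j s) / gap_root j (gap_point j s)) * -1) (at s)"
      using period_integral(2)[OF j, of k "- s"] by (intro DERIV_chain2[where f = ?V and g = uminus]) (auto intro!: derivative_eq_intros)
    from DERIV_add[OF this period_integral(2)[OF j, of k s]] show ?thesis by simp
  qed
  then have "?V (- \<theta>) + ?V \<theta> = ?V (- 0) + ?V 0"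
    using DERIV_isconst_all[of "\<lambda>s. ?V (- s) + ?V s" \<theta> 0] by blast
  then show ?thesis using period_integral(1)[OF j] by simp
qed

text \<open>The integrand is even and has period 2 pi, so every full turn adds twice the value at
  pi.\<close>

lemma period_integral_shift1:
  assumes j: "j \<in> {1..N-1}"
  shows "period_integral k j (\<theta> + 2 * pi) = period_integral k j \<theta> + 2 * period_integral k j pi"
proof -
  let ?V = "period_integral k j"
  have "((\<lambda>s. ?V (s + 2 * pi) - ?V s) has_real_derivative 0) (at s)" for s
  proof -
    have "gap_point j (s + 2 * pi) = gap_point j s" by (simp add: gap_point_def)
    then have "((\<lambda>s. ?V (s + 2 * pi)) has_real_derivative (rpoly (period_poly k) (gap_point j s) / gap_root j (gap_point j s)) * 1) (at s)"
      using period_integral(2)[OF j, of k "s + 2 * pi"] by (intro DERIV_chain2[where f = ?V and g = "\<lambda>s. s + 2 * pi"]) (auto intro!: derivative_eq_intros)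
    from DERIV_diff[OF this period_integral(2)[OF j, of k s]] show ?thesis by simp
  qed
  then have "?V (\<theta> + 2 * pi) - ?V \<theta> = ?V (- pi + 2 * pi) - ?V (- pi)"
    using DERIV_isconst_all[of "\<lambda>s. ?V (s + 2 * pi) - ?V s" \<theta> "- pi"] by blast
  then show ?thesis using period_integral_minus[OF j, of k pi] by simp
qed

lemma period_integral_shift:
  assumes j: "j \<in> {1..N-1}"
  shows "period_integral k j (\<theta> + 2 * pi * of_int n) = period_integral k j \<theta> + 2 * of_int n * period_integral k j pi"
proof (induction n rule: int_induct[of _ 0])
  case base
  show ?case by simp
next
  case (step1 i)
  have "\<theta> + 2 * pi * of_int (i + 1) = (\<theta> + 2 * pi * of_int i) + 2 * pi" by (simp add: algebra_simps)
  then show ?case using period_integral_shift1[OF j, of k "\<theta> + 2 * pi * of_int i"] step1 by (simp add: algebra_simps)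
next
  case (step2 i)
  have "(\<theta> + 2 * pi * of_int (i - 1)) + 2 * pi = \<theta> + 2 * pi * of_int i" by (simp add: algebra_simps)
  then show ?case using period_integral_shift1[OF j, of k "\<theta> + 2 * pi * of_int (i - 1)"] step2 by (simp add: algebra_simps)
qed

lemma gap_disjoint:
  assumes k: "k \<in> {1..N-1}" and j: "j \<in> {1..N-1}" and x: "b k < x" "x < a (k + 1)" "b j \<le> x" "x \<le> a (j + 1)"
  shows "j = k"
proof -
  consider "j < k" | "j = k" | "k < j" by linarith
  then show ?thesis
  proof cases
    case 1
    then have "a (j+1) \<le> a k" using a_less_iff[OF gap_index(1)[OF k] gap_index(2)[OF j]] by simp
    then show ?thesis using x ab[OF gap_index(1)[OF k]] by linarith
  next
    case 3
    then have "b (k+1) \<le> b j" using b_less_iff[OF gap_index(1)[OF j] gap_index(2)[OF k]] by simp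
    then show ?thesis using x ab[OF gap_index(2)[OF k]] by linarith
  qed
qed

lemma crossing_point:
  assumes k: "k \<in> {1..N-1}" and j: "j \<in> {1..N-1}" and x: "b k < x" "x < a (k + 1)" "x \<noteq> gap_point j \<theta>"
  shows "crossing k x (insert (gap_point j \<theta>) ends)"
  unfolding crossing_def
  using k x gap_not_ends[OF k x(1,2)] admissible_insert[OF admissible_ends j gap_point_bounds(1,2)[OF j, of \<theta>]] by simp

lemma pole_period_sum_deriv:
  assumes "k \<in> {1..N-1}" "j \<in> {1..N-1}" "b k < x" "x < a (k + 1)" "x \<noteq> gap_point j \<theta>"
  shows "((\<lambda>\<theta>. pole_period x j \<theta> + period_integral k j \<theta>) has_real_derivative 0) (at \<theta>)"
  using DERIV_add[OF pole_period_deriv[OF crossing_point[OF assms] assms(2)] period_integral(2)[OF assms(2), of k \<theta>]] by simp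

lemma pole_period_0: "sin \<theta> = 0 \<Longrightarrow> pole_period x j \<theta> = 0"
  by (simp add: pole_period_def gap_height_def)

text \<open>The pole moves in a gap that does not contain the crossing point, so the derivative
  identity holds at all angles; both functions vanish at 0.\<close>

lemma pole_period_other:
  assumes k: "k \<in> {1..N-1}" and j: "j \<in> {1..N-1}" and x: "b k < x" "x < a (k + 1)" and "j \<noteq> k"
  shows "pole_period x j \<theta> = - period_integral k j \<theta>"
proof -
  have "x \<noteq> gap_point j s" for s using gap_disjoint[OF k j x] gap_point_bounds[OF j, of s] \<open>j \<noteq> k\<close> by auto
  then have "pole_period x j \<theta> + period_integral k j \<theta> = pole_period x j 0 + period_integral k j 0"
    using DERIV_isconst_all[of "\<lambda>\<theta>. pole_period x j \<theta> + period_integral k j \<theta>" \<theta> 0] pole_period_sum_deriv[OF k j x] by blast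
  then show ?thesis using period_integral(1)[OF j] pole_period_0[of 0 x j] by simp
qed

text \<open>At pi the height is 0 and with it the pole period.\<close>

lemma period_integral_pi_other:
  assumes "k \<in> {1..N-1}" "j \<in> {1..N-1}" "j \<noteq> k"
  shows "period_integral k j pi = 0"
  using pole_period_other[OF assms(1,2) _ _ assms(3), of "gap_mid k" pi] gap_mid_bounds[OF assms(1)] pole_period_0[of pi] by simp

lemma gap_point_mono:
  assumes "j \<in> {1..N-1}" "0 \<le> s" "s \<le> t" "t \<le> pi"
  shows "gap_point j t \<le> gap_point j s"
  unfolding gap_point_def using assms gap_rad_pos[OF assms(1)] cos_monotone_0_pi_le[of s t] by (simp add: mult_left_mono)

lemma gap_point_abs: "gap_point j \<bar>s\<bar> = gap_point j s"
  by (simp add: gap_point_def)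

text \<open>The angle is moved to 0, that is, the pole to the right end of the gap, without meeting
  \<open>x\<close>.\<close>

lemma pole_period_right:
  assumes k: "k \<in> {1..N-1}" and x: "b k < x" and \<theta>: "- pi \<le> \<theta>" "\<theta> \<le> pi" "x < gap_point k \<theta>"
  shows "pole_period x k \<theta> = - period_integral k k \<theta>"
proof -
  let ?f = "\<lambda>\<theta>. pole_period x k \<theta> + period_integral k k \<theta>"
  have xa: "x < a (k+1)" using \<theta>(3) gap_point_bounds(2)[OF k, of \<theta>] by linarith
  have D: "(?f has_real_derivative 0) (at s)" if "\<bar>s\<bar> \<le> \<bar>\<theta>\<bar>" for s
  proof (rule pole_period_sum_deriv[OF k k x xa])
    have "gap_point k \<bar>\<theta>\<bar> \<le> gap_point k \<bar>s\<bar>" using that \<theta> by (intro gap_point_mono[OF k]) auto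
    then show "x \<noteq> gap_point k s" using \<theta>(3) unfolding gap_point_abs by linarith
  qed
  have "?f \<theta> = ?f 0"
  proof (cases "0 \<le> \<theta>")
    case True
    then show ?thesis using const_on_interval[of 0 \<theta> ?f] D by auto
  next
    case False
    then show ?thesis using const_on_interval[of \<theta> 0 ?f] D by auto
  qed
  then show ?thesis using period_integral(1)[OF k] pole_period_0[of 0 x k] by simp
qed

text \<open>On the way to 0 the pole would meet \<open>x\<close>, so the angle is moved to pi or -
  pi instead, the left end of the gap; this choice is the sign.\<close>

lemma pole_period_left:
  assumes k: "k \<in> {1..N-1}" and x: "x < a (k + 1)" and \<theta>: "- pi \<le> \<theta>" "\<theta> \<le> pi" "gap_point k \<theta> < x"
  shows "pole_period x k \<theta> = (if 0 \<le> \<theta> then 1 else -1) * period_integral k k pi - period_integral k k \<theta>"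
proof -
  let ?f = "\<lambda>\<theta>. pole_period x k \<theta> + period_integral k k \<theta>"
  have xb: "b k < x" using \<theta>(3) gap_point_bounds(1)[OF k, of \<theta>] by linarith
  have D: "(?f has_real_derivative 0) (at s)" if "\<bar>\<theta>\<bar> \<le> \<bar>s\<bar>" "\<bar>s\<bar> \<le> pi" for s
  proof (rule pole_period_sum_deriv[OF k k xb x])
    have "gap_point k \<bar>s\<bar> \<le> gap_point k \<bar>\<theta>\<bar>" using that by (intro gap_point_mono[OF k]) auto
    then show "x \<noteq> gap_point k s" using \<theta>(3) unfolding gap_point_abs by linarith
  qed
  show ?thesis
  proof (cases "0 \<le> \<theta>")
    case True
    then have "?f \<theta> = ?f pi" using const_on_interval[of \<theta> pi ?f] D \<theta> by auto
    then show ?thesis using True pole_period_0[of pi x k] by simp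
  next
    case False
    then have "?f (- pi) = ?f \<theta>" using const_on_interval[of "- pi" \<theta> ?f] D \<theta> by auto
    then show ?thesis using False pole_period_0[of "- pi" x k] period_integral_minus[OF k, of k pi] by simp
  qed
qed

text \<open>Moving the crossing point over the pole changes the period by a half residue.\<close>

lemma ring_period_jump:
  assumes k: "k \<in> {1..N-1}" and x: "b k < x" "x < p" "p < x'" "x' < a (k + 1)"
  shows "ring_period x (\<lambda>z. 1 / (z - of_real p)) - ring_period x' (\<lambda>z. 1 / (z - of_real p)) = pi / Re (upper_root (of_real p))"
proof -
  let ?E = "insert p ends" and ?p = "complex_of_real p"
  define w where "w = Re (upper_root ?p)"
  have pn: "p \<notin> ends" using gap_not_ends[OF k, of p] x by auto
  then have psl: "?p \<in> slit_plane ends" by (simp add: real_in_slit_plane)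
  have wp: "upper_root ?p = of_real w"
    unfolding w_def using upper_root_gap_real[OF k, of p] x by (intro of_real_Re[symmetric]) auto
  have w0: "w \<noteq> 0" using upper_root_nz[OF psl order_refl] wp by auto
  have adm: "admissible ?E" using admissible_insert[OF admissible_ends k, of p] x by auto
  have f: "real_fun ?E (\<lambda>z. 1 / (z - ?p))" by (intro real_fun_pole) simp
  obtain G where G: "\<And>z. z \<in> slit_plane ?E \<Longrightarrow> (G has_field_derivative 1 / (z - ?p) / upper_root z) (at z)"
    using primitive_quotient[OF adm f] by blast
  have cr: "crossing k x ?E" "crossing k x' ?E"
    using k x gap_not_ends[OF k] adm by (auto simp: crossing_def)
  have xx: "x < x'" "x \<notin> ?E" "x' \<notin> ?E" using cr x by (auto simp: crossing_def)
  \<comment> \<open>The value of \<open>1 / w\<close> at \<open>p\<close> is split off. The rest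
    divided by \<open>z - p\<close> is real over the gap, so it adds nothing to the imaginary
    part.\<close>
  define n where "n z = 1 / upper_root z - 1 / of_real w" for z
  have nh: "n holomorphic_on slit_plane ends"
    unfolding n_def using w0 by (intro holomorphic_intros upper_root_holomorphic upper_root_nz) auto
  define g where "g z = (if z = ?p then deriv n ?p else (n z - n ?p) / (z - ?p))" for z
  have gh: "g holomorphic_on slit_plane ends"
    unfolding g_def by (rule pole_lemma_open[OF nh open_slit_plane[OF finite_ends]])
  have np: "n ?p = 0" by (simp add: n_def wp)
  have dec: "1 / (z - ?p) / upper_root z = of_real (1 / w) * (1 / (z - ?p)) + g z" if "z \<in> slit_plane ?E" for z
  proof -
    have "z \<noteq> ?p" using that by (auto simp: slit_plane_def)
    then have "g z = n z / (z - ?p)" by (simp add: g_def np)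
    then show ?thesis by (simp add: n_def diff_divide_distrib mult.commute)
  qed
  obtain Gg where Gg: "\<And>z. z \<in> slit_plane ends \<Longrightarrow> (Gg has_field_derivative g z) (at z)"
    using slit_plane_primitive[OF finite_ends gh] by blast
  have nreal: "Im (n (of_real t)) = 0" if "b k < t" "t < a (k+1)" for t
    using upper_root_gap_real[OF k, of t] that by (auto simp: n_def elim!: Reals_cases simp flip: of_real_divide)
  have greal: "Im (g (of_real t)) = 0" if t: "b k < t" "t < a (k+1)" for t
  proof (cases "t = p")
    case False
    then have "g (of_real t) = n (of_real t) / of_real (t - p)" by (simp add: g_def np)
    then show ?thesis using nreal[OF t] by (simp add: Im_divide_of_real del: of_real_diff)
  next
    case True
    have "(n has_field_derivative deriv n ?p) (at ?p)"
      using nh open_slit_plane[OF finite_ends] psl by (metis holomorphic_derivI)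
    from has_field_derivative_Im[OF has_vector_derivative_real_field[OF this, where s = UNIV]]
    have D: "((\<lambda>t. Im (n (of_real t))) has_real_derivative Im (deriv n ?p)) (at p)" .
    have "((\<lambda>t. 0) has_real_derivative Im (deriv n ?p)) (at p)"
      by (rule has_field_derivative_transform_within_open[OF D, of "{b k<..<a (k+1)}"]) (use x nreal in auto)
    then have "Im (deriv n ?p) = 0" using DERIV_unique DERIV_const by blast
    then show ?thesis using True by (simp add: g_def)
  qed
  have "Im (Gg (of_real x)) = Im (Gg (of_real x'))"
    by (rule Im_primitive_eq[of "b k" "a (k+1)" Gg "\<lambda>t. g (of_real t)"])
       (use x greal gap_not_ends[OF k] in \<open>auto intro!: Gg simp: real_in_slit_plane\<close>)
  then have g0: "Im (arc_integral g x x') = 0"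
    using arc_integral_primitive[OF Gg xx(1)] xx by simp
  have hol: "(\<lambda>z. 1 / (z - ?p)) holomorphic_on slit_plane ?E" "g holomorphic_on slit_plane ?E"
    using real_fun_holomorphic_slit[OF f] holomorphic_on_subset[OF gh slit_plane_mono[of ends ?E]] by auto
  have "arc_integral (\<lambda>z. 1 / (z - ?p) / upper_root z) x x' = arc_integral (\<lambda>z. of_real (1 / w) * (1 / (z - ?p)) + g z) x x'"
    by (rule arc_integral_cong[OF xx dec])
  also have "\<dots> = of_real (1 / w) * arc_integral (\<lambda>z. 1 / (z - ?p)) x x' + arc_integral g x x'"
    by (subst arc_integral_add[OF holomorphic_on_mult[OF holomorphic_on_const hol(1)] hol(2) xx], subst arc_integral_cmult[OF hol(1) xx]) (rule refl)
  finally have "Im (arc_integral (\<lambda>z. 1 / (z - ?p) / upper_root z) x x') = - pi / w"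
    using Im_arc_integral_inverse[of x x' p] x g0 by simp
  then show ?thesis
    unfolding ring_period_def
    using arc_integral_primitive[OF G crossingD(2-4)[OF cr(1)]] arc_integral_primitive[OF G crossingD(2-4)[OF cr(2)]]
      arc_integral_primitive[OF G xx] by (simp add: w_def)
qed

text \<open>With the pole over the midpoint of the gap, the formulas for crossing points on its two
  sides are compared. The half residue \<open>pi / (gap_sign k * y)\<close> times the height
  \<open>y\<close> is pi up to sign.\<close>

lemma period_integral_pi:
  assumes k: "k \<in> {1..N-1}"
  shows "period_integral k k pi = - gap_sign k * pi"
proof -
  let ?\<theta> = "pi / 2"
  let ?p = "gap_point k ?\<theta>" and ?y = "gap_height k ?\<theta>"
  have pm: "?p = gap_mid k" by (simp add: gap_point_def)
  define x where "x = (b k + gap_mid k) / 2" define x' where "x' = (gap_mid k + a (k + 1)) / 2"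
  have x: "b k < x" "x < ?p" "?p < x'" "x' < a (k+1)"
    using gap_mid_bounds[OF k] unfolding pm x_def x'_def by auto
  have M: "pole_period x k ?\<theta> = - period_integral k k ?\<theta>"
    using x by (intro pole_period_right[OF k]) auto
  have M': "pole_period x' k ?\<theta> = period_integral k k pi - period_integral k k ?\<theta>"
    using pole_period_left[OF k x(4), of ?\<theta>] x by auto
  let ?f = "\<lambda>z. 1 / (z - complex_of_real ?p)"
  have "reduced_period x ?f - reduced_period x' ?f = ring_period x ?f - ring_period x' ?f"
    unfolding reduced_period_def using ring_period_gap_indep[OF k rpoly_real_fun x(1) _ _ x(4)] x by simp
  also have "\<dots> = pi / (gap_sign k * ?y)"
    unfolding ring_period_jump[OF k x] using upper_root_gap_point[OF k, of ?\<theta>] by simp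
  finally have "?y * (reduced_period x ?f - reduced_period x' ?f) = ?y * (pi / (gap_sign k * ?y))" by simp
  then have "pole_period x k ?\<theta> - pole_period x' k ?\<theta> = ?y * (pi / (gap_sign k * ?y))"
    unfolding pole_period_def by (simp add: right_diff_distrib)
  moreover have "?y \<noteq> 0" using gap_height_eq_0[OF k] by simp
  ultimately show ?thesis using M M' gap_sign(2)[OF k] by auto
qed

section \<open>The lift of the map to angles\<close>

text \<open>The -1/2 is the even part for a pole right of the crossing point. The moment comes from
  the term with \<open>z ^ (N - 1)\<close>, through which alone \<open>\<nu>\<close> enters the
  lift.\<close>

definition Psi_const :: "nat \<Rightarrow> nat \<Rightarrow> real" where
  "Psi_const \<nu> k = - 1 / 2 - nu_sign \<nu> * moment k (N - 1) / (2 * pi)"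

definition Psi_lift :: "nat \<Rightarrow> (nat \<Rightarrow> real) \<Rightarrow> nat \<Rightarrow> real" where
  "Psi_lift \<nu> \<theta> k = Psi_const \<nu> k + (\<Sum>j\<in>{1..N-1}. period_integral k j (\<theta> j)) / (2 * pi)"

lemma gap_data_oval_point:
  assumes "\<And>j. j \<in> {1..N-1} \<Longrightarrow> P j = oval_point j (\<theta> j)"
  shows "gap_data P (\<lambda>j. gap_point j (\<theta> j)) (\<lambda>j. gap_height j (\<theta> j))"
  unfolding gap_data_def using assms gap_height_sq gap_point_bounds by (auto simp: oval_point_def)

text \<open>Angles within one turn are what the formulas for \<open>pole_period\<close> on the
  \<open>k\<close>-th oval require; whole turns are handled separately.\<close>

lemma Psi_lift_restricted:
  assumes P: "\<And>j. j \<in> {1..N-1} \<Longrightarrow> P j = oval_point j (\<theta> j)" and \<nu>: "\<nu> \<in> {1,2}" and k: "k \<in> {1..N-1}"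
    and \<theta>: "\<And>j. j \<in> {1..N-1} \<Longrightarrow> - pi \<le> \<theta> j \<and> \<theta> j \<le> pi"
  shows "Psi \<nu> P k = residue_class (Psi_lift \<nu> \<theta> k)"
proof -
  let ?p = "\<lambda>j. gap_point j (\<theta> j)" and ?y = "\<lambda>j. gap_height j (\<theta> j)"
  have D: "gap_data P ?p ?y" by (rule gap_data_oval_point[OF P])
  obtain x where x: "b k < x" "x < a (k+1)" "x \<noteq> ?p k"
  proof (cases "?p k = gap_mid k")
    case True
    then show ?thesis using that[of "(b k + gap_mid k) / 2"] gap_mid_bounds[OF k] by auto
  next
    case False
    then show ?thesis using that[of "gap_mid k"] gap_mid_bounds[OF k] by auto
  qed
  have cr: "crossing k x (sing_set ?p)"
    using k x gap_sing_set[OF D k x(1,2)] sing_set_admissible[OF D] by (auto simp: crossing_def)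
  have pole: "real_fun (sing_set ?p) (\<lambda>z. 1 / (z - of_real (?p j)))" if "j \<in> {1..N-1}" for j
    using that by (intro real_fun_pole) (auto simp: sing_set_def)
  have rf: "real_fun (sing_set ?p) (\<lambda>z. of_real r * (1 / (z - of_real (?p j))))" if "j \<in> {1..N-1}" for r j
    by (intro real_fun_cmult pole that)
  have "reduced_period x (odd_part \<nu> ?p ?y) =
     nu_sign \<nu> / 2 * moment k (N-1) + (\<Sum>j\<in>{1..N-1}. ?y j / 2 * reduced_period x (\<lambda>z. 1 / (z - of_real (?p j))))"
  proof -
    have "reduced_period x (odd_part \<nu> ?p ?y) = reduced_period x (\<lambda>z. of_real (nu_sign \<nu> / 2) * z ^ (N-1))
        + reduced_period x (\<lambda>z. \<Sum>j\<in>{1..N-1}. of_real (?y j / 2) * (1 / (z - of_real (?p j))))"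
      unfolding odd_part_def[abs_def]
      by (rule reduced_period_add[OF cr]) (intro real_fun_cmult real_fun_power real_fun_ident, rule real_fun_sum, rule rf)
    also have "reduced_period x (\<lambda>z. of_real (nu_sign \<nu> / 2) * z ^ (N-1)) = nu_sign \<nu> / 2 * moment k (N-1)"
      unfolding reduced_period_cmult[OF cr real_fun_power[OF real_fun_ident]] moment_eq[OF cr] ..
    also have "reduced_period x (\<lambda>z. \<Sum>j\<in>{1..N-1}. of_real (?y j / 2) * (1 / (z - of_real (?p j))))
       = (\<Sum>j\<in>{1..N-1}. reduced_period x (\<lambda>z. of_real (?y j / 2) * (1 / (z - of_real (?p j)))))"
      by (rule reduced_period_sum[OF cr]) (rule rf, simp_all)
    also have "\<dots> = (\<Sum>j\<in>{1..N-1}. ?y j / 2 * reduced_period x (\<lambda>z. 1 / (z - of_real (?p j))))"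
      by (intro sum.cong refl reduced_period_cmult[OF cr pole])
    finally show ?thesis .
  qed
  also have "(\<Sum>j\<in>{1..N-1}. ?y j / 2 * reduced_period x (\<lambda>z. 1 / (z - of_real (?p j)))) = (\<Sum>j\<in>{1..N-1}. pole_period x j (\<theta> j)) / 2"
    by (simp add: pole_period_def sum_divide_distrib)
  finally have red: "reduced_period x (odd_part \<nu> ?p ?y) = nu_sign \<nu> / 2 * moment k (N-1) + (\<Sum>j\<in>{1..N-1}. pole_period x j (\<theta> j)) / 2" .
  have rem: "(\<Sum>j\<in>{1..N-1}. f j) = f k + (\<Sum>j\<in>{1..N-1}-{k}. f j)" for f :: "nat \<Rightarrow> real"
    using k by (intro sum.remove) auto
  have oth: "(\<Sum>j\<in>{1..N-1}-{k}. pole_period x j (\<theta> j)) = - (\<Sum>j\<in>{1..N-1}-{k}. period_integral k j (\<theta> j))"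
    unfolding sum_negf[symmetric] by (intro sum.cong refl pole_period_other[OF k _ x(1,2)]) auto
  define \<delta> where "\<delta> = pole_period x k (\<theta> k) + period_integral k k (\<theta> k)"
  have sumM: "(\<Sum>j\<in>{1..N-1}. pole_period x j (\<theta> j)) = \<delta> - (\<Sum>j\<in>{1..N-1}. period_integral k j (\<theta> j))"
    unfolding rem oth \<delta>_def by simp
  \<comment> \<open>If the pole is left of \<open>x\<close>, then \<open>\<delta>\<close> is pi or -
    pi, and half a unit from the even part completes it to an integer.\<close>
  have \<delta>: "(if ?p k < x then 1/2 else 0) - \<delta> / (2 * pi) \<in> \<int>"
  proof (cases "?p k < x")
    case True
    have "\<delta> = (if 0 \<le> \<theta> k then 1 else -1) * (- gap_sign k * pi)"
      unfolding \<delta>_def using pole_period_left[OF k x(2), of "\<theta> k"] \<theta>[OF k] True period_integral_pi[OF k] by simp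
    then show ?thesis using True gap_sign(2)[OF k] by (auto simp: field_simps)
  next
    case False
    then have "\<delta> = 0" unfolding \<delta>_def using pole_period_right[OF k x(1), of "\<theta> k"] \<theta>[OF k] x(3) by simp
    then show ?thesis using False by simp
  qed
  have "Psi \<nu> P k = residue_class ((if ?p k < x then 0 else - 1 / 2) - reduced_period x (odd_part \<nu> ?p ?y) / pi)"
    by (rule Psi_reduced_period[OF D \<nu> k x])
  also have "\<dots> = residue_class (Psi_lift \<nu> \<theta> k)"
    unfolding residue_class_eq
  proof -
    have "(if ?p k < x then 0 else - 1 / 2) - reduced_period x (odd_part \<nu> ?p ?y) / pi - Psi_lift \<nu> \<theta> k
       = (if ?p k < x then 1/2 else 0) - \<delta> / (2 * pi)"
      unfolding red sumM Psi_lift_def Psi_const_def by (simp add: field_simps)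
    then show "(if ?p k < x then 0 else - 1 / 2) - reduced_period x (odd_part \<nu> ?p ?y) / pi - Psi_lift \<nu> \<theta> k \<in> \<int>"
      using \<delta> by simp
  qed
  finally show ?thesis .
qed

text \<open>A full turn of the \<open>j\<close>-th angle adds twice
  \<open>period_integral k j pi\<close>, which is 0 for \<open>j \<noteq> k\<close> and - 2 pi or 2
  pi after doubling for \<open>j = k\<close>.\<close>

lemma Psi_lift_shift:
  assumes k: "k \<in> {1..N-1}"
  shows "Psi_lift \<nu> (\<lambda>j. \<theta> j + 2 * pi * of_int (n j)) k = Psi_lift \<nu> \<theta> k - gap_sign k * of_int (n k)"
proof -
  have "(\<Sum>j\<in>{1..N-1}. period_integral k j (\<theta> j + 2 * pi * of_int (n j))) =
     (\<Sum>j\<in>{1..N-1}. period_integral k j (\<theta> j)) + (\<Sum>j\<in>{1..N-1}. 2 * of_int (n j) * period_integral k j pi)"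
    unfolding sum.distrib[symmetric] by (intro sum.cong refl period_integral_shift)
  also have "(\<Sum>j\<in>{1..N-1}. 2 * of_int (n j) * period_integral k j pi) = (\<Sum>j\<in>{1..N-1}. if j = k then - 2 * pi * gap_sign k * of_int (n k) else 0)"
    using period_integral_pi_other[OF k] period_integral_pi[OF k] by (intro sum.cong) auto
  also have "\<dots> = - 2 * pi * gap_sign k * of_int (n k)" using k by simp
  finally show ?thesis unfolding Psi_lift_def by (simp add: field_simps)
qed

lemma Psi_eq_lift:
  assumes P: "\<And>j. j \<in> {1..N-1} \<Longrightarrow> P j = oval_point j (\<theta> j)" and \<nu>: "\<nu> \<in> {1,2}" and k: "k \<in> {1..N-1}"
  shows "Psi \<nu> P k = residue_class (Psi_lift \<nu> \<theta> k)"
proof -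
  define n where "n j = \<lfloor>(\<theta> j + pi) / (2 * pi)\<rfloor>" for j
  define \<phi> where "\<phi> j = \<theta> j + 2 * pi * of_int (- n j)" for j
  have "- pi \<le> \<phi> j \<and> \<phi> j \<le> pi" for j
  proof -
    have "of_int (n j) \<le> (\<theta> j + pi) / (2 * pi)" "(\<theta> j + pi) / (2 * pi) < of_int (n j) + 1"
      unfolding n_def by linarith+
    then show ?thesis by (simp add: \<phi>_def field_simps)
  qed
  moreover have "P j = oval_point j (\<phi> j)" if "j \<in> {1..N-1}" for j
    using P[OF that] oval_point_periodic[of j "\<theta> j" "- n j"] by (simp only: \<phi>_def)
  ultimately have "Psi \<nu> P k = residue_class (Psi_lift \<nu> \<phi> k)"
    by (intro Psi_lift_restricted[OF _ \<nu> k]) auto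
  also have "\<dots> = residue_class (Psi_lift \<nu> \<theta> k)"
    unfolding residue_class_eq \<phi>_def Psi_lift_shift[OF k] using gap_sign(2)[OF k] by auto
  finally show ?thesis .
qed

end

section \<open>Bijectivity\<close>

text \<open>The product telescopes, since every interior sign occurs twice.\<close>

lemma prod_adjacent_signs:
  fixes s :: "nat \<Rightarrow> real"
  assumes s: "\<And>i. s i * s i = 1" and "j \<le> n"
  shows "(\<Prod>i\<in>{j..<n}. s i * s (i + 1)) = s j * s n"
  using \<open>j \<le> n\<close>
proof (induction n rule: dec_induct)
  case base
  show ?case by (simp add: s)
next
  case (step m)
  have "(\<Prod>i\<in>{j..<Suc m}. s i * s (i + 1)) = s j * (s m * s m) * s (Suc m)"
    using step by (simp add: mult_ac)
  then show ?case by (simp add: s)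
qed

context gap_surface
begin

text \<open>The polynomial has a zero in every cut between two gaps with different prescribed signs.\<close>

lemma sign_polynomial:
  assumes s: "\<And>i. s i * s i = (1::real)"
  shows "\<exists>h. \<forall>j\<in>{1..N-1}. \<forall>x. b j \<le> x \<longrightarrow> x \<le> a (j + 1) \<longrightarrow> s j * rpoly h x > 0"
proof -
  define c where "c i = (a (i+1) + b (i+1)) / 2" for i
  define I where "I = {i\<in>{1..<N-1}. s i * s (i+1) \<noteq> 1}"
  have I: "finite I" "I \<subseteq> {1..<N-1}" by (auto simp: I_def)
  have cI: "a (i+1) < c i" "c i < b (i+1)" if "i \<in> {1..<N-1}" for i
    using ab[of "i+1"] that by (auto simp: c_def)
  have le: "a i \<le> a i'" "b i \<le> b i'" if "i \<in> {1..N}" "i' \<in> {1..N}" "i \<le> i'" for i i'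
    using a_less_iff[OF that(2,1)] b_less_iff[OF that(2,1)] that(3) by (auto simp: not_less[symmetric])
  have inj: "inj_on c I"
  proof (rule linorder_inj_onI)
    fix i i' assume i: "i < i'" "i \<in> I" "i' \<in> I"
    then have ii: "i \<in> {1..<N-1}" "i' \<in> {1..<N-1}" using I(2) by blast+
    then have "b (i+1) \<le> b i'" "b i' < a (i'+1)" using i(1) by (auto intro!: le(2) ba)
    with cI(2)[OF ii(1)] cI(1)[OF ii(2)] show "c i \<noteq> c i'" by linarith
  qed auto
  let ?K = "card (c ` I)"
  have K: "?K < N - 1"
  proof -
    have "?K \<le> card {1..<N-1}" using card_image_le[OF I(1), of c] card_mono[OF _ I(2)] by simp
    then show ?thesis using N2 by simp
  qed
  obtain q where q: "\<And>z::complex. (\<Prod>e\<in>c ` I. z - of_real e) = (\<Sum>n\<le>?K. of_real (q n) * z ^ n)"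
    using prod_linear_factors[of "c ` I"] I(1) by blast
  \<comment> \<open>The factor \<open>s (N - 1)\<close> fixes the sign on the last gap, which lies
    to the right of all zeros.\<close>
  define h where "h m = s (N-1) * (if m \<le> ?K then q m else 0)" for m
  have h: "rpoly h x = s (N-1) * (\<Prod>i\<in>I. x - c i)" for x :: real
  proof -
    have "complex_of_real (\<Prod>i\<in>I. x - c i) = of_real (\<Sum>n\<le>?K. q n * x ^ n)"
      using q[of "of_real x"] by (simp add: prod.reindex[OF inj])
    then have "(\<Prod>i\<in>I. x - c i) = (\<Sum>n\<le>?K. q n * x ^ n)" unfolding of_real_eq_iff .
    moreover have "rpoly h x = (\<Sum>n\<le>?K. s (N-1) * (q n * x ^ n))"
      unfolding rpoly_def h_def using K by (intro sum.mono_neutral_cong_right) auto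
    ultimately show ?thesis by (simp add: sum_distrib_left)
  qed
  have "s j * rpoly h x > 0" if j: "j \<in> {1..N-1}" and x: "b j \<le> x" "x \<le> a (j+1)" for j x
  proof -
    \<comment> \<open>For \<open>i\<close> in \<open>I\<close> this is the sign of
      \<open>x - c i\<close>; for the other indices it is 1, so the product can run over all indices
      and telescope.\<close>
    define t where "t i = (if j \<le> i then s i * s (i+1) else 1)" for i
    have pos: "(x - c i) * t i > 0" if i: "i \<in> I" for i
    proof -
      have i': "i \<in> {1..<N-1}" "s i * s (i+1) \<noteq> 1" using i by (auto simp: I_def)
      show ?thesis
      proof (cases "j \<le> i")
        case True
        have "(s i * s (i+1)) * (s i * s (i+1)) = 1" using s[of i] s[of "i+1"] by algebra
        then have "s i * s (i+1) = -1" using i'(2) by (metis square_eq_1_iff)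
        moreover have "x < c i" using cI(1)[OF i'(1)] le(1)[OF gap_index(2)[OF j], of "i+1"] True i'(1) x by fastforce
        ultimately show ?thesis by (simp add: t_def True)
      next
        case False
        then have "c i < x" using cI(2)[OF i'(1)] le(2)[OF _ gap_index(1)[OF j], of "i+1"] i'(1) x by fastforce
        then show ?thesis using False by (simp add: t_def)
      qed
    qed
    have "(\<Prod>i\<in>I. t i) = (\<Prod>i\<in>{1..<N-1}. t i)"
      by (rule prod.mono_neutral_left) (auto simp: I_def t_def)
    also have "\<dots> = (\<Prod>i\<in>{j..<N-1}. s i * s (i+1))"
      unfolding t_def using j by (intro prod.mono_neutral_cong_right) auto
    also have "\<dots> = s j * s (N-1)" using j by (intro prod_adjacent_signs s) auto
    finally have "s j * rpoly h x = (\<Prod>i\<in>I. (x - c i) * t i)"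
      unfolding h prod.distrib by (simp add: mult_ac)
    then show ?thesis using pos by (simp add: prod_pos)
  qed
  then show ?thesis by blast
qed

text \<open>The off-diagonal integrals have no fixed sign, so single components give nothing. The
  equations are combined with weights \<open>d k\<close> that replace the numerators
  \<open>period_poly k\<close> by \<open>h\<close>, after which every oval contributes with the same
  sign.\<close>

lemma Psi_lift_inj:
  assumes eq: "\<And>k. k \<in> {1..N-1} \<Longrightarrow> Psi_lift \<nu> \<theta> k = Psi_lift \<nu> \<phi> k" and i: "i \<in> {1..N-1}"
  shows "\<theta> i = \<phi> i"
proof -
  let ?I = "{1..N-1}" and ?V = period_integral
  define s where "s j = (if \<phi> j \<le> \<theta> j then 1 else -1 :: real)" for j
  have "s i * s i = 1" for i by (simp add: s_def)
  from sign_polynomial[of s, OF this] obtain h where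
    h: "\<And>j x. j \<in> ?I \<Longrightarrow> b j \<le> x \<Longrightarrow> x \<le> a (j+1) \<Longrightarrow> s j * rpoly h x > 0" by blast
  have "\<forall>j\<in>?I. \<exists>G. \<forall>t. (G has_real_derivative rpoly h (gap_point j t) / gap_root j (gap_point j t)) (at t)"
    using gap_period_integral(2)[OF _ rpoly_holomorphic rpoly_of_real] by blast
  then obtain H where H: "\<And>j t. j \<in> ?I \<Longrightarrow> (H j has_real_derivative rpoly h (gap_point j t) / gap_root j (gap_point j t)) (at t)"
    by metis
  \<comment> \<open>Since \<open>period_integral k j pi\<close> is diagonal, these weights match the
    integrals of \<open>h\<close> over all gaps. The difference \<open>c\<close> then has zero gap
    integrals and vanishes, so \<open>h\<close> is a combination of the
    \<open>period_poly k\<close>.\<close>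
  define d where "d k = (H k pi - H k 0) / ?V k k pi" for k
  define c where "c m = h m - (\<Sum>k\<in>?I. d k * period_poly k m)" for m
  have c: "rpoly c x = rpoly h x - (\<Sum>k\<in>?I. d k * rpoly (period_poly k) x)" for x :: real
    unfolding rpoly_def c_def
    by (simp add: left_diff_distrib sum_subtractf sum_distrib_left sum_distrib_right mult.assoc sum.swap[of _ "{..<N-1}"])
  define F where "F j t = H j t - (\<Sum>k\<in>?I. d k * ?V k j t)" for j t
  have F: "(F j has_real_derivative rpoly c (gap_point j t) / gap_root j (gap_point j t)) (at t)" if "j \<in> ?I" for j t
    unfolding F_def c diff_divide_distrib sum_divide_distrib
    by (rule DERIV_diff[OF H[OF that]], rule DERIV_sum)
       (use DERIV_cmult[OF period_integral(2)[OF that]] in simp)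
  have Fpi: "F j pi - F j 0 = 0" if j: "j \<in> ?I" for j
  proof -
    have "(\<Sum>k\<in>?I. d k * ?V k j pi) = (\<Sum>k\<in>?I. if k = j then d j * ?V j j pi else 0)"
      using period_integral_pi_other j by (intro sum.cong) auto
    also have "\<dots> = H j pi - H j 0"
      using j period_integral_pi[OF j] gap_sign(2)[OF j] by (auto simp: d_def)
    finally show ?thesis by (simp add: F_def period_integral(1)[OF j])
  qed
  have "\<exists>x. b j < x \<and> x < a (j + 1) \<and> rpoly c x = 0" if j: "j \<in> ?I" for j
  proof (rule gap_integral_zero_root[OF j])
    have "((\<lambda>s. rpoly c (gap_point j s) / gap_root j (gap_point j s)) has_integral (F j pi - F j 0)) {0..pi}"
      using F[OF j] by (intro fundamental_theorem_of_calculus)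
        (auto intro: has_field_derivative_at_within simp: has_real_derivative_iff_has_vector_derivative[symmetric])
    then show "((\<lambda>s. rpoly c (gap_point j s) / gap_root j (gap_point j s)) has_integral 0) {0..pi}"
      unfolding Fpi[OF j] .
  qed
  from rpoly_zero_of_gap_roots[OF this] have "rpoly c x = 0" for x :: real by (simp add: rpoly_def)
  then have Fc: "F j (\<theta> j) = F j (\<phi> j)" if "j \<in> ?I" for j
    using F[OF that] DERIV_isconst_all[of "F j" "\<theta> j" "\<phi> j"] by simp
  have "(\<Sum>j\<in>?I. H j (\<theta> j) - H j (\<phi> j)) = (\<Sum>j\<in>?I. \<Sum>k\<in>?I. d k * (?V k j (\<theta> j) - ?V k j (\<phi> j)))"
  proof (rule sum.cong[OF refl])
    fix j assume "j \<in> ?I"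
    from Fc[OF this] show "H j (\<theta> j) - H j (\<phi> j) = (\<Sum>k\<in>?I. d k * (?V k j (\<theta> j) - ?V k j (\<phi> j)))"
      unfolding F_def right_diff_distrib sum_subtractf by linarith
  qed
  also have "\<dots> = (\<Sum>k\<in>?I. d k * (\<Sum>j\<in>?I. ?V k j (\<theta> j) - ?V k j (\<phi> j)))"
    by (subst sum.swap) (simp add: sum_distrib_left)
  also have "\<dots> = 0"
  proof (rule sum.neutral, rule ballI)
    fix k assume "k \<in> ?I"
    from eq[OF this] show "d k * (\<Sum>j\<in>?I. ?V k j (\<theta> j) - ?V k j (\<phi> j)) = 0"
      by (simp add: Psi_lift_def sum_subtractf)
  qed
  finally have sum0: "(\<Sum>j\<in>?I. H j (\<theta> j) - H j (\<phi> j)) = 0" .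
  have pos: "H j (\<theta> j) - H j (\<phi> j) > 0" if j: "j \<in> ?I" and ne: "\<theta> j \<noteq> \<phi> j" for j
  proof (cases "\<phi> j \<le> \<theta> j")
    case True
    have "\<exists>y. (H j has_real_derivative y) (at t) \<and> y > 0" for t
      using H[OF j, of t] h[OF j gap_point_bounds(1,2)[OF j], of t] gap_root_pos[OF j, of t] True
      by (auto simp: s_def intro!: exI divide_pos_pos)
    then show ?thesis using DERIV_pos_imp_increasing[of "\<phi> j" "\<theta> j" "H j"] True ne by auto
  next
    case False
    have "\<exists>y. (H j has_real_derivative y) (at t) \<and> y < 0" for t
      using H[OF j, of t] h[OF j gap_point_bounds(1,2)[OF j], of t] gap_root_pos[OF j, of t] False
      by (auto simp: s_def intro!: exI divide_neg_pos)
    then show ?thesis using DERIV_neg_imp_decreasing[of "\<theta> j" "\<phi> j" "H j"] False by auto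
  qed
  have "H i (\<theta> i) - H i (\<phi> i) = 0"
  proof (rule sum_nonneg_0[OF _ _ sum0 i])
    fix j assume j: "j \<in> ?I"
    show "0 \<le> H j (\<theta> j) - H j (\<phi> j)"
    proof (cases "\<theta> j = \<phi> j")
      case False
      then show ?thesis using pos[OF j] by simp
    qed simp
  qed simp
  then show ?thesis using pos[OF i] by fastforce
qed

text \<open>Off the diagonal the increment over a full turn is 0, so the function is periodic and
  bounded by its maximum over one turn.\<close>

lemma period_integral_bounded:
  assumes k: "k \<in> {1..N-1}" and j: "j \<in> {1..N-1}" and "j \<noteq> k"
  shows "\<exists>C\<ge>0. \<forall>t. \<bar>period_integral k j t\<bar> \<le> C"
proof -
  let ?V = "period_integral k j"
  have "continuous_on {- pi..pi} ?V"
    using period_integral(2)[OF j] by (intro continuous_at_imp_continuous_on ballI) (auto intro: DERIV_isCont)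
  from compact_imp_bounded[OF compact_continuous_image[OF this compact_Icc]]
  obtain C where C: "\<And>t. t \<in> {- pi..pi} \<Longrightarrow> \<bar>?V t\<bar> \<le> C" unfolding bounded_iff by fastforce
  have "\<bar>?V t\<bar> \<le> C" for t
  proof -
    define n where "n = - \<lfloor>(t + pi) / (2 * pi)\<rfloor>"
    have "of_int (- n) \<le> (t + pi) / (2 * pi)" "(t + pi) / (2 * pi) < of_int (- n) + 1"
      unfolding n_def by linarith+
    then have "t + 2 * pi * of_int n \<in> {- pi..pi}" by (simp add: field_simps)
    from C[OF this] show ?thesis
      unfolding period_integral_shift[OF j] period_integral_pi_other[OF k j \<open>j \<noteq> k\<close>] by simp
  qed
  moreover from this[of 0] have "0 \<le> C" by linarith
  ultimately show ?thesis by blast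
qed

text \<open>At a multiple of 2 pi the diagonal integral is known exactly. On opposite faces of a
  cube of half-width \<open>2 * pi * L\<close> it dominates the bounded off-diagonal terms and the
  constant.\<close>

lemma Psi_lift_surj: "\<exists>\<theta>. \<forall>k\<in>{1..N-1}. Psi_lift \<nu> \<theta> k = t k"
proof -
  let ?I = "{1..N-1}" and ?V = period_integral
  define r where "r k = 2 * pi * (Psi_const \<nu> k - t k)" for k
  \<comment> \<open>The factor \<open>- gap_sign k\<close> makes the diagonal term grow with the
    angle.\<close>
  define f where "f k \<theta> = - gap_sign k * ((\<Sum>j\<in>?I. ?V k j (\<theta> j)) + r k)" for k \<theta>
  have "\<forall>k\<in>?I. \<forall>j\<in>?I. \<exists>C. j \<noteq> k \<longrightarrow> 0 \<le> C \<and> (\<forall>x. \<bar>?V k j x\<bar> \<le> C)"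
    using period_integral_bounded by meson
  then obtain C where C: "\<And>k j. k \<in> ?I \<Longrightarrow> j \<in> ?I \<Longrightarrow> j \<noteq> k \<Longrightarrow> 0 \<le> C k j \<and> (\<forall>x. \<bar>?V k j x\<bar> \<le> C k j)"
    by metis
  define B where "B k = (\<Sum>j\<in>?I-{k}. C k j) + \<bar>r k\<bar>" for k
  obtain L :: nat where L: "(\<Sum>k\<in>?I. B k) \<le> of_nat L" using real_arch_simple by blast
  have B0: "0 \<le> B k" if "k \<in> ?I" for k
    unfolding B_def using C[OF that] by (intro add_nonneg_nonneg sum_nonneg) auto
  have BL: "B k \<le> 2 * pi * L" if k: "k \<in> ?I" for k
  proof -
    have "B k \<le> (\<Sum>k\<in>?I. B k)" using B0 k by (intro member_le_sum) auto
    also have "\<dots> \<le> 2 * pi * L" using L pi_gt3 mult_right_mono[of 1 "2 * pi" "real L"] by linarith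
    finally show ?thesis .
  qed
  have f: "\<bar>f k \<theta> - 2 * pi * of_int n\<bar> \<le> 2 * pi * L" if k: "k \<in> ?I" and n: "\<theta> k = 2 * pi * of_int n" for k \<theta> n
  proof -
    have Vk: "?V k k (\<theta> k) = - (2 * pi * of_int n) * gap_sign k"
      using period_integral_shift[OF k, of k 0 n] period_integral(1)[OF k] period_integral_pi[OF k] n by simp
    have "(\<Sum>j\<in>?I. ?V k j (\<theta> j)) = ?V k k (\<theta> k) + (\<Sum>j\<in>?I-{k}. ?V k j (\<theta> j))"
      using k by (intro sum.remove) auto
    then have "f k \<theta> - 2 * pi * of_int n = - gap_sign k * ((\<Sum>j\<in>?I-{k}. ?V k j (\<theta> j)) + r k)"
      unfolding f_def Vk using gap_sign(2)[OF k] by auto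
    then have "\<bar>f k \<theta> - 2 * pi * of_int n\<bar> = \<bar>(\<Sum>j\<in>?I-{k}. ?V k j (\<theta> j)) + r k\<bar>"
      using gap_sign(2)[OF k] by (auto simp: abs_mult)
    also have "\<dots> \<le> \<bar>\<Sum>j\<in>?I-{k}. ?V k j (\<theta> j)\<bar> + \<bar>r k\<bar>" by (rule abs_triangle_ineq)
    also have "\<bar>\<Sum>j\<in>?I-{k}. ?V k j (\<theta> j)\<bar> \<le> (\<Sum>j\<in>?I-{k}. C k j)"
      using C[OF k] by (intro order.trans[OF sum_abs] sum_mono) auto
    finally show ?thesis using BL[OF k] by (simp add: B_def)
  qed
  define T where "T x = 2 * pi * L * (2 * x - 1)" for x :: real
  \<comment> \<open>The constant is spread over the \<open>N - 1\<close> summands and indices are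
    shifted to start at 0, as \<open>poincare_miranda_sum\<close> expects.\<close>
  define v where "v k j x = - gap_sign (k+1) * (?V (k+1) (j+1) (T x) + r (k+1) / real (N-1))" for k j x
  have vf: "(\<Sum>j<N-1. v k j (x j)) = f (k+1) (\<lambda>j. T (x (j-1)))" for k x
  proof -
    have "(\<Sum>j<N-1. v k j (x j)) = - gap_sign (k+1) * ((\<Sum>j<N-1. ?V (k+1) (j+1) (T (x j))) + r (k+1))"
      unfolding v_def sum_distrib_left[symmetric] sum.distrib using N2 by simp
    also have "(\<Sum>j<N-1. ?V (k+1) (j+1) (T (x j))) = (\<Sum>j\<in>?I. ?V (k+1) j (T (x (j-1))))"
      by (rule sum.reindex_bij_witness[of _ "\<lambda>j. j-1" "\<lambda>j. j+1"]) auto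
    finally show ?thesis by (simp add: f_def)
  qed
  obtain x where x: "\<And>k. k < N-1 \<Longrightarrow> (\<Sum>j<N-1. v k j (x j)) = 0"
  proof -
    have "\<exists>x. (\<forall>j<N-1. x j \<in> {0..1}) \<and> (\<forall>k<N-1. (\<Sum>j<N-1. v k j (x j)) = 0)"
    proof (rule poincare_miranda_sum)
      fix k j assume "k < N - 1" "j < N - 1"
      then have j: "j + 1 \<in> ?I" by auto
      have "continuous_on UNIV (?V (k+1) (j+1))"
        using period_integral(2)[OF j] by (intro continuous_at_imp_continuous_on ballI) (auto intro: DERIV_isCont)
      then have "continuous_on {0..1} (\<lambda>x. ?V (k+1) (j+1) (T x))"
        unfolding T_def by (rule continuous_on_compose2) (auto intro!: continuous_intros)
      then show "continuous_on {0..1} (v k j)"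
        unfolding v_def[abs_def] by (intro continuous_intros)
    next
      fix x :: "nat \<Rightarrow> real" and k assume "k < N - 1" "x k = 0"
      then show "(\<Sum>j<N-1. v k j (x j)) \<le> 0"
        unfolding vf using f[of "k+1" "\<lambda>j. T (x (j-1))" "- int L"] by (auto simp: T_def abs_le_iff)
    next
      fix x :: "nat \<Rightarrow> real" and k assume "k < N - 1" "x k = 1"
      then show "(\<Sum>j<N-1. v k j (x j)) \<ge> 0"
        unfolding vf using f[of "k+1" "\<lambda>j. T (x (j-1))" "int L"] by (auto simp: T_def abs_le_iff)
    qed
    then show ?thesis using that by blast
  qed
  have "Psi_lift \<nu> (\<lambda>j. T (x (j-1))) k = t k" if k: "k \<in> ?I" for k
  proof -
    have "k - 1 < N - 1" "k - 1 + 1 = k" using k by auto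
    with x[of "k-1"] vf[of "k-1" x] have "f k (\<lambda>j. T (x (j-1))) = 0" by simp
    then have "(\<Sum>j\<in>?I. ?V k j (T (x (j-1)))) = - r k" unfolding f_def using gap_sign(2)[OF k] by auto
    then show ?thesis unfolding Psi_lift_def r_def by simp
  qed
  then show ?thesis by blast
qed

lemma Psi_bij:
  assumes \<nu>: "\<nu> \<in> {1,2}"
  shows "bij_betw (Psi \<nu>) (\<Pi>\<^sub>E j\<in>{1..N-1}. oval j) (\<Pi>\<^sub>E k\<in>{1..N-1}. real_mod_int)"
proof (rule bij_betwI')
  let ?I = "{1..N-1}"
  have angle: "\<exists>\<theta>. \<forall>j\<in>?I. P j = oval_point j (\<theta> j)" if "P \<in> (\<Pi>\<^sub>E j\<in>?I. oval j)" for P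
  proof (rule bchoice, rule ballI)
    fix j assume j: "j \<in> ?I"
    then show "\<exists>y. P j = oval_point j y" using PiE_mem[OF that j] oval_eq[OF j] by auto
  qed
  show "(Psi \<nu> P = Psi \<nu> P') = (P = P')" if P: "P \<in> (\<Pi>\<^sub>E j\<in>?I. oval j)" "P' \<in> (\<Pi>\<^sub>E j\<in>?I. oval j)" for P P'
  proof
    assume eq: "Psi \<nu> P = Psi \<nu> P'"
    obtain \<theta> \<phi> where ang: "\<And>j. j \<in> ?I \<Longrightarrow> P j = oval_point j (\<theta> j)" "\<And>j. j \<in> ?I \<Longrightarrow> P' j = oval_point j (\<phi> j)"
      using angle[OF P(1)] angle[OF P(2)] by blast
    have "Psi_lift \<nu> \<theta> k - Psi_lift \<nu> \<phi> k \<in> \<int>" if "k \<in> ?I" for k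
      using Psi_eq_lift[OF ang(1) \<nu> that] Psi_eq_lift[OF ang(2) \<nu> that] eq by (simp add: residue_class_eq[symmetric])
    \<comment> \<open>As \<open>gap_sign k\<close> is 1 or -1, any integer difference can be made up
      by whole turns of the \<open>k\<close>-th angle, which do not move the point on the
      oval.\<close>
    then have "\<forall>k\<in>?I. \<exists>m. Psi_lift \<nu> \<theta> k - Psi_lift \<nu> \<phi> k = - gap_sign k * of_int m"
      using gap_sign(2) by (metis Ints_cases mult_minus_left mult_1 minus_minus of_int_minus)
    then obtain m where m: "\<And>k. k \<in> ?I \<Longrightarrow> Psi_lift \<nu> \<theta> k - Psi_lift \<nu> \<phi> k = - gap_sign k * of_int (m k)"
      using bchoice by (metis (no_types, lifting))
    have "\<theta> j = \<phi> j + 2 * pi * of_int (m j)" if j: "j \<in> ?I" for j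
    proof (rule Psi_lift_inj[OF _ j])
      fix k assume k: "k \<in> ?I"
      show "Psi_lift \<nu> \<theta> k = Psi_lift \<nu> (\<lambda>j. \<phi> j + 2 * pi * of_int (m j)) k"
        unfolding Psi_lift_shift[OF k] using m[OF k] by simp
    qed
    then have "P j = P' j" if "j \<in> ?I" for j using that ang oval_point_periodic by simp
    then show "P = P'" using PiE_ext[OF P] by blast
  qed simp
  show "Psi \<nu> P \<in> (\<Pi>\<^sub>E k\<in>?I. real_mod_int)" if P: "P \<in> (\<Pi>\<^sub>E j\<in>?I. oval j)" for P
  proof (rule PiE_I)
    fix k assume k: "k \<in> ?I"
    obtain \<theta> where "\<And>j. j \<in> ?I \<Longrightarrow> P j = oval_point j (\<theta> j)" using angle[OF P] by blast
    from Psi_eq_lift[OF this \<nu> k] show "Psi \<nu> P k \<in> real_mod_int" by (simp add: real_mod_int_eq)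
  next
    fix k assume "k \<notin> ?I"
    then show "Psi \<nu> P k = undefined" by (auto simp: Psi_def restrict_def)
  qed
  show "\<exists>P\<in>(\<Pi>\<^sub>E j\<in>?I. oval j). c = Psi \<nu> P" if c: "c \<in> (\<Pi>\<^sub>E k\<in>?I. real_mod_int)" for c
  proof -
    have "\<forall>k\<in>?I. \<exists>t. c k = residue_class t" using PiE_mem[OF c] unfolding real_mod_int_eq by blast
    then obtain t where t: "\<And>k. k \<in> ?I \<Longrightarrow> c k = residue_class (t k)" by (metis (no_types, lifting) bchoice)
    obtain \<theta> where \<theta>: "\<And>k. k \<in> ?I \<Longrightarrow> Psi_lift \<nu> \<theta> k = t k" using Psi_lift_surj by blast
    let ?P = "\<lambda>j\<in>?I. oval_point j (\<theta> j)"
    have "?P \<in> (\<Pi>\<^sub>E j\<in>?I. oval j)" using oval_eq by auto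
    moreover have "c = Psi \<nu> ?P"
    proof
      fix k
      show "c k = Psi \<nu> ?P k"
      proof (cases "k \<in> ?I")
        case True
        have "Psi \<nu> ?P k = residue_class (Psi_lift \<nu> \<theta> k)" by (rule Psi_eq_lift[OF _ \<nu> True]) simp
        then show ?thesis using t[OF True] \<theta>[OF True] by simp
      next
        case False
        then show ?thesis using PiE_arb[OF c False] by (auto simp: Psi_def restrict_def)
      qed
    qed
    ultimately show ?thesis by blast
  qed
qed

end

theorem theorem2p6:
  fixes N :: nat and a b :: "nat \<Rightarrow> real" and \<nu> :: nat
  assumes "N \<ge> 1"
    and "\<And>k. k \<in> {1..N} \<Longrightarrow> a k < b k"
    and "\<And>k. k \<in> {1..<N} \<Longrightarrow> b k < a (k + 1)"
    and "\<nu> \<in> {1, 2}"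
  shows "bij_betw (hyperelliptic.Psi N a b \<nu>)
           (\<Pi>\<^sub>E j\<in>{1..N - 1}. hyperelliptic.oval N a b j)
           (\<Pi>\<^sub>E k\<in>{1..N - 1}. real_mod_int)"
proof (cases "N = 1")
  \<comment> \<open>The index set is empty and both products consist of the everywhere undefined
    function.\<close>
  case True
  then show ?thesis by (simp add: bij_betw_def hyperelliptic.Psi_def restrict_def)
next
  case False
  then interpret gap_surface N a b
    using assms by unfold_locales auto
  show ?thesis by (rule Psi_bij[OF assms(4)])
qed

end
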